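(* Let $p\ge1$ and let $a_0,\dots,a_p$, $b_1,\dots,b_p$, $\tilde a_0,\dots,\tilde a_p$, $\tilde b_1,\dots,\tilde b_p\in\mathbb{C}$ satisfy Condition C. Put $\psi_{p-1}=\sum_{i=1}^{p-1}b_i-\sum_{i=0}^{p-1}a_i$ and $\tilde\psi_{p-1}=\sum_{i=1}^{p-1}\tilde b_i-\sum_{i=0}^{p-1}\tilde a_i$, and assume $\psi_{p-1}\notin\mathbb{Z}$, $\operatorname{Re}(\psi_{p-1}+\tilde\psi_{p-1})>-2$, $\operatorname{Re}(a_p+\tilde a_p)>0$, $\operatorname{Re}(b_p+\tilde b_p-a_p-\tilde a_p)>0$, $\operatorname{Re}(b_j+\tilde b_j-a_p-\tilde a_p)<2$ for $1\le j\le p-1$, and $\operatorname{Re}(b_p+\tilde b_p-a_j-\tilde a_j)<2$ for $0\le j\le p-1$. Let $0<|z|<1$ and assume the integral $$I_{p+1}(z,\bar z)=\int_{\mathbb{C}^p}\prod_{i=1}^{p}\Big[z_i^{a_i-1}\bar z_i^{\tilde a_i-1}(1-z_i)^{b_i-a_i-1}(1-\bar z_i)^{\tilde b_i-\tilde a_i-1}\Big]\Big(1-z\prod_{i=1}^pz_i\Big)^{-a_0}\Big(1-\bar z\prod_{i=1}^p\bar z_i\Big)^{-\tilde a_0}\,dA(z_1)\cdots dA(z_p)$$ converges absolutely. Then $$I_{p+1}(z,\bar z)=\lambda_0\,u_0(z)\,\tilde u_0(\bar z)+\sum_{j=1}^{p}\lambda_j\,z^{1-b_j}\bar z^{1-\tilde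 b_j}\,F_j(z)\,\tilde F_j(\bar z),$$ where $u_0(z)={}_{p+1}F_p(a_0,a_1,\dots,a_p;b_1,\dots,b_p;z)$, $\tilde u_0(\bar z)={}_{p+1}F_p(\tilde a_0,\dots,\tilde a_p;\tilde b_1,\dots,\tilde b_p;\bar z)$, for $1\le j\le p$ $$F_j(z)={}_{p+1}F_p\big(a_0-b_j+1,a_1-b_j+1,\dots,a_p-b_j+1;\ (1+b_i-b_j)_{1\le i\le p,\,i\ne j},\ 2-b_j;\ z\big)$$ and $\tilde F_j$ is the same with all parameters replaced by their tilde versions and $z$ by $\bar z$; and $$\lambda_0=\prod_{i=1}^{p}\mathfrak{B}(a_i,\,b_i-a_i;\,\tilde a_i,\,\tilde b_i-\tilde a_i),$$ $$\lambda_j=(-1)^{\,b_j-\tilde b_j-a_j+\tilde a_j}\,\mathfrak{B}(b_j-1,\,1-a_0;\,\tilde b_j-1,\,1-\tilde a_0)\prod_{\substack{i=1\\ i\ne j}}^{p}\mathfrak{B}(a_i-b_j+1,\,b_i-a_i;\,\tilde a_i-\tilde b_j+1,\,\tilde b_i-\tilde a_i)\quad(1\le j\le p).$$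
   Context: Condition C: (a) $b_j,\tilde b_j,a_i,\tilde a_i\notin\mathbb{Z}$ for $0\le i\le p$, $1\le j\le p$; (b) $a_i-a_k,\ \tilde a_i-\tilde a_k\notin\mathbb{Z}$ for $i\ne k$ in $\{0,\dots,p\}$, and $b_i-b_k,\ \tilde b_i-\tilde b_k\notin\mathbb{Z}$ for $i\ne k$ in $\{1,\dots,p\}$; (c) $a_i-b_j,\ \tilde a_i-\tilde b_j\notin\mathbb{Z}$ for all $0\le i\le p$, $1\le j\le p$; (d) $a_i-\tilde a_i\in\mathbb{Z}$ for $0\le i\le p$ and $b_j-\tilde b_j\in\mathbb{Z}$ for $1\le j\le p$. Convention: for $w\in\mathbb{C}\setminus\{0\}$ and $\alpha,\tilde\alpha$ with $\alpha-\tilde\alpha\in\mathbb{Z}$, $w^{\alpha}\bar w^{\tilde\alpha}:=|w|^{\alpha+\tilde\alpha}e^{i(\alpha-\tilde\alpha)\arg w}$ (single valued). The integrand of $I_{p+1}$ is a product of such pairs (with $w=z_i$, $w=1-z_i$, $w=1-z\prod z_i$), and $z^{1-b_j}\bar z^{1-\tilde b_j}$ is understood the same way. $dA$ is Lebesgue area measure on $\mathbb{C}$. ${}_{p+1}F_p$ is the generalized hypergeometric series, convergent for $|z|<1$. For $\alpha,\beta,\tilde\alpha,\tilde\beta$ with $\alpha-\tilde\alpha,\beta-\tilde\beta\in\mathbb{Z}$ and $\alpha,\beta,\alpha+\beta\notin\mathbb{Z}$, $$\mathfrak{B}(\alpha,\beta;\tilde\alpha,\tilde\beta)=\frac{\Gamma(\alpha)\Gamma(\beta)}{\Gamma(\alpha+\beta)}\,\frac{\Gamma(\tilde\alpha)\Gamma(\tilde\beta)}{\Gamma(\tilde\alpha+\tilde\beta)}\,\frac{\sin\pi\tilde\alpha\,\sin\pi\tilde\beta}{\sin\pi(\tilde\alpha+\tilde\beta)}$$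 (under Condition C all $\mathfrak{B}$'s above are defined). *)

theory Defs
  imports "HOL-Analysis.Analysis"
begin

text \<open>Single-valued pair power  w^\<alpha> conj(w)^\<alpha>' := |w|^(\<alpha>+\<alpha>') e^(i(\<alpha>-\<alpha>') arg w),
  meaningful when \<alpha> - \<alpha>' is an integer (then independent of the branch of arg).\<close>
definition cpair :: "complex \<Rightarrow> complex \<Rightarrow> complex \<Rightarrow> complex" where
  "cpair w \<alpha> \<alpha>' = exp ((\<alpha> + \<alpha>') * of_real (ln (norm w))) * exp (\<i> * (\<alpha> - \<alpha>') * of_real (Arg w))"

definition hypergeom :: "complex list \<Rightarrow> complex list \<Rightarrow> complex \<Rightarrow> complex" where
  "hypergeom as bs z =
     (\<Sum>n. (prod_list (map (\<lambda>c. pochhammer c n) as) / prod_list (map (\<lambda>c. pochhammer c n) bs))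
           * z ^ n / of_nat (fact n))"

definition fB :: "complex \<Rightarrow> complex \<Rightarrow> complex \<Rightarrow> complex \<Rightarrow> complex" where
  "fB \<alpha> \<beta> \<alpha>' \<beta>' =
     Gamma \<alpha> * Gamma \<beta> / Gamma (\<alpha> + \<beta>) * (Gamma \<alpha>' * Gamma \<beta>' / Gamma (\<alpha>' + \<beta>'))
     * (sin (of_real pi * \<alpha>') * sin (of_real pi * \<beta>') / sin (of_real pi * (\<alpha>' + \<beta>')))"

definition neg1_pow :: "complex \<Rightarrow> complex" where
  "neg1_pow w = (-1) powi (THE k::int. w = of_int k)"

definition condC :: "nat \<Rightarrow> (nat \<Rightarrow> complex) \<Rightarrow> (nat \<Rightarrow> complex) \<Rightarrow> (nat \<Rightarrow> complex) \<Rightarrow> (nat \<Rightarrow> complex) \<Rightarrow> bool" where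
  "condC p a b ta tb \<longleftrightarrow>
     (\<forall>i\<in>{0..p}. a i \<notin> \<int> \<and> ta i \<notin> \<int>) \<and> (\<forall>j\<in>{1..p}. b j \<notin> \<int> \<and> tb j \<notin> \<int>) \<and>
     (\<forall>i\<in>{0..p}. \<forall>k\<in>{0..p}. i \<noteq> k \<longrightarrow> a i - a k \<notin> \<int> \<and> ta i - ta k \<notin> \<int>) \<and>
     (\<forall>i\<in>{1..p}. \<forall>k\<in>{1..p}. i \<noteq> k \<longrightarrow> b i - b k \<notin> \<int> \<and> tb i - tb k \<notin> \<int>) \<and>
     (\<forall>i\<in>{0..p}. \<forall>j\<in>{1..p}. a i - b j \<notin> \<int> \<and> ta i - tb j \<notin> \<int>) \<and>
     (\<forall>i\<in>{0..p}. a i - ta i \<in> \<int>) \<and> (\<forall>j\<in>{1..p}. b j - tb j \<in> \<int>)"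

end

theory Submission
  imports Defs "HOL-Complex_Analysis.Complex_Analysis"
begin

text \<open>
  With respect to the Haar measure of the punctured plane the integral is an iterated multiplicative
  convolution \<open>I p z = (\<integral> f p x * I (p - 1) (z * x))\<close> of complex beta integrands. If \<open>f\<close> has a
  power expansion at infinity and \<open>G\<close> one at zero, splitting the integral at a circle \<open>norm x = c\<close>
  with \<open>1 < c < 1 / norm z\<close> expands the convolution in powers of \<open>z\<close>: the coefficient at an exponent
  of \<open>G\<close> is the finite-part Mellin transform of \<open>f\<close> there, and vice versa. Since the finite-part
  Mellin transform turns convolution into multiplication, that of \<open>I (p - 1)\<close> is a product of complex
  beta values, which are obtained from the convergent complex beta integral by analytic continuation
  and a recursion. The expansion of \<open>I p\<close> and the formula for its Mellin transform are therefore
  proved by one simultaneous induction on \<open>p\<close>, in which all needed inequalities between the exponents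
  are extracted from absolute convergence. The double series belonging to one exponent factors into
  two hypergeometric series because its coefficients are ratios of shifted beta values.
\<close>

subsection \<open>Haar measure of the punctured plane\<close>

text \<open>Both Mellin transforms are needed at infinitely many exponents: that of
  \<open>f p\<close> at 1 - b_j + l and that of \<open>I (p - 1)\<close> at b_p - 1 - l, for all l.
  For large l the first diverges at infinity and the second at zero, so no strip of convergence
  serves them all and finite parts are unavoidable. They exist because exponents of the two
  expansions with equal winding number keep a uniform distance, which is what the non-integrality in
  Condition C provides. The terms subtracted on the two sides of the circle form one double series,
  taken once at radius \<open>c\<close> and once at radius \<open>c * norm z\<close>, and cancel by
  homogeneity. The inequalities come from positivity: the convolution \<open>J\<close> of the
  absolute values admits no cancellation, so every exponent of the expansion bounds it from below
  near zero, and finiteness at a single point constrains all of them.\<close>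

lemma lborel_complex_eq:
  "distr (lborel \<Otimes>\<^sub>M lborel) borel (\<lambda>(u, v). Complex u v) = (lborel :: complex measure)"
proof (rule lborel_eqI [symmetric])
  fix l u :: complex
  assume lu: "\<And>b. b \<in> Basis \<Longrightarrow> l \<bullet> b \<le> u \<bullet> b"
  have "Re l \<le> Re u" "Im l \<le> Im u"
    using lu[of 1] lu[of \<i>] by (auto simp: Basis_complex_def inner_complex_def)
  have meas: "(\<lambda>(u, v). Complex u v) \<in> borel_measurable (lborel \<Otimes>\<^sub>M lborel)"
    by (simp add: Complex_eq split_beta')
  have vim: "(\<lambda>(u, v). Complex u v) -` box l u = {Re l<..<Re u} \<times> {Im l<..<Im u}"
    by (auto simp: in_box_complex_iff)
  have "emeasure (distr (lborel \<Otimes>\<^sub>M lborel) borel (\<lambda>(u, v). Complex u v)) (box l u)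
      = emeasure (lborel \<Otimes>\<^sub>M lborel) ({Re l<..<Re u} \<times> {Im l<..<Im u})"
    by (subst emeasure_distr[OF meas]) (simp_all add: vim space_pair_measure)
  also have "\<dots> = ennreal ((Re u - Re l) * (Im u - Im l))"
    using \<open>Re l \<le> Re u\<close> \<open>Im l \<le> Im u\<close>
    by (simp add: lborel.emeasure_pair_measure_Times ennreal_mult)
  finally show "emeasure (distr (lborel \<Otimes>\<^sub>M lborel) borel (\<lambda>(u, v). Complex u v)) (box l u)
      = ennreal (\<Prod>b\<in>Basis. (u - l) \<bullet> b)"
    by (simp add: Basis_complex_def inner_complex_def)
qed simp

lemma nn_integral_lborel_complex:
  fixes F :: "complex \<Rightarrow> ennreal"
  assumes [measurable]: "F \<in> borel_measurable borel"
  shows "(\<integral>\<^sup>+x. F x \<partial>lborel) = (\<integral>\<^sup>+u. \<integral>\<^sup>+v. F (Complex u v) \<partial>lborel \<partial>lborel)"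
proof -
  have meas [measurable]: "(\<lambda>(u, v). Complex u v) \<in> borel_measurable (lborel \<Otimes>\<^sub>M lborel)"
    by (simp add: Complex_eq split_beta')
  have [measurable]: "(\<lambda>p. F (Complex (fst p) (snd p))) \<in> borel_measurable (lborel \<Otimes>\<^sub>M lborel)"
    using measurable_compose[OF meas assms] by (simp add: split_beta')
  have "(\<integral>\<^sup>+x. F x \<partial>lborel) = (\<integral>\<^sup>+x. F x \<partial>distr (lborel \<Otimes>\<^sub>M lborel) borel (\<lambda>(u, v). Complex u v))"
    by (simp add: lborel_complex_eq)
  also have "\<dots> = (\<integral>\<^sup>+p. F (Complex (fst p) (snd p)) \<partial>(lborel \<Otimes>\<^sub>M lborel))"
    by (subst nn_integral_distr) (simp_all add: split_beta')
  also have "\<dots> = (\<integral>\<^sup>+u. \<integral>\<^sup>+v. F (Complex u v) \<partial>lborel \<partial>lborel)"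
    using lborel.nn_integral_fst[of "\<lambda>p. F (Complex (fst p) (snd p))" lborel] by simp
  finally show ?thesis .
qed

lemma measurable_Complex [measurable (raw)]:
  assumes "f \<in> borel_measurable M" "g \<in> borel_measurable M"
  shows "(\<lambda>x. Complex (f x) (g x)) \<in> borel_measurable M"
  using assms by (simp add: Complex_eq)

lemma nn_integral_lborel_complex':
  fixes F :: "complex \<Rightarrow> ennreal"
  assumes [measurable]: "F \<in> borel_measurable borel"
  shows "(\<integral>\<^sup>+x. F x \<partial>lborel) = (\<integral>\<^sup>+v. \<integral>\<^sup>+u. F (Complex u v) \<partial>lborel \<partial>lborel)"
  unfolding nn_integral_lborel_complex[OF assms]
  by (rule lborel_pair.Fubini') (simp add: split_beta')

text \<open>For c = p + iq with p nonzero the linear map x -> c x is handled by two one-dimensional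
  affine substitutions: first u for fixed v, then v for fixed u, where the second coordinate has
  become the shear (q/p) u + ((p^2 + q^2)/p) v. The two Jacobians multiply to the square of the
  modulus of c.\<close>

lemma nn_integral_lborel_scale_aux:
  fixes F :: "complex \<Rightarrow> ennreal"
  assumes [measurable]: "F \<in> borel_measurable borel" and c: "Re c \<noteq> 0"
  shows "(\<integral>\<^sup>+x. F x \<partial>lborel) = ennreal ((norm c)\<^sup>2) * (\<integral>\<^sup>+x. F (c * x) \<partial>lborel)"
proof -
  define p q where "p = Re c" and "q = Im c"
  have p: "p \<noteq> 0" using c by (simp add: p_def)
  have nc: "(norm c)\<^sup>2 = p\<^sup>2 + q\<^sup>2" by (simp add: p_def q_def cmod_power2)
  have pos: "p\<^sup>2 + q\<^sup>2 > 0" using p by (simp add: sum_power2_gt_zero_iff)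
  have "(\<integral>\<^sup>+x. F (c * x) \<partial>lborel)
      = (\<integral>\<^sup>+v. \<integral>\<^sup>+u. F (Complex (p * u - q * v) (q * u + p * v)) \<partial>lborel \<partial>lborel)"
    by (subst nn_integral_lborel_complex') (simp_all add: p_def q_def complex_eq_iff mult.commute
       times_complex.ctr add.commute)
  also have "\<dots> = (\<integral>\<^sup>+v. ennreal (1 / \<bar>p\<bar>) * (\<integral>\<^sup>+u. F (Complex u ((q / p) * u + ((p\<^sup>2 + q\<^sup>2) / p) * v)) \<partial>lborel) \<partial>lborel)"
  proof (rule nn_integral_cong)
    fix v :: real
    have "(\<integral>\<^sup>+u. F (Complex (p * u - q * v) (q * u + p * v)) \<partial>lborel)
       = ennreal \<bar>1 / p\<bar> * (\<integral>\<^sup>+u. F (Complex (p * (q * v / p + (1 / p) * u) - q * v) (q * (q * v / p + (1 / p) * u) + p * v)) \<partial>lborel)"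
      using p by (subst nn_integral_real_affine[where c = "1 / p" and t = "q * v / p"]) simp_all
    also have "\<dots> = ennreal (1 / \<bar>p\<bar>) * (\<integral>\<^sup>+u. F (Complex u ((q / p) * u + ((p\<^sup>2 + q\<^sup>2) / p) * v)) \<partial>lborel)"
      using p by (intro arg_cong2[where f = "(*)"] nn_integral_cong arg_cong[where f = F])
        (simp_all add: field_simps power2_eq_square)
    finally show "(\<integral>\<^sup>+u. F (Complex (p * u - q * v) (q * u + p * v)) \<partial>lborel) = \<dots>" .
  qed
  also have "\<dots> = ennreal (1 / \<bar>p\<bar>) * (\<integral>\<^sup>+u. \<integral>\<^sup>+v. F (Complex u ((q / p) * u + ((p\<^sup>2 + q\<^sup>2) / p) * v)) \<partial>lborel \<partial>lborel)"
    by (subst nn_integral_cmult, simp, subst lborel_pair.Fubini') (simp_all add: split_beta')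
  also have "(\<integral>\<^sup>+u. \<integral>\<^sup>+v. F (Complex u ((q / p) * u + ((p\<^sup>2 + q\<^sup>2) / p) * v)) \<partial>lborel \<partial>lborel)
     = (\<integral>\<^sup>+u. ennreal (\<bar>p\<bar> / (p\<^sup>2 + q\<^sup>2)) * (\<integral>\<^sup>+v. F (Complex u v) \<partial>lborel) \<partial>lborel)"
  proof (rule nn_integral_cong)
    fix u :: real
    define k where "k = (p\<^sup>2 + q\<^sup>2) / p"
    have k: "k \<noteq> 0" "\<bar>k\<bar> = (p\<^sup>2 + q\<^sup>2) / \<bar>p\<bar>" using p pos by (auto simp: k_def)
    have "(\<integral>\<^sup>+v. F (Complex u v) \<partial>lborel) = ennreal \<bar>k\<bar> * (\<integral>\<^sup>+v. F (Complex u ((q / p) * u + k * v)) \<partial>lborel)"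
      by (rule nn_integral_real_affine) (use k in simp_all)
    moreover have "ennreal (\<bar>p\<bar> / (p\<^sup>2 + q\<^sup>2)) * ennreal \<bar>k\<bar> = 1"
      using p pos unfolding k(2) by (subst ennreal_mult[symmetric]) auto
    ultimately show "(\<integral>\<^sup>+v. F (Complex u ((q / p) * u + ((p\<^sup>2 + q\<^sup>2) / p) * v)) \<partial>lborel)
      = ennreal (\<bar>p\<bar> / (p\<^sup>2 + q\<^sup>2)) * (\<integral>\<^sup>+v. F (Complex u v) \<partial>lborel)"
      by (simp add: k_def[symmetric] mult.assoc[symmetric])
  qed
  also have "\<dots> = ennreal (\<bar>p\<bar> / (p\<^sup>2 + q\<^sup>2)) * (\<integral>\<^sup>+x. F x \<partial>lborel)"
    by (subst nn_integral_cmult) (simp_all add: nn_integral_lborel_complex)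
  finally have eq: "(\<integral>\<^sup>+x. F (c * x) \<partial>lborel)
     = ennreal (1 / \<bar>p\<bar>) * (ennreal (\<bar>p\<bar> / (p\<^sup>2 + q\<^sup>2)) * (\<integral>\<^sup>+x. F x \<partial>lborel))" .
  have "ennreal (p\<^sup>2 + q\<^sup>2) * (ennreal (1 / \<bar>p\<bar>) * ennreal (\<bar>p\<bar> / (p\<^sup>2 + q\<^sup>2))) = 1"
    using p pos by (subst ennreal_mult[symmetric], simp, simp, subst ennreal_mult[symmetric]) auto
  then show ?thesis
    unfolding eq nc by (simp add: mult.assoc[symmetric])
qed

lemma nn_integral_lborel_scale:
  fixes F :: "complex \<Rightarrow> ennreal"
  assumes F [measurable]: "F \<in> borel_measurable borel" and c: "c \<noteq> 0"
  shows "(\<integral>\<^sup>+x. F x \<partial>lborel) = ennreal ((norm c)\<^sup>2) * (\<integral>\<^sup>+x. F (c * x) \<partial>lborel)"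
proof (cases "Re c = 0")
  case False
  then show ?thesis by (intro nn_integral_lborel_scale_aux) auto
next
  case True
  \<comment> \<open>A purely imaginary c is the product of d and 1 + i, both with nonzero real part,
    so the shear argument applies twice.\<close>
  define d where "d = c / (1 + \<i>)"
  have one_i: "1 + \<i> \<noteq> 0" by (auto simp: complex_eq_iff)
  have c_eq: "c = d * (1 + \<i>)" using one_i by (simp add: d_def)
  have "Re d \<noteq> 0"
    using True c by (auto simp: d_def Re_divide complex_eq_iff)
  have "(\<integral>\<^sup>+x. F x \<partial>lborel) = ennreal ((norm d)\<^sup>2) * (\<integral>\<^sup>+x. F (d * x) \<partial>lborel)"
    by (rule nn_integral_lborel_scale_aux) fact+
  also have "(\<integral>\<^sup>+x. F (d * x) \<partial>lborel) = ennreal ((norm (1 + \<i>))\<^sup>2) * (\<integral>\<^sup>+x. F (d * ((1 + \<i>) * x)) \<partial>lborel)"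
    by (rule nn_integral_lborel_scale_aux[of "\<lambda>x. F (d * x)"]) auto
  finally show ?thesis
    by (simp add: c_eq norm_mult power_mult_distrib ennreal_mult mult.assoc)
qed

text \<open>This is the Haar measure of the multiplicative group. Since \<open>1 / 0 = 0\<close>,
  the origin carries no mass and the whole plane can be kept as the space.\<close>

definition haar :: "complex measure" where
  "haar = density lborel (\<lambda>x. ennreal (1 / (norm x)\<^sup>2))"

lemma sets_haar [simp, measurable_cong]: "sets haar = sets borel"
  and space_haar [simp]: "space haar = UNIV"
  by (simp_all add: haar_def)

lemma nn_integral_haar:
  assumes [measurable]: "F \<in> borel_measurable borel"
  shows "(\<integral>\<^sup>+x. F x \<partial>haar) = (\<integral>\<^sup>+x. ennreal (1 / (norm x)\<^sup>2) * F x \<partial>lborel)"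
  by (simp add: haar_def nn_integral_density)

lemma AE_haar_nonzero: "AE x in haar. x \<noteq> 0"
  unfolding haar_def by (subst AE_density) (auto intro!: AE_I2)

text \<open>The density is positive off the origin and the origin is a Lebesgue null set, so both
  measures have the same null sets.\<close>

lemma AE_haar_iff: "(AE x in haar. P x) \<longleftrightarrow> (AE x in lborel. P x)"
proof -
  have nz: "AE x in lborel. x \<noteq> (0::complex)" by (rule AE_lborel_singleton)
  have "(AE x in haar. P x) \<longleftrightarrow> (AE x in lborel. 0 < ennreal (1 / (norm x)\<^sup>2) \<longrightarrow> P x)"
    unfolding haar_def by (subst AE_density) simp_all
  also have "\<dots> \<longleftrightarrow> (AE x in lborel. P x)"
  proof
    assume "AE x in lborel. 0 < ennreal (1 / (norm x)\<^sup>2) \<longrightarrow> P x"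
    with nz show "AE x in lborel. P x" by eventually_elim simp
  next
    assume "AE x in lborel. P x"
    then show "AE x in lborel. 0 < ennreal (1 / (norm x)\<^sup>2) \<longrightarrow> P x" by eventually_elim simp
  qed
  finally show ?thesis .
qed

interpretation haar: sigma_finite_measure haar
  unfolding haar_def
  using sigma_finite_measure.sigma_finite_iff_density_finite
    [OF sigma_finite_lborel, of "\<lambda>x::complex. ennreal (1 / (norm x)\<^sup>2)"] by simp

lemma nn_integral_haar_scale:
  assumes [measurable]: "F \<in> borel_measurable borel" and c: "c \<noteq> 0"
  shows "(\<integral>\<^sup>+x. F (c * x) \<partial>haar) = (\<integral>\<^sup>+x. F x \<partial>haar)"
proof -
  have "(\<integral>\<^sup>+x. F x \<partial>haar) = ennreal ((norm c)\<^sup>2) * (\<integral>\<^sup>+x. ennreal (1 / (norm (c * x))\<^sup>2) * F (c * x) \<partial>lborel)"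
    by (simp add: nn_integral_haar, rule nn_integral_lborel_scale) (use c in auto)
  also have "\<dots> = (\<integral>\<^sup>+x. ennreal ((norm c)\<^sup>2) * (ennreal (1 / (norm (c * x))\<^sup>2) * F (c * x)) \<partial>lborel)"
    by (rule nn_integral_cmult[symmetric]) simp
  also have "\<dots> = (\<integral>\<^sup>+x. ennreal (1 / (norm x)\<^sup>2) * F (c * x) \<partial>lborel)"
    using c by (intro nn_integral_cong)
      (simp add: mult.assoc[symmetric] ennreal_mult[symmetric] norm_mult power_mult_distrib)
  finally show ?thesis by (simp add: nn_integral_haar)
qed

text \<open>The logarithm carries dx/x on the positive half-line to Lebesgue measure, by the
  fundamental theorem of calculus on boxes. The indicator excludes the values of \<open>ln\<close>
  at nonpositive arguments.\<close>

lemma lborel_eq_distr_ln: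
  "lborel = distr (density lborel (\<lambda>x. ennreal (1 / x) * indicator {0<..} x)) borel (ln :: real \<Rightarrow> real)"
proof (rule lborel_eqI)
  fix l u :: real
  assume "\<And>b. b \<in> Basis \<Longrightarrow> l \<bullet> b \<le> u \<bullet> b"
  then have lu: "l \<le> u" by simp
  have [simp]: "ln -` box l u \<in> sets (borel :: real measure)"
    using measurable_sets[of "ln :: real \<Rightarrow> real" borel borel "box l u"] by simp
  have "emeasure (distr (density lborel (\<lambda>x. ennreal (1 / x) * indicator {0<..} x)) borel ln) (box l u)
     = (\<integral>\<^sup>+x. ennreal (1 / x) * indicator {0<..} x * indicator (ln -` box l u) x \<partial>lborel)"
    by (subst emeasure_distr, simp, simp, subst emeasure_density) (simp_all del: box_real)
  also have "\<dots> = (\<integral>\<^sup>+x. ennreal (1 / x) * indicator {exp l..exp u} x \<partial>lborel)"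
  proof (rule nn_integral_cong_AE)
    have "AE x in lborel. x \<noteq> exp l \<and> x \<noteq> exp u"
      using AE_lborel_singleton[of "exp l"] AE_lborel_singleton[of "exp u"] by eventually_elim auto
    then show "AE x in lborel. ennreal (1 / x) * indicator {0<..} x * indicator (ln -` box l u) x
        = ennreal (1 / x) * indicator {exp l..exp u} x"
    proof eventually_elim
      case (elim x)
      have "0 < x \<and> l < ln x \<and> ln x < u \<longleftrightarrow> exp l \<le> x \<and> x \<le> exp u"
        using elim exp_gt_zero[of l] ln_less_cancel_iff[of x "exp u"] ln_less_cancel_iff[of "exp l" x]
        by (smt (verit) exp_ln exp_less_mono exp_less_cancel_iff)
      then show ?case by (auto simp: indicator_def)
    qed
  qed
  also have "\<dots> = ennreal (ln (exp u) - ln (exp l))"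
    using lu by (intro nn_integral_FTC_Icc)
      (auto intro!: derivative_eq_intros simp: field_simps dest: less_le_trans[OF exp_gt_zero] order_trans[OF less_imp_le[OF exp_gt_zero]])
  finally show "emeasure (distr (density lborel (\<lambda>x. ennreal (1 / x) * indicator {0<..} x)) borel ln) (box l u)
     = ennreal (\<Prod>b\<in>Basis. (u - l) \<bullet> b)" by simp
qed simp

lemma nn_integral_exp:
  fixes F :: "real \<Rightarrow> ennreal"
  assumes [measurable]: "F \<in> borel_measurable borel"
  shows "(\<integral>\<^sup>+s. F (exp s) \<partial>lborel) = (\<integral>\<^sup>+x. ennreal (1 / x) * indicator {0<..} x * F x \<partial>lborel)"
  by (subst lborel_eq_distr_ln)
     (auto simp: nn_integral_distr nn_integral_density indicator_def intro!: nn_integral_cong)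

lemma nn_integral_abs_exp:
  fixes F :: "real \<Rightarrow> ennreal"
  assumes [measurable]: "F \<in> borel_measurable borel"
  shows "(\<integral>\<^sup>+x. ennreal (1 / \<bar>x\<bar>) * F x \<partial>lborel) = (\<integral>\<^sup>+s. F (exp s) + F (- exp s) \<partial>lborel)"
proof -
  have "(\<integral>\<^sup>+x. ennreal (1 / \<bar>x\<bar>) * F x \<partial>lborel)
     = (\<integral>\<^sup>+x. ennreal (1 / x) * indicator {0<..} x * F x + ennreal (1 / - x) * indicator {0<..} (-x) * F x \<partial>lborel)"
    by (intro nn_integral_cong) (auto simp: indicator_def abs_if not_less)
  also have "\<dots> = (\<integral>\<^sup>+s. F (exp s) \<partial>lborel) + (\<integral>\<^sup>+x. ennreal (1 / - x) * indicator {0<..} (-x) * F x \<partial>lborel)"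
    by (subst nn_integral_add) (simp_all add: nn_integral_exp)
  also have "(\<integral>\<^sup>+x. ennreal (1 / - x) * indicator {0<..} (-x) * F x \<partial>lborel) = (\<integral>\<^sup>+s. F (- exp s) \<partial>lborel)"
    by (subst nn_integral_real_affine[where c = "-1" and t = 0]) (simp_all add: nn_integral_exp[of "\<lambda>x. F (-x)"])
  finally show ?thesis by (simp add: nn_integral_add)
qed

text \<open>A substitute for polar coordinates: x = e^s (1 + it) or its negative, where t is the
  tangent of the argument and the sign covers the two half-planes. Haar measure becomes ds dt/(1 +
  t^2); for fixed t the logarithm of the modulus is a translate of s, and inversion is a reflection
  of s combined with t -> -t.\<close>

lemma nn_integral_haar_coords:
  fixes F :: "complex \<Rightarrow> ennreal"
  assumes [measurable]: "F \<in> borel_measurable borel"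
  shows "(\<integral>\<^sup>+x. F x \<partial>haar) = (\<integral>\<^sup>+t. ennreal (1 / (1 + t\<^sup>2)) *
     (\<integral>\<^sup>+s. F (of_real (exp s) * Complex 1 t) + F (- of_real (exp s) * Complex 1 t) \<partial>lborel) \<partial>lborel)"
proof -
  have "(\<integral>\<^sup>+x. F x \<partial>haar) = (\<integral>\<^sup>+u. \<integral>\<^sup>+v. ennreal (1 / (norm (Complex u v))\<^sup>2) * F (Complex u v) \<partial>lborel \<partial>lborel)"
    by (subst nn_integral_haar, simp, subst nn_integral_lborel_complex) simp_all
  also have "\<dots> = (\<integral>\<^sup>+u. \<integral>\<^sup>+t. ennreal (1 / \<bar>u\<bar>) * (ennreal (1 / (1 + t\<^sup>2)) * F (of_real u * Complex 1 t)) \<partial>lborel \<partial>lborel)"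
  proof (rule nn_integral_cong_AE)
    show "AE u in lborel. (\<integral>\<^sup>+v. ennreal (1 / (norm (Complex u v))\<^sup>2) * F (Complex u v) \<partial>lborel)
      = (\<integral>\<^sup>+t. ennreal (1 / \<bar>u\<bar>) * (ennreal (1 / (1 + t\<^sup>2)) * F (of_real u * Complex 1 t)) \<partial>lborel)"
      using AE_lborel_singleton[of 0]
    proof eventually_elim
      case (elim u)
      have "(\<integral>\<^sup>+v. ennreal (1 / (norm (Complex u v))\<^sup>2) * F (Complex u v) \<partial>lborel)
        = ennreal \<bar>u\<bar> * (\<integral>\<^sup>+t. ennreal (1 / (norm (Complex u (0 + u * t)))\<^sup>2) * F (Complex u (0 + u * t)) \<partial>lborel)"
        using elim by (intro nn_integral_real_affine) auto
      also have "\<dots> = (\<integral>\<^sup>+t. ennreal \<bar>u\<bar> * (ennreal (1 / (norm (Complex u (0 + u * t)))\<^sup>2) * F (Complex u (0 + u * t))) \<partial>lborel)"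
        by (rule nn_integral_cmult[symmetric]) simp
      also have "\<dots> = (\<integral>\<^sup>+t. ennreal (1 / \<bar>u\<bar>) * (ennreal (1 / (1 + t\<^sup>2)) * F (of_real u * Complex 1 t)) \<partial>lborel)"
      proof (rule nn_integral_cong)
        fix t :: real
        have "u\<^sup>2 + (u * t)\<^sup>2 = u\<^sup>2 * (1 + t\<^sup>2)" by (simp add: power_mult_distrib algebra_simps)
        moreover have "1 + t\<^sup>2 > 0" by (simp add: add_pos_nonneg)
        moreover have "(norm (Complex u (0 + u * t)))\<^sup>2 = u\<^sup>2 + (u * t)\<^sup>2" by (simp add: cmod_power2)
        ultimately have nq: "(norm (Complex u (0 + u * t)))\<^sup>2 = \<bar>u\<bar> * \<bar>u\<bar> * (1 + t\<^sup>2)"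
          by (simp add: power2_eq_square)
        have "\<bar>u\<bar> * (1 / (norm (Complex u (0 + u * t)))\<^sup>2) = 1 / \<bar>u\<bar> * (1 / (1 + t\<^sup>2))"
          using elim \<open>1 + t\<^sup>2 > 0\<close> unfolding nq by (simp add: divide_simps)
        moreover have "Complex u (0 + u * t) = of_real u * Complex 1 t" by (simp add: complex_eq_iff)
        ultimately show "ennreal \<bar>u\<bar> * (ennreal (1 / (norm (Complex u (0 + u * t)))\<^sup>2) * F (Complex u (0 + u * t)))
          = ennreal (1 / \<bar>u\<bar>) * (ennreal (1 / (1 + t\<^sup>2)) * F (of_real u * Complex 1 t))"
          using \<open>1 + t\<^sup>2 > 0\<close> by (simp add: mult.assoc[symmetric] ennreal_mult[symmetric])
      qed
      finally show ?case .
    qed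
  qed
  also have "\<dots> = (\<integral>\<^sup>+t. \<integral>\<^sup>+u. ennreal (1 / \<bar>u\<bar>) * (ennreal (1 / (1 + t\<^sup>2)) * F (of_real u * Complex 1 t)) \<partial>lborel \<partial>lborel)"
    by (rule lborel_pair.Fubini') (simp add: split_beta')
  also have "\<dots> = (\<integral>\<^sup>+t. ennreal (1 / (1 + t\<^sup>2)) *
     (\<integral>\<^sup>+s. F (of_real (exp s) * Complex 1 t) + F (- of_real (exp s) * Complex 1 t) \<partial>lborel) \<partial>lborel)"
  proof (rule nn_integral_cong)
    fix t :: real
    have "(\<integral>\<^sup>+u. ennreal (1 / \<bar>u\<bar>) * (ennreal (1 / (1 + t\<^sup>2)) * F (of_real u * Complex 1 t)) \<partial>lborel)
      = (\<integral>\<^sup>+s. ennreal (1 / (1 + t\<^sup>2)) * (F (of_real (exp s) * Complex 1 t) + F (- of_real (exp s) * Complex 1 t)) \<partial>lborel)"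
      by (subst nn_integral_abs_exp) (simp_all add: distrib_left)
    also have "\<dots> = ennreal (1 / (1 + t\<^sup>2)) * (\<integral>\<^sup>+s. F (of_real (exp s) * Complex 1 t) + F (- of_real (exp s) * Complex 1 t) \<partial>lborel)"
      by (rule nn_integral_cmult) simp
    finally show "(\<integral>\<^sup>+u. ennreal (1 / \<bar>u\<bar>) * (ennreal (1 / (1 + t\<^sup>2)) * F (of_real u * Complex 1 t)) \<partial>lborel) = \<dots>" .
  qed
  finally show ?thesis .
qed

lemma nn_integral_real_shift:
  fixes F :: "real \<Rightarrow> ennreal"
  assumes [measurable]: "F \<in> borel_measurable borel"
  shows "(\<integral>\<^sup>+s. F (t + s) \<partial>lborel) = (\<integral>\<^sup>+s. F s \<partial>lborel)"
  using nn_integral_real_affine[of F 1 t] assms by simp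

lemma nn_integral_haar_inverse:
  fixes F :: "complex \<Rightarrow> ennreal"
  assumes [measurable]: "F \<in> borel_measurable borel"
  shows "(\<integral>\<^sup>+x. F (inverse x) \<partial>haar) = (\<integral>\<^sup>+x. F x \<partial>haar)"
proof -
  have inv: "inverse (of_real (exp s) * Complex 1 t) = of_real (exp (- ln (1 + t\<^sup>2) - s)) * Complex 1 (- t)"
    for s t :: real
  proof -
    have pos: "1 + t\<^sup>2 > 0" by (simp add: add_pos_nonneg)
    have "inverse (of_real (exp s)) = complex_of_real (exp (- s))" by (simp add: exp_minus)
    moreover have "inverse (Complex 1 t) = of_real (exp (- ln (1 + t\<^sup>2))) * Complex 1 (- t)"
      using pos by (simp add: exp_minus complex_eq_iff divide_inverse power2_eq_square)
    moreover have "exp (- ln (1 + t\<^sup>2) - s) = exp (- s) * exp (- ln (1 + t\<^sup>2))"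
      by (metis add.commute diff_conv_add_uminus exp_add)
    ultimately show ?thesis
      by (simp only: inverse_mult_distrib of_real_mult mult.assoc)
  qed
  let ?G = "\<lambda>t s. F (of_real (exp s) * Complex 1 t) + F (- of_real (exp s) * Complex 1 t)"
  have "(\<integral>\<^sup>+x. F (inverse x) \<partial>haar) = (\<integral>\<^sup>+t. ennreal (1 / (1 + t\<^sup>2)) * (\<integral>\<^sup>+s. ?G (- t) (- ln (1 + t\<^sup>2) - s) \<partial>lborel) \<partial>lborel)"
    by (subst nn_integral_haar_coords) (simp_all add: inv inverse_minus_eq del: inverse_mult_distrib)
  also have "\<dots> = (\<integral>\<^sup>+t. ennreal (1 / (1 + t\<^sup>2)) * (\<integral>\<^sup>+s. ?G (- t) s \<partial>lborel) \<partial>lborel)"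
  proof (rule nn_integral_cong)
    fix t :: real
    have "(\<integral>\<^sup>+s. ?G (- t) (- ln (1 + t\<^sup>2) - s) \<partial>lborel) = (\<integral>\<^sup>+s. ?G (- t) s \<partial>lborel)"
      using nn_integral_real_affine[of "?G (- t)" "-1" "- ln (1 + t\<^sup>2)"] by simp
    then show "ennreal (1 / (1 + t\<^sup>2)) * (\<integral>\<^sup>+s. ?G (- t) (- ln (1 + t\<^sup>2) - s) \<partial>lborel)
      = ennreal (1 / (1 + t\<^sup>2)) * (\<integral>\<^sup>+s. ?G (- t) s \<partial>lborel)"
      by (simp only:)
  qed
  also have "\<dots> = (\<integral>\<^sup>+t. ennreal (1 / (1 + t\<^sup>2)) * (\<integral>\<^sup>+s. ?G t s \<partial>lborel) \<partial>lborel)"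
    using nn_integral_real_affine[of "\<lambda>t. ennreal (1 / (1 + t\<^sup>2)) * (\<integral>\<^sup>+s. ?G t s \<partial>lborel)" "-1" 0] by simp
  also have "\<dots> = (\<integral>\<^sup>+x. F x \<partial>haar)"
    by (simp add: nn_integral_haar_coords)
  finally show ?thesis .
qed

lemma nn_integral_arctan_deriv: "(\<integral>\<^sup>+t. ennreal (1 / (1 + t\<^sup>2)) \<partial>lborel) = ennreal pi"
proof -
  let ?f = "\<lambda>t::real. 1 / (1 + t\<^sup>2)"
  have half: "(\<integral>\<^sup>+t. ennreal (?f t) * indicator {0..} t \<partial>lborel) = ennreal (pi / 2 - arctan 0)"
    by (rule nn_integral_FTC_atLeast)
      (auto intro!: derivative_eq_intros tendsto_arctan_at_top simp: field_simps add_nonneg_eq_0_iff)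
  have "(\<integral>\<^sup>+t. ennreal (?f t) \<partial>lborel) = (\<integral>\<^sup>+t. ennreal (?f t) * indicator {0..} t + ennreal (?f t) * indicator {0..} (- t) \<partial>lborel)"
    by (rule nn_integral_cong_AE, use AE_lborel_singleton[of 0] in eventually_elim) (auto simp: indicator_def)
  also have "\<dots> = (\<integral>\<^sup>+t. ennreal (?f t) * indicator {0..} t \<partial>lborel) + (\<integral>\<^sup>+t. ennreal (?f t) * indicator {0..} (-t) \<partial>lborel)"
    by (rule nn_integral_add) auto
  also have "(\<integral>\<^sup>+t. ennreal (?f t) * indicator {0..} (-t) \<partial>lborel) = (\<integral>\<^sup>+t. ennreal (?f t) * indicator {0..} t \<partial>lborel)"
    by (subst nn_integral_real_affine[where c = "-1" and t = 0]) simp_all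
  finally show ?thesis
    unfolding half by (simp flip: ennreal_plus)
qed

text \<open>The length 2 pi of the circle arises as the total mass pi of dt/(1 + t^2), counted once
  for each sign.\<close>

lemma nn_integral_haar_radial:
  fixes F :: "real \<Rightarrow> ennreal"
  assumes [measurable]: "F \<in> borel_measurable borel"
  shows "(\<integral>\<^sup>+x. F (norm x) \<partial>haar) = ennreal (2 * pi) * (\<integral>\<^sup>+s. F (exp s) \<partial>lborel)"
proof -
  have nrm: "norm (of_real (exp s) * Complex 1 t) = exp (ln (1 + t\<^sup>2) / 2 + s)" for s t :: real
  proof -
    have pos: "1 + t\<^sup>2 > 0" by (simp add: add_pos_nonneg)
    have "exp (ln (1 + t\<^sup>2) / 2) = sqrt (1 + t\<^sup>2)"
      using pos by (simp add: ln_sqrt[symmetric])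
    moreover have "norm (Complex 1 t) = sqrt (1 + t\<^sup>2)" by (simp add: cmod_def)
    ultimately show ?thesis by (simp add: norm_mult exp_add)
  qed
  have "(\<integral>\<^sup>+x. F (norm x) \<partial>haar) = (\<integral>\<^sup>+t. ennreal (1 / (1 + t\<^sup>2)) * (\<integral>\<^sup>+s. 2 * F (exp (ln (1 + t\<^sup>2) / 2 + s)) \<partial>lborel) \<partial>lborel)"
    by (subst nn_integral_haar_coords) (simp_all add: nrm mult_2)
  also have "\<dots> = (\<integral>\<^sup>+t. ennreal (1 / (1 + t\<^sup>2)) * (2 * (\<integral>\<^sup>+s. F (exp s) \<partial>lborel)) \<partial>lborel)"
    by (subst nn_integral_cmult, simp, subst nn_integral_real_shift[where F = "\<lambda>s. F (exp s)"]) simp_all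
  also have "\<dots> = ennreal pi * (2 * (\<integral>\<^sup>+s. F (exp s) \<partial>lborel))"
    by (subst nn_integral_multc) (simp_all add: nn_integral_arctan_deriv)
  finally show ?thesis by (simp add: ennreal_mult' mult_ac)
qed

text \<open>Invariance is proved for nonnegative integrals and recorded as an equality of measures;
  in this form it transfers both to Bochner integrals and to integrability.\<close>

lemma distr_haar_eqI:
  assumes [measurable]: "T \<in> borel_measurable borel"
    and "\<And>F :: complex \<Rightarrow> ennreal. F \<in> borel_measurable borel \<Longrightarrow> (\<integral>\<^sup>+x. F (T x) \<partial>haar) = (\<integral>\<^sup>+x. F x \<partial>haar)"
  shows "distr haar borel T = haar"
proof (rule measure_eqI)
  fix A assume "A \<in> sets (distr haar borel T)"
  then have [measurable]: "A \<in> sets borel" by simp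
  have "emeasure (distr haar borel T) A = (\<integral>\<^sup>+x. indicator A x \<partial>distr haar borel T)"
    by simp
  also have "\<dots> = (\<integral>\<^sup>+x. indicator A (T x) \<partial>haar)"
    by (subst nn_integral_distr) auto
  also have "\<dots> = emeasure haar A" by (subst assms(2)) auto
  finally show "emeasure (distr haar borel T) A = emeasure haar A" .
qed simp

lemma distr_haar_scale: "c \<noteq> 0 \<Longrightarrow> distr haar borel (\<lambda>x. c * x) = haar"
  by (rule distr_haar_eqI) (simp_all add: nn_integral_haar_scale)

lemma distr_haar_inverse: "distr haar borel inverse = haar"
  by (rule distr_haar_eqI) (simp_all add: nn_integral_haar_inverse)

lemma distr_haar_norm: "distr haar borel norm = distr (density lborel (\<lambda>_. ennreal (2 * pi))) borel (exp :: real \<Rightarrow> real)"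
proof (rule measure_eqI)
  fix A assume "A \<in> sets (distr haar borel norm)"
  then have [measurable]: "A \<in> sets borel" by simp
  have "emeasure (distr haar borel norm) A = (\<integral>\<^sup>+x. indicator A x \<partial>distr haar borel norm)"
    by simp
  also have "\<dots> = (\<integral>\<^sup>+x. indicator A (norm x) \<partial>haar)"
    by (subst nn_integral_distr) auto
  also have "\<dots> = ennreal (2 * pi) * (\<integral>\<^sup>+s. indicator A (exp s) \<partial>lborel)"
    by (subst nn_integral_haar_radial) auto
  also have "\<dots> = (\<integral>\<^sup>+x. indicator A x \<partial>distr (density lborel (\<lambda>_. ennreal (2 * pi))) borel exp)"
    by (subst nn_integral_distr, simp, simp, subst nn_integral_density) (simp_all add: nn_integral_cmult)
  finally show "emeasure (distr haar borel norm) A = emeasure (distr (density lborel (\<lambda>_. ennreal (2 * pi))) borel exp) A"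
    by simp
qed simp

lemma haar_integral_scale:
  fixes f :: "complex \<Rightarrow> complex"
  assumes [measurable]: "f \<in> borel_measurable borel" and c: "c \<noteq> 0"
  shows "(\<integral>x. f (c * x) \<partial>haar) = (\<integral>x. f x \<partial>haar)"
  by (subst (2) distr_haar_scale[OF c, symmetric], subst integral_distr) simp_all

lemma haar_integrable_scale_iff:
  fixes f :: "complex \<Rightarrow> complex"
  assumes [measurable]: "f \<in> borel_measurable borel" and c: "c \<noteq> 0"
  shows "integrable haar (\<lambda>x. f (c * x)) \<longleftrightarrow> integrable haar f"
  by (subst (2) distr_haar_scale[OF c, symmetric], subst integrable_distr_eq) simp_all

lemma haar_integral_inverse:
  fixes f :: "complex \<Rightarrow> complex"
  assumes [measurable]: "f \<in> borel_measurable borel"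
  shows "(\<integral>x. f (inverse x) \<partial>haar) = (\<integral>x. f x \<partial>haar)"
  by (subst (2) distr_haar_inverse[symmetric], subst integral_distr) simp_all

lemma haar_integrable_inverse_iff:
  fixes f :: "complex \<Rightarrow> complex"
  assumes [measurable]: "f \<in> borel_measurable borel"
  shows "integrable haar (\<lambda>x. f (inverse x)) \<longleftrightarrow> integrable haar f"
  by (subst (2) distr_haar_inverse[symmetric], subst integrable_distr_eq) simp_all

lemma haar_integral_radial:
  fixes f :: "real \<Rightarrow> complex"
  assumes [measurable]: "f \<in> borel_measurable borel"
  shows "(\<integral>x. f (norm x) \<partial>haar) = 2 * pi * (\<integral>s. f (exp s) \<partial>lborel)"
    and "integrable haar (\<lambda>x. f (norm x)) \<longleftrightarrow> integrable lborel (\<lambda>s. f (exp s))"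
proof -
  have "(\<integral>x. f (norm x) \<partial>haar) = (\<integral>x. f x \<partial>distr haar borel norm)"
    by (subst integral_distr) simp_all
  also have "\<dots> = (\<integral>s. f (exp s) \<partial>density lborel (\<lambda>_. ennreal (2 * pi)))"
    unfolding distr_haar_norm by (subst integral_distr) simp_all
  also have "\<dots> = 2 * pi * (\<integral>s. f (exp s) \<partial>lborel)"
    by (subst integral_density) (simp_all add: scaleR_conv_of_real)
  finally show "(\<integral>x. f (norm x) \<partial>haar) = 2 * pi * (\<integral>s. f (exp s) \<partial>lborel)" .
  have "integrable haar (\<lambda>x. f (norm x)) \<longleftrightarrow> integrable (distr haar borel norm) f"
    by (subst integrable_distr_eq) simp_all
  also have "\<dots> \<longleftrightarrow> integrable (density lborel (\<lambda>_. ennreal (2 * pi))) (\<lambda>s. f (exp s))"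
    unfolding distr_haar_norm by (subst integrable_distr_eq) simp_all
  also have "\<dots> \<longleftrightarrow> integrable lborel (\<lambda>s. complex_of_real (2 * pi) * f (exp s))"
    by (subst integrable_density) (simp_all add: scaleR_conv_of_real)
  also have "\<dots> \<longleftrightarrow> integrable lborel (\<lambda>s. f (exp s))"
    using integrable_mult_right[of "1 / complex_of_real (2 * pi)" lborel "\<lambda>s. complex_of_real (2 * pi) * f (exp s)"]
      integrable_mult_right[of "complex_of_real (2 * pi)" lborel "\<lambda>s. f (exp s)"] by auto
  finally show "integrable haar (\<lambda>x. f (norm x)) \<longleftrightarrow> integrable lborel (\<lambda>s. f (exp s))" .
qed

subsection \<open>Quasi-characters\<close>

text \<open>For \<open>x \<noteq> 0\<close> this is \<open>|x|^w (x/|x|)^n\<close>. At \<open>x = 0\<close> the phase is set to \<open>1\<close>, so that \<open>qchar\<close> never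
  vanishes and its absolute value is \<open>exp (Re w * ln (norm x))\<close> everywhere (with \<open>ln 0 = 0\<close>).\<close>
definition qchar :: "int \<Rightarrow> complex \<Rightarrow> complex \<Rightarrow> complex" where
  "qchar n w x = exp (w * of_real (ln (norm x))) * (if x = 0 then 1 else sgn x) powi n"

lemma borel_measurable_powi [measurable (raw)]:
  fixes f :: "'a \<Rightarrow> complex"
  assumes "f \<in> borel_measurable M"
  shows "(\<lambda>x. f x powi n) \<in> borel_measurable M"
  using assms by (cases "n \<ge> 0") (simp_all add: power_int_def)

lemma borel_measurable_sgn_complex [measurable]: "(sgn :: complex \<Rightarrow> complex) \<in> borel_measurable borel"
  unfolding sgn_div_norm[abs_def] by simp

lemma borel_measurable_qchar [measurable]: "qchar n w \<in> borel_measurable borel"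
  unfolding qchar_def[abs_def] by measurable

lemma borel_measurable_qchar_compose [measurable (raw)]:
  "f \<in> borel_measurable M \<Longrightarrow> (\<lambda>x. qchar n w (f x)) \<in> borel_measurable M"
  by (rule measurable_compose[OF _ borel_measurable_qchar])

lemma sets_cball_complex [measurable]: "cball (x::complex) r \<in> sets borel"
  by simp

lemma norm_qchar: "norm (qchar n w x) = exp (Re w * ln (norm x))"
  by (simp add: qchar_def norm_mult norm_power_int norm_sgn)

lemma norm_qchar_powr: "x \<noteq> 0 \<Longrightarrow> norm (qchar n w x) = norm x powr Re w"
  by (simp add: norm_qchar powr_def)

lemma qchar_nonzero [simp]: "qchar n w x \<noteq> 0"
  by (simp add: qchar_def sgn_zero_iff power_int_eq_0_iff)

lemma qchar_mult:
  assumes "x \<noteq> 0" "y \<noteq> 0"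
  shows "qchar n w (x * y) = qchar n w x * qchar n w y"
  using assms by (simp add: qchar_def norm_mult ln_mult sgn_mult power_int_mult_distrib
      distrib_left exp_add)

lemma qchar_add: "qchar (n + m) (w + v) x = qchar n w x * qchar m v x"
  by (cases "x = 0") (simp_all add: qchar_def power_int_add sgn_zero_iff distrib_right exp_add)

lemma qchar_0_0 [simp]: "qchar 0 0 x = 1" by (simp add: qchar_def)

lemma qchar_minus: "qchar (- n) (- w) x = inverse (qchar n w x)"
proof -
  have "qchar (- n) (- w) x * qchar n w x = 1"
    by (subst qchar_add[symmetric]) simp
  then show ?thesis by (simp add: field_simps)
qed

lemma qchar_diff: "qchar (n - m) (w - v) x = qchar n w x / qchar m v x"
  using qchar_add[of n "- m" w "- v" x] by (simp add: qchar_minus divide_inverse)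

lemma qchar_1 [simp]: "qchar n w 1 = 1" by (simp add: qchar_def)

lemma qchar_inverse: "x \<noteq> 0 \<Longrightarrow> qchar n w (inverse x) = inverse (qchar n w x)"
  using qchar_mult[of x "inverse x" n w] by (simp add: field_simps)

lemma qchar_0_norm: "qchar 0 w x = exp (w * of_real (ln (norm x)))"
  by (simp add: qchar_def)

text \<open>Rotation by \<open>cis (pi / n)\<close> preserves the measure and the modulus and
  negates the character, so the integral equals its own negative. This also covers nonintegrable
  integrands, whose integral is 0 by convention.\<close>

lemma qchar_haar_zero:
  assumes n: "n \<noteq> 0" and [measurable]: "S \<in> sets borel"
  shows "(\<integral>x. indicator S (norm x) * qchar n w x \<partial>haar) = 0"
proof -
  define c where "c = cis (pi / of_int n)"
  have c: "c \<noteq> 0" "norm c = 1" by (simp_all add: c_def)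
  have "sgn c = c" using c(2) by (simp add: sgn_eq)
  then have "qchar n w c = c powi n" using c by (simp add: qchar_def)
  also have "\<dots> = cis pi" using n by (simp add: c_def cis_power_int)
  finally have qc: "qchar n w c = -1" by simp
  let ?I = "\<integral>x. indicator S (norm x) * qchar n w x \<partial>haar"
  have "?I = (\<integral>x. indicator S (norm (c * x)) * qchar n w (c * x) \<partial>haar)"
    by (rule haar_integral_scale[symmetric]) (use c in auto)
  also have "\<dots> = (\<integral>x. - (indicator S (norm x) * qchar n w x) \<partial>haar)"
  proof (rule integral_cong_AE)
    show "AE x in haar. indicator S (norm (c * x)) * qchar n w (c * x) = - (indicator S (norm x) * qchar n w x)"
      using AE_haar_nonzero by eventually_elim (simp add: norm_mult c qchar_mult qc)
  qed auto
  also have "\<dots> = - ?I" by simp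
  finally show ?thesis by simp
qed

lemma qchar_haar_radial:
  fixes w :: complex
  assumes [measurable]: "S \<in> sets borel"
  shows "(\<integral>x. indicator S (norm x) * qchar 0 w x \<partial>haar) = 2 * pi * (\<integral>s. indicator S (exp s) * exp (w * of_real s) \<partial>lborel)"
  and "integrable haar (\<lambda>x. indicator S (norm x) * qchar n w x) \<longleftrightarrow> integrable lborel (\<lambda>s. indicator S (exp s) * exp (w * complex_of_real s))"
proof -
  show "(\<integral>x. indicator S (norm x) * qchar 0 w x \<partial>haar) = 2 * pi * (\<integral>s. indicator S (exp s) * exp (w * of_real s) \<partial>lborel)"
    using haar_integral_radial(1)[of "\<lambda>r. indicator S r * exp (w * complex_of_real (ln r))"]
    by (simp add: qchar_def)
  have "integrable haar (\<lambda>x. indicator S (norm x) * qchar n w x) \<longleftrightarrow> integrable haar (\<lambda>x. indicator S (norm x) * qchar 0 w x)"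
    by (intro iffI; elim Bochner_Integration.integrable_bound) (simp_all add: norm_mult norm_qchar)
  also have "\<dots> \<longleftrightarrow> integrable lborel (\<lambda>s. indicator S (exp s) * exp (w * complex_of_real s))"
    using haar_integral_radial(2)[of "\<lambda>r. indicator S r * exp (w * complex_of_real (ln r))"]
    by (simp add: qchar_def)
  finally show "integrable haar (\<lambda>x. indicator S (norm x) * qchar n w x) \<longleftrightarrow> integrable lborel (\<lambda>s. indicator S (exp s) * exp (w * complex_of_real s))" .
qed

lemma integrable_exp_atMost:
  assumes "Re w > 0"
  shows "integrable lborel (\<lambda>s. indicator {..a} s * exp (w * complex_of_real s))"
proof -
  have "(\<integral>\<^sup>+s. ennreal (exp (- (Re w) * s)) * indicator {- a..} s \<partial>lborel) = ennreal (0 - (- exp (- (Re w) * (- a)) / Re w))"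
  proof (rule nn_integral_FTC_atLeast)
    show "((\<lambda>s. - exp (- (Re w) * s) / Re w) \<longlongrightarrow> 0) at_top"
      using assms by real_asymp
  qed (use assms in \<open>auto intro!: derivative_eq_intros\<close>)
  also have "(\<integral>\<^sup>+s. ennreal (exp (- (Re w) * s)) * indicator {- a..} s \<partial>lborel)
     = (\<integral>\<^sup>+s. ennreal (exp (Re w * s)) * indicator {..a} s \<partial>lborel)"
    using nn_integral_real_affine[of "\<lambda>s. ennreal (exp (Re w * s)) * indicator {..a} s" "-1" 0]
    by (simp add: indicator_def minus_le_iff)
  finally have fin: "(\<integral>\<^sup>+s. ennreal (exp (Re w * s)) * indicator {..a} s \<partial>lborel) < \<infinity>"
    by simp
  show ?thesis
    unfolding integrable_iff_bounded
  proof
    have "(\<integral>\<^sup>+s. ennreal (norm (indicator {..a} s * exp (w * complex_of_real s))) \<partial>lborel)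
      = (\<integral>\<^sup>+s. ennreal (exp (Re w * s)) * indicator {..a} s \<partial>lborel)"
      by (intro nn_integral_cong) (simp add: indicator_def)
    then show "(\<integral>\<^sup>+s. ennreal (norm (indicator {..a} s * exp (w * complex_of_real s))) \<partial>lborel) < \<infinity>"
      using fin by simp
  qed simp
qed

lemma integral_exp_atMost:
  assumes "Re w > 0"
  shows "(\<integral>s. indicator {..a} s * exp (w * complex_of_real s) \<partial>lborel) = exp (w * of_real a) / w"
proof -
  have w: "w \<noteq> 0" using assms by auto
  have int: "set_integrable lborel (einterval (-\<infinity>) (ereal a)) (\<lambda>s. exp (w * complex_of_real s))"
    using integrable_exp_atMost[OF assms, of a] unfolding set_integrable_def
    by (rule Bochner_Integration.integrable_bound) (auto split: split_indicator simp: einterval_def)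
  have lim: "((\<lambda>s. exp (w * complex_of_real s) / w) \<longlongrightarrow> 0) at_bot"
  proof (rule tendsto_norm_zero_cancel)
    have "((\<lambda>s. exp (Re w * s) / norm w) \<longlongrightarrow> 0) at_bot"
      using assms w by real_asymp
    then show "((\<lambda>s. norm (exp (w * complex_of_real s) / w)) \<longlongrightarrow> 0) at_bot"
      by (simp add: norm_divide)
  qed
  have "(LBINT s=-\<infinity>..ereal a. exp (w * complex_of_real s)) = exp (w * of_real a) / w - 0"
  proof (rule interval_integral_FTC_integrable[where F = "\<lambda>s. exp (w * complex_of_real s) / w"])
    show "((\<lambda>s. exp (w * complex_of_real s) / w) has_vector_derivative exp (w * complex_of_real x)) (at x)" for x
      using w by (auto intro!: derivative_eq_intros has_vector_derivative_real_field)
    show "(((\<lambda>s. exp (w * complex_of_real s) / w) \<circ> real_of_ereal) \<longlongrightarrow> 0) (at_right (- \<infinity>))"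
      using lim by (simp add: ereal_tendsto_simps1 ereal_tendsto_simps)
    show "(((\<lambda>s. exp (w * complex_of_real s) / w) \<circ> real_of_ereal) \<longlongrightarrow> exp (w * of_real a) / w) (at_left (ereal a))"
      unfolding ereal_tendsto_simps
      by (rule tendsto_within_subset[OF isCont_tendsto_compose]) 
         (use w in \<open>auto intro!: tendsto_eq_intros\<close>)
  qed (use int in auto)
  also have "(LBINT s=-\<infinity>..ereal a. exp (w * complex_of_real s)) = (\<integral>s. indicator {..a} s * exp (w * complex_of_real s) \<partial>lborel)"
    unfolding interval_lebesgue_integral_def set_lebesgue_integral_def
    by (simp, rule integral_cong_AE, simp, simp, use AE_lborel_singleton[of a] in eventually_elim)
       (auto simp: indicator_def einterval_def)
  finally show ?thesis by simp
qed

text \<open>The finite part of the integral of \<open>qchar n w\<close> over \<open>cball 0 c\<close>.\<close>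
definition haar_K :: "int \<Rightarrow> complex \<Rightarrow> real \<Rightarrow> complex" where
  "haar_K n w c = (if n = 0 then 2 * of_real pi * exp (w * of_real (ln c)) / w else 0)"

lemma qchar_integrable_cball:
  assumes "Re w > 0" "c > 0"
  shows "integrable haar (\<lambda>x. indicator (cball 0 c) x * qchar n w x)"
proof -
  have "integrable haar (\<lambda>x. indicator {..c} (norm x) * qchar n w x)"
    using integrable_exp_atMost[OF assms(1), of "ln c"] assms(2)
    by (subst qchar_haar_radial) (simp_all add: indicator_def ln_ge_iff[symmetric])
  then show ?thesis by (simp add: indicator_def)
qed

lemma qchar_integral_cball:
  assumes "Re w > 0" "c > 0"
  shows "(\<integral>x. indicator (cball 0 c) x * qchar n w x \<partial>haar) = haar_K n w c"
proof -
  have ind: "indicator (cball 0 c) x = (indicator {..c} (norm x) :: complex)" for x :: complex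
    by (simp add: indicator_def)
  have le: "exp s \<le> c \<longleftrightarrow> s \<le> ln c" for s using assms(2) by (simp add: ln_ge_iff)
  have ind': "indicator {..c} (exp s) = (indicator {..ln c} s :: complex)" for s
    by (simp add: indicator_def le)
  show ?thesis
  proof (cases "n = 0")
    case True
    then show ?thesis unfolding ind True
      by (subst qchar_haar_radial) (simp_all add: ind' haar_K_def integral_exp_atMost[OF assms(1)])
  next
    case False
    then show ?thesis unfolding ind
      by (subst qchar_haar_zero) (simp_all add: haar_K_def)
  qed
qed

lemma haar_sphere_null: "emeasure haar (sphere 0 c) = 0"
proof (cases "c > 0")
  case True
  have "emeasure haar (sphere 0 c) = (\<integral>\<^sup>+x. indicator {c} (norm x) \<partial>haar)"
  proof -
    have "emeasure haar (sphere 0 c) = (\<integral>\<^sup>+x. indicator (sphere 0 c) x \<partial>haar)" by simp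
    then show ?thesis by (simp add: indicator_def)
  qed
  also have "\<dots> = ennreal (2 * pi) * (\<integral>\<^sup>+s. indicator {c} (exp s) \<partial>lborel)"
    by (subst nn_integral_haar_radial) simp_all
  also have "(\<integral>\<^sup>+s. indicator {c} (exp s) \<partial>lborel) = (\<integral>\<^sup>+s. indicator {ln c} s \<partial>lborel)"
    using True by (intro nn_integral_cong) (auto simp: indicator_def)
  finally show ?thesis by simp
next
  case False
  then have "sphere 0 c \<subseteq> {0::complex}" by auto
  moreover have "emeasure haar {0} = 0"
    by (simp add: haar_def emeasure_density)
  ultimately show ?thesis
    by (metis emeasure_mono le_zero_eq sets_haar borel_singleton sets.empty_sets)
qed

lemma AE_haar_sphere: "AE x in haar. norm x \<noteq> c"
  by (rule AE_I[of _ _ "sphere 0 c"]) (auto simp: haar_sphere_null)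

text \<open>Inversion exchanges the exterior of a disc with a disc and negates both exponents. The
  identity may fail on the boundary circle, which is a null set.\<close>

lemma qchar_outside_inversion:
  assumes "c > 0"
  shows "AE x in haar. indicator (- cball 0 c) (inverse x) * qchar n w (inverse x)
    = indicator (cball 0 (1 / c)) x * qchar (- n) (- w) x"
  using AE_haar_nonzero AE_haar_sphere[of "1 / c"]
proof eventually_elim
  case (elim x)
  have "\<not> norm (inverse x) \<le> c \<longleftrightarrow> norm x \<le> 1 / c"
    using elim assms by (simp add: norm_inverse inverse_eq_divide norm_divide divide_simps not_le mult.commute)
      (auto simp: mult.commute)
  then show ?case using elim by (simp add: indicator_def qchar_inverse qchar_minus)
qed

text \<open>The minus sign is that of 1 / w under w -> - w. Thus one expression,
  \<open>haar_K\<close>, is the integral over a disc for positive real part of w and minus the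
  integral over the exterior for negative real part, which is what makes it usable as a finite
  part.\<close>

lemma qchar_outside_cball:
  assumes "Re w < 0" "c > 0"
  shows "integrable haar (\<lambda>x. indicator (- cball 0 c) x * qchar n w x)"
    and "(\<integral>x. indicator (- cball 0 c) x * qchar n w x \<partial>haar) = - haar_K n w c"
proof -
  have "integrable haar (\<lambda>x. indicator (- cball 0 c) (inverse x) * qchar n w (inverse x))"
    using qchar_integrable_cball[of "- w" "1 / c" "- n"] assms
    by (subst integrable_cong_AE[OF _ _ qchar_outside_inversion]) simp_all
  then show "integrable haar (\<lambda>x. indicator (- cball 0 c) x * qchar n w x)"
    by (subst (asm) haar_integrable_inverse_iff[where f = "\<lambda>x. indicator (- cball 0 c) x * qchar n w x"]) simp_all
  have "(\<integral>x. indicator (- cball 0 c) x * qchar n w x \<partial>haar)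
     = (\<integral>x. indicator (- cball 0 c) (inverse x) * qchar n w (inverse x) \<partial>haar)"
    by (subst haar_integral_inverse[where f = "\<lambda>x. indicator (- cball 0 c) x * qchar n w x"]) simp_all
  also have "\<dots> = (\<integral>x. indicator (cball 0 (1 / c)) x * qchar (- n) (- w) x \<partial>haar)"
    by (rule integral_cong_AE[OF _ _ qchar_outside_inversion[OF assms(2)]]) measurable
  also have "\<dots> = - haar_K n w c"
    using assms by (subst qchar_integral_cball) (simp_all add: haar_K_def ln_div)
  finally show "(\<integral>x. indicator (- cball 0 c) x * qchar n w x \<partial>haar) = - haar_K n w c" .
qed

text \<open>On an annulus no sign of \<open>Re w\<close> is involved: \<open>haar_K\<close> acts as
  an antiderivative in the radius. This is the source of the independence of finite parts from the
  radius of truncation.\<close>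

lemma qchar_integral_annulus:
  assumes "0 < a" "a \<le> b" "n = 0 \<Longrightarrow> w \<noteq> 0"
  shows "(\<integral>x. indicator (cball 0 b - cball 0 a) x * qchar n w x \<partial>haar) = haar_K n w b - haar_K n w a"
proof -
  have ind: "indicator (cball 0 b - cball 0 a) x = (indicator {a<..b} (norm x) :: complex)" for x :: complex
    by (auto simp: indicator_def)
  have mem: "a < exp s \<longleftrightarrow> ln a < s" "exp s \<le> b \<longleftrightarrow> s \<le> ln b" for s
    using assms ln_ge_iff[of b s] ln_less_cancel_iff[of a "exp s"] by auto
  show ?thesis
  proof (cases "n = 0")
    case False
    then show ?thesis unfolding ind
      by (subst qchar_haar_zero) (simp_all add: haar_K_def)
  next
    case True
    have w: "w \<noteq> 0" using True assms by simp
    have "(\<integral>s. indicator {a<..b} (exp s) * exp (w * complex_of_real s) \<partial>lborel)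
       = (\<integral>s. indicator {ln a..ln b} s *\<^sub>R exp (w * complex_of_real s) \<partial>lborel)"
      by (rule integral_cong_AE, simp, simp, use AE_lborel_singleton[of "ln a"] in eventually_elim)
         (auto simp: indicator_def mem split: if_splits)
    also have "\<dots> = exp (w * of_real (ln b)) / w - exp (w * of_real (ln a)) / w"
    proof (rule integral_FTC_atLeastAtMost)
      show "ln a \<le> ln b" using assms by simp
      show "((\<lambda>s. exp (w * complex_of_real s) / w) has_vector_derivative exp (w * complex_of_real x)) (at x within {ln a..ln b})" for x
        using w by (auto intro!: derivative_eq_intros has_vector_derivative_real_field)
    qed (auto intro!: continuous_intros)
    finally have "(\<integral>s. indicator {a<..b} (exp s) * exp (w * complex_of_real s) \<partial>lborel)
       = exp (w * of_real (ln b)) / w - exp (w * of_real (ln a)) / w" .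
    then show ?thesis unfolding ind True
      by (subst qchar_haar_radial) (simp_all add: haar_K_def right_diff_distrib diff_divide_distrib)
  qed
qed

text \<open>The two sides agree at the origin as well: with \<open>ln 0 = 0\<close> and
  \<open>Arg 0 = 0\<close> both equal 1. Integrands can therefore be rewritten pointwise.\<close>

lemma cpair_eq_qchar:
  assumes "s - s' = of_int n"
  shows "cpair x s s' = qchar n (s + s') x"
proof (cases "x = 0")
  case False
  have "exp (\<i> * (s - s') * of_real (Arg x)) = cis (Arg x) powi n"
    by (simp add: assms cis_power_int) (simp add: cis_conv_exp mult_ac)
  then show ?thesis using False by (simp add: cpair_def qchar_def cis_Arg)
qed (simp add: cpair_def qchar_def Arg_zero)

text \<open>A scaling argument: the Haar mass of \<open>cball 0 c\<close> weighted by \<open>|x| powr A\<close> would not decrease when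
  the radius is halved.\<close>
lemma haar_integral_infinite:
  assumes "A \<le> 0" "c > 0"
  shows "(\<integral>\<^sup>+x. indicator (cball 0 c) x * ennreal (exp (A * ln (norm x))) \<partial>haar) = \<infinity>"
proof -
  have "(\<integral>\<^sup>+x. indicator (cball 0 c) x * ennreal (exp (A * ln (norm x))) \<partial>haar)
    = (\<integral>\<^sup>+x. indicator {..c} (norm x) * ennreal (exp (A * ln (norm x))) \<partial>haar)"
    by (simp add: indicator_def)
  also have "\<dots> = ennreal (2 * pi) * (\<integral>\<^sup>+s. indicator {..c} (exp s) * ennreal (exp (A * s)) \<partial>lborel)"
    by (subst nn_integral_haar_radial[where F = "\<lambda>r. indicator {..c} r * ennreal (exp (A * ln r))"]) simp_all
  also have "(\<integral>\<^sup>+s. indicator {..c} (exp s) * ennreal (exp (A * s)) \<partial>lborel) = \<infinity>"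
  proof -
    have "(\<integral>\<^sup>+s. indicator {..min 0 (ln c)} s \<partial>lborel) \<le> (\<integral>\<^sup>+s. indicator {..c} (exp s) * ennreal (exp (A * s)) \<partial>lborel)"
    proof (rule nn_integral_mono)
      fix s :: real
      show "indicator {..min 0 (ln c)} s \<le> indicator {..c} (exp s) * ennreal (exp (A * s))"
      proof -
        have "s \<le> min 0 (ln c) \<Longrightarrow> 1 \<le> ennreal (exp (A * s))"
          using assms ennreal_leI[of 1 "exp (A * s)"] by (simp add: mult_nonpos_nonpos)
        then show ?thesis
          using assms by (auto simp: indicator_def ln_ge_iff)
      qed
    qed
    moreover have "(\<integral>\<^sup>+s. indicator {..min 0 (ln c)} s \<partial>lborel) = (\<infinity>::ennreal)"
    proof -
      have "emeasure lborel {a..} = \<infinity>" for a :: real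
      proof (rule ccontr)
        assume "emeasure lborel {a..} \<noteq> \<infinity>"
        then obtain n where n: "emeasure lborel {a..} < of_nat n"
          using ennreal_Ex_less_of_nat by (auto simp: less_top)
        have "emeasure lborel {a..a + real n} \<le> emeasure lborel {a..}"
          by (rule emeasure_mono) auto
        with n show False by (simp add: ennreal_of_nat_eq_real_of_nat)
      qed
      then have "(\<integral>\<^sup>+s. indicator {- min 0 (ln c)..} s \<partial>lborel) = (\<infinity>::ennreal)"
        by simp
      then show ?thesis
        using nn_integral_real_affine[of "indicator {..min 0 (ln c)}" "-1" 0] by (simp add: indicator_def minus_le_iff)
    qed
    ultimately show ?thesis by (simp add: top.extremum_unique)
  qed
  finally show ?thesis by (simp add: ennreal_mult_top)
qed

lemma sigma_finite_count_space [simp]: "sigma_finite_measure (count_space (UNIV :: 'k :: countable set))"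
  by (rule sigma_finite_measure_count_space_countable) simp

text \<open>Absolutely convergent series are written as integrals over counting measure, so
  exchanging sum and integral is Fubini's theorem. A majorant that separates into a factor depending
  on k and a factor depending on x reduces integrability on the product to two one-variable
  conditions.\<close>

lemma integral_sum_swap:
  fixes h :: "'k :: countable \<Rightarrow> 'a \<Rightarrow> complex"
  assumes M: "sigma_finite_measure M"
    and [measurable]: "\<And>k. h k \<in> borel_measurable M"
    and bound: "\<And>k. AE x in M. norm (h k x) \<le> a k * b x"
    and a: "integrable (count_space UNIV) a" and b: "integrable M b"
  shows "(\<integral>x. (\<integral>k. h k x \<partial>count_space UNIV) \<partial>M) = (\<integral>k. (\<integral>x. h k x \<partial>M) \<partial>count_space UNIV)"
    and "integrable (count_space UNIV) (\<lambda>k. \<integral>x. h k x \<partial>M)"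
    and "integrable M (\<lambda>x. \<integral>k. h k x \<partial>count_space UNIV)"
proof -
  interpret M: sigma_finite_measure M by (rule M)
  interpret N: sigma_finite_measure "count_space (UNIV :: 'k set)" by simp
  interpret P: pair_sigma_finite "count_space (UNIV :: 'k set)" M ..
  have hm [measurable]: "case_prod h \<in> borel_measurable (count_space (UNIV :: 'k set) \<Otimes>\<^sub>M M)"
    by (rule measurable_pair_measure_countable1) auto
  have hi: "integrable M (h k)" for k
    by (rule Bochner_Integration.integrable_bound[OF integrable_mult_right[OF b, of "a k"]])
       (use bound[of k] in \<open>auto elim!: eventually_mono intro: order_trans\<close>)
  have le: "(\<integral>x. norm (h k x) \<partial>M) \<le> \<bar>a k\<bar> * (\<integral>x. \<bar>b x\<bar> \<partial>M)" for k
  proof -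
    have "(\<integral>x. norm (h k x) \<partial>M) \<le> (\<integral>x. \<bar>a k\<bar> * \<bar>b x\<bar> \<partial>M)"
    proof (rule integral_mono_AE)
      show "AE x in M. norm (h k x) \<le> \<bar>a k\<bar> * \<bar>b x\<bar>"
        using bound[of k] by eventually_elim (simp add: abs_mult[symmetric] order_trans)
    qed (use hi[of k] b in \<open>auto intro!: integrable_abs integrable_norm\<close>)
    then show ?thesis by simp
  qed
  have int: "integrable (count_space UNIV \<Otimes>\<^sub>M M) (case_prod h)"
  proof (rule P.Fubini_integrable)
    have "integrable (count_space UNIV) (\<lambda>k. \<bar>a k\<bar> * (\<integral>x. \<bar>b x\<bar> \<partial>M))"
      using a by (intro integrable_mult_left integrable_abs)
    then show "integrable (count_space UNIV) (\<lambda>k. \<integral>x. norm (case_prod h (k, x)) \<partial>M)"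
      by (rule Bochner_Integration.integrable_bound) (use le in \<open>auto intro: order_trans\<close>)
  qed (use hi in auto)
  show "(\<integral>x. (\<integral>k. h k x \<partial>count_space UNIV) \<partial>M) = (\<integral>k. (\<integral>x. h k x \<partial>M) \<partial>count_space UNIV)"
    by (rule P.Fubini_integral[OF int])
  show "integrable (count_space UNIV) (\<lambda>k. \<integral>x. h k x \<partial>M)"
    using P.integrable_fst'[OF int] by simp
  show "integrable M (\<lambda>x. \<integral>k. h k x \<partial>count_space UNIV)"
    using P.integrable_snd[OF int] by simp
qed

subsection \<open>Multiplicative convolutions\<close>

text \<open>Finite-part Mellin transforms: the divergent tail at infinity (for \<open>f\<close>, with expansion
  \<open>\<Sum> d k * qchar (- n k) (- w k)\<close>), respectively at zero (for \<open>G\<close>, with expansion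
  \<open>\<Sum> g k * qchar (n k) (w k)\<close>), is integrated termwise by means of \<open>haar_K\<close>. A coefficient that
  vanishes in one of the two expansions allows them to share a single family of exponents.\<close>
definition FPinf :: "(complex \<Rightarrow> complex) \<Rightarrow> ('k \<Rightarrow> complex) \<Rightarrow> ('k \<Rightarrow> int) \<Rightarrow> ('k \<Rightarrow> complex) \<Rightarrow>
    real \<Rightarrow> int \<Rightarrow> complex \<Rightarrow> complex" where
  "FPinf f d n w c m v = (\<integral>x. indicator (cball 0 c) x * (f x * qchar m v x) \<partial>haar)
     - (\<integral>j. d j * haar_K (m - n j) (v - w j) c \<partial>count_space UNIV)"

definition FPzero :: "(complex \<Rightarrow> complex) \<Rightarrow> ('k \<Rightarrow> complex) \<Rightarrow> ('k \<Rightarrow> int) \<Rightarrow> ('k \<Rightarrow> complex) \<Rightarrow>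
    real \<Rightarrow> int \<Rightarrow> complex \<Rightarrow> complex" where
  "FPzero G g n w c m v = (\<integral>y. indicator (- cball 0 c) y * (G y * qchar m v y) \<partial>haar)
     + (\<integral>k. g k * haar_K (m + n k) (v + w k) c \<partial>count_space UNIV)"

lemma norm_haar_K:
  "norm (haar_K n w c) = (if n = 0 then 2 * pi * exp (Re w * ln c) / norm w else 0)"
  by (simp add: haar_K_def norm_mult norm_divide)

text \<open>Homogeneity: trading the character of one exponent for that of the other moves the
  radius from c to \<open>c * norm z\<close>. This identifies the corrections of the inner and of
  the outer integral in the expansion theorem.\<close>

lemma haar_K_scale:
  assumes "0 < c" "z \<noteq> 0"
  shows "qchar n w z * haar_K (n - m) (w - v) c = qchar m v z * haar_K (n - m) (w - v) (c * norm z)"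
proof (cases "n = m")
  case True
  have "qchar n w z = qchar m v z * qchar 0 (w - v) z"
    by (subst qchar_add[symmetric]) (simp add: True)
  then show ?thesis using assms True
    by (simp add: haar_K_def qchar_0_norm ln_mult distrib_left exp_add)
qed (simp add: haar_K_def)

text \<open>On the circle \<open>norm x = c\<close> both expansions converge. Inside it
  \<open>G (z * x)\<close> is expanded, outside it \<open>f x\<close>; termwise integration leaves
  truncated Mellin integrals, and a double series of cross terms inserted with opposite signs
  completes them to finite parts. \<open>w0\<close> and \<open>f0\<close> dominate the inner part,
  \<open>w1\<close> and \<open>f1\<close> the outer part, and \<delta> keeps the denominators of the
  cross terms away from 0.\<close>

lemma mult_convolution_expansion:
  fixes f G :: "complex \<Rightarrow> complex" and g d w :: "'k :: countable \<Rightarrow> complex" and n :: "'k \<Rightarrow> int"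
  assumes [measurable]: "f \<in> borel_measurable borel" "G \<in> borel_measurable borel"
    and G: "AE y in haar. norm y < 1 \<longrightarrow> G y = (\<integral>k. g k * qchar (n k) (w k) y \<partial>count_space UNIV)"
    and g: "\<And>r. 0 < r \<Longrightarrow> r < 1 \<Longrightarrow> integrable (count_space UNIV) (\<lambda>k. norm (g k) * exp (Re (w k) * ln r))"
    and f: "\<And>x. norm x > 1 \<Longrightarrow> f x = (\<integral>k. d k * qchar (- n k) (- w k) x \<partial>count_space UNIV)"
    and d: "\<And>r. 1 < r \<Longrightarrow> integrable (count_space UNIV) (\<lambda>k. norm (d k) * exp (- Re (w k) * ln r))"
    and delta: "\<delta> > 0" "\<And>k j. g k \<noteq> 0 \<Longrightarrow> d j \<noteq> 0 \<Longrightarrow> n k = n j \<Longrightarrow> \<delta> \<le> norm (w k - w j)"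
    and int: "integrable haar (\<lambda>x. f x * G (z * x))"
    and w0: "\<And>k. g k \<noteq> 0 \<Longrightarrow> w0 \<le> Re (w k)"
    and f0: "\<And>c. 1 < c \<Longrightarrow> integrable haar (\<lambda>x. indicator (cball 0 c) x * (norm (f x) * exp (w0 * ln (norm x))))"
    and w1: "\<And>k. d k \<noteq> 0 \<Longrightarrow> - Re (w k) \<le> w1"
    and f1: "\<And>c. 1 < c \<Longrightarrow> \<exists>C>0. \<forall>x. norm x > c \<longrightarrow> C * exp (w1 * ln (norm x)) \<le> norm (f x)"
    and c: "1 < c" "c * norm z < 1" and z: "z \<noteq> 0"
  shows "(\<integral>x. f x * G (z * x) \<partial>haar) = (\<integral>k. (g k * FPinf f d n w c (n k) (w k)
          + d k * FPzero G g n w (c * norm z) (- n k) (- w k)) * qchar (n k) (w k) z \<partial>count_space UNIV)"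
    and "integrable (count_space UNIV) (\<lambda>k. (g k * FPinf f d n w c (n k) (w k)
          + d k * FPzero G g n w (c * norm z) (- n k) (- w k)) * qchar (n k) (w k) z)"
proof -
  let ?N = "count_space (UNIV :: 'k set)"
  define r where "r = c * norm z"
  have r: "0 < r" "r < 1" using c z by (simp_all add: r_def)
  have lnr: "ln r = ln c + ln (norm z)" using c z by (simp add: r_def ln_mult)
  define q where "q k = qchar (n k) (w k) z" for k
  have nq: "norm (q k) = exp (Re (w k) * ln (norm z))" for k by (simp add: q_def norm_qchar)

  define h where "h k x = indicator (cball 0 c) x * (f x * (g k * q k * qchar (n k) (w k) x))" for k x
  have [measurable]: "h k \<in> borel_measurable haar" for k
    unfolding h_def[abs_def] by measurable
  \<comment> \<open>For \<open>norm x \<le> c\<close> the number norm x / c raised to the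
    nonnegative power \<open>Re (w k) - w0\<close> is at most 1, which moves the dependence on k to
    the radius r < 1. At the origin \<open>ln 0 = 0\<close> does not exceed \<open>ln c\<close>, so
    the bound holds there too.\<close>
  define a where "a k = norm (g k) * exp (Re (w k) * ln r) * exp (- w0 * ln c)" for k
  have a: "integrable ?N a"
    unfolding a_def[abs_def] by (intro integrable_mult_left g r)
  have hb: "norm (h k x) \<le> a k * (indicator (cball 0 c) x * (norm (f x) * exp (w0 * ln (norm x))))" for k x
  proof (cases "x \<in> cball 0 c \<and> g k \<noteq> 0")
    case True
    have "ln (norm x) \<le> ln c"
      using True c by (cases "x = 0") auto
    then have "(Re (w k) - w0) * ln (norm x) \<le> (Re (w k) - w0) * ln c"
      using w0 True by (intro mult_left_mono) auto
    then have "Re (w k) * ln (norm z) + Re (w k) * ln (norm x)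
         \<le> Re (w k) * ln r + - w0 * ln c + w0 * ln (norm x)"
      by (simp add: lnr algebra_simps)
    then have "exp (Re (w k) * ln (norm z)) * exp (Re (w k) * ln (norm x))
         \<le> exp (Re (w k) * ln r) * exp (- w0 * ln c) * exp (w0 * ln (norm x))"
      by (simp add: exp_add[symmetric])
    then have "norm (f x) * norm (g k) * (exp (Re (w k) * ln (norm z)) * exp (Re (w k) * ln (norm x)))
         \<le> norm (f x) * norm (g k) * (exp (Re (w k) * ln r) * exp (- w0 * ln c) * exp (w0 * ln (norm x)))"
      by (intro mult_left_mono) auto
    then show ?thesis using True
      by (simp add: h_def a_def norm_mult nq norm_qchar mult_ac)
  qed (auto simp: h_def a_def)
  note swap1 = integral_sum_swap[OF haar.sigma_finite_measure_axioms, of h, OF _ AE_I2[OF hb] a f0[OF c(1)]]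

  have h_int: "(\<integral>x. h k x \<partial>haar) = g k * q k * (\<integral>x. indicator (cball 0 c) x * (f x * qchar (n k) (w k) x) \<partial>haar)" for k
  proof -
    have "h k = (\<lambda>x. g k * q k * (indicator (cball 0 c) x * (f x * qchar (n k) (w k) x)))"
      by (simp add: h_def fun_eq_iff)
    then show ?thesis by (simp only: integral_mult_right_zero)
  qed
  have "(\<integral>x. indicator (cball 0 c) x * (f x * G (z * x)) \<partial>haar) = (\<integral>x. (\<integral>k. h k x \<partial>?N) \<partial>haar)"
  proof (rule integral_cong_AE)
    have "AE x in distr haar borel ((*) z). norm x < 1 \<longrightarrow> G x = (\<integral>k. g k * qchar (n k) (w k) x \<partial>?N)"
      unfolding distr_haar_scale[OF z] by (rule G)
    then have "AE x in haar. norm (z * x) < 1 \<longrightarrow> G (z * x) = (\<integral>k. g k * qchar (n k) (w k) (z * x) \<partial>?N)"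
      by (rule AE_distrD[rotated]) simp
    then show "AE x in haar. indicator (cball 0 c) x * (f x * G (z * x)) = (\<integral>k. h k x \<partial>?N)"
      using AE_haar_nonzero
    proof eventually_elim
      case (elim x)
      show ?case
      proof (cases "x \<in> cball 0 c")
        case True
        then have "norm z * norm x \<le> norm z * c" by (intro mult_left_mono) auto
        with c have "norm (z * x) < 1" by (simp add: norm_mult mult.commute)
        with elim have "G (z * x) = (\<integral>k. g k * qchar (n k) (w k) (z * x) \<partial>?N)" by simp
        also have "\<dots> = (\<integral>k. g k * q k * qchar (n k) (w k) x \<partial>?N)"
          using elim z by (simp add: qchar_mult q_def mult_ac)
        finally show ?thesis using True by (simp add: h_def)
      qed (simp add: h_def)
    qed
    show "(\<lambda>x. \<integral>k. h k x \<partial>?N) \<in> borel_measurable haar"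
      using swap1(3) by simp
  qed simp
  also have "\<dots> = (\<integral>k. (\<integral>x. h k x \<partial>haar) \<partial>?N)" by (rule swap1(1)) simp
  also have "(\<integral>k. (\<integral>x. h k x \<partial>haar) \<partial>?N) = (\<integral>k. g k * q k * (\<integral>x. indicator (cball 0 c) x * (f x * qchar (n k) (w k) x) \<partial>haar) \<partial>?N)"
    by (simp only: h_int)
  finally have in1: "(\<integral>x. indicator (cball 0 c) x * (f x * G (z * x)) \<partial>haar)
     = (\<integral>k. g k * q k * (\<integral>x. indicator (cball 0 c) x * (f x * qchar (n k) (w k) x) \<partial>haar) \<partial>?N)" .
  have in2: "integrable ?N (\<lambda>k. g k * q k * (\<integral>x. indicator (cball 0 c) x * (f x * qchar (n k) (w k) x) \<partial>haar))"
    using swap1(2) by (simp add: h_int)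
  
  \<comment> \<open>Outside the unit disc G is controlled only through the integrability of
    \<open>f x * G (z * x)\<close>. The lower bound for f turns this into a majorant for every power
    of x in the expansion of f at infinity.\<close>
  obtain C where C: "C > 0" "\<And>x. norm x > c \<Longrightarrow> C * exp (w1 * ln (norm x)) \<le> norm (f x)"
    using f1[OF c(1)] by blast
  define h' where "h' k x = indicator (- cball 0 c) x * (d k * qchar (- n k) (- w k) x * G (z * x))" for k x
  have [measurable]: "h' k \<in> borel_measurable haar" for k
    unfolding h'_def[abs_def] by measurable
  define a' where "a' k = norm (d k) * exp (- Re (w k) * ln c) * (exp (- w1 * ln c) / C)" for k
  have a': "integrable ?N a'"
    unfolding a'_def[abs_def] by (intro integrable_mult_left d c)
  have hb': "norm (h' k x) \<le> a' k * norm (f x * G (z * x))" for k x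
  proof (cases "x \<in> cball 0 c \<or> d k = 0")
    case False
    then have x: "norm x > c" by auto
    have "ln c \<le> ln (norm x)" using x c by (intro ln_mono) auto
    then have "(- Re (w k) - w1) * ln (norm x) \<le> (- Re (w k) - w1) * ln c"
      using w1[of k] False by (intro mult_left_mono_neg) auto
    then have "exp (- Re (w k) * ln (norm x)) \<le> exp (- Re (w k) * ln c) * exp (- w1 * ln c) * exp (w1 * ln (norm x))"
      by (simp add: exp_add[symmetric] algebra_simps)
    also have "\<dots> \<le> exp (- Re (w k) * ln c) * exp (- w1 * ln c) * (norm (f x) / C)"
      using C(1) C(2)[OF x] by (intro mult_left_mono) (auto simp: field_simps)
    finally have "exp (- Re (w k) * ln (norm x)) \<le> exp (- Re (w k) * ln c) * exp (- w1 * ln c) * (norm (f x) / C)" .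
    then have "norm (d k) * norm (G (z * x)) * exp (- Re (w k) * ln (norm x))
      \<le> norm (d k) * norm (G (z * x)) * (exp (- Re (w k) * ln c) * exp (- w1 * ln c) * (norm (f x) / C))"
      by (intro mult_left_mono) auto
    then show ?thesis using False
      by (simp add: h'_def a'_def norm_mult norm_qchar mult_ac)
  next
    case True
    then show ?thesis using C(1) by (auto simp: h'_def a'_def)
  qed
  note swap2 = integral_sum_swap[OF haar.sigma_finite_measure_axioms, of h', OF _ AE_I2[OF hb'] a' integrable_norm[OF int]]
  have h'_int: "(\<integral>x. h' k x \<partial>haar) = d k * q k * (\<integral>y. indicator (- cball 0 r) y * (G y * qchar (- n k) (- w k) y) \<partial>haar)" for k
  proof -
    have pt: "d k * q k * (indicator (- cball 0 r) (z * x) * (G (z * x) * qchar (- n k) (- w k) (z * x))) = h' k x"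
      if x: "x \<noteq> 0" for x
    proof -
      have "q k * qchar (- n k) (- w k) (z * x) = qchar (- n k) (- w k) x"
        unfolding q_def qchar_minus qchar_mult[OF z x] by (simp add: field_simps)
      moreover have "norm z * norm x \<le> c * norm z \<longleftrightarrow> norm x \<le> c"
        using z by (metis mult.commute mult_le_cancel_right_pos zero_less_norm_iff)
      then have "z * x \<in> cball 0 r \<longleftrightarrow> x \<in> cball 0 c"
        by (simp add: r_def norm_mult)
      ultimately show ?thesis
        by (cases "x \<in> cball 0 c") (simp_all add: h'_def)
    qed
    have ae: "AE x in haar. d k * q k * (indicator (- cball 0 r) (z * x) * (G (z * x) * qchar (- n k) (- w k) (z * x))) = h' k x"
      using AE_haar_nonzero by eventually_elim (rule pt)
    have sc: "(\<integral>y. indicator (- cball 0 r) y * (G y * qchar (- n k) (- w k) y) \<partial>haar)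
       = (\<integral>x. indicator (- cball 0 r) (z * x) * (G (z * x) * qchar (- n k) (- w k) (z * x)) \<partial>haar)"
      by (rule haar_integral_scale[of "\<lambda>y. indicator (- cball 0 r) y * (G y * qchar (- n k) (- w k) y)" z, symmetric])
         (use z in simp_all)
    have "d k * q k * (\<integral>y. indicator (- cball 0 r) y * (G y * qchar (- n k) (- w k) y) \<partial>haar) = (\<integral>x. d k * q k * (indicator (- cball 0 r) (z * x) * (G (z * x) * qchar (- n k) (- w k) (z * x))) \<partial>haar)"
      unfolding sc by (rule integral_mult_right_zero[symmetric])
    also have "\<dots> = (\<integral>x. h' k x \<partial>haar)"
    proof (rule integral_cong_AE[OF _ _ ae])
      show "(\<lambda>x. d k * q k * (indicator (- cball 0 r) (z * x) * (G (z * x) * qchar (- n k) (- w k) (z * x)))) \<in> borel_measurable haar"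
        by measurable
      show "h' k \<in> borel_measurable haar" by measurable
    qed
    finally show ?thesis by (rule sym)
  qed
  have "(\<integral>x. indicator (- cball 0 c) x * (f x * G (z * x)) \<partial>haar) = (\<integral>x. (\<integral>k. h' k x \<partial>?N) \<partial>haar)"
  proof (rule Bochner_Integration.integral_cong[OF refl])
    fix x
    show "indicator (- cball 0 c) x * (f x * G (z * x)) = (\<integral>k. h' k x \<partial>?N)"
    proof (cases "x \<in> cball 0 c")
      case False
      with c have x: "norm x > 1" by simp
      have "(\<integral>k. h' k x \<partial>?N) = (\<integral>k. d k * qchar (- n k) (- w k) x * G (z * x) \<partial>?N)"
        using False by (simp add: h'_def)
      also have "\<dots> = f x * G (z * x)"
        by (simp only: integral_mult_left_zero f[OF x])
      finally show ?thesis using False by simp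
    qed (simp add: h'_def)
  qed
  also have "\<dots> = (\<integral>k. (\<integral>x. h' k x \<partial>haar) \<partial>?N)" by (rule swap2(1)) simp
  also have "(\<integral>k. (\<integral>x. h' k x \<partial>haar) \<partial>?N) = (\<integral>k. d k * q k * (\<integral>y. indicator (- cball 0 r) y * (G y * qchar (- n k) (- w k) y) \<partial>haar) \<partial>?N)"
    by (simp only: h'_int)
  finally have out1: "(\<integral>x. indicator (- cball 0 c) x * (f x * G (z * x)) \<partial>haar)
     = (\<integral>k. d k * q k * (\<integral>y. indicator (- cball 0 r) y * (G y * qchar (- n k) (- w k) y) \<partial>haar) \<partial>?N)" .
  have out2: "integrable ?N (\<lambda>k. d k * q k * (\<integral>y. indicator (- cball 0 r) y * (G y * qchar (- n k) (- w k) y) \<partial>haar))"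
    using swap2(2) by (simp add: h'_int)

  \<comment> \<open>The cross terms. Each can be read as a correction of the inner part at radius c
    or, by homogeneity, of the outer part at radius r. The double series converges absolutely, so
    its two iterated sums agree and cancel in the total.\<close>
  define e where "e k j = g k * q k * (d j * haar_K (n k - n j) (w k - w j) c)" for k j
  have e': "e k j = d j * q j * (g k * haar_K (n k - n j) (w k - w j) r)" for k j
    using haar_K_scale[of c z "n k" "w k" "n j" "w j"] c z
    by (simp add: e_def q_def r_def mult_ac)
  define a2 where "a2 k = norm (g k) * exp (Re (w k) * ln r) * (2 * pi / \<delta>)" for k
  have a2: "integrable ?N a2"
    unfolding a2_def[abs_def] by (intro integrable_mult_left g r)
  define b2 where "b2 j = norm (d j) * exp (- Re (w j) * ln c)" for j
  have b2: "integrable ?N b2"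
    unfolding b2_def[abs_def] by (intro d c)
  have eb: "norm (e k j) \<le> a2 k * b2 j" for k j
  proof (cases "g k \<noteq> 0 \<and> d j \<noteq> 0 \<and> n k = n j")
    case True
    then have dl: "\<delta> \<le> norm (w k - w j)" using delta by blast
    have ex: "exp (Re (w k) * ln (norm z)) * exp (Re (w k - w j) * ln c) = exp (Re (w k) * ln r) * exp (- Re (w j) * ln c)"
      by (simp add: exp_add[symmetric] lnr algebra_simps)
    have "exp (Re (w k - w j) * ln c) / norm (w k - w j) \<le> exp (Re (w k - w j) * ln c) / \<delta>"
      using dl delta(1) by (intro divide_left_mono) (auto intro!: mult_pos_pos)
    then have "norm (g k) * norm (d j) * (2 * pi) * exp (Re (w k) * ln (norm z)) * (exp (Re (w k - w j) * ln c) / norm (w k - w j))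
      \<le> norm (g k) * norm (d j) * (2 * pi) * exp (Re (w k) * ln (norm z)) * (exp (Re (w k - w j) * ln c) / \<delta>)"
      by (intro mult_left_mono) auto
    also have "\<dots> = norm (g k) * norm (d j) * (2 * pi) / \<delta> * (exp (Re (w k) * ln (norm z)) * exp (Re (w k - w j) * ln c))"
      by simp
    also have "\<dots> = a2 k * b2 j" unfolding ex by (simp add: a2_def b2_def mult_ac)
    finally show ?thesis using True by (simp add: e_def norm_mult nq norm_haar_K mult_ac)
  next
    case False
    then have "e k j = 0" by (auto simp: e_def haar_K_def)
    then show ?thesis using delta(1) by (simp add: a2_def b2_def)
  qed
  note swap3 = integral_sum_swap[OF sigma_finite_count_space, of e a2 b2, OF _ AE_I2[OF eb] a2 b2]
  have db: "(\<integral>j. (\<integral>k. e k j \<partial>?N) \<partial>?N) = (\<integral>k. (\<integral>j. e k j \<partial>?N) \<partial>?N)"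
    by (rule swap3(1)) simp
  have db1: "integrable ?N (\<lambda>k. \<integral>j. e k j \<partial>?N)" by (rule swap3(2)) simp
  have db2: "integrable ?N (\<lambda>j. \<integral>k. e k j \<partial>?N)" by (rule swap3(3)) simp
  define X where "X k = g k * q k * (\<integral>x. indicator (cball 0 c) x * (f x * qchar (n k) (w k) x) \<partial>haar)" for k
  define Y where "Y k = d k * q k * (\<integral>y. indicator (- cball 0 r) y * (G y * qchar (- n k) (- w k) y) \<partial>haar)" for k
  have summand: "(g k * FPinf f d n w c (n k) (w k) + d k * FPzero G g n w r (- n k) (- w k)) * q k
     = (X k - (\<integral>j. e k j \<partial>?N)) + (Y k + (\<integral>j. e j k \<partial>?N))" for k
  proof -
    have e1: "(\<integral>j. e k j \<partial>?N) = g k * q k * (\<integral>j. d j * haar_K (n k - n j) (w k - w j) c \<partial>?N)"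
      unfolding e_def by (rule integral_mult_right_zero)
    have e2: "(\<integral>j. e j k \<partial>?N) = d k * q k * (\<integral>j. g j * haar_K (n j - n k) (w j - w k) r \<partial>?N)"
      unfolding e' by (rule integral_mult_right_zero)
    have e3: "- n k + n j = n j - n k" "- w k + w j = w j - w k" for j by simp_all
    show ?thesis
      unfolding FPinf_def FPzero_def X_def Y_def e1 e2 e3 by (simp only: ring_distribs mult_ac)
  qed
  have "(\<integral>x. f x * G (z * x) \<partial>haar) = (\<integral>x. indicator (cball 0 c) x * (f x * G (z * x))
       + indicator (- cball 0 c) x * (f x * G (z * x)) \<partial>haar)"
    by (intro Bochner_Integration.integral_cong) (auto simp: indicator_def)
  also have "\<dots> = (\<integral>x. indicator (cball 0 c) x * (f x * G (z * x)) \<partial>haar)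
       + (\<integral>x. indicator (- cball 0 c) x * (f x * G (z * x)) \<partial>haar)"
    by (rule Bochner_Integration.integral_add; rule Bochner_Integration.integrable_bound[OF int])
       (auto simp: indicator_def)
  also have "\<dots> = (\<integral>k. X k \<partial>?N) + (\<integral>k. Y k \<partial>?N)"
    unfolding in1 out1 X_def Y_def ..
  also have "\<dots> = (\<integral>k. (X k - (\<integral>j. e k j \<partial>?N)) + (Y k + (\<integral>j. e j k \<partial>?N)) \<partial>?N)"
    using in2 out2 db1 db2 db unfolding X_def[symmetric] Y_def[symmetric] by simp
  finally show "(\<integral>x. f x * G (z * x) \<partial>haar) = (\<integral>k. (g k * FPinf f d n w c (n k) (w k)
          + d k * FPzero G g n w (c * norm z) (- n k) (- w k)) * qchar (n k) (w k) z \<partial>count_space UNIV)"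
    unfolding q_def[symmetric] r_def[symmetric] summand .
  show "integrable (count_space UNIV) (\<lambda>k. (g k * FPinf f d n w c (n k) (w k)
          + d k * FPzero G g n w (c * norm z) (- n k) (- w k)) * qchar (n k) (w k) z)"
    unfolding q_def[symmetric] r_def[symmetric] summand
    using in2 out2 db1 db2 unfolding X_def[symmetric] Y_def[symmetric] by simp
qed

lemma qchar_integrable_annulus:
  assumes "0 < a"
  shows "integrable haar (\<lambda>x. indicator (cball 0 b - cball 0 a) x * qchar n w x)"
proof -
  have ind: "indicator (cball 0 b - cball 0 a) x = (indicator {a<..b} (norm x) :: complex)" for x :: complex
    by (auto simp: indicator_def)
  have "set_integrable lborel {ln a..ln b} (\<lambda>s. exp (w * complex_of_real s))"
    unfolding set_integrable_def by (intro borel_integrable_compact continuous_intros) simp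
  then have "integrable lborel (\<lambda>s. indicator {a<..b} (exp s) * exp (w * complex_of_real s))"
    unfolding set_integrable_def
  proof (rule Bochner_Integration.integrable_bound, goal_cases)
    case 2
    show ?case
    proof (rule AE_I2)
      fix s :: real
      have "a < exp s \<Longrightarrow> exp s \<le> b \<Longrightarrow> s \<in> {ln a..ln b}"
        using assms ln_ge_iff[of b s] ln_less_cancel_iff[of a "exp s"] by auto
      then show "norm (indicator {a<..b} (exp s) * exp (w * complex_of_real s))
          \<le> norm (indicator {ln a..ln b} s *\<^sub>R exp (w * complex_of_real s))"
        by (auto simp: indicator_def)
    qed
  qed simp
  then show ?thesis unfolding ind by (subst qchar_haar_radial) simp_all
qed

lemma sum_haar_K_integrable:
  assumes g: "integrable (count_space UNIV) (\<lambda>k. norm (g k) * exp (Re (w k) * ln r))"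
    and delta: "\<delta> > 0" "\<And>k. g k \<noteq> 0 \<Longrightarrow> n k = - N \<Longrightarrow> \<delta> \<le> norm (w k + v)"
  shows "integrable (count_space UNIV) (\<lambda>k. g k * haar_K (N + n k) (v + w k) r)"
proof (rule Bochner_Integration.integrable_bound)
  show "integrable (count_space UNIV) (\<lambda>k. norm (g k) * exp (Re (w k) * ln r) * (2 * pi * exp (Re v * ln r) / \<delta>))"
    by (intro integrable_mult_left g)
  show "AE k in count_space UNIV. norm (g k * haar_K (N + n k) (v + w k) r)
      \<le> norm (norm (g k) * exp (Re (w k) * ln r) * (2 * pi * exp (Re v * ln r) / \<delta>))"
  proof (rule AE_I2)
    fix k
    show "norm (g k * haar_K (N + n k) (v + w k) r)
      \<le> norm (norm (g k) * exp (Re (w k) * ln r) * (2 * pi * exp (Re v * ln r) / \<delta>))"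
    proof (cases "g k \<noteq> 0 \<and> n k = - N")
      case True
      have "\<delta> \<le> norm (v + w k)" using delta(2)[of k] True by (simp add: add.commute)
      then have "exp ((Re v + Re (w k)) * ln r) / norm (v + w k) \<le> exp ((Re v + Re (w k)) * ln r) / \<delta>"
        using delta(1) by (intro divide_left_mono mult_pos_pos) auto
      then have "norm (g k) * (2 * pi) * (exp ((Re v + Re (w k)) * ln r) / norm (v + w k))
         \<le> norm (g k) * (2 * pi) * (exp ((Re v + Re (w k)) * ln r) / \<delta>)"
        by (intro mult_left_mono) auto
      also have "exp ((Re v + Re (w k)) * ln r) / \<delta> = exp (Re (w k) * ln r) * exp (Re v * ln r) / \<delta>"
        by (simp add: exp_add[symmetric] algebra_simps)
      finally show ?thesis using True delta(1)
        by (simp add: norm_mult norm_haar_K mult_ac abs_mult)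
    next
      case False
      then have "g k * haar_K (N + n k) (v + w k) r = 0" by (auto simp: haar_K_def)
      then show ?thesis by (simp only: norm_zero norm_ge_zero)
    qed
  qed
qed simp

text \<open>Serves to add one exponent to an expansion: an index whose term vanishes is
  overwritten.\<close>

lemma integral_count_space_update:
  fixes h :: "'k \<Rightarrow> complex"
  assumes h: "integrable (count_space UNIV) h" "h k0 = 0"
  shows "(\<integral>k. (if k = k0 then a else h k) \<partial>count_space UNIV) = a + (\<integral>k. h k \<partial>count_space UNIV)"
    and "integrable (count_space UNIV) (\<lambda>k. if k = k0 then a else h k)"
proof -
  have eq: "(\<lambda>k. if k = k0 then a else h k) = (\<lambda>k. indicator {k0} k *\<^sub>R a + h k)"
    using h(2) by (auto simp: indicator_def)
  have i: "integrable (count_space UNIV) (\<lambda>k. indicator {k0} k *\<^sub>R a)"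
    by (intro integrable_scaleR_left integrable_real_indicator) auto
  have "(\<integral>k. indicator {k0} k *\<^sub>R a \<partial>count_space UNIV) = a"
    by simp
  then show "(\<integral>k. (if k = k0 then a else h k) \<partial>count_space UNIV) = a + (\<integral>k. h k \<partial>count_space UNIV)"
    unfolding eq by (subst Bochner_Integration.integral_add[OF i h(1)]) simp
  show "integrable (count_space UNIV) (\<lambda>k. if k = k0 then a else h k)"
    unfolding eq by (intro Bochner_Integration.integrable_add i h)
qed

text \<open>Enlarging the radius from a to b removes an annulus from the integral. There the
  expansion of G can be integrated termwise, and each term is the difference of
  \<open>haar_K\<close> at the two radii.\<close>

lemma FPzero_radius_indep:
  fixes G :: "complex \<Rightarrow> complex" and g w :: "'k :: countable \<Rightarrow> complex"
  assumes [measurable]: "G \<in> borel_measurable borel"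
    and G: "AE y in haar. norm y < 1 \<longrightarrow> G y = (\<integral>k. g k * qchar (n k) (w k) y \<partial>count_space UNIV)"
    and g: "\<And>r. 0 < r \<Longrightarrow> r < 1 \<Longrightarrow> integrable (count_space UNIV) (\<lambda>k. norm (g k) * exp (Re (w k) * ln r))"
    and w0: "\<And>k. g k \<noteq> 0 \<Longrightarrow> w0 \<le> Re (w k)"
    and delta: "\<delta> > 0" "\<And>k. g k \<noteq> 0 \<Longrightarrow> n k = - N \<Longrightarrow> \<delta> \<le> norm (w k + v)"
    and int: "integrable haar (\<lambda>y. indicator (- cball 0 a) y * (G y * qchar N v y))"
    and ab: "0 < a" "a \<le> b" "b < 1"
  shows "FPzero G g n w a N v = FPzero G g n w b N v"
proof -
  let ?N = "count_space (UNIV :: 'k set)"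
  let ?A = "cball 0 b - cball 0 a :: complex set"
  define h where "h k y = indicator ?A y * (g k * qchar (N + n k) (v + w k) y)" for k y
  have [measurable]: "h k \<in> borel_measurable haar" for k unfolding h_def[abs_def] by measurable
  define a' where "a' k = norm (g k) * exp (Re (w k) * ln b)" for k
  have a': "integrable ?N a'" unfolding a'_def using ab by (intro g) auto
  define b' where "b' y = indicator ?A y * (exp (- w0 * ln b) * exp ((w0 + Re v) * ln (norm y)))" for y :: complex
  have b': "integrable haar b'"
  proof -
    have "integrable haar (\<lambda>y. exp (- w0 * ln b) * norm (indicator ?A y * qchar 0 (of_real (w0 + Re v)) y))"
      by (intro integrable_mult_right integrable_norm qchar_integrable_annulus ab)
    then show ?thesis
      by (rule Bochner_Integration.integrable_bound)
         (auto simp: b'_def[abs_def] indicator_def norm_qchar)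
  qed
  have hb: "norm (h k y) \<le> a' k * b' y" for k y
  proof (cases "y \<in> ?A \<and> g k \<noteq> 0")
    case True
    then have y: "a < norm y" "norm y \<le> b" by auto
    then have "ln (norm y) \<le> ln b" using ab by (intro ln_mono) auto
    then have "(Re (w k) - w0) * ln (norm y) \<le> (Re (w k) - w0) * ln b"
      using w0 True by (intro mult_left_mono) auto
    then have "exp ((Re v + Re (w k)) * ln (norm y))
        \<le> exp (Re (w k) * ln b) * (exp (- w0 * ln b) * exp ((w0 + Re v) * ln (norm y)))"
      by (simp add: exp_add[symmetric] algebra_simps)
    then have "norm (g k) * exp ((Re v + Re (w k)) * ln (norm y))
        \<le> norm (g k) * (exp (Re (w k) * ln b) * (exp (- w0 * ln b) * exp ((w0 + Re v) * ln (norm y))))"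
      by (intro mult_left_mono) auto
    then show ?thesis using True by (simp add: h_def a'_def b'_def norm_mult norm_qchar mult_ac)
  qed (auto simp: h_def a'_def b'_def)
  note swap = integral_sum_swap[OF haar.sigma_finite_measure_axioms, of h, OF _ AE_I2[OF hb] a' b']
  have h_int: "(\<integral>y. h k y \<partial>haar) = g k * haar_K (N + n k) (v + w k) b - g k * haar_K (N + n k) (v + w k) a" for k
  proof (cases "g k = 0")
    case False
    have "h k = (\<lambda>y. g k * (indicator ?A y * qchar (N + n k) (v + w k) y))"
      by (auto simp: h_def)
    then have "(\<integral>y. h k y \<partial>haar) = g k * (\<integral>y. indicator ?A y * qchar (N + n k) (v + w k) y \<partial>haar)"
      by (simp only: integral_mult_right_zero)
    also have "(\<integral>y. indicator ?A y * qchar (N + n k) (v + w k) y \<partial>haar) = haar_K (N + n k) (v + w k) b - haar_K (N + n k) (v + w k) a"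
    proof (rule qchar_integral_annulus)
      assume "N + n k = 0"
      then have "\<delta> \<le> norm (w k + v)" using False delta(2) by (simp add: eq_neg_iff_add_eq_0 add.commute)
      then show "v + w k \<noteq> 0" using delta(1) by (auto simp: add.commute)
    qed (use ab in auto)
    finally show ?thesis by (simp add: algebra_simps)
  qed (simp add: h_def)
  have Ka: "integrable ?N (\<lambda>k. g k * haar_K (N + n k) (v + w k) a)" 
    by (rule sum_haar_K_integrable[OF g delta]) (use ab in auto)
  have Kb: "integrable ?N (\<lambda>k. g k * haar_K (N + n k) (v + w k) b)"
    by (rule sum_haar_K_integrable[OF g delta]) (use ab in auto)
  have "(\<integral>y. indicator ?A y * (G y * qchar N v y) \<partial>haar) = (\<integral>y. (\<integral>k. h k y \<partial>?N) \<partial>haar)"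
  proof (rule integral_cong_AE)
    show "AE y in haar. indicator ?A y * (G y * qchar N v y) = (\<integral>k. h k y \<partial>?N)"
      using G
    proof eventually_elim
      case (elim y)
      show ?case
      proof (cases "y \<in> ?A")
        case True
        then have "norm y < 1" using ab by auto
        with elim have "G y * qchar N v y = (\<integral>k. g k * qchar (n k) (w k) y \<partial>?N) * qchar N v y" by simp
        also have "\<dots> = (\<integral>k. g k * qchar (n k) (w k) y * qchar N v y \<partial>?N)"
          by (rule integral_mult_left_zero[symmetric])
        also have "\<dots> = (\<integral>k. h k y \<partial>?N)"
          using True by (intro Bochner_Integration.integral_cong) (simp_all add: h_def qchar_add mult_ac)
        finally show ?thesis using True by simp
      qed (simp add: h_def)
    qed
    show "(\<lambda>y. \<integral>k. h k y \<partial>?N) \<in> borel_measurable haar" using swap(3) by simp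
  qed simp
  also have "\<dots> = (\<integral>k. (\<integral>y. h k y \<partial>haar) \<partial>?N)" by (rule swap(1)) simp
  also have "\<dots> = (\<integral>k. g k * haar_K (N + n k) (v + w k) b \<partial>?N) - (\<integral>k. g k * haar_K (N + n k) (v + w k) a \<partial>?N)"
    by (simp only: h_int Bochner_Integration.integral_diff[OF Kb Ka])
  finally have ann: "(\<integral>y. indicator ?A y * (G y * qchar N v y) \<partial>haar)
     = (\<integral>k. g k * haar_K (N + n k) (v + w k) b \<partial>?N) - (\<integral>k. g k * haar_K (N + n k) (v + w k) a \<partial>?N)" .
  have "(\<integral>y. indicator (- cball 0 a) y * (G y * qchar N v y) \<partial>haar)
     = (\<integral>y. indicator ?A y * (G y * qchar N v y) + indicator (- cball 0 b) y * (G y * qchar N v y) \<partial>haar)"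
    using ab by (intro Bochner_Integration.integral_cong) (auto simp: indicator_def)
  also have "\<dots> = (\<integral>y. indicator ?A y * (G y * qchar N v y) \<partial>haar)
     + (\<integral>y. indicator (- cball 0 b) y * (G y * qchar N v y) \<partial>haar)"
    using ab by (intro Bochner_Integration.integral_add; intro Bochner_Integration.integrable_bound[OF int])
       (auto simp: indicator_def)
  finally show ?thesis unfolding FPzero_def ann by simp
qed

lemma haar_cball_pos: "0 < r \<Longrightarrow> emeasure haar (cball 0 r) \<noteq> 0"
proof
  assume r: "0 < r" and z: "emeasure haar (cball 0 r) = 0"
  have "(\<integral>\<^sup>+x. indicator (cball 0 r) x * ennreal (exp (0 * ln (norm x))) \<partial>haar) = \<infinity>"
    using r by (intro haar_integral_infinite) auto
  with z show False by simp
qed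

lemma nn_integral_haar_indicator_scale:
  fixes F :: "complex \<Rightarrow> ennreal"
  assumes [measurable]: "F \<in> borel_measurable borel" and "x \<noteq> 0"
  shows "(\<integral>\<^sup>+z. indicator (- cball 0 e) z * F (z * x) \<partial>haar) = (\<integral>\<^sup>+u. indicator (- cball 0 (e * norm x)) u * F u \<partial>haar)"
proof -
  have "(\<integral>\<^sup>+u. indicator (- cball 0 (e * norm x)) u * F u \<partial>haar)
     = (\<integral>\<^sup>+z. indicator (- cball 0 (e * norm x)) (x * z) * F (x * z) \<partial>haar)"
    using assms by (intro nn_integral_haar_scale[symmetric]) auto
  also have "\<dots> = (\<integral>\<^sup>+z. indicator (- cball 0 e) z * F (z * x) \<partial>haar)"
    using assms(2) by (intro nn_integral_cong) (auto simp: indicator_def norm_mult mult.commute)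
  finally show ?thesis ..
qed

text \<open>The hypotheses of the expansion theorem without integrability at a particular z, because
  the theorem will be applied to f with another second factor. Through \<open>f_nonzero\<close>,
  finiteness of integrals involving f passes to the other factor almost everywhere.\<close>

locale mult_convolution =
  fixes f G :: "complex \<Rightarrow> complex" and g d w :: "'k :: countable \<Rightarrow> complex" and n :: "'k \<Rightarrow> int"
    and \<delta> w0 w1 :: real
  assumes f_meas [measurable]: "f \<in> borel_measurable borel"
    and G_meas [measurable]: "G \<in> borel_measurable borel"
    and f_nonzero: "AE x in haar. f x \<noteq> 0"
    and G: "AE y in haar. norm y < 1 \<longrightarrow> G y = (\<integral>k. g k * qchar (n k) (w k) y \<partial>count_space UNIV)"
    and g: "\<And>r. 0 < r \<Longrightarrow> r < 1 \<Longrightarrow> integrable (count_space UNIV) (\<lambda>k. norm (g k) * exp (Re (w k) * ln r))"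
    and f: "\<And>x. norm x > 1 \<Longrightarrow> f x = (\<integral>k. d k * qchar (- n k) (- w k) x \<partial>count_space UNIV)"
    and d: "\<And>r. 1 < r \<Longrightarrow> integrable (count_space UNIV) (\<lambda>k. norm (d k) * exp (- Re (w k) * ln r))"
    and delta: "\<delta> > 0" "\<And>k j. g k \<noteq> 0 \<Longrightarrow> d j \<noteq> 0 \<Longrightarrow> n k = n j \<Longrightarrow> \<delta> \<le> norm (w k - w j)"
    and w0: "\<And>k. g k \<noteq> 0 \<Longrightarrow> w0 \<le> Re (w k)"
    and f0: "\<And>c. 1 < c \<Longrightarrow> integrable haar (\<lambda>x. indicator (cball 0 c) x * (norm (f x) * exp (w0 * ln (norm x))))"
    and w1: "\<And>k. d k \<noteq> 0 \<Longrightarrow> - Re (w k) \<le> w1"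
    and f1: "\<And>c. 1 < c \<Longrightarrow> \<exists>C>0. \<forall>x. norm x > c \<longrightarrow> C * exp (w1 * ln (norm x)) \<le> norm (f x)"
begin

text \<open>The truncated tail \<open>H y = qchar (-N) (-v) y * (\<integral> over norm u > norm y)\<close>
  again has a power expansion inside the unit disc, with one additional exponent, so that the
  expansion theorem applies to the pair \<open>(f, H)\<close>.\<close>
lemma FP_Mellin_convolution:
  fixes N :: int and v :: complex
  assumes fin: "(\<integral>\<^sup>+z. indicator (- cball 0 e) z * ennreal (norm (qchar N v z)) * (\<integral>\<^sup>+x. ennreal (norm (f x * G (z * x))) \<partial>haar) \<partial>haar) < \<infinity>"
    and t_delta: "\<And>k. g k \<noteq> 0 \<or> d k \<noteq> 0 \<Longrightarrow> n k = - N \<Longrightarrow> \<delta> \<le> norm (w k + v)"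
    and t_w0: "w0 \<le> - Re v"
    and spare: "g k0 = 0" "d k0 = 0"
    and e: "0 < e" "e < 1" and c: "1 < c" "c * e < 1"
  shows "(\<integral>z. indicator (- cball 0 e) z * ((\<integral>x. f x * G (z * x) \<partial>haar) * qchar N v z) \<partial>haar)
    + (\<integral>k. (g k * FPinf f d n w c (n k) (w k) + d k * FPzero G g n w (c * e) (- n k) (- w k))
        * haar_K (N + n k) (v + w k) e \<partial>count_space UNIV)
    = FPzero G g n w (c * e) N v * FPinf f d n w c (- N) (- v)"
    and "integrable (count_space UNIV) (\<lambda>k. (g k * FPinf f d n w c (n k) (w k) + d k * FPzero G g n w (c * e) (- n k) (- w k))
        * haar_K (N + n k) (v + w k) e)"
proof -
  let ?N = "count_space (UNIV :: 'k set)"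
  interpret HH: pair_sigma_finite haar haar ..
  define r where "r = c * e"
  have r: "0 < r" "r < 1" using c e by (simp_all add: r_def)

  \<comment> \<open>\<open>E x\<close> is the absolute Mellin tail of G beyond radius
    \<open>e * norm x\<close>. By Tonelli, \<open>fin\<close> says that the integral of
    \<open>E\<close> weighted by the modulus of \<open>f x * qchar (- N) (- v) x\<close> is
    finite.\<close>
  define E where "E x = (\<integral>\<^sup>+u. indicator (- cball 0 (e * norm x)) u * ennreal (norm (G u * qchar N v u)) \<partial>haar)" for x :: complex
  have E_meas [measurable]: "E \<in> borel_measurable borel"
  proof -
    have "E = (\<lambda>x. \<integral>\<^sup>+u. (if e * norm x < norm u then 1 else 0) * ennreal (norm (G u * qchar N v u)) \<partial>haar)"
      unfolding E_def by (intro ext nn_integral_cong) (auto simp: indicator_def)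
    then show ?thesis by simp
  qed
  have inner: "(\<integral>\<^sup>+z. indicator (- cball 0 e) z * ennreal (norm (f x * G (z * x) * qchar N v z)) \<partial>haar)
      = ennreal (norm (f x * qchar (- N) (- v) x)) * E x" if x: "x \<noteq> 0" for x
  proof -
    have "(\<integral>\<^sup>+z. indicator (- cball 0 e) z * ennreal (norm (f x * G (z * x) * qchar N v z)) \<partial>haar)
      = (\<integral>\<^sup>+z. ennreal (norm (f x * qchar (- N) (- v) x)) * (indicator (- cball 0 e) z * ennreal (norm (G (z * x) * qchar N v (z * x)))) \<partial>haar)"
    proof (rule nn_integral_cong_AE)
      show "AE z in haar. indicator (- cball 0 e) z * ennreal (norm (f x * G (z * x) * qchar N v z))
        = ennreal (norm (f x * qchar (- N) (- v) x)) * (indicator (- cball 0 e) z * ennreal (norm (G (z * x) * qchar N v (z * x))))"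
        using AE_haar_nonzero
      proof eventually_elim
        case (elim z)
        have "f x * G (z * x) * qchar N v z = (f x * qchar (- N) (- v) x) * (G (z * x) * qchar N v (z * x))"
          by (simp add: qchar_minus qchar_mult[OF elim x])
        then have "norm (f x * G (z * x) * qchar N v z) = norm (f x * qchar (- N) (- v) x) * norm (G (z * x) * qchar N v (z * x))"
          by (simp only: norm_mult)
        then show ?case by (simp add: ennreal_mult mult_ac)
      qed
    qed
    also have "\<dots> = ennreal (norm (f x * qchar (- N) (- v) x)) *
        (\<integral>\<^sup>+z. indicator (- cball 0 e) z * ennreal (norm (G (z * x) * qchar N v (z * x))) \<partial>haar)"
      by (rule nn_integral_cmult) simp
    also have "(\<integral>\<^sup>+z. indicator (- cball 0 e) z * ennreal (norm (G (z * x) * qchar N v (z * x))) \<partial>haar) = E x"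
      unfolding E_def using x
      by (intro nn_integral_haar_indicator_scale[of "\<lambda>u. ennreal (norm (G u * qchar N v u))"]) simp_all
    finally show ?thesis .
  qed
  define P where "P z x = indicator (- cball 0 e) z * (f x * G (z * x) * qchar N v z)" for z x
  have P_meas [measurable]: "case_prod P \<in> borel_measurable (haar \<Otimes>\<^sub>M haar)"
    unfolding P_def by measurable
  have nP: "ennreal (norm (P z x)) = indicator (- cball 0 e) z * ennreal (norm (f x * G (z * x) * qchar N v z))" for z x
    by (simp add: P_def indicator_def)
  have Pfin1: "(\<integral>\<^sup>+z. \<integral>\<^sup>+x. ennreal (norm (P z x)) \<partial>haar \<partial>haar) < \<infinity>"
  proof -
    have "(\<integral>\<^sup>+z. \<integral>\<^sup>+x. ennreal (norm (P z x)) \<partial>haar \<partial>haar)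
       = (\<integral>\<^sup>+z. indicator (- cball 0 e) z * ennreal (norm (qchar N v z)) * (\<integral>\<^sup>+x. ennreal (norm (f x * G (z * x))) \<partial>haar) \<partial>haar)"
      by (intro nn_integral_cong, subst nn_integral_cmult[symmetric], simp, intro nn_integral_cong)
         (simp add: nP norm_mult ennreal_mult mult_ac)
    then show ?thesis using fin by simp
  qed
  have P_int: "integrable (haar \<Otimes>\<^sub>M haar) (case_prod P)"
    unfolding integrable_iff_bounded
    using Pfin1 by (subst haar.nn_integral_fst[symmetric]) auto
  have Pfin2: "(\<integral>\<^sup>+x. ennreal (norm (f x * qchar (- N) (- v) x)) * E x \<partial>haar) < \<infinity>"
  proof -
    have "(\<integral>\<^sup>+x. ennreal (norm (f x * qchar (- N) (- v) x)) * E x \<partial>haar) = (\<integral>\<^sup>+x. \<integral>\<^sup>+z. ennreal (norm (P z x)) \<partial>haar \<partial>haar)"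
      using AE_haar_nonzero by (intro nn_integral_cong_AE; eventually_elim) (simp add: nP inner)
    also have "\<dots> = (\<integral>\<^sup>+z. \<integral>\<^sup>+x. ennreal (norm (P z x)) \<partial>haar \<partial>haar)"
      by (rule HH.Fubini') (simp add: split_beta')
    finally show ?thesis using Pfin1 by simp
  qed
  \<comment> \<open>Since f does not vanish, \<open>E x\<close> is finite for almost every x. Discs
    have positive measure, so such an x exists with \<open>e * norm x \<le> \<rho>\<close>, however
    small \<rho> is.\<close>
  have G_tail: "integrable haar (\<lambda>u. indicator (- cball 0 \<rho>) u * (G u * qchar N v u))" if \<rho>: "\<rho> > 0" for \<rho>
  proof -
    have "AE x in haar. ennreal (norm (f x * qchar (- N) (- v) x)) * E x \<noteq> \<infinity>"
      by (rule nn_integral_PInf_AE) (use Pfin2 in auto)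
    with f_nonzero AE_haar_nonzero have ae: "AE x in haar. x \<noteq> 0 \<and> E x < \<infinity>"
    proof eventually_elim
      case (elim x)
      then show ?case by (auto simp: ennreal_mult_eq_top_iff less_top[symmetric])
    qed
    have "\<exists>x\<in>cball 0 (\<rho> / e). x \<noteq> 0 \<and> E x < \<infinity>"
    proof (rule ccontr)
      assume neg: "\<not> (\<exists>x\<in>cball 0 (\<rho> / e). x \<noteq> 0 \<and> E x < \<infinity>)"
      have "AE x in haar. x \<notin> cball 0 (\<rho> / e)"
        using ae by eventually_elim (use neg in auto)
      then have "emeasure haar (cball 0 (\<rho> / e)) = 0"
        by (subst (asm) AE_iff_measurable[where N = "cball 0 (\<rho> / e)"]) auto
      with haar_cball_pos[of "\<rho> / e"] \<rho> e show False by simp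
    qed
    then obtain x where x: "norm x \<le> \<rho> / e" "E x < \<infinity>" by auto
    have sub: "e * norm x \<le> \<rho>" using x(1) e by (simp add: field_simps)
    show ?thesis unfolding integrable_iff_bounded
    proof
      have "(\<integral>\<^sup>+u. ennreal (norm (indicator (- cball 0 \<rho>) u * (G u * qchar N v u))) \<partial>haar) \<le> E x"
        unfolding E_def using sub by (intro nn_integral_mono) (auto simp: indicator_def)
      then show "(\<integral>\<^sup>+u. ennreal (norm (indicator (- cball 0 \<rho>) u * (G u * qchar N v u))) \<partial>haar) < \<infinity>"
        using x(2) by (rule le_less_trans)
    qed simp
  qed

  \<comment> \<open>The radial tail integral of G. Multiplied by the inverse character it gives a
    function \<open>H\<close> that can take the place of G in the expansion theorem.\<close>
  define I where "I \<rho> = (\<integral>u. indicator (- cball 0 \<rho>) u * (G u * qchar N v u) \<partial>haar)" for \<rho>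
  define H where "H y = qchar (- N) (- v) y * I (norm y)" for y
  have I_meas [measurable]: "I \<in> borel_measurable borel"
  proof -
    have "I = (\<lambda>\<rho>. \<integral>u. (if \<rho> < norm u then 1 else 0) * (G u * qchar N v u) \<partial>haar)"
      unfolding I_def by (intro ext Bochner_Integration.integral_cong) (auto simp: indicator_def)
    then show ?thesis by simp
  qed
  have H_meas [measurable]: "H \<in> borel_measurable borel"
    unfolding H_def by measurable
  have He: "qchar N v (of_real e) * H (of_real e * x) = qchar (- N) (- v) x * I (e * norm x)" if "x \<noteq> 0" for x
    using that e by (simp add: H_def qchar_mult qchar_minus norm_mult)

  \<comment> \<open>Fubini and the substitution u = z x turn the Mellin integral of the convolution
    over \<open>norm z > e\<close> into the convolution of f with \<open>H\<close> at the single
    point e.\<close>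
  have fH_int: "integrable haar (\<lambda>x. f x * H (of_real e * x))"
    and conv_eq: "(\<integral>z. indicator (- cball 0 e) z * ((\<integral>x. f x * G (z * x) \<partial>haar) * qchar N v z) \<partial>haar)
     = qchar N v (of_real e) * (\<integral>x. f x * H (of_real e * x) \<partial>haar)"
  proof -
    have Px: "AE x in haar. (\<integral>z. P z x \<partial>haar) = qchar N v (of_real e) * (f x * H (of_real e * x))"
      using AE_haar_nonzero
    proof eventually_elim
      case (elim x)
      let ?F = "\<lambda>u. indicator (- cball 0 (e * norm x)) u * (G u * qchar N v u)"
      have "I (e * norm x) = (\<integral>z. ?F (x * z) \<partial>haar)"
        unfolding I_def using elim by (intro haar_integral_scale[symmetric]) simp_all
      then have "f x * qchar (- N) (- v) x * I (e * norm x) = (\<integral>z. f x * qchar (- N) (- v) x * ?F (x * z) \<partial>haar)"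
        by (simp only: integral_mult_right_zero)
      also have "\<dots> = (\<integral>z. P z x \<partial>haar)"
      proof (rule integral_cong_AE)
        show "AE z in haar. f x * qchar (- N) (- v) x * ?F (x * z) = P z x"
          using AE_haar_nonzero
        proof eventually_elim
          case elim2: (elim z)
          have "norm x * norm z \<le> e * norm x \<longleftrightarrow> norm z \<le> e"
            using elim by (metis mult.commute mult_le_cancel_right_pos zero_less_norm_iff)
          then have "x * z \<in> cball 0 (e * norm x) \<longleftrightarrow> z \<in> cball 0 e" by (simp add: norm_mult)
          moreover have "qchar (- N) (- v) x * qchar N v (x * z) = qchar N v z"
            by (simp add: qchar_minus qchar_mult[OF elim elim2])
          ultimately show ?case by (cases "z \<in> cball 0 e") (simp_all add: P_def mult_ac)
        qed
      qed simp_all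
      finally show ?case using He[OF elim] by (simp add: mult_ac)
    qed
    have PI: "integrable haar (\<lambda>x. \<integral>z. P z x \<partial>haar)"
      using HH.integrable_snd[OF P_int] by simp
    have "integrable haar (\<lambda>x. qchar N v (of_real e) * (f x * H (of_real e * x)))"
      using PI by (rule integrable_cong_AE_imp) (use Px in \<open>auto elim: eventually_mono\<close>)
    then have "integrable haar (\<lambda>x. inverse (qchar N v (of_real e)) * (qchar N v (of_real e) * (f x * H (of_real e * x))))"
      by (rule integrable_mult_right)
    then show "integrable haar (\<lambda>x. f x * H (of_real e * x))"
      by (simp add: mult.assoc[symmetric])
    have "(\<integral>z. indicator (- cball 0 e) z * ((\<integral>x. f x * G (z * x) \<partial>haar) * qchar N v z) \<partial>haar)
       = (\<integral>z. (\<integral>x. P z x \<partial>haar) \<partial>haar)"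
      by (intro Bochner_Integration.integral_cong refl)
         (simp only: P_def integral_mult_right_zero integral_mult_left_zero)
    also have "\<dots> = (\<integral>x. (\<integral>z. P z x \<partial>haar) \<partial>haar)"
      by (rule HH.Fubini_integral[OF P_int, symmetric])
    also have "\<dots> = (\<integral>x. qchar N v (of_real e) * (f x * H (of_real e * x)) \<partial>haar)"
      by (rule integral_cong_AE[OF _ _ Px]) (use PI in auto)
    finally show "(\<integral>z. indicator (- cball 0 e) z * ((\<integral>x. f x * G (z * x) \<partial>haar) * qchar N v z) \<partial>haar)
       = qchar N v (of_real e) * (\<integral>x. f x * H (of_real e * x) \<partial>haar)"
      by (simp only: integral_mult_right_zero)
  qed

  define M where "M = FPzero G g n w r N v"
  \<comment> \<open>The index k0 is used by neither expansion, so it can carry the exponent (- N, -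
    v) that \<open>H\<close> has in addition to those of G. Its coefficient \<open>M\<close> is the
    finite-part Mellin transform of G.\<close>
  define n' where "n' = n(k0 := - N)"
  define w' where "w' = w(k0 := - v)"
  \<comment> \<open>The factor that radial integration attaches to the k-th power:
    \<open>haar_K\<close> without its power of the radius. It vanishes unless the winding numbers
    match, so the remaining terms of G drop out of the expansion of \<open>H\<close>.\<close>
  define \<kappa> where "\<kappa> k = (if n k = - N then 2 * of_real pi / (w k + v) else 0)" for k
  define g' where "g' k = (if k = k0 then M else - (\<kappa> k * g k))" for k
  have tg: "\<delta> \<le> norm (w k + v)" if "g k \<noteq> 0" "n k = - N" for k using t_delta that by blast
  have n'w': "n' k0 = - N" "w' k0 = - v" "k \<noteq> k0 \<Longrightarrow> n' k = n k" "k \<noteq> k0 \<Longrightarrow> w' k = w k" for k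
    by (simp_all add: n'_def w'_def)
  have g'0: "g' k \<noteq> 0 \<Longrightarrow> k \<noteq> k0 \<Longrightarrow> g k \<noteq> 0 \<and> n k = - N" for k
    by (auto simp: g'_def \<kappa>_def split: if_splits)

  have H_exp: "H y = (\<integral>k. g' k * qchar (n' k) (w' k) y \<partial>?N)" if y: "norm y < 1" "y \<noteq> 0" for y
  proof -
    have Ki: "integrable ?N (\<lambda>k. g k * haar_K (N + n k) (v + w k) (norm y))"
      by (rule sum_haar_K_integrable[OF g delta(1) tg]) (use y in auto)
    have "FPzero G g n w (norm y) N v = M"
    proof (cases "norm y \<le> r")
      case True
      then show ?thesis unfolding M_def using y r
        by (intro FPzero_radius_indep[OF G_meas G g w0 delta(1) tg G_tail]) auto
    next
      case False
      then show ?thesis unfolding M_def using y r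
        by (intro FPzero_radius_indep[OF G_meas G g w0 delta(1) tg G_tail, symmetric]) auto
    qed
    then have "I (norm y) = M - (\<integral>k. g k * haar_K (N + n k) (v + w k) (norm y) \<partial>?N)"
      unfolding FPzero_def I_def by (simp add: algebra_simps)
    then have Hy: "H y = qchar (- N) (- v) y * M + - qchar (- N) (- v) y * (\<integral>k. g k * haar_K (N + n k) (v + w k) (norm y) \<partial>?N)"
      by (simp only: H_def ring_distribs) simp
    have "H y = qchar (- N) (- v) y * M + (\<integral>k. - (qchar (- N) (- v) y * (g k * haar_K (N + n k) (v + w k) (norm y))) \<partial>?N)"
      unfolding Hy by (simp only: integral_mult_right_zero[symmetric] minus_mult_left)
    also have "\<dots> = (\<integral>k. (if k = k0 then qchar (- N) (- v) y * M else - (qchar (- N) (- v) y * (g k * haar_K (N + n k) (v + w k) (norm y)))) \<partial>?N)"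
      by (subst integral_count_space_update) (use Ki spare in \<open>auto intro!: Bochner_Integration.integrable_minus\<close>)
    also have "\<dots> = (\<integral>k. g' k * qchar (n' k) (w' k) y \<partial>?N)"
    proof (intro Bochner_Integration.integral_cong refl)
      fix k
      have "qchar (- N) (- v) y * haar_K (N + n k) (v + w k) (norm y) = \<kappa> k * qchar (n k) (w k) y"
      proof (cases "n k = - N")
        case True
        have "qchar (n k) (w k) y = qchar (- N) (- v) y * qchar 0 (v + w k) y"
          by (subst qchar_add[symmetric]) (simp add: True)
        then show ?thesis using True by (simp add: haar_K_def \<kappa>_def qchar_0_norm add.commute)
      qed (auto simp: haar_K_def \<kappa>_def)
      then show "(if k = k0 then qchar (- N) (- v) y * M else - (qchar (- N) (- v) y * (g k * haar_K (N + n k) (v + w k) (norm y))))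
          = g' k * qchar (n' k) (w' k) y"
        by (simp add: g'_def n'_def w'_def mult_ac)
    qed
    finally show ?thesis .
  qed
  have g'_sum: "integrable ?N (\<lambda>k. norm (g' k) * exp (Re (w' k) * ln \<rho>))" if \<rho>: "0 < \<rho>" "\<rho> < 1" for \<rho>
  proof -
    have "integrable ?N (\<lambda>k. (if k = k0 then complex_of_real (norm M * exp (- Re v * ln \<rho>))
        else complex_of_real (norm (\<kappa> k * g k) * exp (Re (w k) * ln \<rho>))))"
    proof (rule integral_count_space_update)
      have "integrable ?N (\<lambda>k. norm (g k) * exp (Re (w k) * ln \<rho>) * (2 * pi / \<delta>))"
        by (intro integrable_mult_left g \<rho>)
      then show "integrable ?N (\<lambda>k. complex_of_real (norm (\<kappa> k * g k) * exp (Re (w k) * ln \<rho>)))"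
      proof (rule Bochner_Integration.integrable_bound)
        show "AE k in ?N. norm (complex_of_real (norm (\<kappa> k * g k) * exp (Re (w k) * ln \<rho>)))
            \<le> norm (norm (g k) * exp (Re (w k) * ln \<rho>) * (2 * pi / \<delta>))"
        proof (rule AE_I2)
          fix k
          have "norm (\<kappa> k * g k) \<le> norm (g k) * (2 * pi / \<delta>)"
          proof (cases "g k \<noteq> 0 \<and> n k = - N")
            case True
            then have "norm (\<kappa> k) \<le> 2 * pi / \<delta>"
              using tg[of k] delta(1) by (auto simp: \<kappa>_def norm_divide norm_mult intro!: divide_left_mono mult_pos_pos)
            then show ?thesis
              using mult_left_mono[of "norm (\<kappa> k)" "2 * pi / \<delta>" "norm (g k)"]
              by (simp only: norm_mult mult.commute[of "norm (\<kappa> k)"] norm_ge_zero)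
          qed (use delta(1) in \<open>auto simp: \<kappa>_def\<close>)
          then have "norm (\<kappa> k * g k) * exp (Re (w k) * ln \<rho>) \<le> norm (g k) * (2 * pi / \<delta>) * exp (Re (w k) * ln \<rho>)"
            by (rule mult_right_mono) simp
          then show "norm (complex_of_real (norm (\<kappa> k * g k) * exp (Re (w k) * ln \<rho>)))
            \<le> norm (norm (g k) * exp (Re (w k) * ln \<rho>) * (2 * pi / \<delta>))"
            using delta(1) by (simp add: norm_mult abs_mult mult_ac)
        qed
      qed simp
    qed (use spare in auto)
    then have "integrable ?N (\<lambda>k. norm (if k = k0 then complex_of_real (norm M * exp (- Re v * ln \<rho>))
        else complex_of_real (norm (\<kappa> k * g k) * exp (Re (w k) * ln \<rho>))))"
      by (rule integrable_norm)
    moreover have "(\<lambda>k. norm (if k = k0 then complex_of_real (norm M * exp (- Re v * ln \<rho>))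
        else complex_of_real (norm (\<kappa> k * g k) * exp (Re (w k) * ln \<rho>)))) = (\<lambda>k. norm (g' k) * exp (Re (w' k) * ln \<rho>))"
      by (auto simp: g'_def w'_def norm_mult)
    ultimately show ?thesis by simp
  qed
  have delta': "\<delta> \<le> norm (w' k - w' j)" if "g' k \<noteq> 0" "d j \<noteq> 0" "n' k = n' j" for k j
  proof -
    have j: "j \<noteq> k0" using that spare by auto
    show ?thesis
    proof (cases "k = k0")
      case True
      then have "\<delta> \<le> norm (w j + v)" using t_delta[of j] that j by (simp add: n'w')
      also have "norm (w j + v) = norm (w' k - w' j)" using True j
        by (simp add: n'w' norm_minus_commute[of "- v"])
      finally show ?thesis .
    next
      case False
      then show ?thesis using that j g'0[of k] delta(2)[of k j] by (simp add: n'w')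
    qed
  qed
  have d_cong: "d k * q (n' k) (w' k) = d k * q (n k) (w k)" for k and q :: "int \<Rightarrow> complex \<Rightarrow> complex"
    using spare by (cases "k = k0") (simp_all add: n'w')
  have f': "f x = (\<integral>k. d k * qchar (- n' k) (- w' k) x \<partial>?N)" if "norm x > 1" for x
    unfolding f[OF that] by (simp only: d_cong[of _ "\<lambda>n w. qchar (- n) (- w) x"])
  have d': "integrable ?N (\<lambda>k. norm (d k) * exp (- Re (w' k) * ln \<rho>))" if "1 < \<rho>" for \<rho>
  proof -
    have "(\<lambda>k. norm (d k) * exp (- Re (w' k) * ln \<rho>)) = (\<lambda>k. norm (d k) * exp (- Re (w k) * ln \<rho>))"
      using spare by (auto simp: w'_def)
    then show ?thesis using d[OF that] by simp
  qed
  have w0': "w0 \<le> Re (w' k)" if "g' k \<noteq> 0" for k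
    using g'0[OF that] w0[of k] t_w0 by (cases "k = k0") (auto simp: n'w')
  have w1': "- Re (w' k) \<le> w1" if "d k \<noteq> 0" for k
    using that w1[of k] spare by (cases "k = k0") (auto simp: n'w')
  have H_AE: "AE y in haar. norm y < 1 \<longrightarrow> H y = (\<integral>k. g' k * qchar (n' k) (w' k) y \<partial>?N)"
    using AE_haar_nonzero by eventually_elim (use H_exp in auto)
  have ne: "norm (complex_of_real e) = e" using e by simp
  have ez: "complex_of_real e \<noteq> 0" using e by simp
  have ce: "c * norm (complex_of_real e) < 1" unfolding ne by (rule c(2))
  note rule = mult_convolution_expansion[where f = f and G = H and g = g' and d = d and w = w' and n = n'
      and \<delta> = \<delta> and c = c and z = "of_real e"]
  have "(\<integral>x. f x * H (of_real e * x) \<partial>haar) = (\<integral>k. (g' k * FPinf f d n' w' c (n' k) (w' k)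
          + d k * FPzero H g' n' w' (c * norm (complex_of_real e)) (- n' k) (- w' k)) * qchar (n' k) (w' k) (of_real e) \<partial>?N)"
    by (rule rule(1)) (fact f_meas H_meas H_AE g'_sum f' d' delta(1) delta' fH_int w0' f0 w1' f1 c(1) ce ez)+
  then have step: "(\<integral>x. f x * H (of_real e * x) \<partial>haar) = (\<integral>k. (g' k * FPinf f d n' w' c (n' k) (w' k)
          + d k * FPzero H g' n' w' r (- n' k) (- w' k)) * qchar (n' k) (w' k) (of_real e) \<partial>?N)"
    by (simp only: ne r_def)
  have "integrable ?N (\<lambda>k. (g' k * FPinf f d n' w' c (n' k) (w' k)
          + d k * FPzero H g' n' w' (c * norm (complex_of_real e)) (- n' k) (- w' k)) * qchar (n' k) (w' k) (of_real e))"
    by (rule rule(2)) (fact f_meas H_meas H_AE g'_sum f' d' delta(1) delta' fH_int w0' f0 w1' f1 c(1) ce ez)+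
  then have step_int: "integrable ?N (\<lambda>k. (g' k * FPinf f d n' w' c (n' k) (w' k)
          + d k * FPzero H g' n' w' r (- n' k) (- w' k)) * qchar (n' k) (w' k) (of_real e))"
    by (simp only: ne r_def)

  \<comment> \<open>Integration by parts for finite parts: \<open>H\<close> is, up to a character, a
    radial antiderivative of G, so at an exponent of f its transform is that of G times - \<kappa>
    j.\<close>
  have FPH: "FPzero H g' n' w' r (- n j) (- w j) = - \<kappa> j * FPzero G g n w r (- n j) (- w j)" if dj: "d j \<noteq> 0" for j
  proof -
    have j: "j \<noteq> k0" using dj spare by auto
    have tj: "\<delta> \<le> norm (w j + v)" if "n j = - N" using t_delta[of j] dj that by auto
    \<comment> \<open>With \<open>H\<close> written as an integral over u, its Mellin integral is a
      double integral over r < norm y < norm u. Integrating over y first leaves an annulus, on which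
      \<open>haar_K\<close> is exact.\<close>
    define Q where "Q y u = (if r < norm y \<and> norm y < norm u then 1 else 0) *
        (qchar (- N + - n j) (- v + - w j) y * (G u * qchar N v u))" for y u
    have Q_meas [measurable]: "case_prod Q \<in> borel_measurable (haar \<Otimes>\<^sub>M haar)"
      unfolding Q_def by measurable
    obtain C where C: "C > 0" "\<And>x. norm x > c \<Longrightarrow> C * exp (w1 * ln (norm x)) \<le> norm (f x)"
      using f1[OF c(1)] by blast
    define K0 where "K0 = exp (- Re (w j) * ln c) * exp (- w1 * ln c) / C"
    \<comment> \<open>Because \<open>d j\<close> is nonzero, the power with exponent
      \<open>- Re (w j)\<close> is dominated by f outside the disc of radius c. Absolute convergence
      of the double integral thereby reduces to that of f against the tail \<open>E\<close>.\<close>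
    have fb: "exp (- Re (w j) * ln (norm x)) \<le> K0 * norm (f x)" if x: "norm x > c" for x
    proof -
      have "ln c \<le> ln (norm x)" using x c by (intro ln_mono) auto
      then have "(- Re (w j) - w1) * ln (norm x) \<le> (- Re (w j) - w1) * ln c"
        using w1[OF dj] by (intro mult_left_mono_neg) auto
      then have "exp (- Re (w j) * ln (norm x)) \<le> exp (- Re (w j) * ln c) * exp (- w1 * ln c) * exp (w1 * ln (norm x))"
        by (simp add: exp_add[symmetric] algebra_simps)
      also have "\<dots> \<le> exp (- Re (w j) * ln c) * exp (- w1 * ln c) * (norm (f x) / C)"
        using C(1) C(2)[OF x] by (intro mult_left_mono) (auto simp: field_simps)
      finally show ?thesis by (simp add: K0_def)
    qed
    have K0: "K0 \<ge> 0" using C(1) by (simp add: K0_def)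
    define e1 where "e1 = norm (qchar (- N + - n j) (- v + - w j) (of_real e))"
    have Q_int: "integrable (haar \<Otimes>\<^sub>M haar) (case_prod Q)"
      unfolding integrable_iff_bounded
    proof
      have "(\<integral>\<^sup>+p. ennreal (norm (case_prod Q p)) \<partial>(haar \<Otimes>\<^sub>M haar)) = (\<integral>\<^sup>+y. \<integral>\<^sup>+u. ennreal (norm (Q y u)) \<partial>haar \<partial>haar)"
        by (subst haar.nn_integral_fst[symmetric]) auto
      also have "\<dots> = (\<integral>\<^sup>+x. \<integral>\<^sup>+u. ennreal (norm (Q (of_real e * x) u)) \<partial>haar \<partial>haar)"
        using e by (intro nn_integral_haar_scale[symmetric]) auto
      also have "\<dots> \<le> (\<integral>\<^sup>+x. ennreal (e1 * K0) * (ennreal (norm (f x * qchar (- N) (- v) x)) * E x) \<partial>haar)"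
      proof (rule nn_integral_mono_AE)
        show "AE x in haar. (\<integral>\<^sup>+u. ennreal (norm (Q (of_real e * x) u)) \<partial>haar)
          \<le> ennreal (e1 * K0) * (ennreal (norm (f x * qchar (- N) (- v) x)) * E x)"
          using AE_haar_nonzero
        proof eventually_elim
          case (elim x)
          show ?case
          proof (cases "norm x > c")
            case True
            have qb: "norm (Q (of_real e * x) u) \<le> e1 * K0 * norm (f x * qchar (- N) (- v) x)
                * norm (indicator (- cball 0 (e * norm x)) u * (G u * qchar N v u))" for u
            proof -
              have "norm (qchar (- N + - n j) (- v + - w j) (of_real e * x))
                 = e1 * (norm (qchar (- N) (- v) x) * norm (qchar (- n j) (- w j) x))"
                by (simp only: qchar_mult[OF ez elim] norm_mult e1_def qchar_add[of "- N" "- n j" "- v" "- w j" x])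
              also have "norm (qchar (- n j) (- w j) x) \<le> K0 * norm (f x)"
                using fb[OF True] by (simp add: norm_qchar)
              then have "e1 * (norm (qchar (- N) (- v) x) * norm (qchar (- n j) (- w j) x))
                 \<le> e1 * (norm (qchar (- N) (- v) x) * (K0 * norm (f x)))"
                by (intro mult_left_mono) (auto simp: e1_def)
              finally have b: "norm (qchar (- N + - n j) (- v + - w j) (of_real e * x))
                 \<le> e1 * (norm (qchar (- N) (- v) x) * (K0 * norm (f x)))" .
              have "norm (Q (of_real e * x) u) \<le> norm (qchar (- N + - n j) (- v + - w j) (of_real e * x))
                 * norm (indicator (- cball 0 (e * norm x)) u * (G u * qchar N v u))"
                using e by (auto simp: Q_def indicator_def norm_mult)
              also have "\<dots> \<le> e1 * (norm (qchar (- N) (- v) x) * (K0 * norm (f x)))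
                 * norm (indicator (- cball 0 (e * norm x)) u * (G u * qchar N v u))"
                using b by (rule mult_right_mono) simp
              finally show ?thesis by (simp add: norm_mult mult_ac)
            qed
            have "(\<integral>\<^sup>+u. ennreal (norm (Q (of_real e * x) u)) \<partial>haar)
              \<le> (\<integral>\<^sup>+u. ennreal (e1 * K0 * norm (f x * qchar (- N) (- v) x))
                * (indicator (- cball 0 (e * norm x)) u * ennreal (norm (G u * qchar N v u))) \<partial>haar)"
            proof (rule nn_integral_mono)
              fix u
              have "0 \<le> e1 * K0 * norm (f x * qchar (- N) (- v) x)"
                using K0 by (simp add: e1_def)
              then have "ennreal (e1 * K0 * norm (f x * qchar (- N) (- v) x)
                * norm (indicator (- cball 0 (e * norm x)) u * (G u * qchar N v u)))
                = ennreal (e1 * K0 * norm (f x * qchar (- N) (- v) x))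
                * (indicator (- cball 0 (e * norm x)) u * ennreal (norm (G u * qchar N v u)))"
                by (subst ennreal_mult) (simp_all add: indicator_def)
              then show "ennreal (norm (Q (of_real e * x) u)) \<le> ennreal (e1 * K0 * norm (f x * qchar (- N) (- v) x))
                * (indicator (- cball 0 (e * norm x)) u * ennreal (norm (G u * qchar N v u)))"
                using ennreal_leI[OF qb[of u]] by (simp only:)
            qed
            also have "\<dots> = ennreal (e1 * K0 * norm (f x * qchar (- N) (- v) x)) * E x"
              unfolding E_def by (rule nn_integral_cmult) simp
            finally show ?thesis using K0 by (simp add: ennreal_mult e1_def mult.assoc)
          next
            case False
            then have "e * norm x \<le> r" using e by (simp add: r_def)
            then have "Q (of_real e * x) u = 0" for u using e by (simp add: Q_def norm_mult)
            then show ?thesis by simp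
          qed
        qed
      qed
      also have "\<dots> = ennreal (e1 * K0) * (\<integral>\<^sup>+x. ennreal (norm (f x * qchar (- N) (- v) x)) * E x \<partial>haar)"
        by (rule nn_integral_cmult) simp
      also have "\<dots> < \<infinity>" using Pfin2 by (simp add: ennreal_mult_less_top)
      finally show "(\<integral>\<^sup>+p. ennreal (norm (case_prod Q p)) \<partial>(haar \<Otimes>\<^sub>M haar)) < \<infinity>" .
    qed simp
    define K where "K \<rho> = haar_K (- N + - n j) (- v + - w j) \<rho>" for \<rho>
    define A where "A u = indicator (- cball 0 r) u * (G u * qchar N v u) * (K (norm u) - K r)" for u
    have Qu: "(\<integral>y. Q y u \<partial>haar) = A u" for u
    proof (cases "norm u > r")
      case True
      have "(\<integral>y. Q y u \<partial>haar) = (\<integral>y. G u * qchar N v u * (indicator (cball 0 (norm u) - cball 0 r) y * qchar (- N + - n j) (- v + - w j) y) \<partial>haar)"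
      proof (rule integral_cong_AE)
        show "AE y in haar. Q y u = G u * qchar N v u * (indicator (cball 0 (norm u) - cball 0 r) y * qchar (- N + - n j) (- v + - w j) y)"
          using AE_haar_sphere[of "norm u"] by eventually_elim (auto simp: Q_def indicator_def)
      qed (simp_all add: Q_def)
      also have "\<dots> = G u * qchar N v u * (\<integral>y. indicator (cball 0 (norm u) - cball 0 r) y * qchar (- N + - n j) (- v + - w j) y \<partial>haar)"
        by (rule integral_mult_right_zero)
      also have "(\<integral>y. indicator (cball 0 (norm u) - cball 0 r) y * qchar (- N + - n j) (- v + - w j) y \<partial>haar) = K (norm u) - K r"
        unfolding K_def
      proof (rule qchar_integral_annulus)
        assume "- N + - n j = 0"
        then have "\<delta> \<le> norm (w j + v)" using tj by simp
        moreover have "norm (- v + - w j) = norm (w j + v)"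
          using norm_minus_cancel[of "w j + v"] by (simp add: add.commute)
        ultimately show "- v + - w j \<noteq> 0" using delta(1) by (metis norm_zero not_less)
      qed (use r True in auto)
      finally show ?thesis using True by (simp add: A_def)
    next
      case False
      then have "\<not> (r < norm y \<and> norm y < norm u)" for y :: complex by linarith
      then have "Q y u = 0" for y by (simp only: Q_def if_False mult_zero_left)
      then show ?thesis using False by (simp add: A_def)
    qed
    have A_int: "integrable haar A"
      using HH.integrable_snd[OF Q_int] by (simp add: Qu)
    have "(\<integral>y. indicator (- cball 0 r) y * (H y * qchar (- n j) (- w j) y) \<partial>haar) = (\<integral>y. (\<integral>u. Q y u \<partial>haar) \<partial>haar)"
    proof (intro Bochner_Integration.integral_cong refl)
      fix y
      show "indicator (- cball 0 r) y * (H y * qchar (- n j) (- w j) y) = (\<integral>u. Q y u \<partial>haar)"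
      proof (cases "norm y > r")
        case True
        have "H y * qchar (- n j) (- w j) y = qchar (- N + - n j) (- v + - w j) y * I (norm y)"
          by (simp only: H_def qchar_add mult_ac)
        also have "\<dots> = (\<integral>u. qchar (- N + - n j) (- v + - w j) y * (indicator (- cball 0 (norm y)) u * (G u * qchar N v u)) \<partial>haar)"
          unfolding I_def by (rule integral_mult_right_zero[symmetric])
        also have "\<dots> = (\<integral>u. Q y u \<partial>haar)"
          using True by (intro Bochner_Integration.integral_cong refl) (simp add: Q_def indicator_def)
        finally show ?thesis using True by simp
      qed (simp add: Q_def)
    qed
    also have "\<dots> = (\<integral>u. (\<integral>y. Q y u \<partial>haar) \<partial>haar)"
      by (rule HH.Fubini_integral[OF Q_int, symmetric])
    also have "\<dots> = (\<integral>u. A u \<partial>haar)" by (simp only: Qu)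
    finally have H1: "(\<integral>y. indicator (- cball 0 r) y * (H y * qchar (- n j) (- w j) y) \<partial>haar) = (\<integral>u. A u \<partial>haar)" .

    define T where "T k = - (\<kappa> k * g k) * haar_K (- n j + n k) (- w j + w k) r" for k
    have T0: "T k0 = 0" using spare by (simp add: T_def)
    have Tfull: "g' k * haar_K (- n j + n' k) (- w j + w' k) r = (if k = k0 then M * K r else T k)" for k
      by (simp add: g'_def T_def n'w' K_def add.commute)
    have gi: "integrable ?N (\<lambda>k. if k = k0 then M * K r else T k)"
      unfolding Tfull[symmetric]
    proof (rule sum_haar_K_integrable[OF g'_sum[OF r] delta(1)])
      fix k assume "g' k \<noteq> 0" "n' k = - (- n j)"
      then show "\<delta> \<le> norm (w' k + - w j)" using delta'[of k j] dj j by (simp add: n'w')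
    qed
    have T_int: "integrable ?N T"
    proof -
      have "integrable ?N (\<lambda>k. if k = k0 then 0 else T k)"
        using gi by (rule Bochner_Integration.integrable_bound) auto
      moreover have "(\<lambda>k. if k = k0 then 0 else T k) = T" using T0 by auto
      ultimately show ?thesis by simp
    qed
    have H2: "(\<integral>k. g' k * haar_K (- n j + n' k) (- w j + w' k) r \<partial>?N) = M * K r + (\<integral>k. T k \<partial>?N)"
      unfolding Tfull by (rule integral_count_space_update[OF T_int T0])
    have FPHeq: "FPzero H g' n' w' r (- n j) (- w j) = (\<integral>u. A u \<partial>haar) + (M * K r + (\<integral>k. T k \<partial>?N))"
      unfolding FPzero_def H1 H2 ..
    show ?thesis
    proof (cases "n j = - N")
      case False
      have K: "K \<rho> = 0" for \<rho> using False by (simp add: K_def haar_K_def)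
      have "A = (\<lambda>_. 0)" by (simp add: fun_eq_iff A_def K)
      moreover have "T = (\<lambda>_. 0)" using False by (auto simp: fun_eq_iff T_def \<kappa>_def haar_K_def)
      moreover have "\<kappa> j = 0" using False by (simp add: \<kappa>_def)
      ultimately show ?thesis unfolding FPHeq K by simp
    next
      case True
      have tn: "w j + v \<noteq> 0" using tj[OF True] delta(1) by auto
      have Kr: "K \<rho> = - \<kappa> j * exp ((- v + - w j) * of_real (ln \<rho>))" for \<rho>
      proof -
        define E where "E = exp ((- v + - w j) * of_real (ln \<rho>))"
        have vw: "- v + - w j = - (w j + v)" by simp
        have "K \<rho> = 2 * of_real pi * E / (- v + - w j)"
          unfolding K_def haar_K_def E_def using True by (simp only: refl if_True minus_minus add.left_inverse add.right_inverse)
        also have "\<dots> = - \<kappa> j * E"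
          unfolding vw by (simp only: \<kappa>_def True if_True refl divide_minus_right mult_minus_left times_divide_eq_left)
        finally show ?thesis by (simp only: E_def)
      qed
      define B where "B u = indicator (- cball 0 r) u * (G u * qchar N v u)" for u
      have B_int: "integrable haar B" unfolding B_def by (rule G_tail[OF r(1)])
      define D where "D u = indicator (- cball 0 r) u * (G u * qchar (- n j) (- w j) u)" for u
      have ABD: "- \<kappa> j * D u = A u + K r * B u" for u
      proof -
        have "qchar N v u * K (norm u) = - \<kappa> j * qchar (- n j) (- w j) u"
        proof -
          have "qchar N v u * qchar 0 (- v + - w j) u = qchar (- n j) (- w j) u"
            by (subst qchar_add[symmetric]) (simp add: True)
          then show ?thesis by (simp add: Kr qchar_0_norm)
        qed
        then have "indicator (- cball 0 r) u * (G u * (qchar N v u * K (norm u))) = - \<kappa> j * D u"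
          by (simp add: D_def)
        then show ?thesis by (simp add: A_def B_def algebra_simps)
      qed
      have "- \<kappa> j * (\<integral>u. D u \<partial>haar) = (\<integral>u. A u + K r * B u \<partial>haar)"
        unfolding ABD[symmetric] by (rule integral_mult_right_zero[symmetric])
      also have "\<dots> = (\<integral>u. A u \<partial>haar) + K r * I r"
        unfolding I_def B_def[symmetric] using A_int B_int
        by (subst Bochner_Integration.integral_add) (simp_all del: integral_mult_right_zero add: integral_mult_right_zero)
      finally have Aeq: "(\<integral>u. A u \<partial>haar) = - \<kappa> j * (\<integral>u. D u \<partial>haar) - K r * I r" by simp
      define X where "X k = g k * haar_K (N + n k) (v + w k) r" for k
      define Y where "Y k = g k * haar_K (- n j + n k) (- w j + w k) r" for k
      have X_int: "integrable ?N X" unfolding X_def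
        by (rule sum_haar_K_integrable[OF g[OF r] delta(1) tg])
      have Y_int: "integrable ?N Y" unfolding Y_def
      proof (rule sum_haar_K_integrable[OF g[OF r] delta(1)])
        fix k assume "g k \<noteq> 0" "n k = - (- n j)"
        then show "\<delta> \<le> norm (w k + - w j)" using delta(2)[of k j] dj by simp
      qed
      have M_eq: "M = I r + (\<integral>k. X k \<partial>?N)"
        unfolding M_def FPzero_def I_def X_def ..
      have XYT: "K r * X k + T k = - \<kappa> j * Y k" for k
      proof (cases "g k \<noteq> 0 \<and> n k = - N")
        case k: True
        have bn: "w k + v \<noteq> 0" using tg[of k] k delta(1) by auto
        have "\<delta> \<le> norm (w k - w j)" using delta(2)[of k j] k dj True by simp
        then have cn: "w k - w j \<noteq> 0" using delta(1) by auto
        define a b where "a = w j + v" and "b = w k + v"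
        have ab: "a \<noteq> 0" "b \<noteq> 0" "b - a \<noteq> 0" using tn bn cn by (simp_all add: a_def b_def)
        define Z where "Z = exp ((- w j + w k) * of_real (ln r))"
        have Zs: "exp ((- v + - w j) * of_real (ln r)) * exp ((v + w k) * of_real (ln r)) = Z"
          by (simp add: Z_def exp_add[symmetric] algebra_simps)
        have 1: "K r * X k = - (2 * of_real pi / a) * (2 * of_real pi / b) * (g k * Z)"
          using k True Zs by (simp add: Kr X_def haar_K_def \<kappa>_def a_def b_def add.commute)
        have ba: "- w j + w k = b - a" by (simp add: a_def b_def)
        have 2: "Y k = g k * (2 * of_real pi * Z / (b - a))"
          using k True ba by (simp add: Y_def haar_K_def Z_def)
        have 3: "T k = - (2 * of_real pi / b) * Y k"
          using k by (simp add: T_def Y_def \<kappa>_def b_def)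
        have 4: "\<kappa> j = 2 * of_real pi / a" using True by (simp add: \<kappa>_def a_def)
        \<comment> \<open>This partial fraction merges the two places where the k-th term of G
          enters the transform of \<open>H\<close>: through the constant \<open>M\<close> of the
          additional exponent and through the integrated k-th power. Together they give the k-th
          correction in the finite part of G.\<close>
        have "1 / (a * b) + 1 / (b * (b - a)) = 1 / (a * (b - a))"
          using ab by (simp add: field_simps)
        then have "- ((2 * of_real pi)\<^sup>2 * g k * Z) * (1 / (a * b) + 1 / (b * (b - a))) = - ((2 * of_real pi)\<^sup>2 * g k * Z) * (1 / (a * (b - a)))"
          by simp
        then show ?thesis unfolding 1 3 4 unfolding 2
          by (simp add: power2_eq_square distrib_left mult_ac)
      next
        case k: False
        then show ?thesis using True by (auto simp: X_def T_def Y_def \<kappa>_def haar_K_def)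
      qed
      have "K r * (\<integral>k. X k \<partial>?N) + (\<integral>k. T k \<partial>?N) = (\<integral>k. K r * X k + T k \<partial>?N)"
        using X_int T_int by (subst Bochner_Integration.integral_add) auto
      also have "\<dots> = - \<kappa> j * (\<integral>k. Y k \<partial>?N)"
        unfolding XYT by (rule integral_mult_right_zero)
      finally have fin_eq: "K r * (\<integral>k. X k \<partial>?N) + (\<integral>k. T k \<partial>?N) = - \<kappa> j * (\<integral>k. Y k \<partial>?N)" .
      have "FPzero H g' n' w' r (- n j) (- w j) = - \<kappa> j * (\<integral>u. D u \<partial>haar) + (K r * (\<integral>k. X k \<partial>?N) + (\<integral>k. T k \<partial>?N))"
        unfolding FPHeq Aeq M_eq by (simp add: algebra_simps)
      then show ?thesis unfolding fin_eq FPzero_def D_def[symmetric] Y_def[symmetric]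
        by (simp add: distrib_left)
    qed
  qed

  have FPinf': "FPinf f d n' w' c m u = FPinf f d n w c m u" for m u
    unfolding FPinf_def by (simp only: d_cong[of _ "\<lambda>n w. haar_K (m - n) (u - w) c"])
  define S where "S k = (g k * FPinf f d n w c (n k) (w k) + d k * FPzero G g n w r (- n k) (- w k))
        * haar_K (N + n k) (v + w k) e" for k
  have qK: "qchar N v (of_real e) * (\<kappa> k * qchar (n k) (w k) (of_real e)) = haar_K (N + n k) (v + w k) e" for k
  proof (cases "n k = - N")
    case True
    have "qchar N v (of_real e) * qchar (n k) (w k) (of_real e) = qchar 0 (v + w k) (of_real e)"
      by (subst qchar_add[symmetric]) (simp add: True)
    then show ?thesis using True e by (simp add: \<kappa>_def haar_K_def qchar_0_norm mult_ac add.commute)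
  qed (auto simp: \<kappa>_def haar_K_def)
  \<comment> \<open>At k0 the term is the product of the two transforms. At every other index the
    factor \<kappa> k, times the characters at e, is the \<open>haar_K\<close> of the correction at
    radius e, with a minus sign.\<close>
  have term_eq: "qchar N v (of_real e) * ((g' k * FPinf f d n' w' c (n' k) (w' k)
          + d k * FPzero H g' n' w' r (- n' k) (- w' k)) * qchar (n' k) (w' k) (of_real e))
     = (if k = k0 then M * FPinf f d n w c (- N) (- v) else - S k)" for k
  proof (cases "k = k0")
    case True
    then show ?thesis using spare by (simp add: FPinf' n'w' g'_def qchar_minus)
  next
    case False
    have "d k * FPzero H g' n' w' r (- n k) (- w k) = - (\<kappa> k * (d k * FPzero G g n w r (- n k) (- w k)))"
      by (cases "d k = 0") (simp_all add: FPH)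
    then have "(g' k * FPinf f d n' w' c (n' k) (w' k) + d k * FPzero H g' n' w' r (- n' k) (- w' k))
       = - (\<kappa> k * (g k * FPinf f d n w c (n k) (w k) + d k * FPzero G g n w r (- n k) (- w k)))"
      using False by (simp add: FPinf' n'w' g'_def distrib_left)
    then show ?thesis using False qK[of k]
      by (simp add: n'w' S_def mult_ac)
  qed
  have S0: "S k0 = 0" using spare by (simp add: S_def)
  have int1: "integrable ?N (\<lambda>k. if k = k0 then M * FPinf f d n w c (- N) (- v) else - S k)"
    using integrable_mult_right[OF step_int, of "qchar N v (of_real e)"] unfolding term_eq .
  have S_int: "integrable ?N S"
  proof -
    have "integrable ?N (\<lambda>k. if k = k0 then 0 else - S k)"
      using int1 by (rule Bochner_Integration.integrable_bound) auto
    moreover have "(\<lambda>k. if k = k0 then 0 else - S k) = (\<lambda>k. - S k)" using S0 by auto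
    ultimately show ?thesis by simp
  qed
  have "qchar N v (of_real e) * (\<integral>x. f x * H (of_real e * x) \<partial>haar)
     = (\<integral>k. (if k = k0 then M * FPinf f d n w c (- N) (- v) else - S k) \<partial>?N)"
    unfolding step term_eq[symmetric] by (rule integral_mult_right_zero[symmetric])
  also have "\<dots> = M * FPinf f d n w c (- N) (- v) + (\<integral>k. - S k \<partial>?N)"
    by (rule integral_count_space_update) (use S_int S0 in auto)
  finally show "(\<integral>z. indicator (- cball 0 e) z * ((\<integral>x. f x * G (z * x) \<partial>haar) * qchar N v z) \<partial>haar)
    + (\<integral>k. (g k * FPinf f d n w c (n k) (w k) + d k * FPzero G g n w (c * e) (- n k) (- w k))
        * haar_K (N + n k) (v + w k) e \<partial>count_space UNIV)
    = FPzero G g n w (c * e) N v * FPinf f d n w c (- N) (- v)"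
    unfolding conv_eq r_def[symmetric] S_def[symmetric] M_def by simp
  show "integrable (count_space UNIV) (\<lambda>k. (g k * FPinf f d n w c (n k) (w k) + d k * FPzero G g n w (c * e) (- n k) (- w k))
        * haar_K (N + n k) (v + w k) e)"
    using S_int unfolding S_def r_def .
qed

end

section \<open>Gamma and Beta integrals in logarithmic coordinates\<close>

lemma has_bochner_integral_lborel_ln:
  fixes h :: "real \<Rightarrow> complex"
  assumes [measurable]: "h \<in> borel_measurable borel"
    and "has_bochner_integral lborel (\<lambda>x. indicator {0<..} x *\<^sub>R (h (ln x) / of_real x)) I"
  shows "has_bochner_integral lborel h I"
proof -
  have eq: "(\<lambda>x. indicator {0<..} x *\<^sub>R (h (ln x) / of_real x)) = (\<lambda>x. (indicator {0<..} x * (1 / x)) *\<^sub>R h (ln x))"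
    by (auto simp: indicator_def scaleR_conv_of_real fun_eq_iff)
  define D where "D = density lborel (\<lambda>x. ennreal (1 / x) * indicator {0<..} x)"
  have "ennreal (1 / x) * indicator {0<..} x = ennreal (indicator {0<..} x * (1 / x))" for x :: real
    by (simp add: indicator_def)
  then have D: "D = density lborel (\<lambda>x. ennreal (indicator {0<..} x * (1 / x)))"
    by (simp only: D_def)
  have L: "lborel = distr D borel ln" unfolding D_def by (rule lborel_eq_distr_ln)
  have [measurable_cong]: "sets D = sets borel" by (simp add: D_def)
  have *: "integrable lborel (\<lambda>x. (indicator {0<..} x * (1 / x)) *\<^sub>R h (ln x))"
    "(\<integral>x. (indicator {0<..} x * (1 / x)) *\<^sub>R h (ln x) \<partial>lborel) = I"
    using assms(2) unfolding eq has_bochner_integral_iff by auto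
  have D2: "integrable D (\<lambda>x. h (ln x))" "(\<integral>x. h (ln x) \<partial>D) = I"
    unfolding D using * by (simp_all add: integrable_density integral_density indicator_def)
  have "integrable (distr D borel ln) h"
    using D2(1) by (subst integrable_distr_eq) simp_all
  then have "integrable lborel h" by (simp only: L[symmetric])
  moreover have "(\<integral>x. h x \<partial>distr D borel ln) = I"
    using D2(2) by (subst integral_distr) simp_all
  then have "(\<integral>x. h x \<partial>lborel) = I" by (simp only: L[symmetric])
  ultimately show ?thesis by (simp add: has_bochner_integral_iff)
qed

lemma has_bochner_integral_lborel_shift:
  fixes h :: "real \<Rightarrow> complex"
  assumes "has_bochner_integral lborel h I"
  shows "has_bochner_integral lborel (\<lambda>s. h (e + s)) I"
  using assms lborel_has_bochner_integral_real_affine_iff[of 1 h I e] by simp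

text \<open>Euler's integral after x = e^s. Complex powers become exponentials of linear functions
  of s, so no branches have to be discussed later.\<close>

lemma has_bochner_integral_Gamma_log:
  assumes z: "Re z > 0"
  shows "has_bochner_integral lborel (\<lambda>s. exp (z * of_real s - of_real (exp s))) (Gamma z)"
proof (rule has_bochner_integral_lborel_ln)
  let ?f = "\<lambda>t. complex_of_real t powr (z - 1) / of_real (exp t)"
  have ai: "?f absolutely_integrable_on {0<..}"
    by (rule absolutely_integrable_Gamma_integral'[OF z])
  then have i: "set_integrable lborel {0<..} ?f"
    unfolding set_integrable_def by (subst (asm) integrable_completion) (auto)
  have I0: "(?f has_integral Gamma z) {0<..}"
  proof -
    have "(?f has_integral Gamma z) {0..}" by (rule Gamma_integral_complex[OF z])
    then show ?thesis
      by (subst (asm) has_integral_spike_set_eq[of "{0..}" "{0<..}"]) (auto intro: negligible_subset[of "{0}"])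
  qed
  have "(LINT t:{0<..}|lborel. ?f t) = Gamma z"
    using set_borel_integral_eq_integral(2)[OF i] I0 by (simp add: integral_unique)
  with i have hb: "has_bochner_integral lborel (\<lambda>t. indicator {0<..} t *\<^sub>R ?f t) (Gamma z)"
    by (simp add: has_bochner_integral_iff set_integrable_def set_lebesgue_integral_def)
  have "indicator {0<..} t *\<^sub>R (exp (z * of_real (ln t) - of_real (exp (ln t))) / of_real t) = indicator {0<..} t *\<^sub>R ?f t" for t :: real
  proof (cases "t > 0")
    case True
    then have "exp (complex_of_real (ln t)) = of_real t" by (simp add: exp_of_real)
    then have "complex_of_real t powr (z - 1) = exp (z * of_real (ln t)) / of_real t"
      using True by (simp add: powr_def Ln_of_real left_diff_distrib exp_diff)
    then show ?thesis using True by (simp add: exp_diff exp_of_real field_simps)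
  qed simp
  then show "has_bochner_integral lborel (\<lambda>x. indicator {0<..} x *\<^sub>R
     (exp (z * of_real (ln x) - of_real (exp (ln x))) / of_real x)) (Gamma z)"
    using hb by (simp only:)
qed simp

lemma has_bochner_integral_Gamma_log_scale:
  assumes z: "Re z > 0" and l: "l > 0"
  shows "has_bochner_integral lborel (\<lambda>s. exp (z * of_real s - of_real (l * exp s))) (Gamma z * exp (- z * of_real (ln l)))"
proof -
  have eq: "exp (z * of_real (ln l + s) - of_real (exp (ln l + s))) * exp (- z * of_real (ln l))
     = exp (z * of_real s - of_real (l * exp s))" for s
    using l by (simp add: exp_add[symmetric]) (simp add: exp_add algebra_simps)
  show ?thesis
    using has_bochner_integral_mult_left[OF has_bochner_integral_lborel_shift[OF has_bochner_integral_Gamma_log[OF z], of "ln l"],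
        of "exp (- z * of_real (ln l))"]
    by (simp only: eq)
qed

lemma has_bochner_integral_Beta_log_aux:
  assumes a: "Re \<alpha> > 0"
  shows "has_bochner_integral lborel (\<lambda>s. exp (\<beta> * of_real t - of_real (exp t)) * (exp (\<alpha> * of_real t) * exp (\<alpha> * of_real s - of_real (exp t * exp s))))
     (exp (\<beta> * of_real t - of_real (exp t)) * Gamma \<alpha>)"
proof -
  have eq: "exp (\<alpha> * of_real t) * (Gamma \<alpha> * exp (- \<alpha> * of_real (ln (exp t)))) = Gamma \<alpha>"
    by (simp add: exp_minus)
  have "has_bochner_integral lborel (\<lambda>s. exp (\<beta> * of_real t - of_real (exp t)) * (exp (\<alpha> * of_real t) * exp (\<alpha> * of_real s - of_real (exp t * exp s))))
     (exp (\<beta> * of_real t - of_real (exp t)) * (exp (\<alpha> * of_real t) * (Gamma \<alpha> * exp (- \<alpha> * of_real (ln (exp t))))))"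
    by (intro has_bochner_integral_mult_right has_bochner_integral_Gamma_log_scale a) simp_all
  then show ?thesis by (simp only: eq)
qed

text \<open>Euler's double integral: integrating the kernel over s and then t gives Gamma \<alpha> *
  Gamma \<beta>, while integrating over t first gives the wanted integrand times Gamma (\<alpha> +
  \<beta>).\<close>

lemma has_bochner_integral_Beta_log:
  assumes a: "Re \<alpha> > 0" and b: "Re \<beta> > 0"
  shows "has_bochner_integral lborel (\<lambda>s. exp (\<alpha> * of_real s - (\<alpha> + \<beta>) * of_real (ln (1 + exp s))))
    (Gamma \<alpha> * Gamma \<beta> / Gamma (\<alpha> + \<beta>))"
proof -
  define F where "F t s = exp (\<beta> * of_real t - of_real (exp t)) * (exp (\<alpha> * of_real t) * exp (\<alpha> * of_real s - of_real (exp t * exp s)))"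
    for t s :: real
  have [measurable]: "case_prod F \<in> borel_measurable (lborel \<Otimes>\<^sub>M lborel)"
    unfolding F_def by measurable
  have ab: "Re (\<alpha> + \<beta>) > 0" using a b by simp
  have Fs: "has_bochner_integral lborel (F t) (exp (\<beta> * of_real t - of_real (exp t)) * Gamma \<alpha>)" for t
    unfolding F_def by (rule has_bochner_integral_Beta_log_aux[OF a])
  \<comment> \<open>The modulus of the kernel is the kernel with the parameters replaced by their
    real parts, so the same evaluation yields absolute integrability.\<close>
  have nF: "norm (F t s) = Re (exp (complex_of_real (Re \<beta>) * of_real t - of_real (exp t)) * (exp (complex_of_real (Re \<alpha>) * of_real t) * exp (complex_of_real (Re \<alpha>) * of_real s - of_real (exp t * exp s))))" for t s
  proof -
    have "exp (complex_of_real (Re \<beta>) * of_real t - of_real (exp t)) * (exp (complex_of_real (Re \<alpha>) * of_real t) * exp (complex_of_real (Re \<alpha>) * of_real s - of_real (exp t * exp s)))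
      = complex_of_real (exp (Re \<beta> * t - exp t) * (exp (Re \<alpha> * t) * exp (Re \<alpha> * s - exp t * exp s)))"
      by (simp only: exp_of_real of_real_mult of_real_diff flip: of_real_mult of_real_diff)
    then show ?thesis by (simp add: F_def norm_mult)
  qed
  have int: "integrable (lborel \<Otimes>\<^sub>M lborel) (case_prod F)"
  proof (rule lborel_pair.Fubini_integrable)
    show "AE t in lborel. integrable lborel (\<lambda>s. case_prod F (t, s))"
      using Fs by (auto simp: has_bochner_integral_iff)
    have "(\<integral>s. norm (F t s) \<partial>lborel) = Re (exp (complex_of_real (Re \<beta>) * of_real t - of_real (exp t)) * Gamma (complex_of_real (Re \<alpha>)))" for t
    proof -
      have "has_bochner_integral lborel (\<lambda>s. norm (F t s)) (Re (exp (complex_of_real (Re \<beta>) * of_real t - of_real (exp t)) * Gamma (complex_of_real (Re \<alpha>))))"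
        unfolding nF using a by (intro has_bochner_integral_Re has_bochner_integral_Beta_log_aux) simp
      then show ?thesis by (simp add: has_bochner_integral_iff)
    qed
    moreover have "integrable lborel (\<lambda>t. Re (exp (complex_of_real (Re \<beta>) * of_real t - of_real (exp t)) * Gamma (complex_of_real (Re \<alpha>))))"
      using has_bochner_integral_Gamma_log[of "complex_of_real (Re \<beta>)"] b
      by (intro integrable_Re integrable_mult_left) (auto simp: has_bochner_integral_iff)
    ultimately show "integrable lborel (\<lambda>t. \<integral>s. norm (case_prod F (t, s)) \<partial>lborel)"
      by simp
  qed simp
  have Ft: "has_bochner_integral lborel (\<lambda>t. F t s) (Gamma (\<alpha> + \<beta>) * exp (\<alpha> * of_real s - (\<alpha> + \<beta>) * of_real (ln (1 + exp s))))" for s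
  proof -
    have pos: "1 + exp s > 0" by (simp add: add_pos_pos)
    have "has_bochner_integral lborel (\<lambda>t. exp (\<alpha> * of_real s) * exp ((\<alpha> + \<beta>) * of_real t - of_real ((1 + exp s) * exp t)))
      (exp (\<alpha> * of_real s) * (Gamma (\<alpha> + \<beta>) * exp (- (\<alpha> + \<beta>) * of_real (ln (1 + exp s)))))"
      by (intro has_bochner_integral_mult_right has_bochner_integral_Gamma_log_scale ab pos)
    moreover have "exp (\<alpha> * of_real s) * exp ((\<alpha> + \<beta>) * of_real t - of_real ((1 + exp s) * exp t)) = F t s" for t
      unfolding F_def by (simp add: exp_add[symmetric] algebra_simps)
    moreover have "exp (\<alpha> * of_real s) * (Gamma (\<alpha> + \<beta>) * exp (- (\<alpha> + \<beta>) * of_real (ln (1 + exp s))))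
      = Gamma (\<alpha> + \<beta>) * exp (\<alpha> * of_real s - (\<alpha> + \<beta>) * of_real (ln (1 + exp s)))"
      by (simp only: exp_diff mult_minus_left exp_minus) (simp add: divide_inverse)
    ultimately show ?thesis by (simp only:)
  qed
  have nz: "Gamma (\<alpha> + \<beta>) \<noteq> 0"
  proof
    assume "Gamma (\<alpha> + \<beta>) = 0"
    then obtain n where "\<alpha> + \<beta> = of_int n" "n \<le> 0"
      by (auto simp: Gamma_eq_zero_iff elim!: nonpos_Ints_cases)
    with ab show False by simp
  qed
  have int2: "integrable lborel (\<lambda>s. \<integral>t. F t s \<partial>lborel)"
    using lborel_pair.integrable_snd[OF int] by simp
  have Ft': "(\<integral>t. F t s \<partial>lborel) = Gamma (\<alpha> + \<beta>) * exp (\<alpha> * of_real s - (\<alpha> + \<beta>) * of_real (ln (1 + exp s)))" for s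
    using Ft by (simp add: has_bochner_integral_iff)
  have "(\<integral>s. (\<integral>t. F t s \<partial>lborel) \<partial>lborel) = (\<integral>t. (\<integral>s. F t s \<partial>lborel) \<partial>lborel)"
    by (rule lborel_pair.Fubini_integral[OF int])
  also have "\<dots> = (\<integral>t. exp (\<beta> * of_real t - of_real (exp t)) * Gamma \<alpha> \<partial>lborel)"
    using Fs by (simp add: has_bochner_integral_iff)
  also have "\<dots> = Gamma \<beta> * Gamma \<alpha>"
    using has_bochner_integral_Gamma_log[OF b] by (simp add: has_bochner_integral_iff)
  finally have "has_bochner_integral lborel (\<lambda>s. \<integral>t. F t s \<partial>lborel) (Gamma \<beta> * Gamma \<alpha>)"
    using int2 by (simp add: has_bochner_integral_iff)
  then have "has_bochner_integral lborel (\<lambda>s. (\<integral>t. F t s \<partial>lborel) / Gamma (\<alpha> + \<beta>)) (Gamma \<beta> * Gamma \<alpha> / Gamma (\<alpha> + \<beta>))"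
    by (rule has_bochner_integral_divide_zero)
  then show ?thesis unfolding Ft' using nz by (simp add: mult.commute)
qed

text \<open>Feynman's parameter formula: a product X^(-\<beta>) Y^(-\<alpha>) becomes an integral
  over powers of the single quantity X + e^t Y.\<close>

lemma has_bochner_integral_Beta_log_scale:
  assumes ab: "Re \<alpha> > 0" "Re \<beta> > 0" and X: "X > 0" "Y > 0"
  shows "has_bochner_integral lborel (\<lambda>t. exp (\<alpha> * of_real t - (\<alpha> + \<beta>) * of_real (ln (X + exp t * Y))))
    (exp (- \<beta> * of_real (ln X) - \<alpha> * of_real (ln Y)) * (Gamma \<alpha> * Gamma \<beta> / Gamma (\<alpha> + \<beta>)))"
proof -
  define e where "e = ln Y - ln X"
  have B: "has_bochner_integral lborel (\<lambda>t. exp (\<alpha> * of_real (e + t) - (\<alpha> + \<beta>) * of_real (ln (1 + exp (e + t)))))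
      (Gamma \<alpha> * Gamma \<beta> / Gamma (\<alpha> + \<beta>))"
    by (rule has_bochner_integral_lborel_shift) (rule has_bochner_integral_Beta_log[OF ab])
  have eq: "exp (- \<beta> * of_real (ln X) - \<alpha> * of_real (ln Y)) *
      exp (\<alpha> * of_real (e + t) - (\<alpha> + \<beta>) * of_real (ln (1 + exp (e + t))))
     = exp (\<alpha> * of_real t - (\<alpha> + \<beta>) * of_real (ln (X + exp t * Y)))" for t
  proof -
    have "exp e = exp (ln Y) / exp (ln X)" unfolding e_def by (rule exp_diff)
    then have ee: "exp e = Y / X" using X by simp
    have "X + exp t * Y = X * (1 + Y / X * exp t)" using X by (simp add: distrib_left)
    also have "\<dots> = X * (1 + exp (e + t))" by (simp only: exp_add[of e t] ee)
    finally have XY: "X + exp t * Y = X * (1 + exp (e + t))" .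
    have "0 < 1 + exp (e + t)" using exp_gt_zero[of "e + t"] by linarith
    then have l: "ln (X + exp t * Y) = ln X + ln (1 + exp (e + t))" unfolding XY using X by (intro ln_mult_pos)
    have ring: "- \<beta> * x - \<alpha> * y + (\<alpha> * (y - x + u) - (\<alpha> + \<beta>) * L) = \<alpha> * u - (\<alpha> + \<beta>) * (x + L)" for x y u L
      by (simp add: algebra_simps)
    have e': "complex_of_real e = of_real (ln Y) - of_real (ln X)" by (simp only: e_def of_real_diff)
    have "- \<beta> * of_real (ln X) - \<alpha> * of_real (ln Y) + (\<alpha> * of_real (e + t) - (\<alpha> + \<beta>) * of_real (ln (1 + exp (e + t))))
      = \<alpha> * of_real t - (\<alpha> + \<beta>) * of_real (ln (X + exp t * Y))"
      by (simp only: l of_real_add e' ring)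
    then show ?thesis by (metis exp_add)
  qed
  show ?thesis
    using has_bochner_integral_mult_right[OF B, of "exp (- \<beta> * of_real (ln X) - \<alpha> * of_real (ln Y))"]
    by (simp only: eq)
qed

section \<open>Lebesgue and Haar integrals over the plane, integrability of the beta
  integrand\<close>

lemma haar_integral_lborel:
  fixes f :: "complex \<Rightarrow> complex"
  assumes [measurable]: "f \<in> borel_measurable borel"
  shows "integrable haar f \<longleftrightarrow> integrable lborel (\<lambda>x. f x / of_real ((norm x)\<^sup>2))"
    and "(\<integral>x. f x \<partial>haar) = (\<integral>x. f x / of_real ((norm x)\<^sup>2) \<partial>lborel)"
  unfolding haar_def
  by (subst integrable_density; simp add: scaleR_conv_of_real divide_inverse mult.commute)
     (subst integral_density; simp add: scaleR_conv_of_real divide_inverse mult.commute)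

lemma lborel_complex_eq_haar:
  fixes f :: "complex \<Rightarrow> complex"
  assumes [measurable]: "f \<in> borel_measurable borel"
  shows "integrable lborel f \<longleftrightarrow> integrable haar (\<lambda>x. of_real ((norm x)\<^sup>2) * f x)"
    and "(\<integral>x. f x \<partial>lborel) = (\<integral>x. of_real ((norm x)\<^sup>2) * f x \<partial>haar)"
proof -
  have ae: "AE x in lborel. f x = of_real ((norm x)\<^sup>2) * f x / of_real ((norm x)\<^sup>2)"
    using AE_lborel_singleton[of "0::complex"] by eventually_elim simp
  show "integrable lborel f \<longleftrightarrow> integrable haar (\<lambda>x. of_real ((norm x)\<^sup>2) * f x)"
    by (subst haar_integral_lborel(1), simp) (rule integrable_cong_AE[OF _ _ ae]; simp)
  show "(\<integral>x. f x \<partial>lborel) = (\<integral>x. of_real ((norm x)\<^sup>2) * f x \<partial>haar)"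
    by (subst haar_integral_lborel(2), simp) (rule integral_cong_AE[OF _ _ ae]; simp)
qed

lemma lborel_complex_translate:
  fixes f :: "complex \<Rightarrow> complex"
  assumes [measurable]: "f \<in> borel_measurable borel"
  shows "integrable lborel (\<lambda>x. f (c + x)) \<longleftrightarrow> integrable lborel f"
    and "(\<integral>x. f (c + x) \<partial>lborel) = (\<integral>x. f x \<partial>lborel)"
proof -
  have d: "distr lborel borel ((+) c) = (lborel :: complex measure)" by (rule lborel_distr_plus)
  have "integrable (distr lborel borel ((+) c)) f \<longleftrightarrow> integrable lborel (\<lambda>x. f (c + x))"
    by (rule integrable_distr_eq) simp_all
  then show "integrable lborel (\<lambda>x. f (c + x)) \<longleftrightarrow> integrable lborel f" by (simp only: d)
  have "(\<integral>x. f x \<partial>distr lborel borel ((+) c)) = (\<integral>x. f (c + x) \<partial>lborel)"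
    by (rule integral_distr) simp_all
  then show "(\<integral>x. f (c + x) \<partial>lborel) = (\<integral>x. f x \<partial>lborel)" by (simp only: d)
qed

lemma lborel_complex_uminus:
  fixes f :: "complex \<Rightarrow> complex"
  assumes [measurable]: "f \<in> borel_measurable borel"
  shows "integrable lborel (\<lambda>x. f (- x)) \<longleftrightarrow> integrable lborel f"
    and "(\<integral>x. f (- x) \<partial>lborel) = (\<integral>x. f x \<partial>lborel)"
  using haar_integrable_scale_iff[of "\<lambda>x. of_real ((norm x)\<^sup>2) * f x" "-1"]
    haar_integral_scale[of "\<lambda>x. of_real ((norm x)\<^sup>2) * f x" "-1"]
    lborel_complex_eq_haar[of f] lborel_complex_eq_haar[of "\<lambda>x. f (- x)"] by simp_all

text \<open>Exchanges the singular points 0 and 1 of the beta integrand. This is a symmetry of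
  Lebesgue but not of Haar measure, which is why both are kept in play.\<close>

lemma lborel_complex_reflect:
  fixes f :: "complex \<Rightarrow> complex"
  assumes [measurable]: "f \<in> borel_measurable borel"
  shows "integrable lborel (\<lambda>x. f (1 - x)) \<longleftrightarrow> integrable lborel f"
    and "(\<integral>x. f (1 - x) \<partial>lborel) = (\<integral>x. f x \<partial>lborel)"
  using lborel_complex_uminus[of "\<lambda>x. f (1 + x)"] lborel_complex_translate[of f 1] by simp_all

lemma qchar_shift2:
  "x \<noteq> 0 \<Longrightarrow> qchar n w x / of_real ((norm x)\<^sup>2) = qchar n (w - 2) x"
proof -
  assume x: "x \<noteq> 0"
  have "exp (2 * complex_of_real (ln (norm x))) = of_real ((norm x)\<^sup>2)"
    using x by (simp add: exp_double exp_of_real)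
  then have "qchar 0 2 x = of_real ((norm x)\<^sup>2)" by (simp add: qchar_0_norm)
  then show ?thesis using qchar_diff[of n 0 w 2 x] by simp
qed

lemma lborel_qchar_integrable_cball:
  assumes "Re w > 0" "r > 0"
  shows "integrable lborel (\<lambda>x. indicator (cball 0 r) x * qchar n (w - 2) x)"
proof -
  have "integrable lborel (\<lambda>x. indicator (cball 0 r) x * qchar n w x / of_real ((norm x)\<^sup>2))"
    using qchar_integrable_cball[OF assms] by (subst (asm) haar_integral_lborel(1)) simp_all
  then show ?thesis
    by (rule integrable_cong_AE_imp)
       (use AE_lborel_singleton[of "0::complex"] in \<open>auto elim!: eventually_mono simp: qchar_shift2[symmetric]\<close>)
qed

text \<open>Three regions: near 0, near 1, and away from both. In each of them the quantity to be
  bounded, namely the modulus of 1 - x, the modulus of x, or their quotient, lies between 1/3 and 3,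
  which explains the powers of 3 in the constant.\<close>

lemma beta_integrand_bound:
  fixes a b :: real
  shows "\<exists>C\<ge>0. \<forall>x::complex. x \<noteq> 0 \<longrightarrow> x \<noteq> 1 \<longrightarrow> norm x powr a * norm (1 - x) powr b \<le>
     C * (indicator (cball 0 (1/2)) x * norm x powr a + indicator (cball 0 (1/2)) (1 - x) * norm (1 - x) powr b
       + indicator (- cball 0 (1/2)) x * norm x powr (a + b))"
proof -
  have pb: "r powr t \<le> 3 powr \<bar>t\<bar>" if "1/3 \<le> r" "r \<le> 3" for r t :: real
  proof (cases "t \<ge> 0")
    case True
    then show ?thesis using that by (simp add: powr_mono2)
  next
    case False
    have "r powr t = (1 / r) powr (- t)" using that by (simp add: powr_divide powr_minus_divide)
    also have "\<dots> \<le> 3 powr (- t)" using that False by (intro powr_mono2) (auto simp: field_simps)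
    finally show ?thesis using False by simp
  qed
  define C where "C = 3 powr \<bar>a\<bar> + 3 powr \<bar>b\<bar>"
  have C: "3 powr \<bar>a\<bar> \<le> C" "3 powr \<bar>b\<bar> \<le> C" "C \<ge> 0" by (simp_all add: C_def)
  have "norm x powr a * norm (1 - x) powr b \<le>
     C * (indicator (cball 0 (1/2)) x * norm x powr a + indicator (cball 0 (1/2)) (1 - x) * norm (1 - x) powr b
       + indicator (- cball 0 (1/2)) x * norm x powr (a + b))" if x: "x \<noteq> 0" "x \<noteq> 1" for x :: complex
  proof -
    consider "norm x \<le> 1/2" | "norm x > 1/2" "norm (1 - x) \<le> 1/2" | "norm x > 1/2" "norm (1 - x) > 1/2"
      by linarith
    then show ?thesis
    proof cases
      case 1
      have "1/2 \<le> norm (1 - x)" "norm (1 - x) \<le> 3/2"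
        using 1 norm_triangle_ineq2[of 1 x] norm_triangle_ineq4[of 1 x] by auto
      then have "norm (1 - x) powr b \<le> C" using pb[of "norm (1 - x)" b] C by linarith
      then have "norm x powr a * norm (1 - x) powr b \<le> C * norm x powr a"
        by (subst mult.commute) (simp add: mult_right_mono)
      also have "\<dots> \<le> C * (indicator (cball 0 (1/2)) x * norm x powr a + indicator (cball 0 (1/2)) (1 - x) * norm (1 - x) powr b
       + indicator (- cball 0 (1/2)) x * norm x powr (a + b))"
        using 1 C by (intro mult_left_mono) auto
      finally show ?thesis .
    next
      case 2
      have "norm x \<le> 3/2"
        using 2 norm_triangle_ineq4[of 1 "1 - x"] by auto
      then have "norm x powr a \<le> C" using pb[of "norm x" a] 2 C by linarith
      then have "norm x powr a * norm (1 - x) powr b \<le> C * norm (1 - x) powr b"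
        by (simp add: mult_right_mono)
      also have "\<dots> \<le> C * (indicator (cball 0 (1/2)) x * norm x powr a + indicator (cball 0 (1/2)) (1 - x) * norm (1 - x) powr b
       + indicator (- cball 0 (1/2)) x * norm x powr (a + b))"
        using 2 C by (intro mult_left_mono) (auto simp: indicator_def)
      finally show ?thesis .
    next
      case 3
      have n1: "norm (1 - x) \<le> 1 + norm x" using norm_triangle_ineq4[of 1 x] by simp
      have n2: "norm x \<le> 1 + norm (1 - x)" using norm_triangle_ineq4[of 1 "1 - x"] by simp
      define t where "t = norm (1 - x) / norm x"
      have "t \<le> 3" "1/3 \<le> t" using n1 n2 3 by (auto simp: t_def divide_simps)
      then have tb: "t powr b \<le> C" using pb[of t b] C by linarith
      have nt: "norm (1 - x) = norm x * t"
        unfolding t_def using x(1) by (metis nonzero_mult_div_cancel_left norm_eq_zero times_divide_eq_right)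
      have "norm x powr a * norm (1 - x) powr b = norm x powr (a + b) * t powr b"
        unfolding nt powr_add powr_mult by (rule mult.assoc[symmetric])
      also have "\<dots> \<le> norm x powr (a + b) * C" using tb by (rule mult_left_mono) simp
      also have "\<dots> = C * norm x powr (a + b)" by (rule mult.commute)
      also have "\<dots> \<le> C * (indicator (cball 0 (1/2)) x * norm x powr a + indicator (cball 0 (1/2)) (1 - x) * norm (1 - x) powr b
       + indicator (- cball 0 (1/2)) x * norm x powr (a + b))"
        using 3 C by (intro mult_left_mono) auto
      finally show ?thesis .
    qed
  qed
  then show ?thesis using C(3) by blast
qed

lemma lborel_qchar_integrable_outside:
  assumes "Re w < 0" "r > 0"
  shows "integrable lborel (\<lambda>x. indicator (- cball 0 r) x * qchar n (w - 2) x)"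
proof -
  have "integrable lborel (\<lambda>x. indicator (- cball 0 r) x * qchar n w x / of_real ((norm x)\<^sup>2))"
    using qchar_outside_cball(1)[OF assms] by (subst (asm) haar_integral_lborel(1)) simp_all
  then show ?thesis
    by (rule integrable_cong_AE_imp)
       (use AE_lborel_singleton[of "0::complex"] in \<open>auto elim!: eventually_mono simp: qchar_shift2[symmetric]\<close>)
qed

lemma norm_indicator': "norm (indicator S x :: complex) = indicator S x"
  by (simp add: indicator_def)

text \<open>The conditions are local: Re A > 0 at 0, Re B > 0 at 1 and Re A + Re B < 2 at infinity,
  the last of which is replaced by truncation to a disc when needed.\<close>

lemma beta_integrable_lborel:
  assumes A: "Re A > 0" and B: "Re B > 0" and S: "S = UNIV \<and> Re A + Re B < 2 \<or> S = cball 0 c"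
  shows "integrable lborel (\<lambda>x. indicator S x * (qchar n (A - 2) x * qchar m (B - 2) (1 - x)))"
proof -
  have [measurable]: "S \<in> sets borel" using S by auto
  obtain C where C0: "C \<ge> 0" "\<forall>x::complex. x \<noteq> 0 \<longrightarrow> x \<noteq> 1 \<longrightarrow> norm x powr (Re A - 2) * norm (1 - x) powr (Re B - 2) \<le>
     C * (indicator (cball 0 (1/2)) x * norm x powr (Re A - 2) + indicator (cball 0 (1/2)) (1 - x) * norm (1 - x) powr (Re B - 2)
       + indicator (- cball 0 (1/2)) x * norm x powr (Re A - 2 + (Re B - 2)))"
    using beta_integrand_bound[of "Re A - 2" "Re B - 2"] by (elim exE conjE)
  note C = C0(1) C0(2)[rule_format]
  have i1: "integrable lborel (\<lambda>x. indicator (cball 0 (1/2)) x * qchar 0 (of_real (Re A) - 2) x)"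
    by (rule lborel_qchar_integrable_cball) (use A in auto)
  have i2: "integrable lborel (\<lambda>x. indicator (cball 0 (1/2)) (1 - x) * qchar 0 (of_real (Re B) - 2) (1 - x))"
  proof (rule lborel_complex_reflect(1)[of "\<lambda>x. indicator (cball 0 (1/2)) x * qchar 0 (of_real (Re B) - 2) x", THEN iffD2])
    show "integrable lborel (\<lambda>x. indicator (cball 0 (1/2)) x * qchar 0 (of_real (Re B) - 2) x)"
      by (rule lborel_qchar_integrable_cball) (use B in auto)
  qed simp
  have i3: "integrable lborel (\<lambda>x. indicator S x * (indicator (- cball 0 (1/2)) x * qchar 0 (of_real (Re A - 2 + Re B) - 2) x))"
    using S
  proof
    assume S: "S = UNIV \<and> Re A + Re B < 2"
    then show ?thesis
    proof -
      have "integrable lborel (\<lambda>x. indicator (- cball 0 (1/2)) x * qchar 0 (of_real (Re A - 2 + Re B) - 2) x)"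
        by (rule lborel_qchar_integrable_outside) (use S in auto)
      then show ?thesis using S by (simp only: indicator_UNIV mult_1)
    qed
  next
    assume S: "S = cball 0 c"
    define v where "v = complex_of_real (Re A - 2 + Re B)"
    have "integrable haar (\<lambda>x. indicator (cball 0 c - cball 0 (1/2)) x * qchar 0 v x)"
      by (rule qchar_integrable_annulus) simp
    then have "integrable lborel (\<lambda>x. indicator (cball 0 c - cball 0 (1/2)) x * qchar 0 v x / of_real ((norm x)\<^sup>2))"
      by (subst (asm) haar_integral_lborel(1)) simp_all
    then show ?thesis unfolding v_def[symmetric]
      by (rule integrable_cong_AE_imp)
         (use AE_lborel_singleton[of "0::complex"] in \<open>auto elim!: eventually_mono simp: S indicator_def qchar_shift2[symmetric]\<close>)
  qed
  have pw: "norm (qchar 0 (of_real u) x) = norm x powr u" if "x \<noteq> 0" for u x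
    using that by (simp add: norm_qchar_powr)
  show ?thesis
  proof (rule Bochner_Integration.integrable_bound)
    show "integrable lborel (\<lambda>x. C * (norm (indicator (cball 0 (1/2)) x * qchar 0 (of_real (Re A) - 2) x)
       + norm (indicator (cball 0 (1/2)) (1 - x) * qchar 0 (of_real (Re B) - 2) (1 - x))
       + norm (indicator S x * (indicator (- cball 0 (1/2)) x * qchar 0 (of_real (Re A - 2 + Re B) - 2) x))))"
      by (intro integrable_mult_right Bochner_Integration.integrable_add integrable_norm i1 i2 i3)
    show "AE x in lborel. norm (indicator S x * (qchar n (A - 2) x * qchar m (B - 2) (1 - x)))
      \<le> norm (C * (norm (indicator (cball 0 (1/2)) x * qchar 0 (of_real (Re A) - 2) x)
       + norm (indicator (cball 0 (1/2)) (1 - x) * qchar 0 (of_real (Re B) - 2) (1 - x))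
       + norm (indicator S x * (indicator (- cball 0 (1/2)) x * qchar 0 (of_real (Re A - 2 + Re B) - 2) x))))"
      using AE_lborel_singleton[of "0::complex"] AE_lborel_singleton[of "1::complex"]
    proof eventually_elim
      case (elim x)
      show ?case
      proof (cases "x \<in> S")
        case True
        have e: "of_real (Re A) - 2 = complex_of_real (Re A - 2)" "of_real (Re B) - 2 = complex_of_real (Re B - 2)"
          "of_real (Re A - 2 + Re B) - 2 = complex_of_real (Re A - 2 + (Re B - 2))" by simp_all
        have "norm (qchar n (A - 2) x * qchar m (B - 2) (1 - x)) = norm x powr (Re A - 2) * norm (1 - x) powr (Re B - 2)"
          using elim by (simp add: norm_mult norm_qchar_powr)
        also have "\<dots> \<le> C * (indicator (cball 0 (1/2)) x * norm x powr (Re A - 2) + indicator (cball 0 (1/2)) (1 - x) * norm (1 - x) powr (Re B - 2)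
       + indicator (- cball 0 (1/2)) x * norm x powr (Re A - 2 + (Re B - 2)))"
          using elim by (intro C)
        also have "\<dots> = C * (norm (indicator (cball 0 (1/2)) x * qchar 0 (of_real (Re A) - 2) x)
       + norm (indicator (cball 0 (1/2)) (1 - x) * qchar 0 (of_real (Re B) - 2) (1 - x))
       + norm (indicator S x * (indicator (- cball 0 (1/2)) x * qchar 0 (of_real (Re A - 2 + Re B) - 2) x)))"
          unfolding e norm_mult using elim True by (simp only: pw right_minus_eq not_False_eq_True) (simp add: pw norm_indicator')
        finally show ?thesis using True by simp
      qed (use C(1) in simp)
    qed
  qed simp
qed

section \<open>Evaluation of the complex beta integral for nonnegative windings\<close>

lemma lborel_complex_rotate:
  fixes f :: "complex \<Rightarrow> complex"
  assumes [measurable]: "f \<in> borel_measurable borel" and c: "norm c = 1"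
  shows "integrable lborel (\<lambda>x. f (c * x)) \<longleftrightarrow> integrable lborel f"
    and "(\<integral>x. f (c * x) \<partial>lborel) = (\<integral>x. f x \<partial>lborel)"
proof -
  have "c \<noteq> 0" using c by auto
  then show "integrable lborel (\<lambda>x. f (c * x)) \<longleftrightarrow> integrable lborel f"
    "(\<integral>x. f (c * x) \<partial>lborel) = (\<integral>x. f x \<partial>lborel)"
    using haar_integrable_scale_iff[of "\<lambda>x. of_real ((norm x)\<^sup>2) * f x" c]
      haar_integral_scale[of "\<lambda>x. of_real ((norm x)\<^sup>2) * f x" c]
      lborel_complex_eq_haar[of f] lborel_complex_eq_haar[of "\<lambda>x. f (c * x)"]
    by (simp_all add: norm_mult c)
qed

text \<open>Averaging over the rotations by roots of unity of order larger than the degree leaves only the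
  constant coefficient.\<close>
lemma poly_mean_value_radial:
  fixes P :: "complex poly" and R :: "real \<Rightarrow> complex"
  assumes [measurable]: "R \<in> borel_measurable borel"
    and int: "integrable lborel (\<lambda>y. poly P y * R (norm y))"
  shows "(\<integral>y. poly P y * R (norm y) \<partial>lborel) = (\<integral>y. poly P 0 * R (norm y) \<partial>(lborel :: complex measure))"
proof -
  define m where "m = Suc (degree P)"
  define \<omega> where "\<omega> = cis (2 * pi / real m)"
  have m: "m > 0" by (simp add: m_def)
  have [measurable]: "poly P \<in> borel_measurable borel"
    by (intro borel_measurable_continuous_onI continuous_intros)
  have \<omega>p: "\<omega> ^ i = cis (real i * (2 * pi / real m))" for i
    unfolding \<omega>_def by (rule Complex.DeMoivre)
  have "real m * (2 * pi / real m) = 2 * pi" using m by simp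
  then have \<omega>m: "\<omega> ^ m = 1" unfolding \<omega>p by simp
  have n\<omega>: "norm (\<omega> ^ j) = 1" for j by (simp add: \<omega>_def norm_power)
  have geo: "(\<Sum>j<m. (\<omega> ^ j) ^ i) = (if i = 0 then of_nat m else 0)" if "i < m" for i
  proof (cases "i = 0")
    case False
    have "\<omega> ^ i \<noteq> 1"
    proof
      assume "\<omega> ^ i = 1"
      then have "cis (real i * (2 * pi / real m)) = 1" unfolding \<omega>p .
      then have "exp (\<i> * of_real (real i * (2 * pi / real m))) = 1" by (simp only: cis_conv_exp)
      then obtain k :: int where "real i * (2 * pi / real m) = of_int (2 * k) * pi"
        unfolding exp_eq_1 by (auto simp del: of_int_mult)
      then have "(real i / real m) * (2 * pi) = of_int k * (2 * pi)" by simp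
      then have "real i / real m = of_int k" by (metis mult_right_cancel pi_neq_zero mult_eq_0_iff zero_neq_numeral)
      moreover have "0 < real i / real m" "real i / real m < 1" using that False by auto
      ultimately show False by simp
    qed
    moreover have "(\<Sum>j<m. (\<omega> ^ i) ^ j) * (\<omega> ^ i - 1) = (\<omega> ^ i) ^ m - 1"
      by (simp add: power_diff_1_eq mult.commute)
    moreover have "(\<omega> ^ i) ^ m = 1" by (metis \<omega>m power_mult mult.commute power_one)
    ultimately have "(\<Sum>j<m. (\<omega> ^ i) ^ j) = 0" by simp
    then show ?thesis using False by (simp add: power_mult[symmetric] mult.commute)
  qed simp
  have avg: "(\<Sum>j<m. poly P (\<omega> ^ j * y)) = of_nat m * poly P 0" for y
  proof -
    have "(\<Sum>j<m. poly P (\<omega> ^ j * y)) = (\<Sum>j<m. \<Sum>i\<le>degree P. coeff P i * ((\<omega> ^ j) ^ i * y ^ i))"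
      by (simp add: poly_altdef power_mult_distrib)
    also have "\<dots> = (\<Sum>i\<le>degree P. coeff P i * y ^ i * (\<Sum>j<m. (\<omega> ^ j) ^ i))"
      by (subst sum.swap) (simp add: sum_distrib_left mult_ac)
    also have "\<dots> = (\<Sum>i\<le>degree P. if i = 0 then coeff P i * y ^ i * of_nat m else 0)"
      by (intro sum.cong refl, subst geo) (auto simp: m_def)
    also have "\<dots> = of_nat m * poly P 0" by (simp add: sum.delta poly_0_coeff_0 mult.commute)
    finally show ?thesis .
  qed
  have rot: "integrable lborel (\<lambda>y. poly P (\<omega> ^ j * y) * R (norm y))"
    "(\<integral>y. poly P (\<omega> ^ j * y) * R (norm y) \<partial>lborel) = (\<integral>y. poly P y * R (norm y) \<partial>lborel)" for j
    using lborel_complex_rotate[of "\<lambda>y. poly P y * R (norm y)" "\<omega> ^ j"] int n\<omega>[of j] by (simp_all add: norm_mult)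
  have "of_nat m * (\<integral>y. poly P y * R (norm y) \<partial>lborel) = (\<Sum>j<m. \<integral>y. poly P (\<omega> ^ j * y) * R (norm y) \<partial>lborel)"
    by (simp add: rot(2))
  also have "\<dots> = (\<integral>y. (\<Sum>j<m. poly P (\<omega> ^ j * y) * R (norm y)) \<partial>lborel)"
    by (rule Bochner_Integration.integral_sum[symmetric]) (rule rot)
  also have "\<dots> = (\<integral>y. of_nat m * (poly P 0 * R (norm y)) \<partial>(lborel :: complex measure))"
    by (simp only: sum_distrib_right[symmetric] avg mult.assoc)
  also have "\<dots> = of_nat m * (\<integral>y. poly P 0 * R (norm y) \<partial>(lborel :: complex measure))"
    by (rule integral_mult_right_zero)
  finally show ?thesis using m by simp
qed

text \<open>For nonnegative windings the phases combine with powers of the modulus into the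
  polynomial x^k (1 - x)^k', leaving powers of the squared moduli of x and 1 - x. Feynman's formula
  merges these into a power of one quadratic expression. Completing the square makes it radial about
  a point c, and the mean value property replaces the polynomial by its value at c. What remains are
  two Beta integrals, one radial and one in the Feynman parameter.\<close>

lemma complex_beta_direct:
  fixes k k' :: nat and A B s s' \<alpha> \<beta> :: complex
  assumes A: "Re A > 0" and B: "Re B > 0" and AB: "Re A + Re B < 2"
  defines "s \<equiv> 1 - (A - of_nat k) / 2" and "s' \<equiv> 1 - (B - of_nat k') / 2"
    and "\<alpha> \<equiv> (A + of_nat k) / 2" and "\<beta> \<equiv> (B + of_nat k') / 2"
  shows "(\<integral>x. qchar (int k) (A - 2) x * qchar (int k') (B - 2) (1 - x) \<partial>lborel)
    = pi * Gamma (s + s' - 1) * Gamma \<alpha> * Gamma \<beta> / (Gamma s * Gamma s' * Gamma (\<alpha> + \<beta>))"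
proof -
  define S where "S = s' + s"
  have s: "Re s > 0" "Re s' > 0" "Re (S - 1) > 0" "Re \<alpha> > 0" "Re \<beta> > 0"
    using A B AB by (simp_all add: s_def s'_def \<alpha>_def \<beta>_def S_def field_simps)
  define \<phi> where "\<phi> x = qchar (int k) (A - 2) x * qchar (int k') (B - 2) (1 - x)" for x
  have [measurable]: "\<phi> \<in> borel_measurable borel" unfolding \<phi>_def[abs_def] by measurable
  have \<phi>_int: "integrable lborel \<phi>"
    using beta_integrable_lborel[OF A B, of UNIV 0 "int k" "int k'"] AB by (simp add: \<phi>_def[abs_def])
  have qk: "qchar (int n) (W - 2) x = x ^ n * exp (- (1 - (W - of_nat n) / 2) * of_real (ln ((norm x)\<^sup>2)))"
    if x: "x \<noteq> 0" for n W x
  proof -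
    have l: "ln ((norm x)\<^sup>2) = 2 * ln (norm x)" using x by (simp add: ln_realpow)
    have "qchar (int n) (W - 2) x = exp ((W - 2) * of_real (ln (norm x))) * (x ^ n / of_real (norm x) ^ n)"
      using x by (simp add: qchar_def sgn_eq power_divide)
    also have "complex_of_real (norm x) ^ n = exp (of_nat n * of_real (ln (norm x)))"
      using x by (simp add: exp_of_nat_mult exp_of_real)
    finally have q: "qchar (int n) (W - 2) x = exp ((W - 2) * of_real (ln (norm x))) * (x ^ n / exp (of_nat n * of_real (ln (norm x))))" .
    define M where "M = complex_of_real (ln (norm x))"
    have "- (1 - (W - of_nat n) / 2) * (2 * M) = (W - 2) * M - of_nat n * M" by (simp add: field_simps)
    then have "exp (- (1 - (W - of_nat n) / 2) * (2 * M)) = exp ((W - 2) * M) / exp (of_nat n * M)"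
      by (simp only: exp_diff)
    then show ?thesis unfolding q l M_def[symmetric] of_real_mult of_real_numeral by simp
  qed
  define F where "F x t = x ^ k * (1 - x) ^ k' * exp (s' * of_real t - S * of_real (ln ((norm x)\<^sup>2 + exp t * (norm (1 - x))\<^sup>2)))"
    for x :: complex and t :: real
  have F_meas [measurable]: "case_prod F \<in> borel_measurable (lborel \<Otimes>\<^sub>M lborel)"
    unfolding F_def by measurable
  have \<phi>x: "\<phi> x = x ^ k * (1 - x) ^ k' * exp (- s * of_real (ln ((norm x)\<^sup>2)) - s' * of_real (ln ((norm (1 - x))\<^sup>2)))" if "x \<noteq> 0" "x \<noteq> 1" for x
    unfolding \<phi>_def using that qk[of x k A] qk[of "1 - x" k' B]
    by (simp add: s_def[symmetric] s'_def[symmetric] exp_diff exp_minus field_simps)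
  have Ft: "has_bochner_integral lborel (F x) (\<phi> x * (Gamma s' * Gamma s / Gamma S))" if x: "x \<noteq> 0" "x \<noteq> 1" for x
  proof -
    have "has_bochner_integral lborel (F x) (x ^ k * (1 - x) ^ k' *
       (exp (- s * of_real (ln ((norm x)\<^sup>2)) - s' * of_real (ln ((norm (1 - x))\<^sup>2))) * (Gamma s' * Gamma s / Gamma (s' + s))))"
      unfolding F_def S_def using x s
      by (intro has_bochner_integral_mult_right has_bochner_integral_Beta_log_scale) auto
    moreover note \<phi>x[OF x]
    ultimately show ?thesis by (simp only: S_def mult.assoc)
  qed
  have aex: "AE x in lborel. x \<noteq> (0::complex) \<and> x \<noteq> 1"
    using AE_lborel_singleton[of "0::complex"] AE_lborel_singleton[of "1::complex"] by eventually_elim simp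
  have nFt: "(\<integral>t. norm (F x t) \<partial>lborel) = norm (\<phi> x) * Re (Gamma (of_real (Re s')) * Gamma (of_real (Re s)) / Gamma (of_real (Re S)))"
    if x: "x \<noteq> 0" "x \<noteq> 1" for x
  proof -
    let ?X = "(norm x)\<^sup>2" and ?Y = "(norm (1 - x))\<^sup>2"
    have "has_bochner_integral lborel (\<lambda>t. exp (complex_of_real (Re s') * of_real t - (of_real (Re s') + of_real (Re s)) * of_real (ln (?X + exp t * ?Y))))
      (exp (- complex_of_real (Re s) * of_real (ln ?X) - of_real (Re s') * of_real (ln ?Y)) *
        (Gamma (of_real (Re s')) * Gamma (of_real (Re s)) / Gamma (of_real (Re s') + of_real (Re s))))"
      using x s by (intro has_bochner_integral_Beta_log_scale) auto
    from has_bochner_integral_Re[OF this]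
    have *: "has_bochner_integral lborel (\<lambda>t. exp (Re s' * t - Re S * ln (?X + exp t * ?Y)))
       (exp (- Re s * ln ?X - Re s' * ln ?Y) * Re (Gamma (of_real (Re s')) * Gamma (of_real (Re s)) / Gamma (of_real (Re S))))"
      by (simp add: S_def exp_of_real times_divide_eq_right[symmetric] del: times_divide_eq_right
          flip: of_real_mult of_real_diff of_real_add of_real_minus)
    have n\<phi>: "norm (\<phi> x) = norm (x ^ k * (1 - x) ^ k') * exp (- Re s * ln ?X - Re s' * ln ?Y)"
      unfolding \<phi>x[OF x] by (simp add: norm_mult)
    have "has_bochner_integral lborel (\<lambda>t. norm (F x t)) (norm (x ^ k * (1 - x) ^ k') * (exp (- Re s * ln ?X - Re s' * ln ?Y) * Re (Gamma (of_real (Re s')) * Gamma (of_real (Re s)) / Gamma (of_real (Re S)))))"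
      using has_bochner_integral_mult_right[OF *, of "norm (x ^ k * (1 - x) ^ k')"]
      by (simp add: F_def norm_mult)
    then show ?thesis unfolding n\<phi> by (simp add: has_bochner_integral_iff mult.assoc)
  qed
  have F_int: "integrable (lborel \<Otimes>\<^sub>M lborel) (case_prod F)"
  proof (rule lborel_pair.Fubini_integrable)
    show "AE x in lborel. integrable lborel (\<lambda>t. case_prod F (x, t))"
      using aex by eventually_elim (use Ft in \<open>auto simp: has_bochner_integral_iff\<close>)
    have ae: "AE x in lborel. norm (\<phi> x) * Re (Gamma (of_real (Re s')) * Gamma (of_real (Re s)) / Gamma (of_real (Re S)))
        = (\<integral>t. norm (case_prod F (x, t)) \<partial>lborel)"
      using aex
    proof eventually_elim
      case (elim x)
      then have "x \<noteq> 0" "x \<noteq> 1" by simp_all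
      from nFt[OF this] show ?case by (simp only: prod.case)
    qed
    have "integrable lborel (\<lambda>x. norm (\<phi> x) * Re (Gamma (of_real (Re s')) * Gamma (of_real (Re s)) / Gamma (of_real (Re S))))"
      by (intro integrable_mult_left integrable_norm \<phi>_int)
    then show "integrable lborel (\<lambda>x. \<integral>t. norm (case_prod F (x, t)) \<partial>lborel)"
      by (rule integrable_cong_AE[OF _ _ ae, THEN iffD1, rotated 2]) measurable
  qed simp
  define Q where "Q t = pi * (Gamma (S - 1) / Gamma S) * exp (\<alpha> * of_real t - (\<alpha> + \<beta>) * of_real (ln (1 + exp t)))" for t :: real
  have Fx: "(\<integral>x. F x t \<partial>lborel) = Q t" if Fi: "integrable lborel (\<lambda>x. F x t)" for t
  proof -
    define q where "q = exp t"
    have q: "q > 0" by (simp add: q_def)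
    \<comment> \<open>The weighted mean of 0 and 1 at which the squared modulus of x plus q times
      that of 1 - x is minimal. Translation by c removes the linear term.\<close>
    define c where "c = q / (1 + q)"
    have c: "0 < c" "c < 1" "1 - c = 1 / (1 + q)" using q by (simp_all add: c_def field_simps)
    have [measurable]: "(\<lambda>x. F x t) \<in> borel_measurable borel" unfolding F_def by measurable
    define P :: "complex poly" where "P = [:of_real c, 1:] ^ k * [:of_real (1 - c), -1:] ^ k'"
    define R where "R r = exp (s' * of_real t - S * of_real (ln (c + (1 + q) * r\<^sup>2)))" for r :: real
    have [measurable]: "R \<in> borel_measurable borel" unfolding R_def[abs_def] by measurable
    have cs: "(norm (of_real c + y))\<^sup>2 + q * (norm (1 - (of_real c + y)))\<^sup>2 = c + (1 + q) * (norm y)\<^sup>2" for y :: complex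
    proof -
      have qc: "q = c * (1 + q)" using q by (simp add: c_def)
      have "(norm (of_real c + y))\<^sup>2 + q * (norm (1 - (of_real c + y)))\<^sup>2
        = (1 + q) * (norm y)\<^sup>2 + (2 * Re y * (c * (1 + q) - q) + (c * (c * (1 + q)) + q - 2 * q * c))"
        unfolding cmod_power2 by (simp add: power2_eq_square algebra_simps)
      also have "\<dots> = (1 + q) * (norm y)\<^sup>2 + (q - q * c)" unfolding qc[symmetric] by (simp add: algebra_simps)
      also have "q - q * c = c" using q by (simp add: c_def field_simps)
      finally show ?thesis by simp
    qed
    have Fy: "F (of_real c + y) t = poly P y * R (norm y)" for y
      using cs[of y] by (simp add: F_def P_def R_def q_def[symmetric] add_ac diff_diff_eq)
    have "integrable lborel (\<lambda>y. F (of_real c + y) t)"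
      using lborel_complex_translate(1)[of "\<lambda>x. F x t" "of_real c"] Fi by simp
    then have Pi: "integrable lborel (\<lambda>y. poly P y * R (norm y))" by (simp only: Fy)
    have "(\<integral>x. F x t \<partial>lborel) = (\<integral>y. F (of_real c + y) t \<partial>lborel)"
      by (rule lborel_complex_translate(2)[symmetric]) simp
    also have "\<dots> = (\<integral>y. poly P 0 * R (norm y) \<partial>(lborel :: complex measure))"
      unfolding Fy by (rule poly_mean_value_radial[OF _ Pi]) simp
    also have "\<dots> = poly P 0 * (\<integral>y. R (norm y) \<partial>(lborel :: complex measure))" by simp
    also have "(\<integral>y. R (norm y) \<partial>(lborel :: complex measure)) = (\<integral>y. of_real ((norm y)\<^sup>2) * R (norm y) \<partial>haar)"
      by (rule lborel_complex_eq_haar(2)) simp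
    also have "\<dots> = 2 * pi * (\<integral>u. of_real ((exp u)\<^sup>2) * R (exp u) \<partial>lborel)"
      by (rule haar_integral_radial(1)[of "\<lambda>r. of_real (r\<^sup>2) * R r"]) simp
    also have "(\<integral>u. of_real ((exp u)\<^sup>2) * R (exp u) \<partial>lborel)
      = (1 / 2) * (\<integral>v. of_real (exp v) * exp (s' * of_real t - S * of_real (ln (c + exp v * (1 + q)))) \<partial>lborel)"
      by (subst lborel_integral_real_affine[where c = "1/2" and t = 0])
         (simp_all add: scaleR_conv_of_real R_def exp_double[symmetric] mult.commute)
    also have "(\<integral>v. of_real (exp v) * exp (s' * of_real t - S * of_real (ln (c + exp v * (1 + q)))) \<partial>lborel)
      = (\<integral>v. exp (s' * of_real t) * exp (1 * of_real v - (1 + (S - 1)) * of_real (ln (c + exp v * (1 + q)))) \<partial>lborel)"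
      by (intro Bochner_Integration.integral_cong refl) (simp add: exp_diff exp_of_real[symmetric] mult_ac)
    also have "\<dots> = exp (s' * of_real t) * (\<integral>v. exp (1 * of_real v - (1 + (S - 1)) * of_real (ln (c + exp v * (1 + q)))) \<partial>lborel)"
      by (rule integral_mult_right_zero)
    also have "(\<integral>v. exp (1 * of_real v - (1 + (S - 1)) * of_real (ln (c + exp v * (1 + q)))) \<partial>lborel)
      = exp (- (S - 1) * of_real (ln c) - 1 * of_real (ln (1 + q))) * (Gamma 1 * Gamma (S - 1) / Gamma (1 + (S - 1)))"
      using has_bochner_integral_Beta_log_scale[of 1 "S - 1" c "1 + q"] s c q
      by (simp add: has_bochner_integral_iff)
    finally have eq: "(\<integral>x. F x t \<partial>lborel) = poly P 0 * (2 * pi * (1 / 2 * (exp (s' * of_real t) *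
      (exp (- (S - 1) * of_real (ln c) - 1 * of_real (ln (1 + q))) * (Gamma 1 * Gamma (S - 1) / Gamma (1 + (S - 1)))))))" .
    define L where "L = complex_of_real (ln (1 + q))"
    define T where "T = complex_of_real t"
    have lnc: "complex_of_real (ln c) = T - L"
    proof -
      have "ln c = ln q - ln (1 + q)" unfolding c_def using q by (subst ln_div) auto
      moreover have "ln q = t" by (simp add: q_def)
      ultimately show ?thesis by (simp add: L_def T_def)
    qed
    have "of_real c = exp (T - L)" using c lnc by (metis exp_ln exp_of_real)
    moreover have "complex_of_real (1 - c) = exp (- L)"
      using c(3) q by (simp add: L_def exp_minus exp_of_real divide_inverse flip: of_real_diff)
    ultimately have P0: "poly P 0 = exp (of_nat k * (T - L)) * exp (of_nat k' * (- L))"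
      by (simp add: P_def exp_of_nat_mult[symmetric])
    have ring: "of_nat k * (T - L) + (of_nat k' * (- L) + (s' * T + (- (S - 1) * (T - L) - 1 * L)))
       = \<alpha> * T - (\<alpha> + \<beta>) * L"
      by (simp add: S_def s_def s'_def \<alpha>_def \<beta>_def field_simps)
    have "exp (of_nat k * (T - L)) * (exp (of_nat k' * (- L)) * (exp (s' * T) * exp (- (S - 1) * (T - L) - 1 * L)))
       = exp (\<alpha> * T - (\<alpha> + \<beta>) * L)"
      by (simp only: ring flip: exp_add)
    then show ?thesis
      unfolding eq P0 lnc L_def[symmetric] T_def[symmetric] Q_def q_def[symmetric]
      by (simp add: mult_ac)
  qed
  have Q: "has_bochner_integral lborel Q (pi * (Gamma (S - 1) / Gamma S) * (Gamma \<alpha> * Gamma \<beta> / Gamma (\<alpha> + \<beta>)))"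
    unfolding Q_def by (intro has_bochner_integral_mult_right has_bochner_integral_Beta_log s)
  have "(\<integral>x. \<phi> x \<partial>lborel) * (Gamma s' * Gamma s / Gamma S) = (\<integral>x. \<phi> x * (Gamma s' * Gamma s / Gamma S) \<partial>lborel)"
    by simp
  also have "\<dots> = (\<integral>x. (\<integral>t. F x t \<partial>lborel) \<partial>lborel)"
  proof (rule integral_cong_AE)
    show "AE x in lborel. \<phi> x * (Gamma s' * Gamma s / Gamma S) = (\<integral>t. F x t \<partial>lborel)"
      using aex
    proof eventually_elim
      case (elim x)
      then have "x \<noteq> 0" "x \<noteq> 1" by simp_all
      from Ft[OF this] show ?case by (simp only: has_bochner_integral_iff)
    qed
  qed measurable
  also have "\<dots> = (\<integral>t. (\<integral>x. F x t \<partial>lborel) \<partial>lborel)"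
    by (rule lborel_pair.Fubini_integral[OF F_int, symmetric])
  also have "\<dots> = (\<integral>t. Q t \<partial>lborel)"
  proof (rule integral_cong_AE)
    show "AE t in lborel. (\<integral>x. F x t \<partial>lborel) = Q t"
      using lborel_pair.AE_integrable_snd[OF F_int] by eventually_elim (use Fx in auto)
    show "Q \<in> borel_measurable lborel" unfolding Q_def by measurable
  qed simp
  also have "\<dots> = pi * (Gamma (S - 1) / Gamma S) * (Gamma \<alpha> * Gamma \<beta> / Gamma (\<alpha> + \<beta>))"
    using Q by (simp add: has_bochner_integral_iff)
  finally have main: "(\<integral>x. \<phi> x \<partial>lborel) * (Gamma s' * Gamma s / Gamma S)
     = pi * (Gamma (S - 1) / Gamma S) * (Gamma \<alpha> * Gamma \<beta> / Gamma (\<alpha> + \<beta>))" .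
  have gnz: "Gamma z \<noteq> 0" if "Re z > 0" for z :: complex
    using that by (auto simp: Gamma_eq_zero_iff elim!: nonpos_Ints_cases)
  have "Gamma S \<noteq> 0" "Gamma s \<noteq> 0" "Gamma s' \<noteq> 0" "Gamma (\<alpha> + \<beta>) \<noteq> 0"
    using s by (auto intro!: gnz simp: S_def)
  then have "(\<integral>x. \<phi> x \<partial>lborel) = pi * Gamma (S - 1) * Gamma \<alpha> * Gamma \<beta> / (Gamma s * Gamma s' * Gamma (\<alpha> + \<beta>))"
    using main by (simp add: field_simps)
  then show ?thesis by (simp add: \<phi>_def S_def add.commute)
qed

section \<open>Symmetries of the complex beta function and its evaluation for all windings\<close>

text \<open>The exponents are encoded by \<open>n = \<alpha> - \<alpha>'\<close> and \<open>A = \<alpha> + \<alpha>'\<close>, likewise \<open>m\<close> and \<open>B\<close> for \<open>\<beta>\<close>, \<open>\<beta>'\<close>.\<close>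
definition bval :: "int \<Rightarrow> complex \<Rightarrow> int \<Rightarrow> complex \<Rightarrow> complex" where
  "bval n A m B = fB ((A + of_int n) / 2) ((B + of_int m) / 2) ((A - of_int n) / 2) ((B - of_int m) / 2)"

text \<open>Only \<alpha>, \<beta> and \<alpha> + \<beta> are tested; their tilded versions differ
  from them by integers.\<close>

definition bnonint :: "int \<Rightarrow> complex \<Rightarrow> int \<Rightarrow> complex \<Rightarrow> bool" where
  "bnonint n A m B \<longleftrightarrow> (A + of_int n) / 2 \<notin> \<int> \<and> (B + of_int m) / 2 \<notin> \<int> \<and>
     (A + of_int n) / 2 + (B + of_int m) / 2 \<notin> \<int>"

lemma half_diff: "(A - of_int n) / 2 = (A + of_int n) / 2 - complex_of_int n"
  by (simp add: field_simps)

lemma Ints_diff_of_int_iff: "z - of_int n \<in> \<int> \<longleftrightarrow> z \<in> (\<int> :: complex set)"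
  using Ints_add[of "z - of_int n" "of_int n"] Ints_diff[of z "of_int n"] by auto

lemma Ints_one_minus_iff: "1 - z \<in> \<int> \<longleftrightarrow> z \<in> (\<int> :: complex set)"
  using Ints_diff[of 1 "1 - z"] Ints_diff[of 1 z] by auto

lemma sin_pi_nonzero:
  assumes "z \<notin> \<int>"
  shows "sin (of_real pi * z) \<noteq> (0::complex)"
proof
  assume "sin (of_real pi * z) = 0"
  then obtain n :: int where "of_real pi * z = of_real (of_int n * pi)" unfolding sin_eq_0 by blast
  then have "of_real pi * z = of_real pi * of_int n" by (simp add: mult.commute)
  then have "z = of_int n" by (subst (asm) mult_cancel_left) simp
  then show False using assms by simp
qed

lemma Gamma_nonint:
  assumes "z \<notin> \<int>"
  shows "Gamma z \<noteq> (0::complex)"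
  using assms nonpos_Ints_Int[of z] by (auto simp: Gamma_eq_zero_iff)

lemma Gamma_one_minus:
  assumes "z \<notin> (\<int> :: complex set)"
  shows "Gamma (1 - z) = of_real pi / (sin (of_real pi * z) * Gamma z)"
proof -
  have "Gamma (1 - z) = (Gamma z * Gamma (1 - z)) / Gamma z" using Gamma_nonint[OF assms] by simp
  then show ?thesis by (simp only: Gamma_reflection_complex divide_divide_eq_left)
qed

lemma sin_pi_diff_int: "sin (of_real pi * (z - of_int n)) = (-1) powi n * sin (of_real pi * z :: complex)"
proof -
  have "sin (of_real pi * (z - of_int n)) = sin (of_real pi * z) * cos (of_real (of_int n * pi)) - cos (of_real pi * z) * sin (of_real (of_int n * pi))"
    by (simp add: right_diff_distrib sin_diff mult.commute)
  also have "\<dots> = sin (of_real pi * z) * of_real (cos (of_int n * pi)) - cos (of_real pi * z) * of_real (sin (of_int n * pi))"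
    by (simp only: cos_of_real sin_of_real)
  also have "sin (of_int n * pi) = 0" using sin_npi_int[of n] by (simp add: mult.commute)
  also have "cos (of_int n * pi) = (-1) powi n"
  proof -
    have "((-1)::real) powi n = (if even n then 1 else -1)"
      by (auto elim!: evenE oddE simp: power_int_add power_int_mult)
    then show ?thesis using cos_npi_int[of n] by (simp add: mult.commute)
  qed
  finally show ?thesis by simp
qed

lemma minus1_powi: "((-1::complex) powi n) * ((-1) powi n) = 1"
  by (simp add: power_int_mult_distrib[symmetric])

text \<open>The definition of \<open>fB\<close> takes its sines at the tilded arguments only.
  Passing to the other arguments multiplies them by (-1)^n, (-1)^m and (-1)^(n+m), and these signs
  cancel in the quotient.\<close>

lemma fB_swap_tilde:
  assumes "\<alpha>' = \<alpha> - of_int n" "\<beta>' = \<beta> - of_int m"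
  shows "fB \<alpha>' \<beta>' \<alpha> \<beta> = fB \<alpha> \<beta> \<alpha>' \<beta>'"
proof -
  have s: "sin (of_real pi * \<alpha>') = (-1) powi n * sin (of_real pi * \<alpha>)"
    "sin (of_real pi * \<beta>') = (-1) powi m * sin (of_real pi * \<beta>)"
    "sin (of_real pi * (\<alpha>' + \<beta>')) = (-1) powi (n + m) * sin (of_real pi * (\<alpha> + \<beta>))"
  proof -
    have "\<alpha>' + \<beta>' = \<alpha> + \<beta> - of_int (n + m)" using assms by simp
    then show "sin (of_real pi * (\<alpha>' + \<beta>')) = (-1) powi (n + m) * sin (of_real pi * (\<alpha> + \<beta>))"
      by (simp only: sin_pi_diff_int)
  qed (simp_all only: assms sin_pi_diff_int)
  have "(-1) powi (n + m) = (-1) powi n * ((-1) powi m :: complex)" by (simp add: power_int_add)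
  then show ?thesis unfolding fB_def s by (simp add: mult_ac)
qed

lemma fB_cnj: "fB (cnj \<alpha>) (cnj \<beta>) (cnj \<alpha>') (cnj \<beta>') = cnj (fB \<alpha> \<beta> \<alpha>' \<beta>')"
  by (simp add: fB_def cnj_Gamma cnj_sin)

lemma bval_reflect: "bval m B n A = bval n A m B"
  by (simp add: bval_def fB_def add.commute mult_ac)

lemma bval_cnj: "bval (- n) (cnj A) (- m) (cnj B) = cnj (bval n A m B)"
proof -
  have "bval (- n) (cnj A) (- m) (cnj B) = cnj (fB ((A - of_int n) / 2) ((B - of_int m) / 2) ((A + of_int n) / 2) ((B + of_int m) / 2))"
    unfolding bval_def fB_cnj[symmetric] by simp
  also have "\<dots> = cnj (bval n A m B)"
    unfolding bval_def by (subst fB_swap_tilde[OF half_diff half_diff]) (rule refl)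
  finally show ?thesis .
qed

text \<open>The counterpart, for the values, of the substitution x -> 1/x, which replaces \<alpha>
  by 1 - \<alpha> - \<beta>. The reflection formula converts the Gamma factors; comparing the sines
  of tilded and untilded arguments leaves the sign.\<close>

lemma bval_inversion:
  assumes "bnonint n A m B"
  shows "bval (- n - m) (2 - A - B) m B = (-1) powi m * bval n A m B"
proof -
  define \<alpha> \<beta> \<alpha>' \<beta>' where "\<alpha> = (A + of_int n) / 2" and "\<beta> = (B + of_int m) / 2"
    and "\<alpha>' = (A - of_int n) / 2" and "\<beta>' = (B - of_int m) / 2"
  have t: "\<alpha>' = \<alpha> - of_int n" "\<beta>' = \<beta> - of_int m"
    by (simp_all add: \<alpha>_def \<beta>_def \<alpha>'_def \<beta>'_def half_diff)
  have t3: "\<alpha>' + \<beta>' = \<alpha> + \<beta> - of_int (n + m)" by (simp add: t)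
  have ni: "\<alpha> \<notin> \<int>" "\<beta> \<notin> \<int>" "\<alpha> + \<beta> \<notin> \<int>" using assms by (simp_all add: bnonint_def \<alpha>_def \<beta>_def)
  have ni': "\<alpha>' \<notin> \<int>" "\<beta>' \<notin> \<int>" "\<alpha>' + \<beta>' \<notin> \<int>"
    using ni unfolding t3 unfolding t by (simp_all only: Ints_diff_of_int_iff not_False_eq_True)
  have e: "(2 - A - B + of_int (- n - m)) / 2 = 1 - (\<alpha> + \<beta>)" "(2 - A - B - of_int (- n - m)) / 2 = 1 - (\<alpha>' + \<beta>')"
    by (simp_all add: \<alpha>_def \<beta>_def \<alpha>'_def \<beta>'_def field_simps)
  have a: "1 - (\<alpha> + \<beta>) + \<beta> = 1 - \<alpha>" "1 - (\<alpha>' + \<beta>') + \<beta>' = 1 - \<alpha>'" by simp_all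
  have sp: "sin (of_real pi * (1 - z)) = sin (of_real pi * z :: complex)" for z
    by (simp add: right_diff_distrib sin_diff cos_of_real[of pi, simplified] sin_of_real[of pi, simplified])
  define s1 s2 s3 where "s1 = sin (of_real pi * \<alpha>')" and "s2 = sin (of_real pi * \<beta>')" and "s3 = sin (of_real pi * (\<alpha>' + \<beta>'))"
  have s: "sin (of_real pi * \<alpha>) = (-1) powi n * s1" "sin (of_real pi * (\<alpha> + \<beta>)) = (-1) powi (n + m) * s3"
    unfolding s1_def s3_def t3 unfolding t sin_pi_diff_int mult.assoc[symmetric] minus1_powi by simp_all
  have nz: "s1 \<noteq> 0" "s2 \<noteq> 0" "s3 \<noteq> 0" "Gamma \<alpha> \<noteq> 0" "Gamma \<beta> \<noteq> 0" "Gamma (\<alpha> + \<beta>) \<noteq> 0"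
    "Gamma \<alpha>' \<noteq> 0" "Gamma \<beta>' \<noteq> 0" "Gamma (\<alpha>' + \<beta>') \<noteq> 0"
    unfolding s1_def s2_def s3_def by (intro sin_pi_nonzero Gamma_nonint ni ni')+
  have pn: "(-1) powi n \<noteq> (0::complex)" "(-1) powi m \<noteq> (0::complex)" by simp_all
  have pm: "(-1) powi (n + m) = (-1) powi n * ((-1) powi m :: complex)" by (simp add: power_int_add)
  have "bval (- n - m) (2 - A - B) m B
      = Gamma (1 - (\<alpha> + \<beta>)) * Gamma \<beta> / Gamma (1 - \<alpha>) * (Gamma (1 - (\<alpha>' + \<beta>')) * Gamma \<beta>' / Gamma (1 - \<alpha>')) * (s3 * s2 / s1)"
    unfolding bval_def e fB_def \<beta>_def[symmetric] \<beta>'_def[symmetric] a sp s1_def s2_def s3_def ..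
  also have "\<dots> = (-1) powi m * (Gamma \<alpha> * Gamma \<beta> / Gamma (\<alpha> + \<beta>) * (Gamma \<alpha>' * Gamma \<beta>' / Gamma (\<alpha>' + \<beta>')) * (s1 * s2 / s3))"
  proof -
    define P where "P = ((-1) powi m :: complex)"
    have PP: "P * P = 1" unfolding P_def by (rule minus1_powi)
    then have Pi: "1 / P = P" by (metis nonzero_divide_eq_eq zero_neq_one mult_zero_left)
    have g1: "Gamma (1 - (\<alpha> + \<beta>)) / Gamma (1 - \<alpha>) = P * (s1 * Gamma \<alpha> / (s3 * Gamma (\<alpha> + \<beta>)))"
    proof -
      have "Gamma (1 - (\<alpha> + \<beta>)) / Gamma (1 - \<alpha>) = (1 / P) * (s1 * Gamma \<alpha> / (s3 * Gamma (\<alpha> + \<beta>)))"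
        unfolding Gamma_one_minus[OF ni(3)] Gamma_one_minus[OF ni(1)] s pm P_def
        using nz pn by (simp add: divide_simps)
      then show ?thesis unfolding Pi .
    qed
    have g2: "Gamma (1 - (\<alpha>' + \<beta>')) / Gamma (1 - \<alpha>') = s1 * Gamma \<alpha>' / (s3 * Gamma (\<alpha>' + \<beta>'))"
      unfolding Gamma_one_minus[OF ni'(3)] Gamma_one_minus[OF ni'(1)] s1_def[symmetric] s3_def[symmetric]
      using nz by (simp add: field_simps)
    have "Gamma (1 - (\<alpha> + \<beta>)) * Gamma \<beta> / Gamma (1 - \<alpha>) * (Gamma (1 - (\<alpha>' + \<beta>')) * Gamma \<beta>' / Gamma (1 - \<alpha>')) * (s3 * s2 / s1)
      = (Gamma (1 - (\<alpha> + \<beta>)) / Gamma (1 - \<alpha>)) * Gamma \<beta> * ((Gamma (1 - (\<alpha>' + \<beta>')) / Gamma (1 - \<alpha>')) * Gamma \<beta>') * (s3 * s2 / s1)"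
      by (simp add: divide_inverse mult_ac)
    also have "\<dots> = P * (Gamma \<alpha> * Gamma \<beta> / Gamma (\<alpha> + \<beta>) * (Gamma \<alpha>' * Gamma \<beta>' / Gamma (\<alpha>' + \<beta>')) * (s1 * s2 / s3))"
      unfolding g1 g2 using nz by (simp add: field_simps)
    finally show ?thesis unfolding P_def .
  qed
  also have "Gamma \<alpha> * Gamma \<beta> / Gamma (\<alpha> + \<beta>) * (Gamma \<alpha>' * Gamma \<beta>' / Gamma (\<alpha>' + \<beta>')) * (s1 * s2 / s3) = bval n A m B"
    unfolding bval_def fB_def \<alpha>_def[symmetric] \<beta>_def[symmetric] \<alpha>'_def[symmetric] \<beta>'_def[symmetric] s1_def s2_def s3_def ..
  finally show ?thesis .
qed

definition bint :: "int \<Rightarrow> complex \<Rightarrow> int \<Rightarrow> complex \<Rightarrow> complex" where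
  "bint n A m B = (\<integral>x. qchar n (A - 2) x * qchar m (B - 2) (1 - x) \<partial>lborel)"

lemma bint_reflect: "bint m B n A = bint n A m B"
  using lborel_complex_reflect(2)[of "\<lambda>x. qchar n (A - 2) x * qchar m (B - 2) (1 - x)"]
  by (simp add: bint_def mult.commute)

lemma cnj_powi: "cnj (x powi n) = cnj x powi n"
  by (simp add: power_int_def)

lemma qchar_cnj: "cnj (qchar n w x) = qchar (- n) (cnj w) x"
proof (cases "x = 0")
  case False
  have "cnj (sgn x) * sgn x = 1"
    using False by (simp add: sgn_eq complex_norm_square[symmetric] power2_eq_square mult.commute)
  then have "cnj (sgn x) = inverse (sgn x)"
    by (metis inverse_unique mult.commute)
  then show ?thesis using False by (simp add: qchar_def exp_cnj cnj_powi power_int_minus power_int_inverse)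
qed (simp add: qchar_def exp_cnj)

lemma bint_cnj: "bint (- n) (cnj A) (- m) (cnj B) = cnj (bint n A m B)"
proof -
  have "cnj (bint n A m B) = (\<integral>x. cnj (qchar n (A - 2) x * qchar m (B - 2) (1 - x)) \<partial>lborel)"
    unfolding bint_def by (rule Bochner_Integration.integral_cnj[symmetric])
  then show ?thesis by (simp add: bint_def qchar_cnj)
qed

lemma bint_haar: "bint n A m B = (\<integral>x. qchar n A x * qchar m (B - 2) (1 - x) \<partial>haar)"
  unfolding bint_def
proof (subst haar_integral_lborel(2), simp, rule integral_cong_AE)
  show "AE x in lborel. qchar n (A - 2) x * qchar m (B - 2) (1 - x) = qchar n A x * qchar m (B - 2) (1 - x) / of_real ((norm x)\<^sup>2)"
    using AE_lborel_singleton[of "0::complex"]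
    by eventually_elim (simp add: qchar_shift2[symmetric])
qed simp_all

lemma qchar_minus_1: "qchar n w (-1) = (-1) powi n"
  by (simp add: qchar_def sgn_minus)

lemma qchar_uminus: "x \<noteq> 0 \<Longrightarrow> qchar n w (- x) = (-1) powi n * qchar n w x"
  using qchar_mult[of "-1" x n w] by (simp add: qchar_minus_1)

lemma qchar_one_minus_inverse:
  assumes "x \<noteq> 0" "x \<noteq> 1"
  shows "qchar m W (1 - inverse x) = (-1) powi m * (qchar m W (1 - x) * qchar (- m) (- W) x)"
proof -
  have "1 - inverse x = - ((1 - x) * inverse x)" using assms by (simp add: field_simps)
  then have "qchar m W (1 - inverse x) = (-1) powi m * (qchar m W (1 - x) * qchar m W (inverse x))"
    using assms by (simp only:) (subst qchar_uminus, simp, subst qchar_mult, simp_all)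
  then show ?thesis unfolding qchar_inverse[OF assms(1)] qchar_minus .
qed

lemma haar_ne_1: "AE x in haar. x \<noteq> 0 \<and> x \<noteq> 1"
  unfolding AE_haar_iff using AE_lborel_singleton[of "0::complex"] AE_lborel_singleton[of "1::complex"]
  by eventually_elim simp

text \<open>Exchanges the singular points 0 and infinity by invariance of Haar measure under
  inversion. The sign comes from 1 - 1/x = - (1 - x)/x.\<close>

lemma bint_inversion: "bint n A m B = (-1) powi m * bint (- n - m) (2 - A - B) m B"
proof -
  have "bint n A m B = (\<integral>x. qchar n A (inverse x) * qchar m (B - 2) (1 - inverse x) \<partial>haar)"
    unfolding bint_haar by (subst haar_integral_inverse[of "\<lambda>x. qchar n A x * qchar m (B - 2) (1 - x)"]) simp_all
  also have "\<dots> = (\<integral>x. (-1) powi m * (qchar (- n - m) (2 - A - B) x * qchar m (B - 2) (1 - x)) \<partial>haar)"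
  proof (rule integral_cong_AE)
    show "AE x in haar. qchar n A (inverse x) * qchar m (B - 2) (1 - inverse x)
       = (-1) powi m * (qchar (- n - m) (2 - A - B) x * qchar m (B - 2) (1 - x))"
      using haar_ne_1
    proof eventually_elim
      case (elim x)
      have e: "qchar (- n - m) (2 - A - B) x = qchar (- n + - m) (- A + - (B - 2)) x"
        by (rule arg_cong2[where f = "\<lambda>a b. qchar a b x"]) simp_all
      have x: "x \<noteq> 0" "x \<noteq> 1" using elim by simp_all
      show ?case
        unfolding e qchar_add qchar_one_minus_inverse[OF x] qchar_inverse[OF x(1)] qchar_minus by (simp add: mult_ac)
    qed
  qed simp_all
  also have "\<dots> = (-1) powi m * bint (- n - m) (2 - A - B) m B"
    unfolding bint_haar by (rule integral_mult_right_zero)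
  finally show ?thesis .
qed

text \<open>The direct evaluation contains Gamma factors at 1 - \<alpha>', 1 - \<beta>' and 1 -
  (\<alpha>' + \<beta>'); the reflection formula turns them into the sines of
  \<open>fB\<close>.\<close>

lemma bint_direct:
  assumes ni: "bnonint n A m B" and nm: "n \<ge> 0" "m \<ge> 0"
    and A: "Re A > 0" and B: "Re B > 0" and AB: "Re A + Re B < 2"
  shows "bint n A m B = bval n A m B"
proof -
  define \<alpha> \<beta> \<alpha>' \<beta>' where "\<alpha> = (A + of_int n) / 2" and "\<beta> = (B + of_int m) / 2"
    and "\<alpha>' = (A - of_int n) / 2" and "\<beta>' = (B - of_int m) / 2"
  have t: "\<alpha>' = \<alpha> - of_int n" "\<beta>' = \<beta> - of_int m"
    by (simp_all add: \<alpha>_def \<beta>_def \<alpha>'_def \<beta>'_def half_diff)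
  have t3: "\<alpha>' + \<beta>' = \<alpha> + \<beta> - of_int (n + m)" by (simp add: t)
  have ni: "\<alpha> \<notin> \<int>" "\<beta> \<notin> \<int>" "\<alpha> + \<beta> \<notin> \<int>" using ni by (simp_all add: bnonint_def \<alpha>_def \<beta>_def)
  have ni': "\<alpha>' \<notin> \<int>" "\<beta>' \<notin> \<int>" "\<alpha>' + \<beta>' \<notin> \<int>"
    using ni unfolding t3 unfolding t by (simp_all only: Ints_diff_of_int_iff not_False_eq_True)
  have nn: "of_nat (nat n) = (of_int n :: complex)" "of_nat (nat m) = (of_int m :: complex)" "int (nat n) = n" "int (nat m) = m"
    using nm by simp_all
  have "bint n A m B = pi * Gamma (1 - \<alpha>' + (1 - \<beta>') - 1) * Gamma \<alpha> * Gamma \<beta> / (Gamma (1 - \<alpha>') * Gamma (1 - \<beta>') * Gamma (\<alpha> + \<beta>))"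
    using complex_beta_direct[OF A B AB, of "nat n" "nat m"]
    unfolding nn bint_def \<alpha>_def \<beta>_def \<alpha>'_def \<beta>'_def .
  also have "1 - \<alpha>' + (1 - \<beta>') - 1 = 1 - (\<alpha>' + \<beta>')" by simp
  also have "pi * Gamma (1 - (\<alpha>' + \<beta>')) * Gamma \<alpha> * Gamma \<beta> / (Gamma (1 - \<alpha>') * Gamma (1 - \<beta>') * Gamma (\<alpha> + \<beta>)) = bval n A m B"
    unfolding bval_def fB_def \<alpha>_def[symmetric] \<beta>_def[symmetric] \<alpha>'_def[symmetric] \<beta>'_def[symmetric]
      Gamma_one_minus[OF ni'(3)] Gamma_one_minus[OF ni'(1)] Gamma_one_minus[OF ni'(2)]
    using Gamma_nonint[OF ni'(1)] Gamma_nonint[OF ni'(2)] Gamma_nonint[OF ni'(3)] Gamma_nonint[OF ni(3)]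
      sin_pi_nonzero[OF ni'(1)] sin_pi_nonzero[OF ni'(2)] sin_pi_nonzero[OF ni'(3)]
    by (simp add: field_simps)
  finally show ?thesis .
qed

lemma cnj_Ints_iff: "cnj z \<in> \<int> \<longleftrightarrow> z \<in> \<int>"
proof -
  have *: "cnj w \<in> \<int>" if "w \<in> \<int>" for w using that by (elim Ints_cases) simp
  show ?thesis using *[of z] *[of "cnj z"] by auto
qed

lemma bnonint_cnj:
  assumes "bnonint n A m B"
  shows "bnonint (- n) (cnj A) (- m) (cnj B)"
proof -
  have e: "(cnj A + of_int (- n)) / 2 = cnj ((A + of_int n) / 2 - of_int n)" for A n by (simp add: field_simps)
  have e2: "(A + of_int n) / 2 - of_int n + ((B + of_int m) / 2 - of_int m) = (A + of_int n) / 2 + (B + of_int m) / 2 - of_int (n + m)"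
    by simp
  show ?thesis
    using assms unfolding bnonint_def e complex_cnj_add[symmetric] cnj_Ints_iff e2 Ints_diff_of_int_iff .
qed

lemma bnonint_reflect: "bnonint n A m B \<Longrightarrow> bnonint m B n A"
  by (simp add: bnonint_def add.commute)

lemma bnonint_inversion: "bnonint n A m B \<Longrightarrow> bnonint (- n - m) (2 - A - B) m B"
proof -
  have e: "(2 - A - B + of_int (- n - m)) / 2 = 1 - ((A + of_int n) / 2 + (B + of_int m) / 2)"
    "(2 - A - B + of_int (- n - m)) / 2 + (B + of_int m) / 2 = 1 - (A + of_int n) / 2"
    by (simp_all add: field_simps)
  assume "bnonint n A m B"
  then show ?thesis unfolding bnonint_def e Ints_one_minus_iff by simp
qed

lemma bint_same_sign:
  assumes ni: "bnonint n A m B" and nm: "n \<ge> 0 \<and> m \<ge> 0 \<or> n \<le> 0 \<and> m \<le> 0"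
    and AB: "Re A > 0" "Re B > 0" "Re A + Re B < 2"
  shows "bint n A m B = bval n A m B"
  using nm
proof
  assume "n \<le> 0 \<and> m \<le> 0"
  then have "bint (- n) (cnj A) (- m) (cnj B) = bval (- n) (cnj A) (- m) (cnj B)"
    using AB by (intro bint_direct bnonint_cnj ni) auto
  then have "cnj (bint n A m B) = cnj (bval n A m B)" unfolding bint_cnj bval_cnj .
  then show ?thesis by (simp only: complex_cnj_cancel_iff)
next
  assume "n \<ge> 0 \<and> m \<ge> 0"
  then show ?thesis using bint_direct[OF ni _ _ AB] by blast
qed

lemma bint_inversion_sign:
  assumes ni: "bnonint n A m B" and nm: "n + m \<le> 0 \<and> m \<ge> 0 \<or> n + m \<ge> 0 \<and> m \<le> 0"
    and AB: "Re A > 0" "Re B > 0" "Re A + Re B < 2"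
  shows "bint n A m B = bval n A m B"
proof -
  have "bint (- n - m) (2 - A - B) m B = bval (- n - m) (2 - A - B) m B"
    using nm AB by (intro bint_same_sign bnonint_inversion ni) auto
  then have "bint n A m B = (-1) powi m * ((-1) powi m * bval n A m B)"
    using bint_inversion[of n A m B] bval_inversion[OF ni] by presburger
  then show ?thesis unfolding mult.assoc[symmetric] minus1_powi by simp
qed

text \<open>The windings at 0, 1 and infinity are n, m and - n - m. They add up to 0, so two of them
  are both nonnegative or both nonpositive. Reflection and inversion move these two to the points 0
  and 1, and complex conjugation makes them nonnegative.\<close>

theorem complex_beta:
  assumes ni: "bnonint n A m B" and AB: "Re A > 0" "Re B > 0" "Re A + Re B < 2"
  shows "bint n A m B = bval n A m B"
proof -
  consider "n \<ge> 0 \<and> m \<ge> 0 \<or> n \<le> 0 \<and> m \<le> 0" | "n + m \<le> 0 \<and> m \<ge> 0 \<or> n + m \<ge> 0 \<and> m \<le> 0"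
    | "m + n \<le> 0 \<and> n \<ge> 0 \<or> m + n \<ge> 0 \<and> n \<le> 0" by linarith
  then show ?thesis
  proof cases
    case 1
    then show ?thesis by (rule bint_same_sign[OF ni _ AB])
  next
    case 2
    then show ?thesis by (rule bint_inversion_sign[OF ni _ AB])
  next
    case 3
    have "Re B + Re A < 2" using AB by simp
    then have "bint m B n A = bval m B n A"
      using bint_inversion_sign[OF bnonint_reflect[OF ni] 3 AB(2,1)] by blast
    then show ?thesis unfolding bint_reflect[of m B n A] bval_reflect[of m B n A] .
  qed
qed

section \<open>Holomorphic dependence of integrals on a parameter\<close>

text \<open>Cauchy's estimate on a half ball turns the domination of the integrand into a domination of its
  difference quotients.\<close>
lemma holomorphic_parametric_integral:
  fixes F :: "complex \<Rightarrow> 'a \<Rightarrow> complex"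
  assumes S: "open S"
    and meas: "\<And>t. t \<in> S \<Longrightarrow> F t \<in> borel_measurable M"
    and hol: "\<And>x. (\<lambda>t. F t x) holomorphic_on S"
    and dom: "\<And>t0. t0 \<in> S \<Longrightarrow> \<exists>r>0. \<exists>B. cball t0 r \<subseteq> S \<and> integrable M B \<and> (\<forall>t\<in>cball t0 r. \<forall>x. norm (F t x) \<le> B x)"
  shows "(\<lambda>t. \<integral>x. F t x \<partial>M) holomorphic_on S"
  unfolding holomorphic_on_open[OF S]
proof
  fix t0 assume t0: "t0 \<in> S"
  obtain r B where r: "r > 0" and sub: "cball t0 r \<subseteq> S" and B: "integrable M B"
    and bd: "\<And>t x. t \<in> cball t0 r \<Longrightarrow> norm (F t x) \<le> B x"
    using dom[OF t0] by auto
  have t0c: "t0 \<in> cball t0 r" using r by simp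
  have B0: "0 \<le> B x" for x by (rule order_trans[OF norm_ge_zero bd[OF t0c]])
  have Fi: "integrable M (F t)" if t: "t \<in> cball t0 r" for t
  proof (rule Bochner_Integration.integrable_bound[OF B])
    show "F t \<in> borel_measurable M" using t sub by (intro meas) auto
    show "AE x in M. norm (F t x) \<le> norm (B x)" using bd[OF t] B0 by (intro AE_I2) simp
  qed
  have dF: "((\<lambda>t. F t x) has_field_derivative deriv (\<lambda>t. F t x) t) (at t)" if "t \<in> S" for t x
    by (rule holomorphic_derivI[OF hol S that])
  have dbound: "norm (deriv (\<lambda>t. F t x) t) \<le> B x / (r / 2)" if t: "t \<in> cball t0 (r / 2)" for t x
  proof -
    have sub2: "cball t (r / 2) \<subseteq> cball t0 r"
    proof
      fix u assume "u \<in> cball t (r / 2)"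
      then have "dist t0 u \<le> dist t0 t + dist t u" "dist t u \<le> r / 2" by (auto simp: dist_triangle)
      then show "u \<in> cball t0 r" using t by auto
    qed
    have "norm ((deriv ^^ 1) (\<lambda>t. F t x) t) \<le> fact 1 * B x / (r / 2) ^ 1"
    proof (rule Cauchy_inequality)
      show "(\<lambda>t. F t x) holomorphic_on ball t (r / 2)"
        by (rule holomorphic_on_subset[OF hol]) (use sub2 sub ball_subset_cball in blast)
      show "continuous_on (cball t (r / 2)) (\<lambda>t. F t x)"
        by (rule holomorphic_on_imp_continuous_on, rule holomorphic_on_subset[OF hol]) (use sub2 sub in blast)
      fix u assume "norm (t - u) = r / 2"
      then have "u \<in> cball t (r / 2)" by (simp add: dist_norm)
      then show "norm (F u x) \<le> B x" using sub2 bd by blast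
    qed (use r in auto)
    then show ?thesis by simp
  qed
  define D where "D = (\<lambda>x. deriv (\<lambda>t. F t x) t0)"
  have "((\<lambda>t. ((\<integral>x. F t x \<partial>M) - (\<integral>x. F t0 x \<partial>M)) / (t - t0)) \<longlongrightarrow> (\<integral>x. D x \<partial>M)) (at t0)"
    unfolding tendsto_at_iff_sequentially comp_def
  proof (intro allI impI)
    fix X :: "nat \<Rightarrow> complex" assume X0: "\<forall>i. X i \<in> UNIV - {t0}" and X: "X \<longlonglongrightarrow> t0"
    from X r have "\<forall>\<^sub>F n in sequentially. dist (X n) t0 < r / 2"
      by (intro tendstoD) auto
    then obtain n0 where n0: "\<And>n. n \<ge> n0 \<Longrightarrow> dist (X n) t0 < r / 2"
      by (auto simp: eventually_sequentially)
    define Y where "Y n = X (n + n0)" for n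
    have Y: "Y n \<noteq> t0" "Y n \<in> cball t0 (r / 2)" for n
      using X0 n0[of "n + n0"] by (auto simp: Y_def dist_commute less_imp_le)
    have Yc: "Y n \<in> cball t0 r" for n using Y(2)[of n] r by auto
    have Ylim: "Y \<longlonglongrightarrow> t0" unfolding Y_def by (rule LIMSEQ_ignore_initial_segment[OF X])
    define Q where "Q n x = (F (Y n) x - F t0 x) / (Y n - t0)" for n x
    have Qm [measurable]: "Q n \<in> borel_measurable M" for n
    proof -
      have "Y n \<in> S" using Yc[of n] sub by blast
      then have [measurable]: "F (Y n) \<in> borel_measurable M" "F t0 \<in> borel_measurable M"
        using t0 by (auto intro: meas)
      show ?thesis unfolding Q_def[abs_def] by measurable
    qed
    have Qlim: "(\<lambda>n. Q n x) \<longlonglongrightarrow> D x" for x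
    proof -
      have "((\<lambda>t. (F t x - F t0 x) / (t - t0)) \<longlongrightarrow> D x) (at t0)"
        using dF[OF t0, of x] unfolding D_def has_field_derivative_iff .
      then show ?thesis
        unfolding Q_def tendsto_at_iff_sequentially comp_def using Y(1) Ylim by auto
    qed
    have Dm: "D \<in> borel_measurable M"
      by (rule borel_measurable_LIMSEQ_metric[OF Qm]) (rule Qlim)
    have "(\<lambda>n. \<integral>x. Q n x \<partial>M) \<longlonglongrightarrow> (\<integral>x. D x \<partial>M)"
    proof (rule integral_dominated_convergence[where w = "\<lambda>x. B x / (r / 2)"])
      show "integrable M (\<lambda>x. B x / (r / 2))" using B by simp
      show "AE x in M. (\<lambda>n. Q n x) \<longlonglongrightarrow> D x" using Qlim by simp
      show "AE x in M. norm (Q n x) \<le> B x / (r / 2)" for n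
      proof (rule AE_I2)
        fix x
        have "norm (F (Y n) x - F t0 x) \<le> B x / (r / 2) * norm (Y n - t0)"
        proof (rule field_differentiable_bound)
          show "convex (cball t0 (r / 2))" by simp
          show "((\<lambda>t. F t x) has_field_derivative deriv (\<lambda>t. F t x) t) (at t within cball t0 (r / 2))"
            if "t \<in> cball t0 (r / 2)" for t
          proof -
            have "t \<in> S" using that sub r by auto
            then show ?thesis by (rule has_field_derivative_at_within[OF dF])
          qed
        qed (rule dbound Y(2) centre_in_cball[THEN iffD2] | assumption | (use r in simp))+
        then show "norm (Q n x) \<le> B x / (r / 2)"
          using Y(1)[of n] r by (simp add: Q_def norm_divide divide_simps)
      qed
    qed (use Dm in auto)
    moreover have "(\<integral>x. Q n x \<partial>M) = ((\<integral>x. F (Y n) x \<partial>M) - (\<integral>x. F t0 x \<partial>M)) / (Y n - t0)" for n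
      unfolding Q_def using Fi[OF Yc[of n]] Fi[OF t0c] by (simp add: Bochner_Integration.integral_diff)
    ultimately have "(\<lambda>n. ((\<integral>x. F (X (n + n0)) x \<partial>M) - (\<integral>x. F t0 x \<partial>M)) / (X (n + n0) - t0)) \<longlonglongrightarrow> (\<integral>x. D x \<partial>M)"
      by (simp add: Y_def)
    then show "(\<lambda>n. ((\<integral>x. F (X n) x \<partial>M) - (\<integral>x. F t0 x \<partial>M)) / (X n - t0)) \<longlonglongrightarrow> (\<integral>x. D x \<partial>M)"
      by (rule LIMSEQ_offset)
  qed
  then show "\<exists>f'. ((\<lambda>t. \<integral>x. F t x \<partial>M) has_field_derivative f') (at t0)"
    unfolding has_field_derivative_iff by blast
qed

section \<open>Binomial expansion of the beta integrand\<close>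

definition pcoef :: "complex \<Rightarrow> nat \<Rightarrow> complex" where
  "pcoef \<beta> l = pochhammer (1 - \<beta>) l / fact l"

text \<open>The coefficients of u^l * cnj u^l' in (1 - u)^(\<beta> - 1) (1 - cnj u)^(\<beta>' - 1),
  where \<beta> = (B + m)/2 and \<beta>' = (B - m)/2; \<open>pcoef\<close> gives those of a single
  factor.\<close>

definition bcoef :: "int \<Rightarrow> complex \<Rightarrow> nat \<times> nat \<Rightarrow> complex" where
  "bcoef m B = (\<lambda>(l, l'). pcoef ((B + of_int m) / 2) l * pcoef ((B - of_int m) / 2) l')"

lemma poch_series_sums:
  fixes \<beta> u :: complex
  assumes "norm u < 1"
  shows "(\<lambda>l. pcoef \<beta> l * u ^ l) sums ((1 - u) powr (\<beta> - 1))"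
proof -
  have "(\<lambda>l. ((\<beta> - 1) gchoose l) * (- u) ^ l) sums (1 + - u) powr (\<beta> - 1)"
    using assms by (intro gen_binomial_complex) simp
  moreover have "((\<beta> - 1) gchoose l) * (- u) ^ l = pcoef \<beta> l * u ^ l" for l
  proof -
    have "(- u) ^ l = (-1) ^ l * u ^ l" by (metis mult_minus1 power_mult_distrib)
    moreover have "((-1) ^ l * (-1) ^ l :: complex) = 1" by (simp add: power_mult_distrib[symmetric])
    ultimately show ?thesis by (simp add: gbinomial_pochhammer pcoef_def mult_ac)
  qed
  ultimately show ?thesis by simp
qed

lemma poch_series_summable:
  fixes \<beta> :: complex and r :: real
  assumes r: "0 \<le> r" "r < 1"
  shows "summable (\<lambda>l. norm (pcoef \<beta> l) * r ^ l)"
proof -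
  define s where "s = (1 + r) / 2"
  have s: "r < s" "s < 1" "0 < s" using r by (simp_all add: s_def)
  have "summable (\<lambda>l. pcoef \<beta> l * (of_real s :: complex) ^ l)"
    using poch_series_sums[of "of_real s" \<beta>] s by (auto simp: sums_iff)
  then have "summable (\<lambda>l. norm (pcoef \<beta> l * (of_real r :: complex) ^ l))"
    by (rule powser_insidea) (use r s in auto)
  then show ?thesis using r by (simp add: norm_mult norm_power)
qed

lemma integrable_count_space_prod:
  fixes f g :: "nat \<Rightarrow> 'b :: {banach, second_countable_topology, real_normed_field}"
  assumes "summable (\<lambda>l. norm (f l))" "summable (\<lambda>l. norm (g l))"
  shows "integrable (count_space UNIV) (\<lambda>(l, l'). f l * g l')"
    and "(\<integral>p. (case p of (l, l') \<Rightarrow> f l * g l') \<partial>count_space UNIV) = (\<Sum>l. f l) * (\<Sum>l. g l)"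
proof -
  interpret N: sigma_finite_measure "count_space (UNIV :: nat set)" by simp
  interpret P: pair_sigma_finite "count_space (UNIV :: nat set)" "count_space (UNIV :: nat set)" ..
  have cs: "count_space (UNIV :: nat set) \<Otimes>\<^sub>M count_space (UNIV :: nat set) = count_space UNIV"
    by (simp add: pair_measure_countable)
  have f: "integrable (count_space UNIV) f" and g: "integrable (count_space UNIV) g"
    using assms by (simp_all add: integrable_count_space_nat_iff)
  show i: "integrable (count_space UNIV) (\<lambda>(l, l'). f l * g l')"
    unfolding cs[symmetric]
  proof (rule P.Fubini_integrable)
    show "integrable (count_space UNIV) (\<lambda>l. \<integral>l'. norm (case (l, l') of (l, l') \<Rightarrow> f l * g l') \<partial>count_space UNIV)"
      using integrable_norm[OF f] by (simp add: norm_mult)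
    show "AE l in count_space UNIV. integrable (count_space UNIV) (\<lambda>l'. case (l, l') of (l, l') \<Rightarrow> f l * g l')"
      using g by simp
  qed (simp add: cs)
  have "(\<integral>p. (case p of (l, l') \<Rightarrow> f l * g l') \<partial>count_space UNIV) = (\<integral>l. (\<integral>l'. f l * g l' \<partial>count_space UNIV) \<partial>count_space UNIV)"
    using P.integral_fst'[of "\<lambda>(l, l'). f l * g l'"] i unfolding cs by simp
  also have "\<dots> = (\<integral>l. f l \<partial>count_space UNIV) * (\<integral>l'. g l' \<partial>count_space UNIV)" by simp
  also have "\<dots> = (\<Sum>l. f l) * (\<Sum>l. g l)"
    using f g by (simp add: integral_count_space_nat)
  finally show "(\<integral>p. (case p of (l, l') \<Rightarrow> f l * g l') \<partial>count_space UNIV) = (\<Sum>l. f l) * (\<Sum>l. g l)" .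
qed

text \<open>In the unit disc 1 - u stays in the right half-plane, off the cut of the logarithm.
  There the principal logarithms of 1 - u and 1 - cnj u are conjugate, so the product of the two
  powers is the single-valued one.\<close>

lemma qchar_powr:
  assumes "norm u < 1"
  shows "qchar m (B - 2) (1 - u) = (1 - u) powr ((B + of_int m) / 2 - 1) * (1 - cnj u) powr ((B - of_int m) / 2 - 1)"
proof -
  have re: "Re (1 - u) > 0" using assms complex_Re_le_cmod[of u] by simp
  then have nz: "1 - u \<noteq> 0" by auto
  have nn: "1 - u \<notin> \<real>\<^sub>\<le>\<^sub>0" using re by (auto simp: complex_nonpos_Reals_iff)
  have lc: "Ln (1 - cnj u) = cnj (Ln (1 - u))" using cnj_Ln[OF nn] by simp
  have L: "Ln (1 - u) = of_real (ln (norm (1 - u))) + \<i> * of_real (Arg (1 - u))" by (rule Ln_Arg[OF nz, unfolded of_real_Re])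
  have sg: "sgn (1 - u) = exp (\<i> * of_real (Arg (1 - u)))" using cis_Arg[OF nz] by (simp add: cis_conv_exp)
  have nz': "1 - cnj u \<noteq> 0" using nz by (metis complex_cnj_cancel_iff complex_cnj_diff complex_cnj_one complex_cnj_zero)
  define \<rho> \<theta> where "\<rho> = complex_of_real (ln (norm (1 - u)))" and "\<theta> = complex_of_real (Arg (1 - u))"
  have rc: "cnj \<rho> = \<rho>" "cnj \<theta> = \<theta>" by (simp_all add: \<rho>_def \<theta>_def)
  have "sgn (1 - u) powi m = exp (of_int m * (\<i> * \<theta>))"
    unfolding sg \<theta>_def[symmetric] by (rule exp_power_int)
  then have "qchar m (B - 2) (1 - u) = exp ((B - 2) * \<rho> + of_int m * (\<i> * \<theta>))"
    using nz by (simp add: qchar_def \<rho>_def exp_add)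
  moreover have "(1 - u) powr ((B + of_int m) / 2 - 1) * (1 - cnj u) powr ((B - of_int m) / 2 - 1)
     = exp (((B + of_int m) / 2 - 1) * (\<rho> + \<i> * \<theta>) + ((B - of_int m) / 2 - 1) * (\<rho> - \<i> * \<theta>))"
    using nz nz' by (simp add: powr_def lc L \<rho>_def[symmetric] \<theta>_def[symmetric] rc exp_add[symmetric])

  moreover have "((B + of_int m) / 2 - 1) * (\<rho> + \<i> * \<theta>) + ((B - of_int m) / 2 - 1) * (\<rho> - \<i> * \<theta>)
     = (B - 2) * \<rho> + of_int m * (\<i> * \<theta>)" by (simp add: field_simps)
  ultimately show ?thesis by simp
qed

lemma qchar_power_cnj:
  assumes "u \<noteq> 0"
  shows "u ^ l * cnj u ^ l' = qchar (int l - int l') (of_nat l + of_nat l') u"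
proof -
  have 1: "u ^ l = qchar (int l) (of_nat l) u" for l
  proof -
    have "exp (of_nat l * of_real (ln (norm u))) = complex_of_real (norm u) ^ l"
      using assms by (simp add: exp_of_nat_mult exp_of_real)
    then show ?thesis using assms
      by (simp add: qchar_def sgn_eq power_divide)
  qed
  have "cnj u ^ l' = cnj (qchar (int l') (of_nat l') u)" by (simp add: 1[symmetric])
  then have 2: "cnj u ^ l' = qchar (- int l') (of_nat l') u" by (simp add: qchar_cnj)
  show ?thesis unfolding 1 2 by (simp add: qchar_add[symmetric])
qed

lemma beta_expansion:
  assumes u: "norm u < 1" "u \<noteq> 0"
  shows "qchar m (B - 2) (1 - u) = (\<integral>p. bcoef m B p * qchar (int (fst p) - int (snd p)) (of_nat (fst p) + of_nat (snd p)) u \<partial>count_space UNIV)"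
proof -
  let ?\<beta> = "(B + of_int m) / 2" and ?\<beta>' = "(B - of_int m) / 2"
  let ?f = "\<lambda>l. pcoef ?\<beta> l * u ^ l" and ?g = "\<lambda>l. pcoef ?\<beta>' l * cnj u ^ l"
  have "(\<integral>p. (case p of (l, l') \<Rightarrow> ?f l * ?g l') \<partial>count_space UNIV) = (\<Sum>l. ?f l) * (\<Sum>l. ?g l)"
    using poch_series_summable[of "norm u" ?\<beta>] poch_series_summable[of "norm u" ?\<beta>'] u
    by (intro integrable_count_space_prod(2)) (simp_all add: norm_mult norm_power)
  also have "\<dots> = qchar m (B - 2) (1 - u)"
    using poch_series_sums[of u ?\<beta>] poch_series_sums[of "cnj u" ?\<beta>'] u
    by (simp add: qchar_powr sums_iff)
  finally show ?thesis
    by (subst qchar_power_cnj[OF u(2), symmetric]) (simp add: bcoef_def split_beta mult_ac)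
qed

lemma bcoef_summable:
  assumes r: "0 < r" "r < 1"
  shows "integrable (count_space UNIV) (\<lambda>p. norm (bcoef m B p) * exp ((real (fst p) + real (snd p)) * ln r))"
proof -
  let ?f = "\<lambda>b l. norm (pcoef b l) * r ^ l"
  have "integrable (count_space UNIV) (\<lambda>(l, l'). ?f ((B + of_int m) / 2) l * ?f ((B - of_int m) / 2) l')"
    using r poch_series_summable[of r] by (intro integrable_count_space_prod(1)) (simp_all add: norm_mult abs_mult)
  moreover have "(\<lambda>(l, l'). ?f ((B + of_int m) / 2) l * ?f ((B - of_int m) / 2) l')
      = (\<lambda>p. norm (bcoef m B p) * exp ((real (fst p) + real (snd p)) * ln r))"
  proof (rule ext)
    fix p :: "nat \<times> nat"
    have "exp ((real a + real b) * ln r) = r ^ a * r ^ b" for a b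
      using r by (simp add: distrib_right exp_add exp_of_nat_mult)
    then show "(case p of (l, l') \<Rightarrow> ?f ((B + of_int m) / 2) l * ?f ((B - of_int m) / 2) l')
      = norm (bcoef m B p) * exp ((real (fst p) + real (snd p)) * ln r)"
      by (simp add: bcoef_def split_beta norm_mult mult_ac)
  qed
  ultimately show ?thesis by (simp only:)
qed

section \<open>The finite part of the complex beta integral and its value\<close>

text \<open>\<open>bFP\<close> is the finite part of the complex beta integral; \<open>bsum\<close> is its contribution from
  \<open>norm x > c\<close>, up to sign.\<close>
definition bsum :: "int \<Rightarrow> complex \<Rightarrow> int \<Rightarrow> complex \<Rightarrow> real \<Rightarrow> complex" where
  "bsum n A m B c = (\<integral>p. (-1) powi m * bcoef m B p *
      haar_K (n + m + (int (snd p) - int (fst p))) (A + B - 2 + - (of_nat (fst p) + of_nat (snd p))) c \<partial>count_space UNIV)"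

definition bFP :: "int \<Rightarrow> complex \<Rightarrow> int \<Rightarrow> complex \<Rightarrow> real \<Rightarrow> complex" where
  "bFP n A m B c = (\<integral>x. indicator (cball 0 c) x * (qchar n A x * qchar m (B - 2) (1 - x)) \<partial>haar) - bsum n A m B c"

lemma beta_integrable_haar:
  assumes A: "Re A > 0" and B: "Re B > 0" and S: "S = UNIV \<and> Re A + Re B < 2 \<or> S = cball 0 c"
  shows "integrable haar (\<lambda>x. indicator S x * (qchar n A x * qchar m (B - 2) (1 - x)))"
proof -
  have [measurable]: "S \<in> sets borel" using S by auto
  have ae: "AE x in lborel. indicator S x * (qchar n (A - 2) x * qchar m (B - 2) (1 - x))
     = indicator S x * (qchar n A x * qchar m (B - 2) (1 - x)) / of_real ((norm x)\<^sup>2)"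
    using AE_lborel_singleton[of "0::complex"] by eventually_elim (simp add: qchar_shift2[symmetric])
  have "integrable lborel (\<lambda>x. indicator S x * (qchar n A x * qchar m (B - 2) (1 - x)) / of_real ((norm x)\<^sup>2))"
    by (rule integrable_cong_AE[OF _ _ ae, THEN iffD1]) (simp_all add: beta_integrable_lborel[OF A B S])
  then show ?thesis by (subst haar_integral_lborel(1)) simp_all
qed

text \<open>The integers are closed. The uniform gap bounds the denominators of
  \<open>haar_K\<close> simultaneously in all terms of a series.\<close>

lemma Ints_distance:
  assumes "z \<notin> (\<int> :: complex set)"
  shows "\<exists>\<delta>>0. \<forall>k::int. \<delta> \<le> norm (z + of_int k)"
proof -
  have "\<exists>\<delta>>0. \<forall>y\<in>(\<int> :: complex set). \<delta> \<le> dist z y"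
    using separate_point_closed[OF closed_Ints assms] by blast
  then obtain \<delta> where \<delta>: "\<delta> > 0" "\<And>y. y \<in> (\<int> :: complex set) \<Longrightarrow> \<delta> \<le> dist z y" by blast
  have "\<delta> \<le> norm (z + of_int k)" for k :: int
  proof -
    have "\<delta> \<le> dist z (- of_int k)" by (rule \<delta>(2)) simp
    then show ?thesis by (simp add: dist_norm)
  qed
  then show ?thesis using \<delta>(1) by blast
qed

text \<open>When the angular frequencies cancel, the radial exponent is twice a number congruent to
  \<open>\<alpha> + \<beta>\<close> modulo the integers.\<close>
lemma bsum_exponent:
  fixes A B :: complex
  assumes "n + m + (int (snd p) - int (fst p)) = 0"
  shows "A + B - 2 + - (of_nat (fst p) + of_nat (snd p))
    = 2 * ((A + of_int n) / 2 + (B + of_int m) / 2 + of_int (- 1 - int (fst p)))"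
proof -
  have "int (snd p) = int (fst p) - n - m" using assms by linarith
  then have "(of_int (int (snd p)) :: complex) = of_int (int (fst p) - n - m)" by (simp only:)
  then have e: "(of_nat (snd p) :: complex) = of_nat (fst p) - of_int n - of_int m" by simp
  show ?thesis unfolding e by (simp add: field_simps)
qed

lemma bcoef_summable_inverse:
  assumes c: "c > 1"
  shows "integrable (count_space UNIV) (\<lambda>p. norm (bcoef m B p) * exp (- (real (fst p) + real (snd p)) * ln c))"
proof -
  have eq: "(real (fst p) + real (snd p)) * ln (1 / c) = - (real (fst p) + real (snd p)) * ln c" for p :: "nat \<times> nat"
    using c by (simp add: ln_div algebra_simps)
  have "integrable (count_space UNIV) (\<lambda>p. norm (bcoef m B p) * exp ((real (fst p) + real (snd p)) * ln (1 / c)))"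
    by (rule bcoef_summable) (use c in auto)
  then show ?thesis unfolding eq .
qed

lemma bsum_integrable:
  assumes ni: "(A + of_int n) / 2 + (B + of_int m) / 2 \<notin> \<int>" and c: "c > 1"
  shows "integrable (count_space UNIV) (\<lambda>p. (-1) powi m * bcoef m B p *
      haar_K (n + m + (int (snd p) - int (fst p))) (A + B - 2 + - (of_nat (fst p) + of_nat (snd p))) c)"
proof -
  obtain \<delta> where \<delta>: "\<delta> > 0" "\<forall>k::int. \<delta> \<le> norm ((A + of_int n) / 2 + (B + of_int m) / 2 + of_int k)"
    using Ints_distance[OF ni] by blast
  show ?thesis
  proof (rule sum_haar_K_integrable[where \<delta> = \<delta>])
    show "integrable (count_space UNIV) (\<lambda>p. norm ((-1) powi m * bcoef m B p) * exp (Re (- (of_nat (fst p) + of_nat (snd p))) * ln c))"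
      using bcoef_summable_inverse[OF c] by (simp add: norm_mult norm_power_int)
    fix p :: "nat \<times> nat" assume "int (snd p) - int (fst p) = - (n + m)"
    then have e: "n + m + (int (snd p) - int (fst p)) = 0" by simp
    have "norm (- (of_nat (fst p) + of_nat (snd p)) + (A + B - 2))
      = 2 * norm ((A + of_int n) / 2 + (B + of_int m) / 2 + of_int (- 1 - int (fst p)))"
      using bsum_exponent[OF e, of A B] by (metis add.commute norm_mult norm_numeral)
    then show "\<delta> \<le> norm (- (of_nat (fst p) + of_nat (snd p)) + (A + B - 2))"
      using \<delta>(2)[rule_format, of "- 1 - int (fst p)"] \<delta>(1) by linarith
  qed (rule \<delta>(1))
qed

text \<open>With u = 1/x one has 1 - x = - (1 - u)/u. The sign contributes
  \<open>(-1) powi m\<close>, and the powers of u are turned back into powers of x.\<close>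

lemma beta_expansion_infinity:
  assumes x: "norm x > 1"
  shows "qchar n A x * qchar m (B - 2) (1 - x) = (\<integral>p. (-1) powi m * bcoef m B p *
      qchar (n + m + (int (snd p) - int (fst p))) (A + B - 2 + - (of_nat (fst p) + of_nat (snd p))) x \<partial>count_space UNIV)"
proof -
  define u where "u = inverse x"
  have x0: "x \<noteq> 0" using x by auto
  have u: "u \<noteq> 0" "norm u < 1" using x x0 by (auto simp: u_def norm_inverse norm_divide divide_simps)
  then have u1: "u \<noteq> 1" by auto
  have xu: "x = inverse u" by (simp add: u_def)
  have qu: "qchar N V u = qchar (- N) (- V) x" for N V
    unfolding u_def qchar_inverse[OF x0] qchar_minus ..
  have "qchar m (B - 2) (1 - x) = (-1) powi m * (qchar m (B - 2) (1 - u) * qchar (- m) (- (B - 2)) u)"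
    unfolding xu by (rule qchar_one_minus_inverse[OF u(1) u1])
  also have "qchar (- m) (- (B - 2)) u = qchar m (B - 2) x" unfolding qu by simp
  also have "qchar m (B - 2) (1 - u) = (\<integral>p. bcoef m B p * qchar (int (fst p) - int (snd p)) (of_nat (fst p) + of_nat (snd p)) u \<partial>count_space UNIV)"
    by (rule beta_expansion[OF u(2,1)])
  finally have "qchar n A x * qchar m (B - 2) (1 - x) = (qchar n A x * (-1) powi m * qchar m (B - 2) x) *
    (\<integral>p. bcoef m B p * qchar (int (fst p) - int (snd p)) (of_nat (fst p) + of_nat (snd p)) u \<partial>count_space UNIV)"
    by (simp only: mult_ac)
  also have "\<dots> = (\<integral>p. (qchar n A x * (-1) powi m * qchar m (B - 2) x) *
      (bcoef m B p * qchar (int (fst p) - int (snd p)) (of_nat (fst p) + of_nat (snd p)) u) \<partial>count_space UNIV)"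
    by (rule integral_mult_right_zero[symmetric])
  also have "\<dots> = (\<integral>p. (-1) powi m * bcoef m B p *
      qchar (n + m + (int (snd p) - int (fst p))) (A + B - 2 + - (of_nat (fst p) + of_nat (snd p))) x \<partial>count_space UNIV)"
  proof (intro Bochner_Integration.integral_cong refl)
    fix p :: "nat \<times> nat"
    have "qchar (n + m + (int (snd p) - int (fst p))) (A + B - 2 + - (of_nat (fst p) + of_nat (snd p))) x
      = qchar (n + m + (int (snd p) - int (fst p))) (A + (B - 2) + - (of_nat (fst p) + of_nat (snd p))) x"
      by (simp only: add_diff_eq)
    also have "\<dots> = qchar n A x * qchar m (B - 2) x * qchar (int (snd p) - int (fst p)) (- (of_nat (fst p) + of_nat (snd p))) x"
      by (simp only: qchar_add)
    also have "qchar (int (snd p) - int (fst p)) (- (of_nat (fst p) + of_nat (snd p))) x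
      = qchar (int (fst p) - int (snd p)) (of_nat (fst p) + of_nat (snd p)) u"
      unfolding qu by simp
    finally show "(qchar n A x * (-1) powi m * qchar m (B - 2) x) *
      (bcoef m B p * qchar (int (fst p) - int (snd p)) (of_nat (fst p) + of_nat (snd p)) u)
      = (-1) powi m * bcoef m B p *
      qchar (n + m + (int (snd p) - int (fst p))) (A + B - 2 + - (of_nat (fst p) + of_nat (snd p))) x"
      by (simp only: mult_ac)
  qed
  finally show ?thesis .
qed

text \<open>Where the integral converges at infinity, its part outside the disc can be integrated
  termwise and equals - \<open>bsum\<close>. There the finite part is the full integral.\<close>

lemma bFP_strip:
  assumes ni: "bnonint n A m B" and AB: "Re A > 0" "Re B > 0" "Re A + Re B < 2" and c: "c > 1"
  shows "bFP n A m B c = bval n A m B"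
proof -
  define f where "f x = qchar n A x * qchar m (B - 2) (1 - x)" for x
  have fi: "integrable haar f"
    using beta_integrable_haar[OF AB(1,2), of UNIV c n m] AB(3) by (simp add: f_def[abs_def])
  define h where "h p x = indicator (- cball 0 c) x * ((-1) powi m * bcoef m B p *
      qchar (n + m + (int (snd p) - int (fst p))) (A + B - 2 + - (of_nat (fst p) + of_nat (snd p))) x)" for p x
  have [measurable]: "h p \<in> borel_measurable haar" for p unfolding h_def[abs_def] by measurable
  have hb: "norm (h p x) \<le> norm (bcoef m B p) * exp (- (real (fst p) + real (snd p)) * ln c) *
     norm (indicator (- cball 0 c) x * qchar 0 (A + B - 2) x)" for p x
  proof (cases "x \<in> cball 0 c")
    case False
    then have "ln c \<le> ln (norm x)" using c by (intro ln_mono) auto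
    then have "- (real (fst p) + real (snd p)) * ln (norm x) \<le> - (real (fst p) + real (snd p)) * ln c"
      by (intro mult_left_mono_neg) auto
    then have "exp ((Re A + Re B - 2) * ln (norm x)) * exp (- (real (fst p) + real (snd p)) * ln (norm x))
      \<le> exp ((Re A + Re B - 2) * ln (norm x)) * exp (- (real (fst p) + real (snd p)) * ln c)"
      by simp
    then have "norm (bcoef m B p) * (exp ((Re A + Re B - 2) * ln (norm x)) * exp (- (real (fst p) + real (snd p)) * ln (norm x)))
      \<le> norm (bcoef m B p) * (exp ((Re A + Re B - 2) * ln (norm x)) * exp (- (real (fst p) + real (snd p)) * ln c))"
      by (rule mult_left_mono) simp
    moreover have "norm (qchar (n + m + (int (snd p) - int (fst p))) (A + B - 2 + - (of_nat (fst p) + of_nat (snd p))) x)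
       = exp ((Re A + Re B - 2) * ln (norm x)) * exp (- (real (fst p) + real (snd p)) * ln (norm x))"
      unfolding norm_qchar exp_add[symmetric] by (simp add: algebra_simps)
    ultimately show ?thesis using False
      by (simp add: h_def norm_mult norm_power_int norm_qchar mult_ac)
  qed (simp add: h_def)
  have bi: "integrable haar (\<lambda>x. norm (indicator (- cball 0 c) x * qchar 0 (A + B - 2) x))"
    by (intro integrable_norm qchar_outside_cball(1)) (use AB c in auto)
  note swap = integral_sum_swap[OF haar.sigma_finite_measure_axioms, of h, OF _ AE_I2[OF hb] bcoef_summable_inverse[OF c] bi]
  have hi: "(\<integral>x. h p x \<partial>haar) = - ((-1) powi m * bcoef m B p *
      haar_K (n + m + (int (snd p) - int (fst p))) (A + B - 2 + - (of_nat (fst p) + of_nat (snd p))) c)" for p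
  proof -
    have "h p = (\<lambda>x. (-1) powi m * bcoef m B p * (indicator (- cball 0 c) x *
      qchar (n + m + (int (snd p) - int (fst p))) (A + B - 2 + - (of_nat (fst p) + of_nat (snd p))) x))"
      by (simp add: h_def fun_eq_iff)
    then have "(\<integral>x. h p x \<partial>haar) = (-1) powi m * bcoef m B p * (\<integral>x. indicator (- cball 0 c) x *
      qchar (n + m + (int (snd p) - int (fst p))) (A + B - 2 + - (of_nat (fst p) + of_nat (snd p))) x \<partial>haar)"
      by (simp only: integral_mult_right_zero)
    also have "(\<integral>x. indicator (- cball 0 c) x *
      qchar (n + m + (int (snd p) - int (fst p))) (A + B - 2 + - (of_nat (fst p) + of_nat (snd p))) x \<partial>haar)
      = - haar_K (n + m + (int (snd p) - int (fst p))) (A + B - 2 + - (of_nat (fst p) + of_nat (snd p))) c"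
      by (rule qchar_outside_cball(2)) (use AB c in auto)
    finally show ?thesis by (simp only: mult_minus_right)
  qed
  have "(\<integral>x. indicator (- cball 0 c) x * f x \<partial>haar) = (\<integral>x. (\<integral>p. h p x \<partial>count_space UNIV) \<partial>haar)"
  proof (intro Bochner_Integration.integral_cong refl)
    fix x
    show "indicator (- cball 0 c) x * f x = (\<integral>p. h p x \<partial>count_space UNIV)"
    proof (cases "x \<in> cball 0 c")
      case False
      then have "norm x > 1" using c by auto
      then show ?thesis using False beta_expansion_infinity[of x n A m B] by (simp add: h_def f_def)
    qed (simp add: h_def)
  qed
  also have "\<dots> = (\<integral>p. (\<integral>x. h p x \<partial>haar) \<partial>count_space UNIV)" by (rule swap(1)) simp
  also have "\<dots> = - bsum n A m B c" unfolding hi bsum_def by (rule Bochner_Integration.integral_minus)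
  finally have out: "(\<integral>x. indicator (- cball 0 c) x * f x \<partial>haar) = - bsum n A m B c" .
  have "bval n A m B = (\<integral>x. f x \<partial>haar)"
    using complex_beta[OF ni AB] by (simp add: bint_haar f_def)
  also have "\<dots> = (\<integral>x. indicator (cball 0 c) x * f x + indicator (- cball 0 c) x * f x \<partial>haar)"
    by (intro Bochner_Integration.integral_cong) (auto simp: indicator_def)
  also have "\<dots> = (\<integral>x. indicator (cball 0 c) x * f x \<partial>haar) + (\<integral>x. indicator (- cball 0 c) x * f x \<partial>haar)"
    by (rule Bochner_Integration.integral_add; rule Bochner_Integration.integrable_bound[OF fi])
       (auto simp: indicator_def f_def[abs_def])
  finally have "bval n A m B = (\<integral>x. indicator (cball 0 c) x * f x \<partial>haar) + - bsum n A m B c"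
    unfolding out .
  then show ?thesis unfolding bFP_def f_def by simp
qed

text \<open>The right half-plane without the values of A excluded by \<open>bnonint\<close>. The
  removed set is closed and countable, so the domain is open and still connected, as analytic
  continuation requires.\<close>

definition bdom :: "int \<Rightarrow> int \<Rightarrow> complex \<Rightarrow> complex set" where
  "bdom n m B = {A. Re A > 0} - {A. (A + of_int n) / 2 \<in> \<int> \<or> (A + of_int n) / 2 + (B + of_int m) / 2 \<in> \<int>}"

lemma bdom_open: "open (bdom n m B)"
proof -
  have "closed ((\<lambda>A. (A + of_int n) / 2) -` \<int> \<union> (\<lambda>A. (A + of_int n) / 2 + (B + of_int m) / 2) -` (\<int> :: complex set))"
    by (intro closed_Un continuous_closed_vimage closed_Ints) (auto intro!: continuous_intros)
  then have "closed {A. (A + of_int n) / 2 \<in> \<int> \<or> (A + of_int n) / 2 + (B + of_int m) / 2 \<in> \<int>}"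
    by (simp add: vimage_def Collect_disj_eq)
  then show ?thesis unfolding bdom_def
    by (intro open_Diff open_halfspace_Re_gt)
qed

lemma bdom_connected: "connected (bdom n m B)"
proof -
  have cI: "countable (\<int> :: complex set)" by (simp add: Ints_def countable_image)
  have "{A. (A + of_int n) / 2 \<in> \<int> \<or> (A + of_int n) / 2 + (B + of_int m) / 2 \<in> \<int>}
     \<subseteq> (\<lambda>k. 2 * k - of_int n) ` \<int> \<union> (\<lambda>k. 2 * k - of_int n - (B + of_int m)) ` \<int>"
  proof
    fix A assume "A \<in> {A. (A + of_int n) / 2 \<in> \<int> \<or> (A + of_int n) / 2 + (B + of_int m) / 2 \<in> \<int>}"
    moreover have "A = 2 * ((A + of_int n) / 2) - of_int n"
      "A = 2 * ((A + of_int n) / 2 + (B + of_int m) / 2) - of_int n - (B + of_int m)" by (simp_all add: field_simps)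
    ultimately show "A \<in> (\<lambda>k. 2 * k - of_int n) ` \<int> \<union> (\<lambda>k. 2 * k - of_int n - (B + of_int m)) ` \<int>" by blast
  qed
  then have "countable {A. (A + of_int n) / 2 \<in> \<int> \<or> (A + of_int n) / 2 + (B + of_int m) / 2 \<in> \<int>}"
    by (rule countable_subset) (intro countable_Un countable_image cI)
  then show ?thesis unfolding bdom_def
    by (intro path_connected_imp_connected path_connected_open_diff_countable open_halfspace_Re_gt convex_connected convex_halfspace_Re_gt)
       simp_all
qed

lemma bnonint_bdom: "A \<in> bdom n m B \<Longrightarrow> (B + of_int m) / 2 \<notin> \<int> \<Longrightarrow> bnonint n A m B"
  by (simp add: bdom_def bnonint_def)

lemma bval_holomorphic:
  assumes B: "(B + of_int m) / 2 \<notin> \<int>"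
  shows "(\<lambda>A. bval n A m B) holomorphic_on bdom n m B"
proof -
  have ni: "(A + of_int n) / 2 \<notin> \<int>" "(A + of_int n) / 2 + (B + of_int m) / 2 \<notin> \<int>"
    "(A - of_int n) / 2 \<notin> \<int>" "(A - of_int n) / 2 + (B - of_int m) / 2 \<notin> \<int>" if "A \<in> bdom n m B" for A
  proof -
    show 1: "(A + of_int n) / 2 \<notin> \<int>" and 2: "(A + of_int n) / 2 + (B + of_int m) / 2 \<notin> \<int>"
      using that by (simp_all add: bdom_def)
    show "(A - of_int n) / 2 \<notin> \<int>" unfolding half_diff Ints_diff_of_int_iff by (rule 1)
    have "(A - of_int n) / 2 + (B - of_int m) / 2 = (A + of_int n) / 2 + (B + of_int m) / 2 - of_int (n + m)"
      by (simp add: field_simps)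
    then show "(A - of_int n) / 2 + (B - of_int m) / 2 \<notin> \<int>" using 2 by (simp only: Ints_diff_of_int_iff not_False_eq_True)
  qed
  have np: "z \<notin> \<int> \<Longrightarrow> z \<notin> \<int>\<^sub>\<le>\<^sub>0" for z :: complex using nonpos_Ints_Int by blast
  show ?thesis
    unfolding bval_def fB_def
    by (intro holomorphic_intros np ni Gamma_nonint sin_pi_nonzero) simp_all
qed

lemma beta_ball_holomorphic:
  assumes B: "Re B > 0"
  shows "(\<lambda>A. \<integral>x. indicator (cball 0 c) x * (qchar n A x * qchar m (B - 2) (1 - x)) \<partial>haar) holomorphic_on {A. Re A > 0}"
proof (rule holomorphic_parametric_integral)
  show "open {A::complex. Re A > 0}" by (rule open_halfspace_Re_gt)
  show "(\<lambda>x. indicator (cball 0 c) x * (qchar n A x * qchar m (B - 2) (1 - x))) \<in> borel_measurable haar" for A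
    by measurable
  show "(\<lambda>A. indicator (cball 0 c) x * (qchar n A x * qchar m (B - 2) (1 - x))) holomorphic_on {A. Re A > 0}" for x
    unfolding qchar_def by (intro holomorphic_intros)
  fix A0 :: complex assume "A0 \<in> {A. Re A > 0}"
  then have A0: "Re A0 > 0" by simp
  define r where "r = Re A0 / 2"
  have r: "r > 0" using A0 by (simp add: r_def)
  \<comment> \<open>On the closed disc of radius r about A0 = A the real part lies between r and 3
    r. The lower bound controls the integrand where \<open>ln (norm x)\<close> is negative, the
    upper bound where it is not.\<close>
  define D where "D x = norm (indicator (cball 0 c) x * (qchar n (of_real r) x * qchar m (B - 2) (1 - x)))
     + norm (indicator (cball 0 c) x * (qchar n (of_real (3 * r)) x * qchar m (B - 2) (1 - x)))" for x
  have "integrable haar D" unfolding D_def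
    by (intro Bochner_Integration.integrable_add integrable_norm beta_integrable_haar[OF _ B]) (use r in auto)
  moreover have re: "r \<le> Re A" "Re A \<le> 3 * r" if "A \<in> cball A0 r" for A
    using that abs_Re_le_cmod[of "A0 - A"] by (auto simp: dist_norm r_def)
  then have "cball A0 r \<subseteq> {A. Re A > 0}" using r by fastforce
  moreover have "norm (indicator (cball 0 c) x * (qchar n A x * qchar m (B - 2) (1 - x))) \<le> D x" if A: "A \<in> cball A0 r" for A x
  proof -
    have "exp (Re A * ln (norm x)) \<le> exp (r * ln (norm x)) + exp (3 * r * ln (norm x))"
    proof (cases "ln (norm x) \<ge> 0")
      case True
      then have "exp (Re A * ln (norm x)) \<le> exp (3 * r * ln (norm x))" using re[OF A] by (simp add: mult_right_mono)
      then show ?thesis by (simp add: add_increasing)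
    next
      case False
      then have "exp (Re A * ln (norm x)) \<le> exp (r * ln (norm x))" using re[OF A] by (simp add: mult_right_mono_neg)
      then show ?thesis by (simp add: add_increasing2)
    qed
    then have "norm (indicator (cball 0 c) x * qchar m (B - 2) (1 - x)) * exp (Re A * ln (norm x))
       \<le> norm (indicator (cball 0 c) x * qchar m (B - 2) (1 - x)) * (exp (r * ln (norm x)) + exp (3 * r * ln (norm x)))"
      by (rule mult_left_mono) simp
    then show ?thesis by (simp add: D_def norm_mult norm_qchar distrib_left mult_ac)
  qed
  ultimately show "\<exists>r>0. \<exists>D. cball A0 r \<subseteq> {A. Re A > 0} \<and> integrable haar D \<and>
     (\<forall>A\<in>cball A0 r. \<forall>x. norm (indicator (cball 0 c) x * (qchar n A x * qchar m (B - 2) (1 - x))) \<le> D x)"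
    using r by blast
qed

lemma bsum_holomorphic:
  assumes c: "c > 1"
  shows "(\<lambda>A. bsum n A m B c) holomorphic_on bdom n m B"
  unfolding bsum_def
proof (rule holomorphic_parametric_integral)
  show "open (bdom n m B)" by (rule bdom_open)
  let ?F = "\<lambda>A p. (-1) powi m * bcoef m B p *
      haar_K (n + m + (int (snd p) - int (fst p))) (A + B - 2 + - (of_nat (fst p) + of_nat (snd p))) c"
  show "?F A \<in> borel_measurable (count_space UNIV)" for A by simp
  have dist: "\<exists>\<delta>>0. \<forall>p. n + m + (int (snd p) - int (fst p)) = 0 \<longrightarrow> 2 * \<delta> \<le> norm (A + B - 2 + - (of_nat (fst p) + of_nat (snd p)))"
    if A: "A \<in> bdom n m B" for A
  proof -
    have "(A + of_int n) / 2 + (B + of_int m) / 2 \<notin> \<int>" using A by (simp add: bdom_def)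
    then obtain \<delta> where \<delta>: "\<delta> > 0" "\<forall>k::int. \<delta> \<le> norm ((A + of_int n) / 2 + (B + of_int m) / 2 + of_int k)"
      using Ints_distance by blast
    have "2 * \<delta> \<le> norm (A + B - 2 + - (of_nat (fst p) + of_nat (snd p)))"
      if "n + m + (int (snd p) - int (fst p)) = 0" for p
      unfolding bsum_exponent[OF that] norm_mult using \<delta>(2)[rule_format, of "- 1 - int (fst p)"] by simp
    then show ?thesis using \<delta>(1) by blast
  qed
  show "(\<lambda>A. ?F A p) holomorphic_on bdom n m B" for p
  proof (cases "n + m + (int (snd p) - int (fst p)) = 0")
    case True
    have ne: "A + B - 2 + - (of_nat (fst p) + of_nat (snd p)) \<noteq> 0" if "A \<in> bdom n m B" for A
      using dist[OF that] True by fastforce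
    have "(\<lambda>A. (-1) powi m * bcoef m B p * (2 * of_real pi * exp ((A + B - 2 + - (of_nat (fst p) + of_nat (snd p))) * of_real (ln c))
        / (A + B - 2 + - (of_nat (fst p) + of_nat (snd p))))) holomorphic_on bdom n m B"
      by (intro holomorphic_intros) (rule ne)
    then show ?thesis unfolding haar_K_def True by (simp only: if_True refl)
  qed (simp add: haar_K_def)
  fix A0 assume A0: "A0 \<in> bdom n m B"
  obtain \<delta> where \<delta>: "\<delta> > 0" "\<And>p. n + m + (int (snd p) - int (fst p)) = 0 \<Longrightarrow> 2 * \<delta> \<le> norm (A0 + B - 2 + - (of_nat (fst p) + of_nat (snd p)))"
    using dist[OF A0] by blast
  obtain r1 where r1: "r1 > 0" "cball A0 r1 \<subseteq> bdom n m B"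
    using bdom_open A0 open_contains_cball by blast
  \<comment> \<open>At A0 the denominators have modulus at least 2 \<delta>. Moving A by at most
    \<delta> leaves half of that, uniformly over all terms.\<close>
  define r where "r = min r1 \<delta>"
  have r: "r > 0" "r \<le> \<delta>" "cball A0 r \<subseteq> bdom n m B" using r1 \<delta>(1) by (auto simp: r_def)
  define D where "D p = norm (bcoef m B p) * exp (- (real (fst p) + real (snd p)) * ln c) * (2 * pi * exp ((Re A0 + r + Re B - 2) * ln c) / \<delta>)" for p
  have "integrable (count_space UNIV) D" unfolding D_def
    by (intro integrable_mult_left bcoef_summable_inverse c)
  moreover have "norm (?F A p) \<le> D p" if A: "A \<in> cball A0 r" for A p
  proof (cases "n + m + (int (snd p) - int (fst p)) = 0")
    case True
    let ?W = "\<lambda>A. A + B - 2 + - (of_nat (fst p) + of_nat (snd p))"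
    have We: "?W A0 = ?W A + (A0 - A)" by simp
    have "norm (?W A0) \<le> norm (?W A) + norm (A0 - A)" unfolding We by (rule norm_triangle_ineq)
    then have w: "\<delta> \<le> norm (?W A)" using \<delta>(2)[OF True] r(2) A by (simp add: dist_norm)
    have "Re A \<le> Re A0 + r" using A abs_Re_le_cmod[of "A0 - A"] by (auto simp: dist_norm)
    then have "Re (?W A) * ln c \<le> (Re A0 + r + Re B - 2 + - (real (fst p) + real (snd p))) * ln c"
      using c by (intro mult_right_mono) auto
    then have "exp (Re (?W A) * ln c) \<le> exp ((Re A0 + r + Re B - 2) * ln c) * exp (- (real (fst p) + real (snd p)) * ln c)"
      by (simp only: exp_add[symmetric] exp_le_cancel_iff distrib_right)
    then have "exp (Re (?W A) * ln c) / norm (?W A) \<le> exp ((Re A0 + r + Re B - 2) * ln c) * exp (- (real (fst p) + real (snd p)) * ln c) / \<delta>"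
      using w \<delta>(1) by (intro frac_le) auto
    then have "norm (bcoef m B p) * (2 * pi) * (exp (Re (?W A) * ln c) / norm (?W A))
       \<le> norm (bcoef m B p) * (2 * pi) * (exp ((Re A0 + r + Re B - 2) * ln c) * exp (- (real (fst p) + real (snd p)) * ln c) / \<delta>)"
      by (rule mult_left_mono) simp
    moreover have "norm (?F A p) = norm (bcoef m B p) * (2 * pi) * (exp (Re (?W A) * ln c) / norm (?W A))"
      unfolding norm_mult norm_haar_K True by (simp add: norm_power_int)
    ultimately show ?thesis by (simp only: D_def) (simp add: mult_ac)
  next
    case False
    then have "?F A p = 0" by (simp add: haar_K_def)
    then have z: "norm (?F A p) = 0" by (simp only: norm_zero)
    show ?thesis unfolding z using \<delta>(1) by (simp add: D_def)
  qed
  ultimately show "\<exists>r>0. \<exists>D. cball A0 r \<subseteq> bdom n m B \<and> integrable (count_space UNIV) D \<and>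
     (\<forall>A\<in>cball A0 r. \<forall>p. norm (?F A p) \<le> D p)"
    using r by blast
qed

text \<open>Analytic continuation in A from the strip 0 < Re A < 2 - Re B, which is nonempty since
  Re B < 2, to the right half-plane.\<close>

lemma bFP_small_B:
  assumes ni: "bnonint n A m B" and A: "Re A > 0" and B: "0 < Re B" "Re B < 2" and c: "c > 1"
  shows "bFP n A m B c = bval n A m B"
proof -
  have Bn: "(B + of_int m) / 2 \<notin> \<int>" using ni by (simp add: bnonint_def)
  let ?s = "bdom n m B \<inter> {A. Re A < 2 - Re B}"
  show ?thesis
  proof (rule analytic_continuation_open[of ?s "bdom n m B" "\<lambda>A. bFP n A m B c" "\<lambda>A. bval n A m B"])
    show "open ?s" by (intro open_Int bdom_open open_halfspace_Re_lt)
    show "open (bdom n m B)" "connected (bdom n m B)" by (rule bdom_open, rule bdom_connected)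
    show "A \<in> bdom n m B" using ni A by (simp add: bdom_def bnonint_def)
    show "(\<lambda>A. bval n A m B) holomorphic_on bdom n m B" by (rule bval_holomorphic[OF Bn])
    have "bdom n m B \<subseteq> {A. Re A > 0}" by (auto simp: bdom_def)
    then show "(\<lambda>A. bFP n A m B c) holomorphic_on bdom n m B"
      unfolding bFP_def by (intro holomorphic_on_diff bsum_holomorphic c holomorphic_on_subset[OF beta_ball_holomorphic] B(1))
    show "?s \<noteq> {}"
    proof -
      \<comment> \<open>The imaginary part is chosen so that neither \<alpha> nor \<alpha> + \<beta>
        is real, whatever the sign of \<open>Im B\<close>.\<close>
      define A1 where "A1 = Complex ((2 - Re B) / 2) (1 + \<bar>Im B\<bar>)"
      have nI: "z \<notin> \<int>" if "Im z \<noteq> 0" for z using that by (auto elim!: Ints_cases)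
      have pos: "0 < 1 + \<bar>Im B\<bar> + Im B" by (simp add: abs_if)
      have "Im ((A1 + of_int n) / 2) \<noteq> 0" by (simp add: A1_def)
      moreover have "Im ((A1 + of_int n) / 2 + (B + of_int m) / 2) \<noteq> 0"
      proof -
        have e: "Im ((A1 + of_int n) / 2 + (B + of_int m) / 2) = (1 + \<bar>Im B\<bar> + Im B) / 2"
          by (simp add: A1_def add_divide_distrib)
        show ?thesis unfolding e using pos by (metis divide_eq_0_iff less_irrefl zero_neq_numeral)
      qed
      ultimately have "A1 \<in> ?s" unfolding bdom_def using B nI by (simp add: A1_def)
      then show ?thesis by blast
    qed
    fix z assume "z \<in> ?s"
    then show "bFP n z m B c = bval n z m B"
      using B c Bn by (intro bFP_strip bnonint_bdom) (auto simp: bdom_def)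
  qed auto
qed

text \<open>Reindexing along an injection off whose range the terms vanish: it covers both index
  shifts and the passage from triples to pairs with fixed first component.\<close>

lemma integral_count_space_inj:
  fixes F :: "'b \<Rightarrow> 'c :: {banach, second_countable_topology}" and \<phi> :: "'a \<Rightarrow> 'b"
  assumes inj: "inj \<phi>" and 0: "\<And>y. y \<notin> range \<phi> \<Longrightarrow> F y = 0"
  shows "integrable (count_space UNIV) F \<longleftrightarrow> integrable (count_space UNIV) (\<lambda>x. F (\<phi> x))"
    and "(\<integral>y. F y \<partial>count_space UNIV) = (\<integral>x. F (\<phi> x) \<partial>count_space UNIV)"
proof -
  have b: "bij_betw \<phi> UNIV (range \<phi>)" using inj by (simp add: bij_betw_def)
  have "integrable (count_space UNIV) F \<longleftrightarrow> integrable (count_space (range \<phi>)) F"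
    by (fold Infinite_Set_Sum.abs_summable_on_def, rule Infinite_Set_Sum.abs_summable_on_cong_neutral) (use 0 in auto)
  also have "\<dots> \<longleftrightarrow> integrable (count_space UNIV) (\<lambda>x. F (\<phi> x))"
    by (fold Infinite_Set_Sum.abs_summable_on_def, rule Infinite_Set_Sum.abs_summable_on_reindex_bij_betw[OF b, symmetric])
  finally show "integrable (count_space UNIV) F \<longleftrightarrow> integrable (count_space UNIV) (\<lambda>x. F (\<phi> x))" .
  have "infsetsum F UNIV = infsetsum F (range \<phi>)"
    by (rule infsetsum_cong_neutral) (use 0 in auto)
  also have "\<dots> = infsetsum (\<lambda>x. F (\<phi> x)) UNIV"
    by (rule infsetsum_reindex_bij_betw[OF b, symmetric])
  finally show "(\<integral>y. F y \<partial>count_space UNIV) = (\<integral>x. F (\<phi> x) \<partial>count_space UNIV)"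
    unfolding infsetsum_def .
qed

lemma pcoef_Suc: "pcoef (\<beta> + 1) (Suc l) = pcoef \<beta> (Suc l) - pcoef \<beta> l"
proof -
  have 1: "pochhammer (1 - (\<beta> + 1)) (Suc l) = - \<beta> * pochhammer (1 - \<beta>) l"
    by (simp add: pochhammer_rec)
  have 2: "pochhammer (1 - \<beta>) (Suc l) = pochhammer (1 - \<beta>) l * (1 - \<beta> + of_nat l)"
    by (rule pochhammer_Suc)
  have "pcoef (\<beta> + 1) (Suc l) * fact (Suc l) = (pcoef \<beta> (Suc l) - pcoef \<beta> l) * fact (Suc l)"
    unfolding pcoef_def 1 2 by (simp add: field_simps del: of_nat_Suc) (simp add: algebra_simps)
  then show ?thesis unfolding mult_right_cancel[OF fact_nonzero] .
qed

text \<open>Raising m and B together by 1 raises \<beta> by 1 and leaves \<beta>' alone, which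
  multiplies the generating function by 1 - u.\<close>

lemma bcoef_rec:
  "bcoef (m + 1) (B + 1) p = bcoef m B p - (if fst p = 0 then 0 else bcoef m B (fst p - 1, snd p))"
proof -
  have e: "(B + 1 + of_int (m + 1)) / 2 = (B + of_int m) / 2 + 1" "(B + 1 - of_int (m + 1)) / 2 = (B - of_int m) / 2"
    by (simp_all add: field_simps)
  obtain l l' where p: "p = (l, l')" by (cases p)
  show ?thesis
  proof (cases l)
    case 0
    then show ?thesis unfolding p bcoef_def split_conv e by (simp add: pcoef_def)
  next
    case (Suc k)
    show ?thesis unfolding p bcoef_def split_conv e Suc pcoef_Suc by (simp add: left_diff_distrib)
  qed
qed

text \<open>In \<open>bcoef_rec\<close> the unshifted coefficient belongs to the exponent A + 1 and
  the shifted one, after reindexing l, to A. The additional sign in \<open>(-1) powi (m + 1)\<close>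
  arranges them as in the conclusion.\<close>

lemma bsum_rec:
  assumes ni: "(A + of_int n) / 2 + (B + of_int m) / 2 \<notin> \<int>" and c: "c > 1"
  shows "bsum n A (m + 1) (B + 1) c = bsum n A m B c - bsum (n + 1) (A + 1) m B c"
proof -
  let ?N = "count_space UNIV :: (nat \<times> nat) measure"
  have sg: "(-1 :: complex) powi (m + 1) = - ((-1) powi m)" by (simp add: power_int_add)
  define h where "h p = (-1) powi m * bcoef m B p *
      haar_K (n + m + (int (snd p) - int (fst p))) (A + B - 2 + - (of_nat (fst p) + of_nat (snd p))) c" for p
  define h1 where "h1 p = (-1) powi m * bcoef m B p *
      haar_K (n + 1 + m + (int (snd p) - int (fst p))) (A + 1 + B - 2 + - (of_nat (fst p) + of_nat (snd p))) c" for p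
  define hs where "hs p = (if fst p = 0 then 0 else h (fst p - 1, snd p))" for p
  have hi: "integrable ?N h" unfolding h_def by (rule bsum_integrable[OF ni c])
  have "(A + 1 + of_int (n + 1)) / 2 + (B + of_int m) / 2 = (A + of_int n) / 2 + (B + of_int m) / 2 + of_int 1"
    by (simp add: field_simps)
  then have ni1: "(A + 1 + of_int (n + 1)) / 2 + (B + of_int m) / 2 \<notin> \<int>"
    using ni by (metis add_diff_cancel_right' Ints_diff_of_int_iff)
  have h1i: "integrable ?N h1" unfolding h1_def by (rule bsum_integrable[OF ni1 c])
  have inj: "inj (apfst Suc :: nat \<times> nat \<Rightarrow> nat \<times> nat)" by (auto simp: inj_def)
  have out: "hs p = 0" if "p \<notin> range (apfst Suc)" for p
  proof (cases "fst p")
    case (Suc k)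
    then have "p = apfst Suc (k, snd p)" by (cases p) simp
    with that show ?thesis by (metis rangeI)
  qed (simp add: hs_def)
  have hsS: "(\<lambda>p. hs (apfst Suc p)) = h" by (auto simp: hs_def fun_eq_iff)
  have hsi: "integrable ?N hs" using integral_count_space_inj(1)[of _ hs, OF inj out] hi by (simp add: hsS)
  have "(\<integral>p. hs p \<partial>?N) = (\<integral>p. hs (apfst Suc p) \<partial>?N)"
    by (rule integral_count_space_inj(2)[OF inj out])
  also have "\<dots> = (\<integral>p. h p \<partial>?N)" by (simp only: hsS)
  also have "\<dots> = bsum n A m B c" by (simp only: h_def bsum_def)
  finally have hsv: "(\<integral>p. hs p \<partial>?N) = bsum n A m B c" .
  have "bsum n A (m + 1) (B + 1) c = (\<integral>p. hs p - h1 p \<partial>?N)"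
    unfolding bsum_def
  proof (intro Bochner_Integration.integral_cong refl)
    fix p :: "nat \<times> nat"
    have e: "n + (m + 1) + (int (snd p) - int (fst p)) = n + 1 + m + (int (snd p) - int (fst p))"
      "A + (B + 1) - 2 + - (of_nat (fst p) + of_nat (snd p)) = A + 1 + B - 2 + - (of_nat (fst p) + of_nat (snd p))"
      by simp_all
    have "fst p \<noteq> 0 \<Longrightarrow> haar_K (n + m + (int (snd p) - int (fst p - 1))) (A + B - 2 + - (of_nat (fst p - 1) + of_nat (snd p))) c
       = haar_K (n + 1 + m + (int (snd p) - int (fst p))) (A + 1 + B - 2 + - (of_nat (fst p) + of_nat (snd p))) c"
      by (intro arg_cong2[where f = "\<lambda>n w. haar_K n w c"]) (simp_all add: of_nat_diff)
    then show "(-1) powi (m + 1) * bcoef (m + 1) (B + 1) p * haar_K (n + (m + 1) + (int (snd p) - int (fst p)))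
        (A + (B + 1) - 2 + - (of_nat (fst p) + of_nat (snd p))) c = hs p - h1 p"
      unfolding sg e bcoef_rec hs_def h_def h1_def
      by (cases "fst p = 0") (simp_all add: algebra_simps)
  qed
  also have "\<dots> = bsum n A m B c - bsum (n + 1) (A + 1) m B c"
  proof -
    have "(\<integral>p. h1 p \<partial>?N) = bsum (n + 1) (A + 1) m B c" by (simp only: h1_def bsum_def)
    then show ?thesis by (subst Bochner_Integration.integral_diff[OF hsi h1i]) (simp only: hsv)
  qed
  finally show ?thesis .
qed

lemma qchar_1_1: "x \<noteq> 0 \<Longrightarrow> qchar 1 1 x = x"
  using qchar_power_cnj[of x 1 0] by simp

text \<open>Comes from multiplying the integrand by 1 - x: a factor 1 - x raises m and B by 1, and a
  factor x raises n and A by 1.\<close>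

lemma bFP_rec:
  assumes ni: "(A + of_int n) / 2 + (B + of_int m) / 2 \<notin> \<int>" and AB: "Re A > 0" "Re B > 0" and c: "c > 1"
  shows "bFP n A (m + 1) (B + 1) c = bFP n A m B c - bFP (n + 1) (A + 1) m B c"
proof -
  have "(\<integral>x. indicator (cball 0 c) x * (qchar n A x * qchar (m + 1) (B + 1 - 2) (1 - x)) \<partial>haar)
    = (\<integral>x. indicator (cball 0 c) x * (qchar n A x * qchar m (B - 2) (1 - x))
        - indicator (cball 0 c) x * (qchar (n + 1) (A + 1) x * qchar m (B - 2) (1 - x)) \<partial>haar)"
  proof (rule integral_cong_AE)
    show "AE x in haar. indicator (cball 0 c) x * (qchar n A x * qchar (m + 1) (B + 1 - 2) (1 - x))
      = indicator (cball 0 c) x * (qchar n A x * qchar m (B - 2) (1 - x))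
        - indicator (cball 0 c) x * (qchar (n + 1) (A + 1) x * qchar m (B - 2) (1 - x))"
      using haar_ne_1
    proof eventually_elim
      case (elim x)
      have e1: "qchar (m + 1) (B - 2 + 1) (1 - x) = qchar m (B - 2) (1 - x) * (1 - x)"
        unfolding qchar_add using elim by (simp add: qchar_1_1)
      have e2: "qchar (n + 1) (A + 1) x = qchar n A x * x"
        unfolding qchar_add using elim by (simp add: qchar_1_1)
      have e3: "B + 1 - 2 = B - 2 + 1" by simp
      have aux: "i * (X * (Y * (1 - x))) = i * (X * Y) - i * (X * x * Y)" for i X Y :: complex
        by (simp add: algebra_simps)
      show ?case unfolding e3 e1 e2 by (rule aux)
    qed
  qed simp_all
  also have "\<dots> = (\<integral>x. indicator (cball 0 c) x * (qchar n A x * qchar m (B - 2) (1 - x)) \<partial>haar)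
        - (\<integral>x. indicator (cball 0 c) x * (qchar (n + 1) (A + 1) x * qchar m (B - 2) (1 - x)) \<partial>haar)"
    by (intro Bochner_Integration.integral_diff beta_integrable_haar) (use AB in auto)
  finally show ?thesis unfolding bFP_def bsum_rec[OF ni c] by simp
qed

text \<open>The classical relation B(\<alpha>, \<beta> + 1) = B(\<alpha>, \<beta>) - B(\<alpha> + 1,
  \<beta>). The tilded arguments, hence all sines, stay fixed.\<close>

lemma bval_rec:
  assumes ni: "bnonint n A m B"
  shows "bval n A (m + 1) (B + 1) = bval n A m B - bval (n + 1) (A + 1) m B"
proof -
  define \<alpha> \<beta> \<alpha>' \<beta>' where "\<alpha> = (A + of_int n) / 2" and "\<beta> = (B + of_int m) / 2"
    and "\<alpha>' = (A - of_int n) / 2" and "\<beta>' = (B - of_int m) / 2"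
  have e: "(B + 1 + of_int (m + 1)) / 2 = \<beta> + 1" "(B + 1 - of_int (m + 1)) / 2 = \<beta>'"
    "(A + 1 + of_int (n + 1)) / 2 = \<alpha> + 1" "(A + 1 - of_int (n + 1)) / 2 = \<alpha>'"
    by (simp_all add: \<alpha>_def \<beta>_def \<alpha>'_def \<beta>'_def field_simps)
  have n: "\<alpha> \<notin> \<int>" "\<beta> \<notin> \<int>" "\<alpha> + \<beta> \<notin> \<int>" using ni by (simp_all add: bnonint_def \<alpha>_def \<beta>_def)
  have np: "z \<notin> \<int> \<Longrightarrow> z \<notin> \<int>\<^sub>\<le>\<^sub>0" for z :: complex using nonpos_Ints_Int by blast
  have nz: "\<alpha> + \<beta> \<noteq> 0" using n(3) by auto
  have G: "Gamma (\<alpha> + 1) = \<alpha> * Gamma \<alpha>" "Gamma (\<beta> + 1) = \<beta> * Gamma \<beta>"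
    "Gamma (\<alpha> + \<beta> + 1) = (\<alpha> + \<beta>) * Gamma (\<alpha> + \<beta>)"
    using n by (simp_all add: Gamma_plus1 np)
  have s: "\<alpha> + (\<beta> + 1) = \<alpha> + \<beta> + 1" "\<alpha> + 1 + \<beta> = \<alpha> + \<beta> + 1" by simp_all
  have gn: "Gamma (\<alpha> + \<beta>) \<noteq> 0" by (rule Gamma_nonint[OF n(3)])
  have "fB \<alpha> (\<beta> + 1) \<alpha>' \<beta>' = fB \<alpha> \<beta> \<alpha>' \<beta>' - fB (\<alpha> + 1) \<beta> \<alpha>' \<beta>'"
  proof -
    have "Gamma \<alpha> * Gamma (\<beta> + 1) / Gamma (\<alpha> + (\<beta> + 1))
      = Gamma \<alpha> * Gamma \<beta> / Gamma (\<alpha> + \<beta>) - Gamma (\<alpha> + 1) * Gamma \<beta> / Gamma (\<alpha> + 1 + \<beta>)"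
      unfolding s G using nz gn by (simp add: divide_simps) (simp add: algebra_simps)
    then show ?thesis unfolding fB_def by (simp only: left_diff_distrib)
  qed
  then show ?thesis unfolding bval_def e unfolding \<alpha>_def \<beta>_def \<alpha>'_def \<beta>'_def .
qed

text \<open>Continuation in A requires Re B < 2 for a nonempty initial strip. The recursion
  expresses the case of B through B - 1 with Re A still positive, so induction on a bound for Re B
  reaches every positive real part.\<close>

theorem bFP_eq_bval:
  assumes "bnonint n A m B" "Re A > 0" "Re B > 0" "c > 1"
  shows "bFP n A m B c = bval n A m B"
proof -
  obtain N :: nat where "Re B < 2 + real N"
    using reals_Archimedean2[of "Re B - 2"] by (auto simp: algebra_simps)
  then show ?thesis using assms
  proof (induction N arbitrary: n A m B)
    case 0
    then show ?case by (intro bFP_small_B) simp_all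
  next
    case (Suc N)
    show ?case
    proof (cases "Re B < 2")
      case True
      then show ?thesis using Suc.prems by (intro bFP_small_B) simp_all
    next
      case False
      define m' B' where "m' = m - 1" and "B' = B - 1"
      have mB: "m = m' + 1" "B = B' + 1" by (simp_all add: m'_def B'_def)
      have h: "(B' + of_int m') / 2 = (B + of_int m) / 2 - of_int 1"
        "(A + of_int n) / 2 + (B' + of_int m') / 2 = (A + of_int n) / 2 + (B + of_int m) / 2 - of_int 1"
        "(A + 1 + of_int (n + 1)) / 2 = (A + of_int n) / 2 - of_int (- 1)"
        "(A + 1 + of_int (n + 1)) / 2 + (B' + of_int m') / 2 = (A + of_int n) / 2 + (B + of_int m) / 2"
        by (simp_all add: m'_def B'_def field_simps)
      have n1: "bnonint n A m' B'" and n2: "bnonint (n + 1) (A + 1) m' B'"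
        using Suc.prems(2) unfolding bnonint_def h(2,4) unfolding h(1,3) Ints_diff_of_int_iff by simp_all
      have B': "Re B' > 0" "Re B' < 2 + real N" using False Suc.prems(1) by (simp_all add: B'_def)
      have "bFP n A m' B' c = bval n A m' B'" "bFP (n + 1) (A + 1) m' B' c = bval (n + 1) (A + 1) m' B'"
        using Suc.prems by (intro Suc.IH n1 n2 B'; simp)+
      moreover have "(A + of_int n) / 2 + (B' + of_int m') / 2 \<notin> \<int>" using n1 unfolding bnonint_def by blast
      ultimately show ?thesis unfolding mB
        using bFP_rec[of A n B' m' c] bval_rec[OF n1] Suc.prems B' by simp
    qed
  qed
qed

section \<open>Annuli, elementary lower bounds and distances from the integers\<close>

lemma haar_annulus:
  assumes "0 < a" "a < b"
  shows "(\<integral>\<^sup>+x. indicator {a<..b} (norm x) \<partial>haar) = ennreal (2 * pi * (ln b - ln a))"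
proof -
  have "(\<integral>\<^sup>+x. indicator {a<..b} (norm (x::complex)) \<partial>haar) = ennreal (2 * pi) * (\<integral>\<^sup>+s. indicator {a<..b} (exp s) \<partial>lborel)"
    by (rule nn_integral_haar_radial) simp
  also have "(\<integral>\<^sup>+s. indicator {a<..b} (exp s) \<partial>lborel) = (\<integral>\<^sup>+s. indicator {ln a<..ln b} s \<partial>lborel)"
  proof (intro nn_integral_cong)
    fix s :: real
    have "b > 0" using assms by simp
    then have "a < exp s \<longleftrightarrow> ln a < s" "exp s \<le> b \<longleftrightarrow> s \<le> ln b"
      using assms by (metis exp_less_cancel_iff exp_ln, metis exp_le_cancel_iff exp_ln)
    then show "(indicator {a<..b} (exp s) :: ennreal) = indicator {ln a<..ln b} s" by (simp add: indicator_def)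
  qed
  also have "\<dots> = ennreal (ln b - ln a)" using assms by simp
  finally show ?thesis by (simp add: ennreal_mult'[symmetric])
qed

text \<open>The device behind the lower bounds: an integral is at least K times the mass of an
  annulus, and by invariance the annulus may be prescribed for z x instead of x.\<close>

lemma haar_annulus_lower:
  fixes F :: "complex \<Rightarrow> ennreal"
  assumes ab: "0 < a" "a < b" and K: "0 \<le> K" and z: "z \<noteq> 0"
    and F: "\<And>x. a < norm (z * x) \<Longrightarrow> norm (z * x) \<le> b \<Longrightarrow> ennreal K \<le> F x"
  shows "ennreal (K * (2 * pi * (ln b - ln a))) \<le> (\<integral>\<^sup>+x. F x \<partial>haar)"
proof -
  have "ennreal (K * (2 * pi * (ln b - ln a))) = ennreal K * (\<integral>\<^sup>+x. indicator {a<..b} (norm x) \<partial>haar)"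
    unfolding haar_annulus[OF ab] using K ab by (intro ennreal_mult) auto
  also have "\<dots> = ennreal K * (\<integral>\<^sup>+x. indicator {a<..b} (norm (z * x)) \<partial>haar)"
    using nn_integral_haar_scale[of "\<lambda>x. indicator {a<..b} (norm x)" z] z by simp
  also have "\<dots> = (\<integral>\<^sup>+x. ennreal K * indicator {a<..b} (norm (z * x)) \<partial>haar)"
    by (rule nn_integral_cmult[symmetric]) simp
  also have "\<dots> \<le> (\<integral>\<^sup>+x. F x \<partial>haar)"
    by (intro nn_integral_mono) (auto simp: indicator_def intro: F)
  finally show ?thesis .
qed

text \<open>Turns an almost-everywhere statement into a point of prescribed approximate modulus; it
  supplies the points at which \<open>J\<close> or a tail integral is finite.\<close>

lemma AE_haar_annulus:
  assumes P: "AE x in haar. P x" and ab: "0 < a" "a < b"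
  shows "\<exists>x. a < norm x \<and> norm x \<le> b \<and> P x"
proof (rule ccontr)
  assume neg: "\<nexists>x. a < norm x \<and> norm x \<le> b \<and> P x"
  have "AE x in haar. (indicator {a<..b} (norm x) :: ennreal) = 0"
    using P by eventually_elim (use neg in \<open>auto simp: indicator_def\<close>)
  then have "(\<integral>\<^sup>+x. indicator {a<..b} (norm (x::complex)) \<partial>haar) = 0"
    by (subst nn_integral_cong_AE[where v = "\<lambda>_. 0"]) simp_all
  then have "2 * pi * (ln b - ln a) \<le> 0" unfolding haar_annulus[OF ab] by (simp only: ennreal_eq_0_iff)
  moreover have "0 < 2 * pi * (ln b - ln a)" using ab by (intro mult_pos_pos) auto
  ultimately show False by linarith
qed

lemma AE_haar_scale:
  assumes P: "AE x in haar. P (z * x)" and z: "z \<noteq> 0" and [measurable]: "Measurable.pred borel P"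
  shows "AE y in haar. P y"
proof -
  have "AE y in distr haar borel (\<lambda>x. z * x). P y"
    by (subst AE_distr_iff) (use P in simp_all)
  then show ?thesis unfolding distr_haar_scale[OF z] .
qed

lemma exp_ln_lower:
  fixes s l h :: real
  assumes "0 < l"
  shows "\<exists>C>0. \<forall>t. l \<le> t \<longrightarrow> t \<le> h \<longrightarrow> C \<le> exp (s * ln t)"
proof (intro exI[of _ "exp (- \<bar>s\<bar> * (\<bar>ln l\<bar> + \<bar>ln h\<bar>))"] conjI allI impI)
  fix t assume t: "l \<le> t" "t \<le> h"
  then have "ln l \<le> ln t" "ln t \<le> ln h" using assms by auto
  then have "\<bar>ln t\<bar> \<le> \<bar>ln l\<bar> + \<bar>ln h\<bar>" by linarith
  then have "\<bar>s\<bar> * \<bar>ln t\<bar> \<le> \<bar>s\<bar> * (\<bar>ln l\<bar> + \<bar>ln h\<bar>)" by (rule mult_left_mono) simp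
  then have "\<bar>s * ln t\<bar> \<le> \<bar>s\<bar> * (\<bar>ln l\<bar> + \<bar>ln h\<bar>)" by (simp only: abs_mult)
  then have "- \<bar>s\<bar> * (\<bar>ln l\<bar> + \<bar>ln h\<bar>) \<le> s * ln t" by linarith
  then show "exp (- \<bar>s\<bar> * (\<bar>ln l\<bar> + \<bar>ln h\<bar>)) \<le> exp (s * ln t)" by simp
qed simp

lemma exp_ln_lower_norm:
  assumes "0 < l"
  obtains C :: real where "C > 0" "\<And>x :: complex. l \<le> norm x \<Longrightarrow> norm x \<le> h \<Longrightarrow> C \<le> exp (s * ln (norm x))"
proof -
  obtain C where "C > 0" "\<forall>t. l \<le> t \<longrightarrow> t \<le> h \<longrightarrow> C \<le> exp (s * ln t)"
    using exp_ln_lower[OF assms, of h s] by auto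
  then show thesis by (intro that[of C]) auto
qed

lemma Ints_distance_finite:
  assumes "finite S" "\<And>z. z \<in> S \<Longrightarrow> z \<notin> (\<int> :: complex set)"
  shows "\<exists>\<delta>>0. \<forall>z\<in>S. \<forall>k::int. \<delta> \<le> norm (z + of_int k)"
  using assms
proof (induction S)
  case empty
  then show ?case by (intro exI[of _ 1]) simp
next
  case (insert x S)
  then obtain \<delta> where \<delta>: "\<delta> > 0" "\<forall>z\<in>S. \<forall>k::int. \<delta> \<le> norm (z + of_int k)" by auto
  obtain \<epsilon> where \<epsilon>: "\<epsilon> > 0" "\<forall>k::int. \<epsilon> \<le> norm (x + of_int k)" using Ints_distance[of x] insert.prems by auto
  show ?case
  proof (intro exI[of _ "min \<delta> \<epsilon>"] conjI ballI allI)
    fix z and k :: int assume "z \<in> insert x S"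
    then show "min \<delta> \<epsilon> \<le> norm (z + of_int k)"
    proof
      assume "z = x"
      then show ?thesis using \<epsilon>(2)[rule_format, of k] by simp
    next
      assume "z \<in> S"
      then have "\<delta> \<le> norm (z + of_int k)" using \<delta>(2) by blast
      then show ?thesis by simp
    qed
  qed (use \<delta> \<epsilon> in simp)
qed

lemma nonint_shift:
  assumes "x \<notin> (\<int> :: complex set)" "y = x + of_int k \<or> y = of_int k - x"
  shows "y \<notin> \<int>"
proof
  assume y: "y \<in> \<int>"
  from assms(2) have "x = y - of_int k \<or> x = of_int k - y" by auto
  then have "x \<in> \<int>" using y by (auto intro: Ints_diff)
  with assms(1) show False by contradiction
qed

subsection \<open>Iterated convolutions of beta integrands\<close>

text \<open>\<open>na i = a_i - a~_i\<close> and \<open>sa i = a_i + a~_i\<close>, and similarly \<open>nb\<close>, \<open>sb\<close> for the \<open>b_j\<close>, where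
  \<open>b_0 = b~_0 = 1\<close>. Thus \<open>ah i = a_i\<close>, \<open>bh j = b_j\<close>, and later \<open>ah' i = a~_i\<close>, \<open>bh' j = b~_j\<close>.\<close>
locale beta_chain =
  fixes na nb :: "nat \<Rightarrow> int" and sa sb :: "nat \<Rightarrow> complex" and P :: nat
  assumes nb0: "nb 0 = 0" and sb0: "sb 0 = 2"
    and gen_ab: "i \<le> P \<Longrightarrow> j \<le> P \<Longrightarrow> (sa i + of_int (na i)) / 2 - (sb j + of_int (nb j)) / 2 \<notin> \<int>"
    and gen_bb: "i \<le> P \<Longrightarrow> j \<le> P \<Longrightarrow> i \<noteq> j \<Longrightarrow> (sb i + of_int (nb i)) / 2 - (sb j + of_int (nb j)) / 2 \<notin> \<int>"
begin

definition ah :: "nat \<Rightarrow> complex" where "ah i = (sa i + of_int (na i)) / 2"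
definition bh :: "nat \<Rightarrow> complex" where "bh j = (sb j + of_int (nb j)) / 2"

lemmas gen_ab' = gen_ab[folded ah_def bh_def]
lemmas gen_bb' = gen_bb[folded bh_def]

text \<open>The factor of the integrand in one variable, with radial exponent \<open>sa i\<close>
  instead of \<open>sa i - 2\<close> because Haar measure supplies the missing power.\<close>

definition f :: "nat \<Rightarrow> complex \<Rightarrow> complex" where
  "f i x = qchar (na i) (sa i) x * qchar (nb i - na i) (sb i - sa i - 2) (1 - x)"

primrec I :: "nat \<Rightarrow> complex \<Rightarrow> complex" where
  "I 0 = (\<lambda>y. qchar (- na 0) (- sa 0) (1 - y))"
| "I (Suc p) = (\<lambda>z. \<integral>x. f (Suc p) x * I p (z * x) \<partial>haar)"

text \<open>The convolution of the absolute values, in \<open>ennreal\<close> so that it makes sense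
  before convergence is known. Absolute convergence is used in the form
  \<open>J p z < \<infinity>\<close>.\<close>

primrec J :: "nat \<Rightarrow> complex \<Rightarrow> ennreal" where
  "J 0 = (\<lambda>y. ennreal (norm (qchar (- na 0) (- sa 0) (1 - y))))"
| "J (Suc p) = (\<lambda>z. \<integral>\<^sup>+x. ennreal (norm (f (Suc p) x)) * J p (z * x) \<partial>haar)"

text \<open>The index \<open>(j, l, l')\<close> stands for the exponent of \<open>z^(1 - b_j + l) * cnj z^(1 - b~_j + l')\<close>.\<close>
definition en :: "nat \<times> nat \<times> nat \<Rightarrow> int" where
  "en k = int (fst (snd k)) - int (snd (snd k)) - nb (fst k)"
definition ew :: "nat \<times> nat \<times> nat \<Rightarrow> complex" where
  "ew k = 2 - sb (fst k) + (of_nat (fst (snd k)) + of_nat (snd (snd k)))"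

text \<open>The coefficients of \<open>f i\<close> at infinity, placed on the indices with first
  component i so that all expansions share the exponents \<open>en\<close> and
  \<open>ew\<close>.\<close>

definition d :: "nat \<Rightarrow> nat \<times> nat \<times> nat \<Rightarrow> complex" where
  "d i k = (if fst k = i then (-1) powi (nb i - na i) * bcoef (nb i - na i) (sb i - sa i) (snd k) else 0)"

text \<open>To be identified with the finite-part Mellin transform of \<open>f i\<close> at the
  character (N, v).\<close>

definition E :: "nat \<Rightarrow> int \<Rightarrow> complex \<Rightarrow> complex" where
  "E i N v = bval (na i + N) (sa i + v) (nb i - na i) (sb i - sa i)"

primrec M :: "nat \<Rightarrow> int \<Rightarrow> complex \<Rightarrow> complex" where
  "M 0 N v = bval N v (- na 0) (2 - sa 0)"
| "M (Suc p) N v = M p N v * E (Suc p) (- N) (- v)"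

text \<open>\<open>M p\<close> will be the finite-part Mellin transform of \<open>I p\<close> and \<open>g p\<close> the coefficients of its
  expansion at zero.\<close>
primrec g :: "nat \<Rightarrow> nat \<times> nat \<times> nat \<Rightarrow> complex" where
  "g 0 k = (if fst k = 0 then bcoef (- na 0) (2 - sa 0) (snd k) else 0)"
| "g (Suc p) k = g p k * E (Suc p) (en k) (ew k) + d (Suc p) k * M p (- en k) (- ew k)"

text \<open>Keeps the Mellin parameter (v + N)/2 off all integer translates of a_i and b_i, with b_0
  = 1: the beta values in \<open>M p\<close> are then defined and the corrections in the finite part
  have nonzero denominators.\<close>

definition gen :: "nat \<Rightarrow> int \<Rightarrow> complex \<Rightarrow> bool" where
  "gen p N v \<longleftrightarrow> (\<forall>i\<le>p. (v + of_int N) / 2 - ah i \<notin> \<int> \<and> (v + of_int N) / 2 - bh i \<notin> \<int>)"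

lemma g_support: "g p k \<noteq> 0 \<Longrightarrow> fst k \<le> p"
  by (induction p) (auto simp: d_def split: if_splits)

lemma half_exponent: "(ew k + of_int (en k)) / 2 = 1 - bh (fst k) + of_nat (fst (snd k))"
  by (simp add: en_def ew_def bh_def field_simps)

text \<open>For equal windings the difference of two exponents is twice a difference of two b's up
  to an integer, so Condition C separates exponents with different first components
  uniformly.\<close>

lemma exponent_diff:
  assumes "en k = en j"
  shows "ew k - ew j = 2 * (bh (fst j) - bh (fst k) + of_int (int (fst (snd k)) - int (fst (snd j))))"
proof -
  have "ew k - ew j = 2 * ((ew k + of_int (en k)) / 2 - (ew j + of_int (en j)) / 2)"
    using assms by (simp add: field_simps)
  then show ?thesis unfolding half_exponent by simp
qed

lemma exponent_add:
  assumes "en k = - N"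
  shows "ew k + v = 2 * ((v + of_int N) / 2 - bh (fst k) + of_int (1 + int (fst (snd k))))"
proof -
  have "ew k + v = 2 * ((ew k + of_int (en k)) / 2 + (v + of_int N) / 2)"
    using assms by (simp add: field_simps)
  then show ?thesis unfolding half_exponent by (simp add: algebra_simps)
qed

lemma f_measurable [measurable]: "f i \<in> borel_measurable borel"
  unfolding f_def[abs_def] by measurable

lemma I_measurable [measurable]: "I p \<in> borel_measurable borel"
proof (induction p)
  case (Suc p)
  note [measurable] = Suc
  show ?case unfolding I.simps by measurable
qed simp

lemma J_measurable [measurable]: "J p \<in> borel_measurable borel"
proof (induction p)
  case (Suc p)
  note [measurable] = Suc
  show ?case unfolding J.simps by measurable
qed simp

lemma f_nonzero: "f i x \<noteq> 0" by (simp add: f_def)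

lemma norm_f: "norm (f i x) = exp (Re (sa i) * ln (norm x)) * exp ((Re (sb i) - Re (sa i) - 2) * ln (norm (1 - x)))"
  by (simp add: f_def norm_mult norm_qchar)

lemma norm_I_le: "ennreal (norm (I p z)) \<le> J p z"
proof (induction p arbitrary: z)
  case (Suc p)
  show ?case
  proof (cases "integrable haar (\<lambda>x. f (Suc p) x * I p (z * x))")
    case True
    then have "ennreal (norm (I (Suc p) z)) \<le> (\<integral>\<^sup>+x. ennreal (norm (f (Suc p) x * I p (z * x))) \<partial>haar)"
      unfolding I.simps by (rule integral_norm_bound_ennreal)
    also have "\<dots> \<le> J (Suc p) z" unfolding J.simps
    proof (rule nn_integral_mono)
      fix x
      show "ennreal (norm (f (Suc p) x * I p (z * x))) \<le> ennreal (norm (f (Suc p) x)) * J p (z * x)"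
        by (simp only: norm_mult ennreal_mult norm_ge_zero) (rule mult_left_mono[OF Suc.IH], simp)
    qed
    finally show ?thesis .
  qed (simp add: not_integrable_integral_eq)
qed simp

lemma fI_integrable:
  assumes "J (Suc p) z < \<infinity>"
  shows "integrable haar (\<lambda>x. f (Suc p) x * I p (z * x))"
  unfolding integrable_iff_bounded
proof
  have "(\<integral>\<^sup>+x. ennreal (norm (f (Suc p) x * I p (z * x))) \<partial>haar) \<le> J (Suc p) z" unfolding J.simps
  proof (rule nn_integral_mono)
    fix x
    show "ennreal (norm (f (Suc p) x * I p (z * x))) \<le> ennreal (norm (f (Suc p) x)) * J p (z * x)"
      by (simp only: norm_mult ennreal_mult norm_ge_zero) (rule mult_left_mono[OF norm_I_le], simp)
  qed
  then show "(\<integral>\<^sup>+x. ennreal (norm (f (Suc p) x * I p (z * x))) \<partial>haar) < \<infinity>" using assms by (rule le_less_trans)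
qed simp

text \<open>1 - x = x (1/x - 1), and the second factor has modulus between 1 - 1/c and 2 when
  \<open>norm x > c\<close>.\<close>

lemma f_lower_infinity:
  assumes c: "c > 1"
  shows "\<exists>C>0. \<forall>x. norm x > c \<longrightarrow> C * exp ((Re (sb i) - 2) * ln (norm x)) \<le> norm (f i x)"
proof -
  obtain C where C: "C > 0" "\<And>x :: complex. 1 - 1 / c \<le> norm x \<Longrightarrow> norm x \<le> 2 \<Longrightarrow> C \<le> exp ((Re (sb i) - Re (sa i) - 2) * ln (norm x))"
    by (rule exp_ln_lower_norm[of "1 - 1 / c" 2 "Re (sb i) - Re (sa i) - 2"]) (use c in auto)
  have "C * exp ((Re (sb i) - 2) * ln (norm x)) \<le> norm (f i x)" if x: "norm x > c" for x
  proof -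
    define u where "u = inverse x - 1"
    have x0: "x \<noteq> 0" using x c by auto
    have ix: "norm (inverse x) \<le> 1 / c" using x c by (auto simp: norm_inverse norm_divide divide_simps)
    have "1 / c < 1" using c by simp
    then have u: "1 - 1 / c \<le> norm u" "norm u \<le> 2"
      using ix norm_triangle_ineq2[of 1 "inverse x"] norm_triangle_ineq4[of "inverse x" 1]
      unfolding u_def by (simp_all add: norm_minus_commute)
    have "1 - x = x * u" using x0 by (simp add: u_def algebra_simps)
    moreover have "norm u > 0" using u(1) \<open>1 / c < 1\<close> by linarith
    ultimately have l: "ln (norm (1 - x)) = ln (norm x) + ln (norm u)" using x0 by (simp add: norm_mult ln_mult)
    have "norm (f i x) = exp ((Re (sb i) - 2) * ln (norm x)) * exp ((Re (sb i) - Re (sa i) - 2) * ln (norm u))"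
      unfolding norm_f l exp_add[symmetric] by (simp add: algebra_simps)
    then show ?thesis using mult_left_mono[OF C(2)[OF u], of "exp ((Re (sb i) - 2) * ln (norm x))"] by (simp add: mult.commute)
  qed
  then show ?thesis using C(1) by blast
qed

lemma f_lower_zero:
  obtains C where "C > 0" "\<And>x. norm x \<le> 1 / 2 \<Longrightarrow> C * exp (Re (sa i) * ln (norm x)) \<le> norm (f i x)"
proof -
  obtain C where C: "C > 0" "\<And>x :: complex. 1 / 2 \<le> norm x \<Longrightarrow> norm x \<le> 3 / 2 \<Longrightarrow> C \<le> exp ((Re (sb i) - Re (sa i) - 2) * ln (norm x))"
    by (rule exp_ln_lower_norm[of "1 / 2" "3 / 2" "Re (sb i) - Re (sa i) - 2"]) auto
  show thesis
  proof (rule that[OF C(1)])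
    fix x :: complex assume x: "norm x \<le> 1 / 2"
    then have "1 / 2 \<le> norm (1 - x)" "norm (1 - x) \<le> 3 / 2"
      using norm_triangle_ineq2[of 1 x] norm_triangle_ineq4[of 1 x] by simp_all
    from mult_left_mono[OF C(2)[OF this], of "exp (Re (sa i) * ln (norm x))"]
    show "C * exp (Re (sa i) * ln (norm x)) \<le> norm (f i x)" by (simp add: norm_f mult.commute)
  qed
qed

lemma f_lower_one:
  obtains C where "C > 0" "\<And>x. norm (1 - x) \<le> 1 / 2 \<Longrightarrow> C * exp ((Re (sb i) - Re (sa i) - 2) * ln (norm (1 - x))) \<le> norm (f i x)"
proof -
  obtain C where C: "C > 0" "\<And>x :: complex. 1 / 2 \<le> norm x \<Longrightarrow> norm x \<le> 3 / 2 \<Longrightarrow> C \<le> exp (Re (sa i) * ln (norm x))"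
    by (rule exp_ln_lower_norm[of "1 / 2" "3 / 2" "Re (sa i)"]) auto
  show thesis
  proof (rule that[OF C(1)])
    fix x :: complex assume x: "norm (1 - x) \<le> 1 / 2"
    then have "1 / 2 \<le> norm x" "norm x \<le> 3 / 2"
      using norm_triangle_ineq2[of 1 "1 - x"] norm_triangle_ineq4[of 1 "1 - x"] by simp_all
    from mult_right_mono[OF C(2)[OF this], of "exp ((Re (sb i) - Re (sa i) - 2) * ln (norm (1 - x)))"]
    show "C * exp ((Re (sb i) - Re (sa i) - 2) * ln (norm (1 - x))) \<le> norm (f i x)" by (simp add: norm_f)
  qed
qed

text \<open>Every exponent of the expansion of \<open>I p\<close> shows up in \<open>J p\<close>
  without cancellation. Each induction step keeps the old exponents by restricting x to a fixed
  annulus and obtains the new one by restricting y x.\<close>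

lemma J_lower:
  assumes "j \<le> p" "0 < r" "r < 1"
  shows "\<exists>C>0. \<forall>y. 0 < norm y \<longrightarrow> norm y \<le> r \<longrightarrow> ennreal (C * exp ((2 - Re (sb j)) * ln (norm y))) \<le> J p y"
  using assms
proof (induction p arbitrary: j r)
  case 0
  obtain C where C: "C > 0" "\<And>x :: complex. 1 - r \<le> norm x \<Longrightarrow> norm x \<le> 2 \<Longrightarrow> C \<le> exp (- Re (sa 0) * ln (norm x))"
    by (rule exp_ln_lower_norm[of "1 - r" 2 "- Re (sa 0)"]) (use 0 in auto)
  have "ennreal (C * exp ((2 - Re (sb j)) * ln (norm y))) \<le> J 0 y" if y: "norm y \<le> r" for y
  proof -
    have "1 - r \<le> norm (1 - y)" "norm (1 - y) \<le> 2"
      using y 0 norm_triangle_ineq2[of 1 y] norm_triangle_ineq4[of 1 y] by simp_all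
    then have "C \<le> exp (- Re (sa 0) * ln (norm (1 - y)))" by (rule C(2))
    then show ?thesis using 0(1) sb0 by (simp add: norm_qchar ennreal_leI)
  qed
  then show ?case using C(1) by blast
next
  case (Suc p)
  let ?i = "Suc p"
  show ?case
  proof (cases "j \<le> p")
    case True
    define e where "e = 2 - Re (sb j)"
    obtain C where C: "C > 0" "\<And>y. 0 < norm y \<Longrightarrow> norm y \<le> r \<Longrightarrow> ennreal (C * exp (e * ln (norm y))) \<le> J p y"
      using Suc.IH[OF True Suc.prems(2,3)] unfolding e_def by blast
    obtain C2 where C2: "C2 > 0" "\<And>x. norm x \<le> 1 / 2 \<Longrightarrow> C2 * exp (Re (sa ?i) * ln (norm x)) \<le> norm (f ?i x)"
      by (rule f_lower_zero[where i = ?i]) auto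
    \<comment> \<open>On 1/4 < norm x \<le> 1/2 the factor f is bounded below, and
      \<open>J p (y * x)\<close> passes its power of the modulus of y on to the integral.\<close>
    obtain C3 where C3: "C3 > 0" "\<And>x :: complex. 1 / 4 \<le> norm x \<Longrightarrow> norm x \<le> 1 / 2 \<Longrightarrow> C3 \<le> exp ((Re (sa ?i) + e) * ln (norm x))"
      by (rule exp_ln_lower_norm[of "1 / 4" "1 / 2" "Re (sa ?i) + e"]) auto
    have "ennreal (C * C2 * C3 * (2 * pi * (ln (1 / 2) - ln (1 / 4))) * exp (e * ln (norm y))) \<le> J ?i y"
      if y: "0 < norm y" "norm y \<le> r" for y
    proof -
      have "ennreal (C * C2 * C3 * exp (e * ln (norm y)) * (2 * pi * (ln (1 / 2) - ln (1 / 4)))) \<le> J ?i y"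
        unfolding J.simps
      proof (rule haar_annulus_lower[where z = 1])
        fix x :: complex assume "1 / 4 < norm (1 * x)" "norm (1 * x) \<le> 1 / 2"
        then have x: "1 / 4 \<le> norm x" "norm x \<le> 1 / 2" "0 < norm x" by (simp_all del: zero_less_norm_iff)
        have "norm (y * x) \<le> r * 1" unfolding norm_mult using x y Suc.prems by (intro mult_mono) auto
        then have 1: "ennreal (C * exp (e * ln (norm (y * x)))) \<le> J p (y * x)"
          using x y by (intro C(2)) (auto simp: norm_mult)
        have 2: "ennreal (C2 * exp (Re (sa ?i) * ln (norm x))) \<le> ennreal (norm (f ?i x))"
          by (rule ennreal_leI[OF C2(2)[OF x(2)]])
        have "C * C2 * C3 * exp (e * ln (norm y)) \<le> C * C2 * exp (e * ln (norm y)) * exp ((Re (sa ?i) + e) * ln (norm x))"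
          using mult_left_mono[OF C3(2)[OF x(1,2)], of "C * C2 * exp (e * ln (norm y))"] C(1) C2(1) by (simp add: mult_ac)
        also have "\<dots> = C2 * exp (Re (sa ?i) * ln (norm x)) * (C * exp (e * ln (norm (y * x))))"
        proof -
          have l: "ln (norm (y * x)) = ln (norm y) + ln (norm x)" using x(3) y(1) by (simp add: norm_mult ln_mult)
          show ?thesis unfolding l distrib_left distrib_right exp_add by (simp only: mult_ac)
        qed
        finally have "ennreal (C * C2 * C3 * exp (e * ln (norm y)))
          \<le> ennreal (C2 * exp (Re (sa ?i) * ln (norm x))) * ennreal (C * exp (e * ln (norm (y * x))))"
          using C(1) C2(1) by (simp add: ennreal_mult[symmetric] ennreal_leI)
        also have "\<dots> \<le> ennreal (norm (f ?i x)) * J p (y * x)" by (rule mult_mono[OF 2 1]) simp_all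
        finally show "ennreal (C * C2 * C3 * exp (e * ln (norm y))) \<le> ennreal (norm (f ?i x)) * J p (y * x)" .
      qed (use C(1) C2(1) C3(1) in simp_all)
      then show ?thesis by (simp add: mult_ac)
    qed
    moreover have "ln (1 / 4) < ln (1 / 2 :: real)" by simp
    then have "C * C2 * C3 * (2 * pi * (ln (1 / 2) - ln (1 / 4))) > 0"
      using C(1) C2(1) C3(1) by (intro mult_pos_pos) auto
    ultimately show ?thesis unfolding e_def by blast
  next
    case False
    then have j: "j = ?i" using Suc.prems by simp
    define e where "e = 2 - Re (sb ?i)"
    \<comment> \<open>Now y x is kept in the annulus between r1 and r2, where \<open>J p\<close> is
      bounded below by a constant. Since \<open>norm y \<le> r < r1\<close>, this forces
      \<open>norm x > r1 / r > 1\<close>, and the behaviour of f at infinity produces the new power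
      of the modulus of y.\<close>
    define r1 r2 where "r1 = (1 + r) / 2" and "r2 = (3 + r) / 4"
    have r12: "0 < r1" "r < r1" "r1 < r2" "0 < r2" "r2 < 1" using Suc.prems by (simp_all add: r1_def r2_def)
    obtain C where C: "C > 0" "\<And>y. 0 < norm y \<Longrightarrow> norm y \<le> r2 \<Longrightarrow> ennreal C \<le> J p y"
      using Suc.IH[of 0 r2] r12 sb0 by auto
    have c: "r1 / r > 1" using r12 Suc.prems by simp
    obtain C2 where C2: "C2 > 0" "\<And>x. norm x > r1 / r \<Longrightarrow> C2 * exp ((Re (sb ?i) - 2) * ln (norm x)) \<le> norm (f ?i x)"
      using f_lower_infinity[OF c, of ?i] by auto
    obtain C3 where C3: "C3 > 0" "\<And>x :: complex. r1 \<le> norm x \<Longrightarrow> norm x \<le> r2 \<Longrightarrow> C3 \<le> exp (- e * ln (norm x))"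
      by (rule exp_ln_lower_norm[of r1 r2 "- e"]) (use r12 in auto)
    have "ennreal (C * C2 * C3 * (2 * pi * (ln r2 - ln r1)) * exp (e * ln (norm y))) \<le> J ?i y"
      if y: "0 < norm y" "norm y \<le> r" for y
    proof -
      have "ennreal (C * C2 * C3 * exp (e * ln (norm y)) * (2 * pi * (ln r2 - ln r1))) \<le> J ?i y"
        unfolding J.simps
      proof (rule haar_annulus_lower[where z = y])
        fix x :: complex assume x: "r1 < norm (y * x)" "norm (y * x) \<le> r2"
        have x0: "norm x > 0" using x(1) r12(1) by (cases "x = 0") auto
        have "norm y * norm x \<le> r * norm x" by (rule mult_right_mono[OF y(2)]) simp
        then have "r1 < r * norm x" using x(1) unfolding norm_mult by linarith
        then have xr: "norm x > r1 / r" using Suc.prems by (simp add: field_simps)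
        have 1: "ennreal C \<le> J p (y * x)" using x x0 y by (intro C(2)) (auto simp: norm_mult)
        have 2: "ennreal (C2 * exp ((Re (sb ?i) - 2) * ln (norm x))) \<le> ennreal (norm (f ?i x))"
          by (rule ennreal_leI[OF C2(2)[OF xr]])
        have "C * C2 * C3 * exp (e * ln (norm y)) \<le> C * C2 * exp (e * ln (norm y)) * exp (- e * ln (norm (y * x)))"
          using mult_left_mono[OF C3(2)[of "y * x"], of "C * C2 * exp (e * ln (norm y))"] x C(1) C2(1) by (simp add: mult_ac)
        also have "exp (e * ln (norm y)) * exp (- e * ln (norm (y * x))) = exp ((Re (sb ?i) - 2) * ln (norm x))"
          unfolding exp_add[symmetric] using x0 y by (simp add: norm_mult ln_mult e_def algebra_simps)
        then have "C * C2 * exp (e * ln (norm y)) * exp (- e * ln (norm (y * x))) = C2 * exp ((Re (sb ?i) - 2) * ln (norm x)) * C"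
          by (simp add: mult_ac)
        finally have "ennreal (C * C2 * C3 * exp (e * ln (norm y))) \<le> ennreal (C2 * exp ((Re (sb ?i) - 2) * ln (norm x))) * ennreal C"
          using C(1) C2(1) by (simp add: ennreal_mult[symmetric] ennreal_leI)
        also have "\<dots> \<le> ennreal (norm (f ?i x)) * J p (y * x)" by (rule mult_mono[OF 2 1]) simp_all
        finally show "ennreal (C * C2 * C3 * exp (e * ln (norm y))) \<le> ennreal (norm (f ?i x)) * J p (y * x)" .
      qed (use C(1) C2(1) C3(1) r12(1,3) y in \<open>simp_all\<close>)
      then show ?thesis by (simp add: mult_ac)
    qed
    moreover have "ln r1 < ln r2" using r12 by simp
    then have "C * C2 * C3 * (2 * pi * (ln r2 - ln r1)) > 0"
      using C(1) C2(1) C3(1) by (intro mult_pos_pos) auto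
    ultimately show ?thesis unfolding j e_def by blast
  qed
qed

lemma J_lower_const:
  assumes "0 < r" "r < 1"
  obtains C where "C > 0" "\<And>y. 0 < norm y \<Longrightarrow> norm y \<le> r \<Longrightarrow> ennreal C \<le> J p y"
  using J_lower[OF le0 assms, of p] sb0 by auto

end

section \<open>Inequalities forced by absolute convergence\<close>

lemma haar_K_inverse:
  assumes "e > 0"
  shows "haar_K (- n) (- w) (1 / e) = - haar_K n w e"
  using assms by (simp add: haar_K_def ln_div)

text \<open>Near 1 the modulus of x is at most 3/2, so Haar integrability gives Lebesgue
  integrability at the price of the constant 9/4. Reflection moves the singularity to 0, where the
  mass is infinite for \<beta> \<le> 0.\<close>

lemma beta_necessary_one:
  fixes \<beta> \<eta> :: real
  assumes \<eta>: "0 < \<eta>" "\<eta> \<le> 1 / 2"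
    and h: "integrable haar (\<lambda>x. indicator (cball 0 \<eta>) (1 - x) * qchar 0 (of_real (\<beta> - 2)) (1 - x))"
  shows "\<beta> > 0"
proof (rule ccontr)
  assume "\<not> \<beta> > 0"
  then have \<beta>: "\<beta> \<le> 0" by simp
  define h' where "h' x = indicator (cball 0 \<eta>) (1 - x) * qchar 0 (of_real (\<beta> - 2)) (1 - x)" for x
  have [measurable]: "h' \<in> borel_measurable borel" unfolding h'_def[abs_def] by measurable
  have "integrable lborel (\<lambda>x. h' x / of_real ((norm x)\<^sup>2))"
    using h haar_integral_lborel(1)[of h'] unfolding h'_def[abs_def] by simp
  then have "integrable lborel (\<lambda>x. of_real (9 / 4) * (h' x / of_real ((norm x)\<^sup>2)))"
    by (rule integrable_mult_right)
  then have "integrable lborel h'"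
  proof (rule Bochner_Integration.integrable_bound)
    show "AE x in lborel. norm (h' x) \<le> norm (of_real (9 / 4) * (h' x / of_real ((norm x)\<^sup>2)))"
    proof (rule AE_I2)
      fix x
      show "norm (h' x) \<le> norm (of_real (9 / 4) * (h' x / of_real ((norm x)\<^sup>2)))"
      proof (cases "norm (1 - x) \<le> \<eta>")
        case True
        then have x: "1 / 2 \<le> norm x" "norm x \<le> 3 / 2"
          using \<eta> norm_triangle_ineq2[of 1 "1 - x"] norm_triangle_ineq4[of 1 "1 - x"] by simp_all
        have "(norm x)\<^sup>2 \<le> (3 / 2)\<^sup>2" by (rule power_mono[OF x(2)]) simp
        then have "(norm x)\<^sup>2 \<le> 9 / 4" by (simp add: power2_eq_square)
        moreover have "0 < (norm x)\<^sup>2" using x(1) by auto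
        ultimately have "1 \<le> 9 / 4 / (norm x)\<^sup>2" by simp
        then have "norm (h' x) * 1 \<le> norm (h' x) * (9 / 4 / (norm x)\<^sup>2)" by (rule mult_left_mono) simp
        moreover have "norm (of_real (9 / 4) * (h' x / of_real ((norm x)\<^sup>2))) = norm (h' x) * (9 / 4 / (norm x)\<^sup>2)"
          by (simp only: norm_mult norm_divide norm_of_real) simp
        ultimately show ?thesis by simp
      qed (simp add: h'_def)
    qed
  qed simp
  then have "integrable lborel (\<lambda>x. h' (1 - x))" using lborel_complex_reflect(1)[of h'] by simp
  then have "integrable haar (\<lambda>x. of_real ((norm x)\<^sup>2) * h' (1 - x))"
    using lborel_complex_eq_haar(1)[of "\<lambda>x. h' (1 - x)"] by simp
  then have fin: "(\<integral>\<^sup>+x. ennreal (norm (of_real ((norm x)\<^sup>2) * h' (1 - x))) \<partial>haar) < \<infinity>"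
    unfolding integrable_iff_bounded by blast
  have "(\<integral>\<^sup>+x. ennreal (norm (of_real ((norm x)\<^sup>2) * h' (1 - x))) \<partial>haar)
     = (\<integral>\<^sup>+x. indicator (cball 0 \<eta>) x * ennreal (exp (\<beta> * ln (norm x))) \<partial>haar)"
  proof (rule nn_integral_cong_AE)
    show "AE x in haar. ennreal (norm (of_real ((norm x)\<^sup>2) * h' (1 - x))) = indicator (cball 0 \<eta>) x * ennreal (exp (\<beta> * ln (norm x)))"
      using AE_haar_nonzero
    proof eventually_elim
      case (elim x)
      have "(norm x)\<^sup>2 = exp (2 * ln (norm x))"
        using elim by (simp add: exp_double)
      then have "(norm x)\<^sup>2 * exp ((\<beta> - 2) * ln (norm x)) = exp (\<beta> * ln (norm x))"
        by (simp add: exp_add[symmetric] algebra_simps)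
      then show ?case by (cases "norm x \<le> \<eta>") (simp_all add: h'_def norm_mult norm_qchar norm_power)
    qed
  qed
  then show False using fin haar_integral_infinite[OF \<beta> \<eta>(1)] by simp
qed

text \<open>The converse to the integrability of the beta integrand on a disc; since c > 1 the disc
  contains both singular points in its interior.\<close>

lemma beta_necessary:
  assumes int: "integrable haar (\<lambda>x. indicator (cball 0 c) x * (qchar n A x * qchar m (B - 2) (1 - x)))" and c: "c > 1"
  shows "Re A > 0" "Re B > 0"
proof -
  let ?F = "\<lambda>x. indicator (cball 0 c) x * (qchar n A x * qchar m (B - 2) (1 - x))"
  have fin: "(\<integral>\<^sup>+x. ennreal (norm (?F x)) \<partial>haar) < \<infinity>" using int unfolding integrable_iff_bounded by blast
  show "Re A > 0"
  proof (rule ccontr)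
    assume "\<not> Re A > 0"
    then have A: "Re A \<le> 0" by simp
    obtain C where C: "C > 0" "\<And>x :: complex. 1 / 2 \<le> norm x \<Longrightarrow> norm x \<le> 3 / 2 \<Longrightarrow> C \<le> exp ((Re B - 2) * ln (norm x))"
      by (rule exp_ln_lower_norm[of "1 / 2" "3 / 2" "Re B - 2"]) auto
    have "ennreal C * (\<integral>\<^sup>+x. indicator (cball 0 (1 / 2)) x * ennreal (exp (Re A * ln (norm x))) \<partial>haar)
      = (\<integral>\<^sup>+x. ennreal C * (indicator (cball 0 (1 / 2)) x * ennreal (exp (Re A * ln (norm x)))) \<partial>haar)"
      by (rule nn_integral_cmult[symmetric]) simp
    also have "\<dots> \<le> (\<integral>\<^sup>+x. ennreal (norm (?F x)) \<partial>haar)"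
    proof (rule nn_integral_mono)
      fix x :: complex
      show "ennreal C * (indicator (cball 0 (1 / 2)) x * ennreal (exp (Re A * ln (norm x)))) \<le> ennreal (norm (?F x))"
      proof (cases "norm x \<le> 1 / 2")
        case True
        then have "1 / 2 \<le> norm (1 - x)" "norm (1 - x) \<le> 3 / 2"
          using norm_triangle_ineq2[of 1 x] norm_triangle_ineq4[of 1 x] by simp_all
        from mult_right_mono[OF C(2)[OF this], of "exp (Re A * ln (norm x))"]
        have "C * exp (Re A * ln (norm x)) \<le> norm (?F x)"
          using True c by (simp add: norm_mult norm_qchar mult.commute)
        then show ?thesis using True C(1) by (simp add: ennreal_mult[symmetric] ennreal_leI)
      qed simp
    qed
    finally show False using fin C(1) haar_integral_infinite[OF A, of "1 / 2"] by (simp add: ennreal_mult_eq_top_iff top_unique)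
  qed
  show "Re B > 0"
  proof (rule beta_necessary_one)
    obtain C where C: "C > 0" "\<And>x :: complex. 1 / 2 \<le> norm x \<Longrightarrow> norm x \<le> 3 / 2 \<Longrightarrow> C \<le> exp (Re A * ln (norm x))"
      by (rule exp_ln_lower_norm[of "1 / 2" "3 / 2" "Re A"]) auto
    define \<eta> where "\<eta> = min (1 / 2) (c - 1)"
    show "0 < \<eta>" using c by (simp add: \<eta>_def)
    show "\<eta> \<le> 1 / 2" unfolding \<eta>_def by (rule min.cobounded1)
    have "integrable haar (\<lambda>x. of_real (1 / C) * ?F x)" by (rule integrable_mult_right[OF int])
    then show "integrable haar (\<lambda>x. indicator (cball 0 \<eta>) (1 - x) * qchar 0 (of_real (Re B - 2)) (1 - x))"
    proof (rule Bochner_Integration.integrable_bound)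
      show "AE x in haar. norm (indicator (cball 0 \<eta>) (1 - x) * qchar 0 (of_real (Re B - 2)) (1 - x)) \<le> norm (of_real (1 / C) * ?F x)"
      proof (rule AE_I2)
        fix x
        show "norm (indicator (cball 0 \<eta>) (1 - x) * qchar 0 (of_real (Re B - 2)) (1 - x)) \<le> norm (of_real (1 / C) * ?F x)"
        proof (cases "norm (1 - x) \<le> \<eta>")
          case True
          have x: "1 / 2 \<le> norm x" "norm x \<le> 3 / 2" "norm x \<le> c"
            using True norm_triangle_ineq2[of 1 "1 - x"] norm_triangle_ineq4[of 1 "1 - x"] by (simp_all add: \<eta>_def)
          from mult_right_mono[OF C(2)[OF x(1,2)], of "exp ((Re B - 2) * ln (norm (1 - x)))"]
          have "C * exp ((Re B - 2) * ln (norm (1 - x))) \<le> norm (?F x)"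
            using x(3) by (simp add: norm_mult norm_qchar)
          then have "exp ((Re B - 2) * ln (norm (1 - x))) \<le> 1 / C * norm (?F x)" using C(1) by (simp add: field_simps)
          moreover have "norm (of_real (1 / C) * ?F x) = 1 / C * norm (?F x)"
            using C(1) by (simp only: norm_mult norm_of_real) simp
          moreover have "norm (indicator (cball 0 \<eta>) (1 - x) * qchar 0 (of_real (Re B - 2)) (1 - x)) = exp ((Re B - 2) * ln (norm (1 - x)))"
            using True by (simp add: norm_mult norm_qchar)
          ultimately show ?thesis by (simp only:)
        qed simp
      qed
    qed simp
  qed
qed

context beta_chain
begin

text \<open>Near x = 0 the integrand of \<open>J (Suc p) z\<close> is at least a multiple of the
  modulus of x to the stated exponent, by the lower bounds for both factors. The inequality makes
  the Mellin integral of \<open>f (Suc p)\<close> converge at zero at every exponent of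
  \<open>I p\<close>.\<close>

lemma finite_at_zero:
  assumes z: "0 < norm z" "norm z < 1" and J: "J (Suc p) z < \<infinity>" and j: "j \<le> p"
  shows "0 < Re (sa (Suc p)) + 2 - Re (sb j)"
proof (rule ccontr)
  let ?i = "Suc p"
  define e where "e = 2 - Re (sb j)"
  assume "\<not> ?thesis"
  then have A: "Re (sa ?i) + e \<le> 0" by (simp add: e_def)
  obtain C where C: "C > 0" "\<And>y. 0 < norm y \<Longrightarrow> norm y \<le> norm z \<Longrightarrow> ennreal (C * exp (e * ln (norm y))) \<le> J p y"
    using J_lower[OF j z] unfolding e_def by blast
  obtain C2 where C2: "C2 > 0" "\<And>x. norm x \<le> 1 / 2 \<Longrightarrow> C2 * exp (Re (sa ?i) * ln (norm x)) \<le> norm (f ?i x)"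
    by (rule f_lower_zero[where i = ?i]) auto
  define K where "K = C * C2 * exp (e * ln (norm z))"
  have K: "K > 0" using C(1) C2(1) by (simp add: K_def)
  have "ennreal K * (\<integral>\<^sup>+x. indicator (cball 0 (1 / 2)) x * ennreal (exp ((Re (sa ?i) + e) * ln (norm x))) \<partial>haar)
     = (\<integral>\<^sup>+x. ennreal K * (indicator (cball 0 (1 / 2)) x * ennreal (exp ((Re (sa ?i) + e) * ln (norm x)))) \<partial>haar)"
    by (rule nn_integral_cmult[symmetric]) simp
  also have "\<dots> \<le> J ?i z" unfolding J.simps
  proof (rule nn_integral_mono_AE)
    show "AE x in haar. ennreal K * (indicator (cball 0 (1 / 2)) x * ennreal (exp ((Re (sa ?i) + e) * ln (norm x))))
       \<le> ennreal (norm (f ?i x)) * J p (z * x)"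
      using AE_haar_nonzero
    proof eventually_elim
      case (elim x)
      show ?case
      proof (cases "norm x \<le> 1 / 2")
        case True
        have "norm (z * x) \<le> norm z * 1" unfolding norm_mult using True by (intro mult_left_mono) auto
        then have 1: "ennreal (C * exp (e * ln (norm (z * x)))) \<le> J p (z * x)" using elim z by (intro C(2)) auto
        have 2: "ennreal (C2 * exp (Re (sa ?i) * ln (norm x))) \<le> ennreal (norm (f ?i x))"
          by (rule ennreal_leI[OF C2(2)[OF True]])
        have l: "ln (norm (z * x)) = ln (norm z) + ln (norm x)" using z elim by (simp add: norm_mult ln_mult)
        have eq: "K * exp ((Re (sa ?i) + e) * ln (norm x)) = C2 * exp (Re (sa ?i) * ln (norm x)) * (C * exp (e * ln (norm (z * x))))"
          unfolding K_def l distrib_left distrib_right exp_add by (simp only: mult_ac)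
        have "ennreal K * (indicator (cball 0 (1 / 2)) x * ennreal (exp ((Re (sa ?i) + e) * ln (norm x))))
          = ennreal (C2 * exp (Re (sa ?i) * ln (norm x))) * ennreal (C * exp (e * ln (norm (z * x))))"
          using True K C(1) C2(1) eq by (simp add: ennreal_mult[symmetric])
        also have "\<dots> \<le> ennreal (norm (f ?i x)) * J p (z * x)" by (rule mult_mono[OF 2 1]) simp_all
        finally show ?thesis .
      qed simp
    qed
  qed
  finally show False using J K haar_integral_infinite[OF A, of "1 / 2"]
    by (simp add: ennreal_mult_eq_top_iff top_unique)
qed

text \<open>For x within \<eta> of 1 the modulus of z x stays below r = (1 + norm z)/2 < 1, where
  \<open>J p\<close> is bounded below. Convergence at x = 1 is then that of the power of 1 - x
  alone.\<close>

lemma finite_at_one: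
  assumes z: "0 < norm z" "norm z < 1" and J: "J (Suc p) z < \<infinity>"
  shows "0 < Re (sb (Suc p)) - Re (sa (Suc p))"
proof (rule beta_necessary_one)
  let ?i = "Suc p"
  define r where "r = (1 + norm z) / 2"
  define \<eta> where "\<eta> = min (1 / 2) ((1 - norm z) / 2)"
  show \<eta>: "0 < \<eta>" "\<eta> \<le> 1 / 2" using z by (simp_all add: \<eta>_def)
  obtain C where C: "C > 0" "\<And>y. 0 < norm y \<Longrightarrow> norm y \<le> r \<Longrightarrow> ennreal C \<le> J p y"
    by (rule J_lower_const[of r p]) (use z in \<open>auto simp: r_def add_pos_nonneg\<close>)
  obtain C2 where C2: "C2 > 0" "\<And>x. norm (1 - x) \<le> 1 / 2 \<Longrightarrow>
      C2 * exp ((Re (sb ?i) - Re (sa ?i) - 2) * ln (norm (1 - x))) \<le> norm (f ?i x)"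
    by (rule f_lower_one[where i = ?i]) auto
  let ?h = "\<lambda>x. indicator (cball 0 \<eta>) (1 - x) * qchar 0 (of_real (Re (sb ?i) - Re (sa ?i) - 2)) (1 - x)"
  have "(\<integral>\<^sup>+x. ennreal (norm (?h x)) \<partial>haar) \<le> (\<integral>\<^sup>+x. ennreal (1 / (C * C2)) * (ennreal (norm (f ?i x)) * J p (z * x)) \<partial>haar)"
  proof (rule nn_integral_mono)
    fix x
    show "ennreal (norm (?h x)) \<le> ennreal (1 / (C * C2)) * (ennreal (norm (f ?i x)) * J p (z * x))"
    proof (cases "norm (1 - x) \<le> \<eta>")
      case True
      then have x: "norm (1 - x) \<le> 1 / 2" "norm x \<le> 1 + \<eta>" "1 / 2 \<le> norm x"
        using \<eta> norm_triangle_ineq4[of 1 "1 - x"] norm_triangle_ineq2[of 1 "1 - x"] by simp_all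
      define y where "y = exp ((Re (sb ?i) - Re (sa ?i) - 2) * ln (norm (1 - x)))"
      have "norm (z * x) \<le> norm z * (1 + \<eta>)" unfolding norm_mult using x by (intro mult_left_mono) auto
      also have "\<dots> \<le> norm z + 1 * \<eta>" unfolding distrib_left using z \<eta> by (intro add_mono mult_right_mono) auto
      also have "\<dots> \<le> r" by (simp add: r_def \<eta>_def min_def field_simps)
      finally have 1: "ennreal C \<le> J p (z * x)" using x(3) z by (intro C(2)) auto
      have 2: "ennreal (C2 * y) \<le> ennreal (norm (f ?i x))"
        unfolding y_def by (rule ennreal_leI[OF C2(2)[OF x(1)]])
      have "ennreal (norm (?h x)) = ennreal (1 / (C * C2)) * (ennreal (C2 * y) * ennreal C)"
        using True C(1) C2(1) by (simp add: ennreal_mult[symmetric] norm_qchar y_def)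
      also have "\<dots> \<le> ennreal (1 / (C * C2)) * (ennreal (norm (f ?i x)) * J p (z * x))"
        by (intro mult_left_mono mult_mono 1 2) simp_all
      finally show ?thesis .
    qed simp
  qed
  also have "\<dots> = ennreal (1 / (C * C2)) * J ?i z" unfolding J.simps by (rule nn_integral_cmult) simp
  also have "\<dots> < \<infinity>" using J by (simp add: ennreal_mult_less_top)
  finally have "(\<integral>\<^sup>+x. ennreal (norm (?h x)) \<partial>haar) < \<infinity>" .
  then show "integrable haar ?h" unfolding integrable_iff_bounded by simp
qed

text \<open>Finiteness of the absolute Mellin integral of \<open>J p\<close> truncated at zero; s is
  meant as the real part of the Mellin parameter.\<close>

definition fin :: "nat \<Rightarrow> real \<Rightarrow> real \<Rightarrow> bool" where
  "fin p e s \<longleftrightarrow> (\<integral>\<^sup>+y. indicator (- cball 0 e) y * (ennreal (exp (s * ln (norm y))) * J p y) \<partial>haar) < \<infinity>"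

text \<open>At infinity \<open>f (Suc p)\<close> is at least of order
  \<open>Re (sb (Suc p)) - 2\<close>. Convergence of the convolution at one z therefore controls the
  tail of \<open>J p\<close> against every power not exceeding this one, after the substitution y =
  z x.\<close>

lemma tail_finite:
  assumes J: "J (Suc p) z < \<infinity>" and z: "z \<noteq> 0" and c: "1 < c" and s: "s \<le> Re (sb (Suc p)) - 2"
  shows "fin p (c * norm z) s"
proof -
  let ?i = "Suc p"
  define w1 where "w1 = Re (sb ?i) - 2"
  obtain C where C: "C > 0" "\<And>x. norm x > c \<Longrightarrow> C * exp (w1 * ln (norm x)) \<le> norm (f ?i x)"
    using f_lower_infinity[OF c, of ?i] unfolding w1_def by auto
  define K where "K = exp (s * ln (norm z)) * exp ((s - w1) * ln c) / C"
  have K: "K \<ge> 0" using C(1) by (simp add: K_def)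
  have "(\<integral>\<^sup>+y. indicator (- cball 0 (c * norm z)) y * (ennreal (exp (s * ln (norm y))) * J p y) \<partial>haar)
    = (\<integral>\<^sup>+x. indicator (- cball 0 c) x * (ennreal (exp (s * ln (norm (x * z)))) * J p (x * z)) \<partial>haar)"
    by (rule nn_integral_haar_indicator_scale[symmetric, of "\<lambda>y. ennreal (exp (s * ln (norm y))) * J p y"]) (use z in simp_all)
  also have "\<dots> \<le> (\<integral>\<^sup>+x. ennreal K * (ennreal (norm (f ?i x)) * J p (z * x)) \<partial>haar)"
  proof (rule nn_integral_mono)
    fix x
    show "indicator (- cball 0 c) x * (ennreal (exp (s * ln (norm (x * z)))) * J p (x * z))
      \<le> ennreal K * (ennreal (norm (f ?i x)) * J p (z * x))"
    proof (cases "norm x > c")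
      case True
      have "ln c \<le> ln (norm x)" using True c by (intro ln_mono) auto
      then have "(s - w1) * ln (norm x) \<le> (s - w1) * ln c" using s by (intro mult_left_mono_neg) (auto simp: w1_def)
      then have b: "s * ln (norm x) \<le> (s - w1) * ln c + w1 * ln (norm x)" by (simp add: algebra_simps)
      have x0: "x \<noteq> 0" using True c by auto
      have l: "ln (norm (x * z)) = ln (norm z) + ln (norm x)" using z x0 by (simp add: norm_mult ln_mult)
      have "exp (s * ln (norm (x * z))) = exp (s * ln (norm z)) * exp (s * ln (norm x))"
        unfolding l distrib_left exp_add ..
      also have "\<dots> \<le> exp (s * ln (norm z)) * (exp ((s - w1) * ln c) * exp (w1 * ln (norm x)))"
        using b by (intro mult_left_mono) (simp_all add: exp_add[symmetric])
      also have "\<dots> = K * (C * exp (w1 * ln (norm x)))" using C(1) by (simp add: K_def)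
      also have "\<dots> \<le> K * norm (f ?i x)" by (rule mult_left_mono[OF C(2)[OF True] K])
      finally have "ennreal (exp (s * ln (norm (x * z)))) \<le> ennreal K * ennreal (norm (f ?i x))"
        using K by (simp add: ennreal_mult[symmetric] ennreal_leI)
      from mult_right_mono[OF this, of "J p (z * x)"] show ?thesis
        using True by (simp add: mult.assoc mult.commute[of x z])
    qed simp
  qed
  also have "\<dots> = ennreal K * J ?i z" unfolding J.simps by (rule nn_integral_cmult) simp
  also have "\<dots> < \<infinity>" using J by (simp add: ennreal_mult_less_top)
  finally show ?thesis unfolding fin_def .
qed

text \<open>By Tonelli the truncated Mellin integral of the convolution integrates f against tails
  of \<open>J p\<close> beyond \<open>e * norm x\<close>. Finiteness at some small x bounds the tail
  from any radius. As x tends to 0 these tails stay bounded below, so the power of x in front of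
  them must itself be integrable, which is the second inequality.\<close>

lemma fin_Suc:
  assumes fin: "fin (Suc p) e s" and e: "0 < e" "e < 1"
  shows "\<And>\<rho>. \<rho> > 0 \<Longrightarrow> fin p \<rho> s" "0 < Re (sa (Suc p)) - s"
proof -
  let ?i = "Suc p"
  interpret HH: pair_sigma_finite haar haar ..
  define \<Phi> where "\<Phi> x = (\<integral>\<^sup>+u. indicator (- cball 0 (e * norm x)) u * (ennreal (exp (s * ln (norm u))) * J p u) \<partial>haar)" for x :: complex
  have \<Phi>_meas [measurable]: "\<Phi> \<in> borel_measurable borel"
  proof -
    have "\<Phi> = (\<lambda>x. \<integral>\<^sup>+u. (if e * norm x < norm u then 1 else 0) * (ennreal (exp (s * ln (norm u))) * J p u) \<partial>haar)"
      unfolding \<Phi>_def by (intro ext nn_integral_cong) (auto simp: indicator_def)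
    then show ?thesis by simp
  qed
  define Q where "Q z x = indicator (- cball 0 e) z * (ennreal (exp (s * ln (norm z))) * (ennreal (norm (f ?i x)) * J p (z * x)))" for z x
  have Q_meas [measurable]: "case_prod Q \<in> borel_measurable (haar \<Otimes>\<^sub>M haar)"
    unfolding Q_def by measurable
  have inner: "(\<integral>\<^sup>+z. Q z x \<partial>haar) = ennreal (norm (f ?i x) * exp (- s * ln (norm x))) * \<Phi> x" if x: "x \<noteq> 0" for x
  proof -
    have "(\<integral>\<^sup>+z. Q z x \<partial>haar) = (\<integral>\<^sup>+z. ennreal (norm (f ?i x) * exp (- s * ln (norm x))) *
       (indicator (- cball 0 e) z * (ennreal (exp (s * ln (norm (z * x)))) * J p (z * x))) \<partial>haar)"
    proof (rule nn_integral_cong_AE)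
      show "AE z in haar. Q z x = ennreal (norm (f ?i x) * exp (- s * ln (norm x))) *
       (indicator (- cball 0 e) z * (ennreal (exp (s * ln (norm (z * x)))) * J p (z * x)))"
        using AE_haar_nonzero
      proof eventually_elim
        case (elim z)
        have l: "ln (norm (z * x)) = ln (norm z) + ln (norm x)" using x elim by (simp add: norm_mult ln_mult)
        have "exp (s * ln (norm z)) = exp (- s * ln (norm x)) * exp (s * ln (norm (z * x)))"
          unfolding exp_add[symmetric] l by (simp add: algebra_simps)
        then have "ennreal (exp (s * ln (norm z))) = ennreal (exp (- s * ln (norm x))) * ennreal (exp (s * ln (norm (z * x))))"
          by (simp only: ennreal_mult exp_ge_zero)
        then show ?case unfolding Q_def by (simp only: ennreal_mult norm_ge_zero exp_ge_zero mult_ac)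
      qed
    qed
    also have "\<dots> = ennreal (norm (f ?i x) * exp (- s * ln (norm x))) *
       (\<integral>\<^sup>+z. indicator (- cball 0 e) z * (ennreal (exp (s * ln (norm (z * x)))) * J p (z * x)) \<partial>haar)"
      by (rule nn_integral_cmult) simp
    also have "(\<integral>\<^sup>+z. indicator (- cball 0 e) z * (ennreal (exp (s * ln (norm (z * x)))) * J p (z * x)) \<partial>haar) = \<Phi> x"
      unfolding \<Phi>_def by (rule nn_integral_haar_indicator_scale[of "\<lambda>y. ennreal (exp (s * ln (norm y))) * J p y"]) (use x in simp_all)
    finally show ?thesis .
  qed
  have "(\<integral>\<^sup>+x. ennreal (norm (f ?i x) * exp (- s * ln (norm x))) * \<Phi> x \<partial>haar) = (\<integral>\<^sup>+x. \<integral>\<^sup>+z. Q z x \<partial>haar \<partial>haar)"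
    using AE_haar_nonzero by (intro nn_integral_cong_AE; eventually_elim) (simp add: inner)
  also have "\<dots> = (\<integral>\<^sup>+z. \<integral>\<^sup>+x. Q z x \<partial>haar \<partial>haar)"
    by (rule HH.Fubini') (simp add: split_beta')
  also have "\<dots> = (\<integral>\<^sup>+z. indicator (- cball 0 e) z * (ennreal (exp (s * ln (norm z))) * J ?i z) \<partial>haar)"
    unfolding Q_def J.simps by (intro nn_integral_cong) (simp add: nn_integral_cmult)
  finally have fin': "(\<integral>\<^sup>+x. ennreal (norm (f ?i x) * exp (- s * ln (norm x))) * \<Phi> x \<partial>haar) < \<infinity>"
    using fin unfolding fin_def by simp
  show "fin p \<rho> s" if \<rho>: "\<rho> > 0" for \<rho>
  proof -
    have "AE x in haar. ennreal (norm (f ?i x) * exp (- s * ln (norm x))) * \<Phi> x \<noteq> \<infinity>"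
      by (rule nn_integral_PInf_AE) (use fin' in auto)
    then have ae: "AE x in haar. \<Phi> x < \<infinity>"
    proof eventually_elim
      case (elim x)
      then show ?case using f_nonzero[of ?i x] by (auto simp: ennreal_mult_eq_top_iff less_top[symmetric])
    qed
    define t where "t = \<rho> / e"
    have "0 < t" using \<rho> e by (simp add: t_def)
    then have "\<exists>x. t / 2 < norm x \<and> norm x \<le> t \<and> \<Phi> x < \<infinity>" by (intro AE_haar_annulus[OF ae]) simp_all
    then obtain x where x: "norm x \<le> \<rho> / e" "\<Phi> x < \<infinity>" unfolding t_def by blast
    have sub: "e * norm x \<le> \<rho>" using x(1) e by (simp add: field_simps)
    have "(\<integral>\<^sup>+y. indicator (- cball 0 \<rho>) y * (ennreal (exp (s * ln (norm y))) * J p y) \<partial>haar) \<le> \<Phi> x"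
      unfolding \<Phi>_def using sub by (intro nn_integral_mono) (auto simp: indicator_def)
    then show ?thesis unfolding fin_def using x(2) by (rule le_less_trans)
  qed
  show "0 < Re (sa ?i) - s"
  proof (rule ccontr)
    assume "\<not> ?thesis"
    then have A: "Re (sa ?i) - s \<le> 0" by simp
    define r where "r = (1 + e) / 2"
    have r: "e < r" "r < 1" "0 < r" using e by (simp_all add: r_def)
    obtain C where C: "C > 0" "\<And>y. 0 < norm y \<Longrightarrow> norm y \<le> r \<Longrightarrow> ennreal C \<le> J p y"
      by (rule J_lower_const[of r p]) (use r in auto)
    obtain C2 where C2: "C2 > 0" "\<And>x. norm x \<le> 1 / 2 \<Longrightarrow> C2 * exp (Re (sa ?i) * ln (norm x)) \<le> norm (f ?i x)"
      by (rule f_lower_zero[where i = ?i]) auto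
    obtain C3 where C3: "C3 > 0" "\<And>x :: complex. e \<le> norm x \<Longrightarrow> norm x \<le> r \<Longrightarrow> C3 \<le> exp (s * ln (norm x))"
      by (rule exp_ln_lower_norm[of e r s]) (use e in auto)
    define m where "m = C3 * C * (2 * pi * (ln r - ln e))"
    have m: "m > 0" unfolding m_def using C C3 r e by (intro mult_pos_pos) auto
    \<comment> \<open>For \<open>norm x \<le> 1 / 2\<close> the region of the tail contains the
      annulus between e and r, on which \<open>J p\<close> is bounded below.\<close>
    have \<Phi>: "ennreal m \<le> \<Phi> x" if x: "norm x \<le> 1 / 2" for x
      unfolding \<Phi>_def m_def
    proof (rule haar_annulus_lower[where z = 1])
      fix u :: complex assume u: "e < norm (1 * u)" "norm (1 * u) \<le> r"
      have "e * norm x \<le> e * 1" using e x by (intro mult_left_mono) auto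
      then have "u \<in> - cball 0 (e * norm x)" using u by simp
      moreover have "ennreal C3 \<le> ennreal (exp (s * ln (norm u)))" using u by (intro ennreal_leI C3(2)) auto
      moreover have "ennreal C \<le> J p u" using u e by (intro C(2)) auto
      ultimately show "ennreal (C3 * C) \<le> indicator (- cball 0 (e * norm x)) u * (ennreal (exp (s * ln (norm u))) * J p u)"
        using C(1) C3(1) by (simp add: ennreal_mult mult_mono)
    qed (use e r C(1) C3(1) in auto)
    have "ennreal (C2 * m) * (\<integral>\<^sup>+x. indicator (cball 0 (1 / 2)) x * ennreal (exp ((Re (sa ?i) - s) * ln (norm x))) \<partial>haar)
       = (\<integral>\<^sup>+x. ennreal (C2 * m) * (indicator (cball 0 (1 / 2)) x * ennreal (exp ((Re (sa ?i) - s) * ln (norm x)))) \<partial>haar)"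
      by (rule nn_integral_cmult[symmetric]) simp
    also have "\<dots> \<le> (\<integral>\<^sup>+x. ennreal (norm (f ?i x) * exp (- s * ln (norm x))) * \<Phi> x \<partial>haar)"
    proof (rule nn_integral_mono)
      fix x :: complex
      show "ennreal (C2 * m) * (indicator (cball 0 (1 / 2)) x * ennreal (exp ((Re (sa ?i) - s) * ln (norm x))))
        \<le> ennreal (norm (f ?i x) * exp (- s * ln (norm x))) * \<Phi> x"
      proof (cases "norm x \<le> 1 / 2")
        case True
        have "C2 * exp ((Re (sa ?i) - s) * ln (norm x)) = C2 * exp (Re (sa ?i) * ln (norm x)) * exp (- s * ln (norm x))"
          by (simp add: exp_add[symmetric] algebra_simps)
        also have "\<dots> \<le> norm (f ?i x) * exp (- s * ln (norm x))" by (rule mult_right_mono[OF C2(2)[OF True]]) simp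
        finally have 1: "ennreal (C2 * exp ((Re (sa ?i) - s) * ln (norm x))) \<le> ennreal (norm (f ?i x) * exp (- s * ln (norm x)))"
          by (rule ennreal_leI)
        have "ennreal (C2 * m) * (indicator (cball 0 (1 / 2)) x * ennreal (exp ((Re (sa ?i) - s) * ln (norm x))))
          = ennreal (C2 * exp ((Re (sa ?i) - s) * ln (norm x))) * ennreal m"
          using True C2(1) m by (simp add: ennreal_mult[symmetric] mult_ac)
        also have "\<dots> \<le> ennreal (norm (f ?i x) * exp (- s * ln (norm x))) * \<Phi> x"
          by (rule mult_mono[OF 1 \<Phi>[OF True]]) simp_all
        finally show ?thesis .
      qed simp
    qed
    finally show False using fin' C2(1) m haar_integral_infinite[OF A, of "1 / 2"]
      by (simp add: ennreal_mult_eq_top_iff top_unique)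
  qed
qed

lemma J_AE_finite:
  assumes J: "J (Suc p) z < \<infinity>" and z: "z \<noteq> 0"
  shows "AE y in haar. J p y < \<infinity>"
proof (rule AE_haar_scale[OF _ z])
  have "AE x in haar. ennreal (norm (f (Suc p) x)) * J p (z * x) \<noteq> \<infinity>"
    by (rule nn_integral_PInf_AE) (use J in auto)
  then show "AE x in haar. J p (z * x) < \<infinity>"
  proof eventually_elim
    case (elim x)
    then show ?case using f_nonzero[of "Suc p" x] by (auto simp: ennreal_mult_eq_top_iff less_top[symmetric])
  qed
qed simp

lemma fin_AE:
  assumes "fin p e s"
  shows "AE y in haar. norm y > e \<longrightarrow> J p y < \<infinity>"
proof -
  have "AE y in haar. indicator (- cball 0 e) y * (ennreal (exp (s * ln (norm y))) * J p y) \<noteq> \<infinity>"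
    by (rule nn_integral_PInf_AE) (use assms in \<open>auto simp: fin_def\<close>)
  then show ?thesis
  proof eventually_elim
    case (elim y)
    then show ?case by (auto simp: ennreal_mult_eq_top_iff less_top[symmetric])
  qed
qed

text \<open>Only indices with first component i contribute corrections, and these form
  \<open>bsum\<close>. The transform is thus the finite part of a beta integral whose exponents at 0
  are shifted by (N, v).\<close>

lemma FPinf_f:
  assumes ni: "bnonint (na i + N) (sa i + v) (nb i - na i) (sb i - sa i)"
    and AB: "0 < Re (sa i + v)" "0 < Re (sb i) - Re (sa i)" and c: "1 < c"
  shows "FPinf (f i) (d i) en ew c N v = E i N v"
proof -
  have "(\<integral>j. d i j * haar_K (N - en j) (v - ew j) c \<partial>count_space UNIV)
    = (\<integral>p. d i (i, p) * haar_K (N - en (i, p)) (v - ew (i, p)) c \<partial>count_space UNIV)"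
    by (rule integral_count_space_inj(2)) (auto simp: inj_def d_def image_iff)
  also have "\<dots> = bsum (na i + N) (sa i + v) (nb i - na i) (sb i - sa i) c"
    unfolding bsum_def
  proof (intro Bochner_Integration.integral_cong refl)
    fix p :: "nat \<times> nat"
    have e: "N - en (i, p) = na i + N + (nb i - na i) + (int (snd p) - int (fst p))"
      "v - ew (i, p) = sa i + v + (sb i - sa i) - 2 + - (of_nat (fst p) + of_nat (snd p))"
      by (simp_all add: en_def ew_def)
    show "d i (i, p) * haar_K (N - en (i, p)) (v - ew (i, p)) c = (-1) powi (nb i - na i) * bcoef (nb i - na i) (sb i - sa i) p *
       haar_K (na i + N + (nb i - na i) + (int (snd p) - int (fst p))) (sa i + v + (sb i - sa i) - 2 + - (of_nat (fst p) + of_nat (snd p))) c"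
      unfolding e by (simp add: d_def)
  qed
  finally have s: "(\<integral>j. d i j * haar_K (N - en j) (v - ew j) c \<partial>count_space UNIV)
    = bsum (na i + N) (sa i + v) (nb i - na i) (sb i - sa i) c" .
  have "f i x * qchar N v x = qchar (na i + N) (sa i + v) x * qchar (nb i - na i) (sb i - sa i - 2) (1 - x)" for x
    unfolding f_def qchar_add by (simp only: mult_ac)
  then have "FPinf (f i) (d i) en ew c N v = bFP (na i + N) (sa i + v) (nb i - na i) (sb i - sa i) c"
    unfolding FPinf_def s bFP_def by (simp only:)
  also have "\<dots> = E i N v" unfolding E_def by (rule bFP_eq_bval[OF ni AB(1) _ c]) (use AB in simp)
  finally show ?thesis .
qed

lemma bh0: "bh 0 = 1" by (simp add: bh_def nb0 sb0)

text \<open>Inversion carries the tail of \<open>I 0\<close> to a beta integral over the disc of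
  radius 1/e, and the finite part at zero to one at infinity. Convergence of the tail yields the
  positivity of the real parts. The sign of the inversion appears once for the integral and once for
  the value, and cancels.\<close>

lemma FPzero_I0:
  assumes gen: "gen 0 N v" and e: "0 < e" "e < 1" and fin: "fin 0 e (Re v)"
  shows "FPzero (I 0) (g 0) en ew e N v = M 0 N v"
proof -
  \<comment> \<open>n and A are the exponents at infinity of the beta integrand with exponents (N,
    v) at 0 and (m, B) at 1; inversion brings them to 0.\<close>
  define m B n A where "m = - na 0" and "B = 2 - sa 0" and "n = - N - m" and "A = 2 - v - B"
  have I0: "I 0 y = qchar m (B - 2) (1 - y)" for y by (simp add: m_def B_def)
  have "(B + of_int m) / 2 = of_int 1 - ah 0" "v / 2 + of_int N / 2 = (v + of_int N) / 2"
    by (simp_all add: B_def m_def ah_def field_simps)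
  moreover have "ah 0 \<notin> \<int>" using nonint_shift[of "ah 0 - bh 0" "ah 0" 1] gen_ab'[of 0 0] by (simp add: bh0)
  ultimately have b1: "(B + of_int m) / 2 \<notin> \<int>" using nonint_shift[of "ah 0" "(B + of_int m) / 2" 1] by simp
  have g: "(v + of_int N) / 2 - ah 0 \<notin> \<int>" "(v + of_int N) / 2 - 1 \<notin> \<int>" using gen by (simp_all add: gen_def bh0)
  have b2: "(v + of_int N) / 2 \<notin> \<int>" using nonint_shift[OF g(2), of "(v + of_int N) / 2" 1] by simp
  have "(v + of_int N) / 2 + (B + of_int m) / 2 = (v + of_int N) / 2 - ah 0 + of_int 1"
    by (simp add: B_def m_def ah_def field_simps)
  then have b3: "(v + of_int N) / 2 + (B + of_int m) / 2 \<notin> \<int>" using nonint_shift[OF g(1)] by blast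
  have ni: "bnonint N v m B" using b1 b2 b3 by (simp add: bnonint_def)
  have ni': "bnonint n A m B" using bnonint_inversion[OF ni] by (simp add: n_def A_def)
  define h where "h y = indicator (- cball 0 e) y * (I 0 y * qchar N v y)" for y
  have [measurable]: "h \<in> borel_measurable borel" unfolding h_def[abs_def] by measurable
  have hi: "integrable haar h" unfolding integrable_iff_bounded
  proof
    have "(\<integral>\<^sup>+y. ennreal (norm (h y)) \<partial>haar) = (\<integral>\<^sup>+y. indicator (- cball 0 e) y * (ennreal (exp (Re v * ln (norm y))) * J 0 y) \<partial>haar)"
      by (intro nn_integral_cong) (auto simp: h_def norm_mult norm_qchar indicator_def ennreal_mult[symmetric] mult.commute)
    then show "(\<integral>\<^sup>+y. ennreal (norm (h y)) \<partial>haar) < \<infinity>" using fin unfolding fin_def by simp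
  qed simp
  define k where "k x = indicator (cball 0 (1 / e)) x * (qchar n A x * qchar m (B - 2) (1 - x))" for x
  have [measurable]: "k \<in> borel_measurable borel" unfolding k_def[abs_def] by measurable
  have hk: "AE x in haar. h (inverse x) = (-1) powi m * k x"
    using haar_ne_1 AE_haar_sphere[of "1 / e"]
  proof eventually_elim
    case (elim x)
    have "inverse x \<in> - cball 0 e \<longleftrightarrow> x \<in> cball 0 (1 / e)"
      using elim e by (auto simp: norm_inverse norm_divide field_simps)
    then have i: "indicator (- cball 0 e) (inverse x) = (indicator (cball 0 (1 / e)) x :: complex)" by (simp add: indicator_def)
    have q: "qchar N v (inverse x) = qchar (- N) (- v) x" using elim by (simp add: qchar_inverse qchar_minus)
    have nA: "n = - N + - m" "A = - v + - (B - 2)" by (simp_all add: n_def A_def)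
    have q2: "qchar n A x = qchar (- N) (- v) x * qchar (- m) (- (B - 2)) x" unfolding nA by (rule qchar_add)
    show ?case unfolding h_def k_def I0 i q q2
      using elim by (subst qchar_one_minus_inverse) (simp_all only: mult_ac not_False_eq_True)
  qed
  have "integrable haar (\<lambda>x. h (inverse x))" using hi haar_integrable_inverse_iff[of h] by simp
  then have "integrable haar (\<lambda>x. (-1) powi m * k x)"
    by (rule integrable_cong_AE_imp) (use hk in \<open>auto elim: eventually_mono\<close>)
  then have "integrable haar (\<lambda>x. (-1) powi m * ((-1) powi m * k x))" by (rule integrable_mult_right)
  then have ki: "integrable haar k" using minus1_powi[of m] by (simp add: mult.assoc[symmetric])
  have e1: "1 / e > 1" using e by simp
  have AB: "Re A > 0" "Re B > 0" using beta_necessary[OF ki[unfolded k_def[abs_def]] e1] by auto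
  have "(\<integral>y. h y \<partial>haar) = (\<integral>x. h (inverse x) \<partial>haar)" by (rule haar_integral_inverse[symmetric]) simp
  also have "\<dots> = (\<integral>x. (-1) powi m * k x \<partial>haar)" by (rule integral_cong_AE[OF _ _ hk]) simp_all
  also have "\<dots> = (-1) powi m * (\<integral>x. k x \<partial>haar)" by (rule integral_mult_right_zero)
  finally have 1: "(\<integral>y. h y \<partial>haar) = (-1) powi m * (\<integral>x. k x \<partial>haar)" .
  have "(\<integral>k. g 0 k * haar_K (N + en k) (v + ew k) e \<partial>count_space UNIV)
    = (\<integral>p. g 0 (0, p) * haar_K (N + en (0, p)) (v + ew (0, p)) e \<partial>count_space UNIV)"
    by (rule integral_count_space_inj(2)) (auto simp: inj_def image_iff)
  also have "\<dots> = (\<integral>p. - ((-1) powi m) * ((-1) powi m * bcoef m B p *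
      haar_K (n + m + (int (snd p) - int (fst p))) (A + B - 2 + - (of_nat (fst p) + of_nat (snd p))) (1 / e)) \<partial>count_space UNIV)"
  proof (intro Bochner_Integration.integral_cong refl)
    fix p :: "nat \<times> nat"
    have "n + m + (int (snd p) - int (fst p)) = - (N + en (0, p))"
      "A + B - 2 + - (of_nat (fst p) + of_nat (snd p)) = - (v + ew (0, p))"
      by (simp_all add: n_def A_def en_def ew_def nb0 sb0)
    then have "haar_K (n + m + (int (snd p) - int (fst p))) (A + B - 2 + - (of_nat (fst p) + of_nat (snd p))) (1 / e)
       = - haar_K (N + en (0, p)) (v + ew (0, p)) e" by (simp only: haar_K_inverse[OF e(1)])
    moreover have "(-1) powi m * ((-1) powi m * X) = X" for X :: complex
      using minus1_powi[of m] by (simp add: mult.assoc[symmetric])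
    ultimately show "g 0 (0, p) * haar_K (N + en (0, p)) (v + ew (0, p)) e = - ((-1) powi m) * ((-1) powi m * bcoef m B p *
      haar_K (n + m + (int (snd p) - int (fst p))) (A + B - 2 + - (of_nat (fst p) + of_nat (snd p))) (1 / e))"
      by (simp add: m_def B_def mult.assoc)
  qed
  also have "\<dots> = - ((-1) powi m) * bsum n A m B (1 / e)" unfolding bsum_def by (rule integral_mult_right_zero)
  finally have 2: "(\<integral>k. g 0 k * haar_K (N + en k) (v + ew k) e \<partial>count_space UNIV) = - ((-1) powi m) * bsum n A m B (1 / e)" .
  have "FPzero (I 0) (g 0) en ew e N v = (-1) powi m * (\<integral>x. k x \<partial>haar) + - ((-1) powi m) * bsum n A m B (1 / e)"
    unfolding FPzero_def 2 using 1 unfolding h_def by (simp only:)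
  also have "\<dots> = (-1) powi m * bFP n A m B (1 / e)"
    unfolding bFP_def k_def by (simp only: right_diff_distrib) simp
  also have "bFP n A m B (1 / e) = bval n A m B" by (rule bFP_eq_bval[OF ni' AB e1])
  also have "bval n A m B = (-1) powi m * bval N v m B" unfolding n_def A_def by (rule bval_inversion[OF ni])
  also have "(-1) powi m * ((-1) powi m * bval N v m B) = bval N v m B"
    using minus1_powi[of m] by (simp add: mult.assoc[symmetric])
  finally show ?thesis by (simp only: M.simps m_def B_def)
qed

end

section \<open>The simultaneous induction for the expansion and the Mellin transform\<close>

context beta_chain
begin

definition expands :: "nat \<Rightarrow> complex \<Rightarrow> bool" where
  "expands p z \<longleftrightarrow> I p z = (\<integral>k. g p k * qchar (en k) (ew k) z \<partial>count_space UNIV) \<and>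
     integrable (count_space UNIV) (\<lambda>k. g p k * qchar (en k) (ew k) z)"

lemma convolution_locale:
  assumes z0: "0 < norm z0" "norm z0 < 1" "J (Suc p) z0 < \<infinity>" and p: "Suc p \<le> P"
    and S: "\<And>y. 0 < norm y \<Longrightarrow> norm y < 1 \<Longrightarrow> J p y < \<infinity> \<Longrightarrow> expands p y"
    and \<delta>: "0 < \<delta>" "\<And>i j k. i \<le> P \<Longrightarrow> j \<le> P \<Longrightarrow> i \<noteq> j \<Longrightarrow> \<delta> \<le> norm (bh i - bh j + of_int k)"
    and w0: "\<And>j. j \<le> p \<Longrightarrow> w0 \<le> 2 - Re (sb j)" "0 < Re (sa (Suc p)) + w0"
  shows "mult_convolution (f (Suc p)) (I p) (g p) (d (Suc p)) ew en \<delta> w0 (Re (sb (Suc p)) - 2)"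
proof (rule mult_convolution.intro)
  let ?i = "Suc p"
  have z0': "z0 \<noteq> 0" using z0 by auto
  show "f ?i \<in> borel_measurable borel" "I p \<in> borel_measurable borel" by simp_all
  show "AE x in haar. f ?i x \<noteq> 0" by (simp add: f_nonzero)
  have ae: "AE y in haar. J p y < \<infinity>" by (rule J_AE_finite[OF z0(3) z0'])
  show "AE y in haar. norm y < 1 \<longrightarrow> I p y = (\<integral>k. g p k * qchar (en k) (ew k) y \<partial>count_space UNIV)"
    using ae AE_haar_nonzero
  proof eventually_elim
    case (elim y)
    then show ?case using S[of y] by (simp add: expands_def)
  qed
  show wk: "w0 \<le> Re (ew k)" if "g p k \<noteq> 0" for k
  proof -
    have "2 - Re (sb (fst k)) \<le> Re (ew k)" by (simp add: ew_def)
    then show ?thesis using w0(1)[OF g_support[OF that]] by linarith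
  qed
  show "integrable (count_space UNIV) (\<lambda>k. norm (g p k) * exp (Re (ew k) * ln r))" if r: "0 < r" "r < 1" for r
  proof -
    \<comment> \<open>Absolute summability at r is inherited from a point y of slightly larger
      modulus at which \<open>J p\<close> is finite. The common lower bound w0 of the exponents
      makes the comparison uniform in k.\<close>
    have "\<exists>y. r < norm y \<and> norm y \<le> (1 + r) / 2 \<and> J p y < \<infinity>" using r by (intro AE_haar_annulus[OF ae]) simp_all
    then obtain y where y: "r < norm y" "norm y \<le> (1 + r) / 2" "J p y < \<infinity>" by blast
    have "integrable (count_space UNIV) (\<lambda>k. g p k * qchar (en k) (ew k) y)"
    proof -
      have "0 < norm y" by (rule less_trans[OF r(1) y(1)])
      moreover have "norm y < 1" by (rule le_less_trans[OF y(2)]) (use r in simp)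
      ultimately show ?thesis using S[of y] y(3) unfolding expands_def by blast
    qed
    then have "integrable (count_space UNIV) (\<lambda>k. exp (w0 * (ln r - ln (norm y))) * norm (g p k * qchar (en k) (ew k) y))"
      by (intro integrable_mult_right integrable_norm)
    then show ?thesis
    proof (rule Bochner_Integration.integrable_bound)
      show "AE k in count_space UNIV. norm (norm (g p k) * exp (Re (ew k) * ln r))
         \<le> norm (exp (w0 * (ln r - ln (norm y))) * norm (g p k * qchar (en k) (ew k) y))"
      proof (rule AE_I2)
        fix k
        show "norm (norm (g p k) * exp (Re (ew k) * ln r)) \<le> norm (exp (w0 * (ln r - ln (norm y))) * norm (g p k * qchar (en k) (ew k) y))"
        proof (cases "g p k = 0")
          case False
          have "0 < norm y" using y(1) r by linarith
          then have "ln r \<le> ln (norm y)" using y(1) r by (intro ln_mono) auto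
          then have "Re (ew k) * (ln r - ln (norm y)) \<le> w0 * (ln r - ln (norm y))"
            using wk[OF False] by (intro mult_right_mono_neg) auto
          then have "Re (ew k) * ln r \<le> w0 * (ln r - ln (norm y)) + Re (ew k) * ln (norm y)"
            by (simp add: algebra_simps)
          then have "exp (Re (ew k) * ln r) \<le> exp (w0 * (ln r - ln (norm y))) * exp (Re (ew k) * ln (norm y))"
            by (simp only: exp_add[symmetric] exp_le_cancel_iff)
          then have "norm (g p k) * exp (Re (ew k) * ln r) \<le> norm (g p k) * (exp (w0 * (ln r - ln (norm y))) * exp (Re (ew k) * ln (norm y)))"
            by (rule mult_left_mono) simp
          then show ?thesis by (simp add: norm_mult norm_qchar abs_mult mult_ac)
        qed simp
      qed
    qed simp
  qed
  show "f ?i x = (\<integral>k. d ?i k * qchar (- en k) (- ew k) x \<partial>count_space UNIV)" if x: "norm x > 1" for x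
  proof -
    have "(\<integral>k. d ?i k * qchar (- en k) (- ew k) x \<partial>count_space UNIV)
      = (\<integral>p. d ?i (?i, p) * qchar (- en (?i, p)) (- ew (?i, p)) x \<partial>count_space UNIV)"
      by (rule integral_count_space_inj(2)) (auto simp: inj_def d_def image_iff)
    also have "\<dots> = (\<integral>p. (-1) powi (nb ?i - na ?i) * bcoef (nb ?i - na ?i) (sb ?i - sa ?i) p *
       qchar (na ?i + (nb ?i - na ?i) + (int (snd p) - int (fst p))) (sa ?i + (sb ?i - sa ?i) - 2 + - (of_nat (fst p) + of_nat (snd p))) x \<partial>count_space UNIV)"
    proof (intro Bochner_Integration.integral_cong refl)
      fix p :: "nat \<times> nat"
      have e: "- en (?i, p) = na ?i + (nb ?i - na ?i) + (int (snd p) - int (fst p))"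
        "- ew (?i, p) = sa ?i + (sb ?i - sa ?i) - 2 + - (of_nat (fst p) + of_nat (snd p))"
        by (simp_all add: en_def ew_def)
      show "d ?i (?i, p) * qchar (- en (?i, p)) (- ew (?i, p)) x = (-1) powi (nb ?i - na ?i) * bcoef (nb ?i - na ?i) (sb ?i - sa ?i) p *
       qchar (na ?i + (nb ?i - na ?i) + (int (snd p) - int (fst p))) (sa ?i + (sb ?i - sa ?i) - 2 + - (of_nat (fst p) + of_nat (snd p))) x"
        unfolding e by (simp add: d_def)
    qed
    also have "\<dots> = f ?i x" unfolding f_def by (rule beta_expansion_infinity[OF x, symmetric])
    finally show ?thesis by (rule sym)
  qed
  show "integrable (count_space UNIV) (\<lambda>k. norm (d ?i k) * exp (- Re (ew k) * ln r))" if r: "1 < r" for r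
  proof -
    have "integrable (count_space UNIV) (\<lambda>p. norm (bcoef (nb ?i - na ?i) (sb ?i - sa ?i) p) * exp (- (real (fst p) + real (snd p)) * ln r)
        * exp ((Re (sb ?i) - 2) * ln r))"
      by (intro integrable_mult_left bcoef_summable_inverse r)
    moreover have "norm (bcoef (nb ?i - na ?i) (sb ?i - sa ?i) p) * exp (- (real (fst p) + real (snd p)) * ln r) * exp ((Re (sb ?i) - 2) * ln r)
      = norm (d ?i (?i, p)) * exp (- Re (ew (?i, p)) * ln r)" for p
    proof -
      have "- Re (ew (?i, p)) * ln r = - (real (fst p) + real (snd p)) * ln r + (Re (sb ?i) - 2) * ln r"
        by (simp add: ew_def algebra_simps)
      then have "exp (- Re (ew (?i, p)) * ln r) = exp (- (real (fst p) + real (snd p)) * ln r) * exp ((Re (sb ?i) - 2) * ln r)"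
        by (simp only: exp_add)
      moreover have "norm (d ?i (?i, p)) = norm (bcoef (nb ?i - na ?i) (sb ?i - sa ?i) p)" by (simp add: d_def norm_mult norm_power_int)
      ultimately show ?thesis by (simp only: mult.assoc)
    qed
    ultimately have i: "integrable (count_space UNIV) (\<lambda>p. norm (d ?i (?i, p)) * exp (- Re (ew (?i, p)) * ln r))" by (simp only:)
    show ?thesis
      by (rule integral_count_space_inj(1)[of "Pair ?i" "\<lambda>k. norm (d ?i k) * exp (- Re (ew k) * ln r)", THEN iffD2])
         (use i in \<open>auto simp: inj_def d_def image_iff\<close>)
  qed
  show "0 < \<delta>" by (rule \<delta>(1))
  show "\<delta> \<le> norm (ew k - ew j)" if kj: "g p k \<noteq> 0" "d ?i j \<noteq> 0" "en k = en j" for k j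
  proof -
    have j: "fst j = ?i" using kj(2) by (simp add: d_def split: if_splits)
    have k: "fst k \<le> p" by (rule g_support[OF kj(1)])
    have "\<delta> \<le> norm (bh (fst j) - bh (fst k) + of_int (int (fst (snd k)) - int (fst (snd j))))"
      using j k p by (intro \<delta>(2)) auto
    moreover have "norm (ew k - ew j) = 2 * norm (bh (fst j) - bh (fst k) + of_int (int (fst (snd k)) - int (fst (snd j))))"
      unfolding exponent_diff[OF kj(3)] norm_mult by simp
    ultimately show ?thesis using \<delta>(1) by linarith
  qed
  show "integrable haar (\<lambda>x. indicator (cball 0 c) x * (norm (f ?i x) * exp (w0 * ln (norm x))))" if c: "1 < c" for c
  proof -
    have "integrable haar (\<lambda>x. norm (indicator (cball 0 c) x * (qchar 0 (sa ?i + of_real w0) x * qchar 0 (sb ?i - sa ?i - 2) (1 - x))))"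
      using w0(2) finite_at_one[OF z0] by (intro integrable_norm beta_integrable_haar) auto
    moreover have "norm (indicator (cball 0 c) x * (qchar 0 (sa ?i + of_real w0) x * qchar 0 (sb ?i - sa ?i - 2) (1 - x)))
      = indicator (cball 0 c) x * (norm (f ?i x) * exp (w0 * ln (norm x)))" for x
      unfolding norm_mult norm_qchar norm_f norm_indicator' by (simp add: distrib_right exp_add)
    ultimately show ?thesis by (simp only:)
  qed
  show "- Re (ew k) \<le> Re (sb ?i) - 2" if "d ?i k \<noteq> 0" for k
    using that by (auto simp: d_def ew_def split: if_splits)
  show "\<exists>C>0. \<forall>x. norm x > c \<longrightarrow> C * exp ((Re (sb ?i) - 2) * ln (norm x)) \<le> norm (f ?i x)" if "1 < c" for c
    by (rule f_lower_infinity[OF that])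
qed

lemma half_diff_ab: "(sb i - sa i + of_int (nb i - na i)) / 2 = bh i - ah i"
  by (simp add: ah_def bh_def field_simps)

text \<open>The transform of f is a beta value because its Mellin integral converges at zero at each
  exponent of \<open>I p\<close>. That of \<open>I p\<close> is \<open>M p\<close> by the hypothesis
  \<open>T\<close>, whose finiteness condition is the tail at z; the strict inequality
  \<open>norm z < \<rho>\<close> leaves the room which \<open>tail_finite\<close> needs. Condition C
  makes all parameters that occur generic.\<close>

lemma coef_Suc:
  assumes p: "Suc p \<le> P" and z: "0 < norm z" "norm z < \<rho>" "\<rho> < 1" and J: "J (Suc p) z < \<infinity>"
    and T: "\<And>N v e. gen p N v \<Longrightarrow> 0 < e \<Longrightarrow> e < 1 \<Longrightarrow> fin p e (Re v) \<Longrightarrow> FPzero (I p) (g p) en ew e N v = M p N v"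
    and c: "1 < c"
  shows "g p k * FPinf (f (Suc p)) (d (Suc p)) en ew c (en k) (ew k)
     + d (Suc p) k * FPzero (I p) (g p) en ew \<rho> (- en k) (- ew k) = g (Suc p) k"
proof -
  let ?i = "Suc p"
  have z1: "norm z < 1" using z by linarith
  have 1: "g p k * FPinf (f ?i) (d ?i) en ew c (en k) (ew k) = g p k * E ?i (en k) (ew k)"
  proof (cases "g p k = 0")
    case False
    then have j: "fst k \<le> p" by (rule g_support)
    have "(sa ?i + ew k + of_int (na ?i + en k)) / 2 = ah ?i + (ew k + of_int (en k)) / 2" by (simp add: ah_def field_simps)
    then have \<alpha>: "(sa ?i + ew k + of_int (na ?i + en k)) / 2 = ah ?i - bh (fst k) + of_int (1 + int (fst (snd k)))"
      unfolding half_exponent by simp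
    have "bnonint (na ?i + en k) (sa ?i + ew k) (nb ?i - na ?i) (sb ?i - sa ?i)"
      unfolding bnonint_def \<alpha> half_diff_ab
    proof (intro conjI)
      show "ah ?i - bh (fst k) + of_int (1 + int (fst (snd k))) \<notin> \<int>"
        by (rule nonint_shift[OF gen_ab'[of ?i "fst k"], of _ "1 + int (fst (snd k))"]) (use p j in auto)
      show "bh ?i - ah ?i \<notin> \<int>"
        by (rule nonint_shift[OF gen_ab'[of ?i ?i], of _ 0]) (use p in auto)
      show "ah ?i - bh (fst k) + of_int (1 + int (fst (snd k))) + (bh ?i - ah ?i) \<notin> \<int>"
        by (rule nonint_shift[OF gen_bb'[of ?i "fst k"], of _ "1 + int (fst (snd k))"]) (use p j in auto)
    qed
    moreover have "0 < Re (sa ?i + ew k)"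
      using finite_at_zero[OF z(1) z1 J j] by (simp add: ew_def)
    ultimately show ?thesis using finite_at_one[OF z(1) z1 J] c by (simp add: FPinf_f)
  qed simp
  have 2: "d ?i k * FPzero (I p) (g p) en ew \<rho> (- en k) (- ew k) = d ?i k * M p (- en k) (- ew k)"
  proof (cases "d ?i k = 0")
    case False
    then have k: "fst k = ?i" by (simp add: d_def split: if_splits)
    have "(- ew k + of_int (- en k)) / 2 = - ((ew k + of_int (en k)) / 2)" by (simp add: field_simps)
    then have t: "(- ew k + of_int (- en k)) / 2 = bh ?i - of_int (1 + int (fst (snd k)))"
      unfolding half_exponent k by simp
    have "gen p (- en k) (- ew k)" unfolding gen_def t
    proof (intro allI impI conjI)
      fix i assume i: "i \<le> p"
      show "bh ?i - of_int (1 + int (fst (snd k))) - ah i \<notin> \<int>"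
        by (rule nonint_shift[OF gen_ab'[of i ?i], of _ "- (1 + int (fst (snd k)))"]) (use p i in auto)
      show "bh ?i - of_int (1 + int (fst (snd k))) - bh i \<notin> \<int>"
        by (rule nonint_shift[OF gen_bb'[of ?i i], of _ "- (1 + int (fst (snd k)))"]) (use p i in auto)
    qed
    moreover have "fin p (\<rho> / norm z * norm z) (Re (- ew k))"
      by (rule tail_finite[OF J]) (use z k in \<open>auto simp: ew_def\<close>)
    then have "fin p \<rho> (Re (- ew k))" using z by simp
    moreover have "0 < \<rho>" using z by linarith
    ultimately have "FPzero (I p) (g p) en ew \<rho> (- en k) (- ew k) = M p (- en k) (- ew k)" using z(3) by (intro T)
    then show ?thesis by (simp only:)
  qed simp
  show ?thesis unfolding 1 2 by simp
qed

lemma bh_distance: "\<exists>\<delta>>0. \<forall>i\<le>P. \<forall>j\<le>P. i \<noteq> j \<longrightarrow> (\<forall>k::int. \<delta> \<le> norm (bh i - bh j + of_int k))"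
proof -
  let ?S = "(\<lambda>(i, j). bh i - bh j) ` {(i, j) \<in> {..P} \<times> {..P}. i \<noteq> j}"
  have "finite {(i, j) \<in> {..P} \<times> {..P}. i \<noteq> j}" by (rule finite_subset[of _ "{..P} \<times> {..P}"]) auto
  then have "\<exists>\<delta>>0. \<forall>z\<in>?S. \<forall>k::int. \<delta> \<le> norm (z + of_int k)"
    by (intro Ints_distance_finite finite_imageI) (use gen_bb' in auto)
  then show ?thesis by fastforce
qed

text \<open>The minimum of the finitely many leading exponents: it is itself one of them and so
  satisfies the inequality forced by convergence at zero.\<close>

lemma w0_exists:
  assumes z0: "0 < norm z0" "norm z0 < 1" "J (Suc p) z0 < \<infinity>"
  shows "\<exists>w0. (\<forall>j\<le>p. w0 \<le> 2 - Re (sb j)) \<and> 0 < Re (sa (Suc p)) + w0"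
proof -
  let ?W = "(\<lambda>j. 2 - Re (sb j)) ` {..p}"
  have "Min ?W \<in> ?W" by (rule Min_in) auto
  then obtain j where j': "Min ?W = 2 - Re (sb j)" "j \<in> {..p}" by (rule imageE)
  then have j: "j \<le> p" "Min ?W = 2 - Re (sb j)" by simp_all
  have "\<forall>j\<le>p. Min ?W \<le> 2 - Re (sb j)" by auto
  moreover have "0 < Re (sa (Suc p)) + Min ?W" unfolding j(2) using finite_at_zero[OF z0 j(1)] by linarith
  ultimately show ?thesis by blast
qed

lemma expands_0:
  assumes y: "0 < norm y" "norm y < 1"
  shows "expands 0 y"
proof -
  let ?b = "bcoef (- na 0) (2 - sa 0)"
  have e: "en (0, p) = int (fst p) - int (snd p)" "ew (0, p) = of_nat (fst p) + of_nat (snd p)" for p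
    by (simp_all add: en_def ew_def nb0 sb0)
  have "I 0 y = qchar (- na 0) (2 - sa 0 - 2) (1 - y)" by simp
  also have "\<dots> = (\<integral>p. ?b p * qchar (int (fst p) - int (snd p)) (of_nat (fst p) + of_nat (snd p)) y \<partial>count_space UNIV)"
    by (rule beta_expansion) (use y in auto)
  also have "\<dots> = (\<integral>p. g 0 (0, p) * qchar (en (0, p)) (ew (0, p)) y \<partial>count_space UNIV)"
    unfolding e by simp
  also have "\<dots> = (\<integral>k. g 0 k * qchar (en k) (ew k) y \<partial>count_space UNIV)"
    by (rule integral_count_space_inj(2)[of "Pair 0" "\<lambda>k. g 0 k * qchar (en k) (ew k) y", symmetric])
       (auto simp: inj_def image_iff)
  finally have 1: "I 0 y = (\<integral>k. g 0 k * qchar (en k) (ew k) y \<partial>count_space UNIV)" .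
  have "integrable (count_space UNIV) (\<lambda>p. norm (?b p) * exp ((real (fst p) + real (snd p)) * ln (norm y)))"
    by (rule bcoef_summable) (use y in auto)
  then have "integrable (count_space UNIV) (\<lambda>p. g 0 (0, p) * qchar (en (0, p)) (ew (0, p)) y)"
    by (rule Bochner_Integration.integrable_bound) (simp_all add: e norm_mult norm_qchar)
  then have "integrable (count_space UNIV) (\<lambda>k. g 0 k * qchar (en k) (ew k) y)"
    by (subst integral_count_space_inj(1)[of "Pair 0"]) (auto simp: inj_def image_iff)
  with 1 show ?thesis by (simp only: expands_def)
qed

lemma expands_Suc:
  assumes p: "Suc p \<le> P" and z: "0 < norm z" "norm z < 1" and J: "J (Suc p) z < \<infinity>"
    and S: "\<And>y. 0 < norm y \<Longrightarrow> norm y < 1 \<Longrightarrow> J p y < \<infinity> \<Longrightarrow> expands p y"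
    and T: "\<And>N v e. gen p N v \<Longrightarrow> 0 < e \<Longrightarrow> e < 1 \<Longrightarrow> fin p e (Re v) \<Longrightarrow> FPzero (I p) (g p) en ew e N v = M p N v"
  shows "expands (Suc p) z"
proof -
  let ?i = "Suc p"
  obtain w0 where w0: "\<forall>j\<le>p. w0 \<le> 2 - Re (sb j)" "0 < Re (sa ?i) + w0" using w0_exists[OF z J] by blast
  obtain \<delta> where \<delta>: "\<delta> > 0" "\<forall>i\<le>P. \<forall>j\<le>P. i \<noteq> j \<longrightarrow> (\<forall>k::int. \<delta> \<le> norm (bh i - bh j + of_int k))"
    using bh_distance by (elim exE conjE)
  have \<delta>': "\<And>i j k. i \<le> P \<Longrightarrow> j \<le> P \<Longrightarrow> i \<noteq> j \<Longrightarrow> \<delta> \<le> norm (bh i - bh j + of_int k)" using \<delta>(2) by blast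
  have w0b: "\<And>j. j \<le> p \<Longrightarrow> w0 \<le> 2 - Re (sb j)" using w0(1) by blast
  interpret X: mult_convolution "f ?i" "I p" "g p" "d ?i" ew en \<delta> w0 "Re (sb ?i) - 2"
    by (rule convolution_locale[OF z J p]) (fact S \<delta>(1) \<delta>' w0b w0(2))+
  \<comment> \<open>The midpoint of 1 and 1 / norm z.\<close>
  define c where "c = (1 + 1 / norm z) / 2"
  have c: "1 < c" using z by (simp add: c_def)
  have cz: "c * norm z = (norm z + 1) / 2" using z by (simp add: c_def field_simps)
  have c1: "c * norm z < 1" "norm z < c * norm z" unfolding cz using z by simp_all
  have z0: "z \<noteq> 0" using z by auto
  have coef: "g p k * FPinf (f ?i) (d ?i) en ew c (en k) (ew k)
     + d ?i k * FPzero (I p) (g p) en ew (c * norm z) (- en k) (- ew k) = g ?i k" for k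
    by (rule coef_Suc) (fact p z(1) c1(2) c1(1) J T c)+
  note rule = mult_convolution_expansion[where f = "f ?i" and G = "I p" and g = "g p" and d = "d ?i" and w = ew and n = en
      and \<delta> = \<delta> and c = c and z = z]
  have step1: "(\<integral>x. f ?i x * I p (z * x) \<partial>haar) = (\<integral>k. (g p k * FPinf (f ?i) (d ?i) en ew c (en k) (ew k)
     + d ?i k * FPzero (I p) (g p) en ew (c * norm z) (- en k) (- ew k)) * qchar (en k) (ew k) z \<partial>count_space UNIV)"
    by (rule rule(1)) (fact X.f_meas X.G_meas X.G X.g X.f X.d X.delta(1) X.delta(2) fI_integrable[OF J] X.w0 X.f0 X.w1 X.f1 c c1(1) z0)+
  have step2: "integrable (count_space UNIV) (\<lambda>k. (g p k * FPinf (f ?i) (d ?i) en ew c (en k) (ew k)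
     + d ?i k * FPzero (I p) (g p) en ew (c * norm z) (- en k) (- ew k)) * qchar (en k) (ew k) z)"
    by (rule rule(2)) (fact X.f_meas X.G_meas X.G X.g X.f X.d X.delta(1) X.delta(2) fI_integrable[OF J] X.w0 X.f0 X.w1 X.f1 c c1(1) z0)+
  show ?thesis unfolding expands_def I.simps(2)
    by (rule conjI) (fact step1[unfolded coef] step2[unfolded coef])+
qed

lemma FPzero_Suc:
  assumes p: "Suc p \<le> P" and gen: "gen (Suc p) N v" and e: "0 < e" "e < 1" and fin: "fin (Suc p) e (Re v)"
    and S: "\<And>y. 0 < norm y \<Longrightarrow> norm y < 1 \<Longrightarrow> J p y < \<infinity> \<Longrightarrow> expands p y"
    and T: "\<And>N v e. gen p N v \<Longrightarrow> 0 < e \<Longrightarrow> e < 1 \<Longrightarrow> fin p e (Re v) \<Longrightarrow> FPzero (I p) (g p) en ew e N v = M p N v"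
  shows "FPzero (I (Suc p)) (g (Suc p)) en ew e N v = M (Suc p) N v"
proof -
  let ?i = "Suc p"
  define t where "t = (v + of_int N) / 2"
  have gen_t: "t - ah i \<notin> \<int>" "t - bh i \<notin> \<int>" if "i \<le> ?i" for i using gen that by (simp_all add: gen_def t_def)
  \<comment> \<open>A point of finiteness from which the inequalities are extracted. It is taken so
    close to the circle of radius e that \<open>norm z < c * e\<close> for the c below, as
    \<open>coef_Suc\<close> demands.\<close>
  have "\<exists>z. e < norm z \<and> norm z \<le> (3 * e + 1) / 4 \<and> (norm z > e \<longrightarrow> J ?i z < \<infinity>)"
    using e by (intro AE_haar_annulus[OF fin_AE[OF fin]]) simp_all
  then obtain z where z: "e < norm z" "norm z \<le> (3 * e + 1) / 4" "J ?i z < \<infinity>" by blast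
  have z1: "0 < norm z" by (rule less_trans[OF e(1) z(1)])
  have z2: "norm z < 1" by (rule le_less_trans[OF z(2)]) (use e in simp)
  define c where "c = (1 + 1 / e) / 2"
  have c: "1 < c" using e by (simp add: c_def)
  have ce: "c * e = (e + 1) / 2" using e by (simp add: c_def field_simps)
  have "(3 * e + 1) / 4 < (e + 1) / 2" using e by (simp add: field_simps)
  with z(2) have "norm z < (e + 1) / 2" by (rule le_less_trans)
  then have c1: "c * e < 1" "norm z < c * e" "0 < c * e" unfolding ce using e by simp_all
  have sav: "0 < Re (sa ?i) - Re v" by (rule fin_Suc(2)[OF fin e])
  obtain w0 where w0: "\<forall>j\<le>p. w0 \<le> 2 - Re (sb j)" "0 < Re (sa ?i) + w0" using w0_exists[OF z1 z2 z(3)] by blast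
  \<comment> \<open>The lower bound must also lie below - Re v, the exponent contributed by the tail
    function; the inequality \<open>sav\<close> keeps f integrable against it at zero.\<close>
  define w0' where "w0' = min w0 (- Re v)"
  obtain \<delta> where \<delta>: "\<delta> > 0" "\<forall>i\<le>P. \<forall>j\<le>P. i \<noteq> j \<longrightarrow> (\<forall>k::int. \<delta> \<le> norm (bh i - bh j + of_int k))"
    using bh_distance by (elim exE conjE)
  have "\<exists>\<delta>>0. \<forall>z\<in>(\<lambda>i. t - bh i) ` {..?i}. \<forall>k::int. \<delta> \<le> norm (z + of_int k)"
    by (rule Ints_distance_finite) (use gen_t in auto)
  then obtain \<epsilon> where \<epsilon>: "\<epsilon> > 0" "\<forall>z\<in>(\<lambda>i. t - bh i) ` {..?i}. \<forall>k::int. \<epsilon> \<le> norm (z + of_int k)"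
    by (elim exE conjE)
  define \<eta> where "\<eta> = min \<delta> \<epsilon>"
  have \<eta>: "\<eta> > 0" "\<eta> \<le> \<delta>" "\<eta> \<le> \<epsilon>" using \<delta>(1) \<epsilon>(1) by (simp_all add: \<eta>_def)
  have \<eta>': "\<And>i j k. i \<le> P \<Longrightarrow> j \<le> P \<Longrightarrow> i \<noteq> j \<Longrightarrow> \<eta> \<le> norm (bh i - bh j + of_int k)"
    using \<delta>(2) \<eta>(2) by (meson order_trans)
  have w0b: "w0' \<le> 2 - Re (sb j)" if "j \<le> p" for j using w0(1)[rule_format, OF that] by (simp add: w0'_def)
  have w0c: "0 < Re (sa ?i) + w0'" using w0(2) sav by (simp add: w0'_def min_def)
  interpret X: mult_convolution "f ?i" "I p" "g p" "d ?i" ew en \<eta> w0' "Re (sb ?i) - 2"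
    by (rule convolution_locale[OF z1 z2 z(3) p]) (fact S \<eta>(1) \<eta>' w0b w0c)+
  have fin': "(\<integral>\<^sup>+z. indicator (- cball 0 e) z * ennreal (norm (qchar N v z)) * (\<integral>\<^sup>+x. ennreal (norm (f ?i x * I p (z * x))) \<partial>haar) \<partial>haar) < \<infinity>"
  proof -
    have "(\<integral>\<^sup>+z. indicator (- cball 0 e) z * ennreal (norm (qchar N v z)) * (\<integral>\<^sup>+x. ennreal (norm (f ?i x * I p (z * x))) \<partial>haar) \<partial>haar)
      \<le> (\<integral>\<^sup>+z. indicator (- cball 0 e) z * (ennreal (exp (Re v * ln (norm z))) * J ?i z) \<partial>haar)"
    proof (rule nn_integral_mono)
      fix z
      have "(\<integral>\<^sup>+x. ennreal (norm (f ?i x * I p (z * x))) \<partial>haar) \<le> J ?i z" unfolding J.simps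
      proof (rule nn_integral_mono)
        fix x
        show "ennreal (norm (f ?i x * I p (z * x))) \<le> ennreal (norm (f ?i x)) * J p (z * x)"
          by (simp only: norm_mult ennreal_mult norm_ge_zero) (rule mult_left_mono[OF norm_I_le], simp)
      qed
      from mult_left_mono[OF this, of "indicator (- cball 0 e) z * ennreal (exp (Re v * ln (norm z)))"]
      show "indicator (- cball 0 e) z * ennreal (norm (qchar N v z)) * (\<integral>\<^sup>+x. ennreal (norm (f ?i x * I p (z * x))) \<partial>haar)
        \<le> indicator (- cball 0 e) z * (ennreal (exp (Re v * ln (norm z))) * J ?i z)"
        by (simp only: norm_qchar mult.assoc) simp
    qed
    then show ?thesis using fin unfolding fin_def by (rule le_less_trans)
  qed
  have td: "\<eta> \<le> norm (ew k + v)" if k: "g p k \<noteq> 0 \<or> d ?i k \<noteq> 0" "en k = - N" for k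
  proof -
    have "fst k \<le> ?i" using k(1) g_support[of p k] by (auto simp: d_def split: if_splits)
    then have "\<epsilon> \<le> norm (t - bh (fst k) + of_int (1 + int (fst (snd k))))" by (intro \<epsilon>(2)[rule_format]) auto
    moreover have "norm (ew k + v) = 2 * norm (t - bh (fst k) + of_int (1 + int (fst (snd k))))"
      unfolding exponent_add[OF k(2)] t_def norm_mult by simp
    ultimately show ?thesis using \<eta> \<epsilon>(1) by linarith
  qed
  have tw: "w0' \<le> - Re v" by (simp add: w0'_def)
  \<comment> \<open>The first component p + 2 occurs neither in \<open>g p\<close> nor in
    \<open>d (Suc p)\<close>, so this index is free for the additional exponent.\<close>
  have sp1: "g p (Suc ?i, 0, 0) = 0" using g_support[of p "(Suc ?i, 0, 0)"] by auto
  have sp2: "d ?i (Suc ?i, 0, 0) = 0" by (simp add: d_def)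
  have coef: "g p k * FPinf (f ?i) (d ?i) en ew c (en k) (ew k)
     + d ?i k * FPzero (I p) (g p) en ew (c * e) (- en k) (- ew k) = g ?i k" for k
    by (rule coef_Suc) (fact p z1 c1(2) c1(1) z(3) T c)+
  have main: "(\<integral>z. indicator (- cball 0 e) z * ((\<integral>x. f ?i x * I p (z * x) \<partial>haar) * qchar N v z) \<partial>haar)
    + (\<integral>k. (g p k * FPinf (f ?i) (d ?i) en ew c (en k) (ew k) + d ?i k * FPzero (I p) (g p) en ew (c * e) (- en k) (- ew k))
        * haar_K (N + en k) (v + ew k) e \<partial>count_space UNIV)
    = FPzero (I p) (g p) en ew (c * e) N v * FPinf (f ?i) (d ?i) en ew c (- N) (- v)"
    by (rule X.FP_Mellin_convolution(1)) (fact fin' td tw sp1 sp2 e c c1(1))+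
  have 1: "FPzero (I p) (g p) en ew (c * e) N v = M p N v"
    by (rule T[OF _ c1(3,1) fin_Suc(1)[OF fin e c1(3)]]) (use gen in \<open>simp add: gen_def\<close>)
  have 2: "FPinf (f ?i) (d ?i) en ew c (- N) (- v) = E ?i (- N) (- v)"
  proof (rule FPinf_f[OF _ _ finite_at_one[OF z1 z2 z(3)] c])
    show "0 < Re (sa ?i + - v)" using sav by simp
    have \<alpha>: "(sa ?i + - v + of_int (na ?i + - N)) / 2 = ah ?i - t" by (simp add: ah_def t_def field_simps)
    show "bnonint (na ?i + - N) (sa ?i + - v) (nb ?i - na ?i) (sb ?i - sa ?i)"
      unfolding bnonint_def \<alpha> half_diff_ab
    proof (intro conjI)
      show "ah ?i - t \<notin> \<int>" by (rule nonint_shift[OF gen_t(1)[of ?i], of _ 0]) auto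
      show "bh ?i - ah ?i \<notin> \<int>" by (rule nonint_shift[OF gen_ab'[of ?i ?i], of _ 0]) (use p in auto)
      show "ah ?i - t + (bh ?i - ah ?i) \<notin> \<int>" by (rule nonint_shift[OF gen_t(2)[of ?i], of _ 0]) auto
    qed
  qed
  have m: "(\<integral>z. indicator (- cball 0 e) z * ((\<integral>x. f ?i x * I p (z * x) \<partial>haar) * qchar N v z) \<partial>haar)
    + (\<integral>k. g ?i k * haar_K (N + en k) (v + ew k) e \<partial>count_space UNIV) = M p N v * E ?i (- N) (- v)"
    using main by (simp only: coef 1 2)
  have I': "I ?i z = (\<integral>x. f ?i x * I p (z * x) \<partial>haar)" for z by (simp only: I.simps)
  have "FPzero (I ?i) (g ?i) en ew e N v = (\<integral>z. indicator (- cball 0 e) z * (I ?i z * qchar N v z) \<partial>haar)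
    + (\<integral>k. g ?i k * haar_K (N + en k) (v + ew k) e \<partial>count_space UNIV)" by (rule FPzero_def)
  also have "\<dots> = M p N v * E ?i (- N) (- v)" unfolding I' by (rule m)
  also have "\<dots> = M ?i N v" by (rule M.simps(2)[symmetric])
  finally show ?thesis .
qed

theorem chain_expansion:
  assumes "p \<le> P"
  shows "\<And>z. 0 < norm z \<Longrightarrow> norm z < 1 \<Longrightarrow> J p z < \<infinity> \<Longrightarrow> expands p z"
    and "\<And>N v e. gen p N v \<Longrightarrow> 0 < e \<Longrightarrow> e < 1 \<Longrightarrow> fin p e (Re v) \<Longrightarrow> FPzero (I p) (g p) en ew e N v = M p N v"
proof -
  have "(\<forall>z. 0 < norm z \<longrightarrow> norm z < 1 \<longrightarrow> J p z < \<infinity> \<longrightarrow> expands p z) \<and>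
    (\<forall>N v e. gen p N v \<longrightarrow> 0 < e \<longrightarrow> e < 1 \<longrightarrow> fin p e (Re v) \<longrightarrow> FPzero (I p) (g p) en ew e N v = M p N v)"
    using assms
  proof (induction p)
    case 0
    then show ?case using expands_0 FPzero_I0 by blast
  next
    case (Suc p)
    then have S: "\<And>y. 0 < norm y \<Longrightarrow> norm y < 1 \<Longrightarrow> J p y < \<infinity> \<Longrightarrow> expands p y"
      and T: "\<And>N v e. gen p N v \<Longrightarrow> 0 < e \<Longrightarrow> e < 1 \<Longrightarrow> fin p e (Re v) \<Longrightarrow> FPzero (I p) (g p) en ew e N v = M p N v"
      by auto
    show ?case
    proof (intro conjI allI impI)
      fix z assume z: "0 < norm z" "norm z < 1" "J (Suc p) z < \<infinity>"
      show "expands (Suc p) z" by (rule expands_Suc) (fact Suc.prems z S T)+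
    next
      fix N v e assume *: "gen (Suc p) N v" "0 < e" "e < 1" "fin (Suc p) e (Re v)"
      show "FPzero (I (Suc p)) (g (Suc p)) en ew e N v = M (Suc p) N v" by (rule FPzero_Suc) (fact Suc.prems * S T)+
    qed
  qed
  then show "\<And>z. 0 < norm z \<Longrightarrow> norm z < 1 \<Longrightarrow> J p z < \<infinity> \<Longrightarrow> expands p z"
    and "\<And>N v e. gen p N v \<Longrightarrow> 0 < e \<Longrightarrow> e < 1 \<Longrightarrow> fin p e (Re v) \<Longrightarrow> FPzero (I p) (g p) en ew e N v = M p N v"
    by blast+
qed

end

section \<open>Shifted beta values and factorisation of double series\<close>

lemma nonint_nonpos: "z \<notin> \<int> \<Longrightarrow> z \<notin> (\<int>\<^sub>\<le>\<^sub>0 :: complex set)"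
  using nonpos_Ints_Int by blast

lemma Gamma_add_of_nat:
  fixes z :: complex
  assumes "z \<notin> \<int>"
  shows "Gamma (z + of_nat l) = Gamma z * pochhammer z l"
  using pochhammer_Gamma[OF nonint_nonpos[OF assms], of l] Gamma_nonint[OF assms] by simp

lemma pochhammer_nonint:
  fixes z :: complex
  assumes "z \<notin> \<int>"
  shows "pochhammer z l \<noteq> 0"
  using assms pochhammer_eq_0_iff[of z l] by auto

text \<open>The shift multiplies two of the sines by the same sign, once in the numerator and once
  in the denominator, so only quotients of Gamma values change.\<close>

lemma fB_shift:
  assumes "\<alpha> \<notin> \<int>" "\<alpha> + \<beta> \<notin> \<int>" "\<alpha>' \<notin> \<int>" "\<alpha>' + \<beta>' \<notin> \<int>"
  shows "fB (\<alpha> + of_nat l) \<beta> (\<alpha>' + of_nat l') \<beta>' = fB \<alpha> \<beta> \<alpha>' \<beta>' *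
    (pochhammer \<alpha> l / pochhammer (\<alpha> + \<beta>) l) * (pochhammer \<alpha>' l' / pochhammer (\<alpha>' + \<beta>') l')"
proof -
  have e: "x + of_nat l + y = x + y + of_nat l" for x y :: complex and l by simp
  have G: "Gamma (x + of_nat l) * Gamma y / Gamma (x + of_nat l + y) = Gamma x * Gamma y / Gamma (x + y) * (pochhammer x l / pochhammer (x + y) l)"
    if "x \<notin> \<int>" "x + y \<notin> \<int>" for x y :: complex and l
    unfolding e Gamma_add_of_nat[OF that(1)] Gamma_add_of_nat[OF that(2)] by simp
  have s: "sin (of_real pi * (x + of_nat l')) = (-1) powi (- int l') * sin (of_real pi * x)" for x :: complex
    using sin_pi_diff_int[of x "- int l'"] by simp
  have S: "sin (of_real pi * (\<alpha>' + of_nat l')) * sin (of_real pi * \<beta>') / sin (of_real pi * (\<alpha>' + of_nat l' + \<beta>'))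
    = sin (of_real pi * \<alpha>') * sin (of_real pi * \<beta>') / sin (of_real pi * (\<alpha>' + \<beta>'))"
    unfolding e s by simp
  show ?thesis unfolding fB_def G[OF assms(1,2)] G[OF assms(3,4)] S by (simp only: mult_ac)
qed

lemma pochhammer_reflect:
  fixes z :: complex
  shows "pochhammer (z - of_nat l) l = (-1) ^ l * pochhammer (1 - z) l"
proof -
  have "pochhammer (1 - z) l = (-1) ^ l * pochhammer (z - of_nat l) l"
    using pochhammer_minus[of "z - 1" l] by simp
  moreover have "(-1) ^ l * ((-1) ^ l * x) = x" for x :: complex
    by (simp add: mult.assoc[symmetric] power_mult_distrib[symmetric])
  ultimately show ?thesis by simp
qed

text \<open>The upward shift started from \<alpha> - l. Reading the Pochhammer products backwards
  turns them into symbols of 1 - \<alpha> and 1 - \<alpha> - \<beta>, with signs that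
  cancel.\<close>

lemma fB_shift_down:
  assumes "\<alpha> \<notin> \<int>" "\<alpha> + \<beta> \<notin> \<int>" "\<alpha>' \<notin> \<int>" "\<alpha>' + \<beta>' \<notin> \<int>"
  shows "fB (\<alpha> - of_nat l) \<beta> (\<alpha>' - of_nat l') \<beta>' = fB \<alpha> \<beta> \<alpha>' \<beta>' *
    (pochhammer (1 - \<alpha> - \<beta>) l / pochhammer (1 - \<alpha>) l) * (pochhammer (1 - \<alpha>' - \<beta>') l' / pochhammer (1 - \<alpha>') l')"
proof -
  have n: "x - of_nat l \<notin> \<int>" if "x \<notin> \<int>" for x :: complex and l
    by (rule nonint_shift[OF that, of _ "- int l"]) simp
  have e: "x - of_nat l + y = x + y - of_nat l" for x y :: complex and l by simp
  have n1: "pochhammer (1 - x) l \<noteq> 0" if "x \<notin> \<int>" for x :: complex and l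
    by (rule pochhammer_nonint, rule nonint_shift[OF that, of _ 1]) simp
  have r: "pochhammer (x - of_nat l) l / pochhammer (x - of_nat l + y) l = pochhammer (1 - x) l / pochhammer (1 - x - y) l" for x y :: complex and l
    unfolding e pochhammer_reflect diff_diff_eq[symmetric] by simp
  have "fB (\<alpha> - of_nat l + of_nat l) \<beta> (\<alpha>' - of_nat l' + of_nat l') \<beta>' = fB (\<alpha> - of_nat l) \<beta> (\<alpha>' - of_nat l') \<beta>' *
    (pochhammer (\<alpha> - of_nat l) l / pochhammer (\<alpha> - of_nat l + \<beta>) l) * (pochhammer (\<alpha>' - of_nat l') l' / pochhammer (\<alpha>' - of_nat l' + \<beta>') l')"
    by (rule fB_shift) (simp_all only: e n assms not_False_eq_True)
  then have "fB \<alpha> \<beta> \<alpha>' \<beta>' = fB (\<alpha> - of_nat l) \<beta> (\<alpha>' - of_nat l') \<beta>' *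
    (pochhammer (1 - \<alpha>) l / pochhammer (1 - \<alpha> - \<beta>) l) * (pochhammer (1 - \<alpha>') l' / pochhammer (1 - \<alpha>' - \<beta>') l')"
    unfolding r by simp
  moreover have "pochhammer (1 - \<alpha>) l \<noteq> 0" "pochhammer (1 - \<alpha>') l' \<noteq> 0" using n1 assms by auto
  moreover have "pochhammer (1 - \<alpha> - \<beta>) l \<noteq> 0" "pochhammer (1 - \<alpha>' - \<beta>') l' \<noteq> 0"
    using n1[OF assms(2)] n1[OF assms(4)] by (simp_all add: diff_diff_eq)
  ultimately show ?thesis by simp
qed

lemma fB_nonzero:
  assumes "\<alpha> \<notin> \<int>" "\<beta> \<notin> \<int>" "\<alpha> + \<beta> \<notin> \<int>" "\<alpha>' \<notin> \<int>" "\<beta>' \<notin> \<int>" "\<alpha>' + \<beta>' \<notin> \<int>"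
  shows "fB \<alpha> \<beta> \<alpha>' \<beta>' \<noteq> 0"
  unfolding fB_def using assms Gamma_nonint sin_pi_nonzero by simp

text \<open>Summability of each factor is read off from the double series along the slices l' = 0
  and l = 0, hence the nonzero constant and the normalised first terms. In this way convergence of
  the hypergeometric series comes with the expansion.\<close>

lemma double_series_product:
  fixes u v :: "nat \<Rightarrow> complex"
  assumes C: "C \<noteq> 0" and u0: "u 0 = 1" "v 0 = 1"
    and int: "integrable (count_space UNIV) (\<lambda>q :: nat \<times> nat. C * (u (fst q) * v (snd q)))"
  shows "(\<integral>q. C * (u (fst q) * v (snd q)) \<partial>count_space UNIV) = C * ((\<Sum>l. u l) * (\<Sum>l. v l))"
proof -
  let ?F = "\<lambda>q :: nat \<times> nat. C * (u (fst q) * v (snd q))"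
  have sec: "integrable (count_space UNIV) (\<lambda>l. ?F (\<phi> l))" if "inj \<phi>" for \<phi> :: "nat \<Rightarrow> nat \<times> nat"
  proof -
    have "integrable (count_space UNIV) (\<lambda>q. if q \<in> range \<phi> then ?F q else 0)"
      using int by (rule Bochner_Integration.integrable_bound) auto
    then show ?thesis
      by (subst (asm) integral_count_space_inj(1)[OF that]) auto
  qed
  have "summable (\<lambda>l. norm (u l))"
    using sec[of "\<lambda>l. (l, 0)"] C u0 by (simp add: inj_def integrable_count_space_nat_iff norm_mult summable_cmult_iff)
  moreover have "summable (\<lambda>l. norm (v l))"
    using sec[of "\<lambda>l. (0, l)"] C u0 by (simp add: inj_def integrable_count_space_nat_iff norm_mult summable_cmult_iff)
  ultimately have "(\<integral>q. u (fst q) * v (snd q) \<partial>count_space UNIV) = (\<Sum>l. u l) * (\<Sum>l. v l)"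
    using integrable_count_space_prod(2)[of u v] by (simp add: split_beta')
  then show ?thesis by simp
qed

lemma integral_count_space_split:
  fixes F :: "nat \<times> 'b \<Rightarrow> complex"
  assumes int: "integrable (count_space UNIV) F" and F: "\<And>k. fst k > p \<Longrightarrow> F k = 0"
  shows "(\<integral>k. F k \<partial>count_space UNIV) = (\<Sum>j\<le>p. \<integral>q. F (j, q) \<partial>count_space UNIV)"
    and "\<And>j. integrable (count_space UNIV) (\<lambda>q. F (j, q))"
proof -
  define G where "G j k = (if fst k = j then F k else 0)" for j k
  have Gi: "integrable (count_space UNIV) (G j)" for j
    using int by (rule Bochner_Integration.integrable_bound) (auto simp: G_def)
  have G0: "G j k = 0" if "k \<notin> range (Pair j)" for j k
    using that by (cases k) (auto simp: G_def image_iff)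
  have inj: "inj (Pair j :: 'b \<Rightarrow> nat \<times> 'b)" for j by (simp add: inj_def)
  have "integrable (count_space UNIV) (G j) \<longleftrightarrow> integrable (count_space UNIV) (\<lambda>q. G j (j, q))" for j
    by (rule integral_count_space_inj(1)[OF inj G0])
  then have "integrable (count_space UNIV) (\<lambda>q. G j (j, q))" for j using Gi by blast
  then show "integrable (count_space UNIV) (\<lambda>q. F (j, q))" for j by (simp add: G_def)
  have "F k = (\<Sum>j\<le>p. G j k)" for k
    using F[of k] by (cases "fst k \<le> p") (simp_all add: G_def)
  then have "(\<integral>k. F k \<partial>count_space UNIV) = (\<integral>k. (\<Sum>j\<le>p. G j k) \<partial>count_space UNIV)" by (simp only:)
  also have "\<dots> = (\<Sum>j\<le>p. \<integral>k. G j k \<partial>count_space UNIV)" by (rule Bochner_Integration.integral_sum) (rule Gi)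
  also have "\<dots> = (\<Sum>j\<le>p. \<integral>q. F (j, q) \<partial>count_space UNIV)"
  proof (rule sum.cong[OF refl])
    fix j
    have "(\<integral>k. G j k \<partial>count_space UNIV) = (\<integral>q. G j (j, q) \<partial>count_space UNIV)"
      by (rule integral_count_space_inj(2)[OF inj G0])
    then show "(\<integral>k. G j k \<partial>count_space UNIV) = (\<integral>q. F (j, q) \<partial>count_space UNIV)" by (simp add: G_def)
  qed
  finally show "(\<integral>k. F k \<partial>count_space UNIV) = (\<Sum>j\<le>p. \<integral>q. F (j, q) \<partial>count_space UNIV)" .
qed

lemma neg1_pow_of_int: "neg1_pow (of_int k) = (-1) powi k"
  unfolding neg1_pow_def by simp

section \<open>Hypergeometric form of the coefficients\<close>

context beta_chain
begin

definition ah' :: "nat \<Rightarrow> complex" where "ah' i = (sa i - of_int (na i)) / 2"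
definition bh' :: "nat \<Rightarrow> complex" where "bh' j = (sb j - of_int (nb j)) / 2"

lemma tilde_shift: "ah' i = ah i - of_int (na i)" "bh' i = bh i - of_int (nb i)"
  by (simp_all add: ah'_def bh'_def ah_def bh_def field_simps)

lemma gen_ab_tilde: "i \<le> P \<Longrightarrow> j \<le> P \<Longrightarrow> ah' i - bh' j \<notin> \<int>"
  by (rule nonint_shift[OF gen_ab'[of i j], of _ "nb j - na i"]) (simp_all add: tilde_shift)

lemma gen_bb_tilde: "i \<le> P \<Longrightarrow> j \<le> P \<Longrightarrow> i \<noteq> j \<Longrightarrow> bh' i - bh' j \<notin> \<int>"
  by (rule nonint_shift[OF gen_bb'[of i j], of _ "nb j - nb i"]) (simp_all add: tilde_shift)

text \<open>The factor \<open>E i\<close> at the leading exponent, l = l' = 0, of the j-th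
  series.\<close>

definition Eb :: "nat \<Rightarrow> nat \<Rightarrow> complex" where
  "Eb i j = fB (ah i - bh j + 1) (bh i - ah i) (ah' i - bh' j + 1) (bh' i - ah' i)"

text \<open>A uniform form of the coefficients of u_0 and of F_j, meant for \<open>y 0 = 1\<close>:
  the denominator is the product over all i in 0, ..., P, where i = j gives \<open>fact l\<close>
  and, for j > 0, i = 0 gives the symbol of \<open>2 - y j\<close>.\<close>

definition hc :: "(nat \<Rightarrow> complex) \<Rightarrow> (nat \<Rightarrow> complex) \<Rightarrow> nat \<Rightarrow> nat \<Rightarrow> complex" where
  "hc x y j l = (\<Prod>i\<in>{0..P}. pochhammer (x i - y j + 1) l) /
     ((\<Prod>i\<in>{1..P} - {j}. pochhammer (y i - y j + 1) l) * (if j = 0 then 1 else pochhammer (2 - y j) l)) / fact l"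

definition \<Lambda> :: "nat \<Rightarrow> complex" where
  "\<Lambda> j = (if j = 0 then 1 else (-1) powi (nb j - na j) * fB (bh j - 1) (1 - ah 0) (bh' j - 1) (1 - ah' 0)) *
     (\<Prod>i\<in>{1..P} - {j}. Eb i j)"

lemma M_prod: "M p N v = bval N v (- na 0) (2 - sa 0) * (\<Prod>i\<in>{1..p}. E i (- N) (- v))"
  by (induction p) (simp_all add: prod.nat_ivl_Suc' mult_ac)

text \<open>An exponent with first component j > 0 is created at step j, with a coefficient of
  \<open>f j\<close> times the Mellin transform of \<open>I (j - 1)\<close>; later steps multiply it
  by their transforms. As \<open>M\<close> contains each \<open>E i\<close> at the negated argument,
  the earlier and the later factors have the same form, and the product runs over all i except
  j.\<close>

lemma g_prod:
  "g p k = (if fst k = 0 then bcoef (- na 0) (2 - sa 0) (snd k) * (\<Prod>i\<in>{1..p}. E i (en k) (ew k))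
    else if fst k \<le> p then d (fst k) k * bval (- en k) (- ew k) (- na 0) (2 - sa 0) * (\<Prod>i\<in>{1..p} - {fst k}. E i (en k) (ew k))
    else 0)"
proof (induction p)
  case (Suc p)
  consider "fst k = 0" | "0 < fst k" "fst k \<le> p" | "fst k = Suc p" | "fst k > Suc p" by linarith
  then show ?case
  proof cases
    case 1
    then show ?thesis unfolding g.simps Suc by (simp add: d_def prod.nat_ivl_Suc' mult_ac)
  next
    case 2
    have "{1..Suc p} - {fst k} = insert (Suc p) ({1..p} - {fst k})" using 2 by auto
    then have "(\<Prod>i\<in>{1..Suc p} - {fst k}. E i (en k) (ew k)) = E (Suc p) (en k) (ew k) * (\<Prod>i\<in>{1..p} - {fst k}. E i (en k) (ew k))"
      by simp
    moreover have "d (Suc p) k = 0" using 2 by (simp add: d_def)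
    ultimately show ?thesis unfolding g.simps Suc using 2 by (simp only: if_False if_True mult_zero_left add_0_right neq0_conv le_SucI mult_ac) simp
  next
    case 3
    have "{1..Suc p} - {fst k} = {1..p}" using 3 by auto
    then show ?thesis unfolding g.simps Suc M_prod using 3 by simp
  next
    case 4
    then show ?thesis unfolding g.simps Suc by (simp add: d_def)
  qed
qed simp

lemma half_exponent': "(ew k - of_int (en k)) / 2 = 1 - bh' (fst k) + of_nat (snd (snd k))"
  by (simp add: en_def ew_def bh'_def field_simps)

lemma E_exponent:
  assumes "i \<le> P" "j \<le> P" "i \<noteq> j"
  shows "E i (en (j, l, l')) (ew (j, l, l')) = Eb i j * (pochhammer (ah i - bh j + 1) l / pochhammer (bh i - bh j + 1) l) *
     (pochhammer (ah' i - bh' j + 1) l' / pochhammer (bh' i - bh' j + 1) l')"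
proof -
  let ?k = "(j, l, l')"
  have "(sa i + ew ?k + of_int (na i + en ?k)) / 2 = ah i + (ew ?k + of_int (en ?k)) / 2"
    "(sa i + ew ?k - of_int (na i + en ?k)) / 2 = ah' i + (ew ?k - of_int (en ?k)) / 2"
    by (simp_all add: ah_def ah'_def field_simps)
  then have 1: "(sa i + ew ?k + of_int (na i + en ?k)) / 2 = ah i - bh j + 1 + of_nat l"
    "(sa i + ew ?k - of_int (na i + en ?k)) / 2 = ah' i - bh' j + 1 + of_nat l'"
    unfolding half_exponent half_exponent' by simp_all
  have 2: "(sb i - sa i + of_int (nb i - na i)) / 2 = bh i - ah i" "(sb i - sa i - of_int (nb i - na i)) / 2 = bh' i - ah' i"
    by (simp_all add: ah_def bh_def ah'_def bh'_def field_simps)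
  have s: "ah i - bh j + 1 + (bh i - ah i) = bh i - bh j + 1" "ah' i - bh' j + 1 + (bh' i - ah' i) = bh' i - bh' j + 1" by simp_all
  have n: "ah i - bh j + 1 \<notin> \<int>" "ah' i - bh' j + 1 \<notin> \<int>" "bh i - bh j + 1 \<notin> \<int>" "bh' i - bh' j + 1 \<notin> \<int>"
    using nonint_shift[OF gen_ab'[OF assms(1,2)], of _ 1] nonint_shift[OF gen_ab_tilde[OF assms(1,2)], of _ 1]
      nonint_shift[OF gen_bb'[OF assms], of _ 1] nonint_shift[OF gen_bb_tilde[OF assms], of _ 1] by simp_all
  show ?thesis unfolding E_def bval_def 1 2 Eb_def
    by (subst fB_shift) (simp_all only: s n not_False_eq_True)
qed

text \<open>For j > 0 the missing factor i = j is replaced by the expansion coefficients of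
  \<open>f j\<close>, which supply the symbol of a_j - b_j + 1 and \<open>fact l\<close>. The
  transform of \<open>I 0\<close> is shifted downwards and supplies those of a_0 - b_j + 1 and 2 -
  b_j.\<close>

lemma coefficient_eq:
  assumes j: "j \<le> P"
  shows "g P (j, l, l') = \<Lambda> j * (hc ah bh j l * hc ah' bh' j l')"
proof -
  let ?k = "(j, l, l')"
  define X where "X = (\<Prod>i\<in>{1..P} - {j}. pochhammer (ah i - bh j + 1) l)"
  define X' where "X' = (\<Prod>i\<in>{1..P} - {j}. pochhammer (ah' i - bh' j + 1) l')"
  define Y where "Y = (\<Prod>i\<in>{1..P} - {j}. pochhammer (bh i - bh j + 1) l)"
  define Y' where "Y' = (\<Prod>i\<in>{1..P} - {j}. pochhammer (bh' i - bh' j + 1) l')"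
  define B where "B = (\<Prod>i\<in>{1..P} - {j}. Eb i j)"
  have prodE: "(\<Prod>i\<in>{1..P} - {j}. E i (en ?k) (ew ?k)) = B * (X / Y) * (X' / Y')"
  proof -
    have "(\<Prod>i\<in>{1..P} - {j}. E i (en ?k) (ew ?k)) = (\<Prod>i\<in>{1..P} - {j}. Eb i j * (pochhammer (ah i - bh j + 1) l / pochhammer (bh i - bh j + 1) l) *
     (pochhammer (ah' i - bh' j + 1) l' / pochhammer (bh' i - bh' j + 1) l'))"
      by (rule prod.cong[OF refl], rule E_exponent) (use j in auto)
    then show ?thesis unfolding B_def X_def X'_def Y_def Y'_def by (simp only: prod.distrib prod_dividef)
  qed
  have half: "(2 - sa 0 + of_int (- na 0)) / 2 = 1 - ah 0" "(2 - sa 0 - of_int (- na 0)) / 2 = 1 - ah' 0"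
    by (simp_all add: ah_def ah'_def field_simps)
  have b0': "bh 0 = 1" "bh' 0 = 1" by (simp_all add: bh_def bh'_def nb0 sb0)
  show ?thesis
  proof (cases "j = 0")
    case True
    have P0: "(\<Prod>i\<in>{0..P}. h i) = h 0 * (\<Prod>i\<in>{1..P} - {j}. h i)" for h :: "nat \<Rightarrow> complex"
      using True by (simp add: prod.atLeast_Suc_atMost)
    have bc: "bcoef (- na 0) (2 - sa 0) (l, l') = pochhammer (ah 0) l / fact l * (pochhammer (ah' 0) l' / fact l')"
      unfolding bcoef_def split_conv half pcoef_def by simp
    have "g P ?k = pochhammer (ah 0) l / fact l * (pochhammer (ah' 0) l' / fact l') * (B * (X / Y) * (X' / Y'))"
      using prodE True unfolding g_prod by (simp add: bc)
    moreover have "hc ah bh j l = pochhammer (ah 0) l * X / Y / fact l" "hc ah' bh' j l' = pochhammer (ah' 0) l' * X' / Y' / fact l'"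
      unfolding hc_def P0 X_def[symmetric] X'_def[symmetric] Y_def[symmetric] Y'_def[symmetric] using True by (simp_all add: b0')
    moreover have "\<Lambda> j = B" using True by (simp add: \<Lambda>_def B_def)
    ultimately show ?thesis by (simp add: mult_ac)
  next
    case False
    have P0: "(\<Prod>i\<in>{0..P}. h i) = h 0 * (h j * (\<Prod>i\<in>{1..P} - {j}. h i))" for h :: "nat \<Rightarrow> complex"
    proof -
      have "(\<Prod>i\<in>{0..P}. h i) = h 0 * (\<Prod>i\<in>{1..P}. h i)" by (simp add: prod.atLeast_Suc_atMost)
      also have "(\<Prod>i\<in>{1..P}. h i) = h j * (\<Prod>i\<in>{1..P} - {j}. h i)"
        by (rule prod.remove) (use False j in auto)
      finally show ?thesis .
    qed
    have halfd: "(sb j - sa j + of_int (nb j - na j)) / 2 = bh j - ah j" "(sb j - sa j - of_int (nb j - na j)) / 2 = bh' j - ah' j"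
      by (simp_all add: ah_def bh_def ah'_def bh'_def field_simps)
    have e1: "1 - (bh j - ah j) = ah j - bh j + 1" "1 - (bh' j - ah' j) = ah' j - bh' j + 1" by simp_all
    have dk: "d j ?k = (-1) powi (nb j - na j) * (pochhammer (ah j - bh j + 1) l / fact l * (pochhammer (ah' j - bh' j + 1) l' / fact l'))"
      unfolding d_def bcoef_def snd_conv split_conv halfd pcoef_def e1 by simp
    have "(- ew ?k + of_int (- en ?k)) / 2 = - ((ew ?k + of_int (en ?k)) / 2)"
      "(- ew ?k - of_int (- en ?k)) / 2 = - ((ew ?k - of_int (en ?k)) / 2)" by (simp_all add: field_simps)
    then have halfe: "(- ew ?k + of_int (- en ?k)) / 2 = bh j - 1 - of_nat l" "(- ew ?k - of_int (- en ?k)) / 2 = bh' j - 1 - of_nat l'"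
      unfolding half_exponent half_exponent' by simp_all
    have n: "bh j - 1 \<notin> \<int>" "bh' j - 1 \<notin> \<int>"
      using gen_bb'[OF j le0 False] gen_bb_tilde[OF j le0 False] by (simp_all add: b0')
    have n2: "bh j - 1 + (1 - ah 0) \<notin> \<int>" "bh' j - 1 + (1 - ah' 0) \<notin> \<int>"
      using nonint_shift[OF gen_ab'[OF le0 j], of _ 0] nonint_shift[OF gen_ab_tilde[OF le0 j], of _ 0] by simp_all
    have e2: "1 - (bh j - 1) - (1 - ah 0) = ah 0 - bh j + 1" "1 - (bh j - 1) = 2 - bh j"
      "1 - (bh' j - 1) - (1 - ah' 0) = ah' 0 - bh' j + 1" "1 - (bh' j - 1) = 2 - bh' j" by simp_all
    have bv: "bval (- en ?k) (- ew ?k) (- na 0) (2 - sa 0) = fB (bh j - 1) (1 - ah 0) (bh' j - 1) (1 - ah' 0) *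
      (pochhammer (ah 0 - bh j + 1) l / pochhammer (2 - bh j) l) * (pochhammer (ah' 0 - bh' j + 1) l' / pochhammer (2 - bh' j) l')"
      unfolding bval_def half halfe by (subst fB_shift_down[OF n(1) n2(1) n(2) n2(2)]) (simp only: e2(1,3), simp only: e2(2,4))
    have "g P ?k = d j ?k * bval (- en ?k) (- ew ?k) (- na 0) (2 - sa 0) * (B * (X / Y) * (X' / Y'))"
      using prodE False j unfolding g_prod by simp
    moreover have "hc ah bh j l = pochhammer (ah 0 - bh j + 1) l * (pochhammer (ah j - bh j + 1) l * X) / (Y * pochhammer (2 - bh j) l) / fact l"
      "hc ah' bh' j l' = pochhammer (ah' 0 - bh' j + 1) l' * (pochhammer (ah' j - bh' j + 1) l' * X') / (Y' * pochhammer (2 - bh' j) l') / fact l'"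
      unfolding hc_def P0 X_def[symmetric] X'_def[symmetric] Y_def[symmetric] Y'_def[symmetric] using False by simp_all
    moreover have "\<Lambda> j = (-1) powi (nb j - na j) * fB (bh j - 1) (1 - ah 0) (bh' j - 1) (1 - ah' 0) * B"
      using False by (simp add: \<Lambda>_def B_def)
    ultimately show ?thesis unfolding dk bv by (simp add: mult_ac)
  qed
qed

text \<open>Required for factoring the double series: with a vanishing constant nothing about its
  factors could be inferred from its convergence.\<close>

lemma \<Lambda>_nonzero:
  assumes j: "j \<le> P"
  shows "\<Lambda> j \<noteq> 0"
proof -
  have Eb: "Eb i j \<noteq> 0" if "i \<le> P" "i \<noteq> j" for i
    unfolding Eb_def
  proof (rule fB_nonzero)
    show "ah i - bh j + 1 \<notin> \<int>" by (rule nonint_shift[OF gen_ab'[OF that(1) j], of _ 1]) simp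
    show "bh i - ah i \<notin> \<int>" by (rule nonint_shift[OF gen_ab'[OF that(1,1)], of _ 0]) simp
    show "ah i - bh j + 1 + (bh i - ah i) \<notin> \<int>" by (rule nonint_shift[OF gen_bb'[OF that(1) j that(2)], of _ 1]) simp
    show "ah' i - bh' j + 1 \<notin> \<int>" by (rule nonint_shift[OF gen_ab_tilde[OF that(1) j], of _ 1]) simp
    show "bh' i - ah' i \<notin> \<int>" by (rule nonint_shift[OF gen_ab_tilde[OF that(1,1)], of _ 0]) simp
    show "ah' i - bh' j + 1 + (bh' i - ah' i) \<notin> \<int>" by (rule nonint_shift[OF gen_bb_tilde[OF that(1) j that(2)], of _ 1]) simp
  qed
  have b0': "bh 0 = 1" "bh' 0 = 1" by (simp_all add: bh_def bh'_def nb0 sb0)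
  have "fB (bh j - 1) (1 - ah 0) (bh' j - 1) (1 - ah' 0) \<noteq> 0" if "j \<noteq> 0"
  proof (rule fB_nonzero)
    show "bh j - 1 \<notin> \<int>" "bh' j - 1 \<notin> \<int>"
      using gen_bb'[OF j le0 that] gen_bb_tilde[OF j le0 that] by (simp_all add: b0')
    show "1 - ah 0 \<notin> \<int>" "1 - ah' 0 \<notin> \<int>"
      using nonint_shift[OF gen_ab'[OF le0 le0], of _ 0] nonint_shift[OF gen_ab_tilde[OF le0 le0], of _ 0] by (simp_all add: b0')
    show "bh j - 1 + (1 - ah 0) \<notin> \<int>" "bh' j - 1 + (1 - ah' 0) \<notin> \<int>"
      using nonint_shift[OF gen_ab'[OF le0 j], of _ 0] nonint_shift[OF gen_ab_tilde[OF le0 j], of _ 0] by simp_all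
  qed
  then show ?thesis using Eb by (simp add: \<Lambda>_def)
qed

theorem I_expansion:
  assumes z: "0 < norm z" "norm z < 1" and J: "J P z < \<infinity>"
  shows "I P z = (\<Sum>j\<le>P. \<Lambda> j * qchar (- nb j) (2 - sb j) z * ((\<Sum>l. hc ah bh j l * z ^ l) * (\<Sum>l. hc ah' bh' j l * cnj z ^ l)))"
proof -
  let ?F = "\<lambda>k. g P k * qchar (en k) (ew k) z"
  have z0: "z \<noteq> 0" using z by auto
  have ex: "I P z = (\<integral>k. ?F k \<partial>count_space UNIV)" "integrable (count_space UNIV) ?F"
    using chain_expansion(1)[OF le_refl z J] by (auto simp: expands_def)
  have F0: "?F k = 0" if "fst k > P" for k using g_support[of P k] that by auto
  have Fj: "?F (j, q) = \<Lambda> j * qchar (- nb j) (2 - sb j) z * (hc ah bh j (fst q) * z ^ fst q * (hc ah' bh' j (snd q) * cnj z ^ snd q))"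
    if "j \<le> P" for j q
  proof -
    obtain l l' where q: "q = (l, l')" by (cases q)
    have "en (j, q) = - nb j + (int l - int l')" "ew (j, q) = 2 - sb j + (of_nat l + of_nat l')"
      by (simp_all add: en_def ew_def q)
    then have "qchar (en (j, q)) (ew (j, q)) z = qchar (- nb j) (2 - sb j) z * (z ^ l * cnj z ^ l')"
      by (simp only: qchar_add qchar_power_cnj[OF z0])
    then show ?thesis using coefficient_eq[OF that, of l l'] by (simp add: q mult_ac)
  qed
  have "I P z = (\<Sum>j\<le>P. \<integral>q. ?F (j, q) \<partial>count_space UNIV)"
    unfolding ex(1) by (rule integral_count_space_split(1)[OF ex(2) F0])
  also have "\<dots> = (\<Sum>j\<le>P. \<Lambda> j * qchar (- nb j) (2 - sb j) z * ((\<Sum>l. hc ah bh j l * z ^ l) * (\<Sum>l. hc ah' bh' j l * cnj z ^ l)))"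
  proof (rule sum.cong[OF refl])
    fix j assume "j \<in> {..P}"
    then have j: "j \<le> P" by simp
    have "integrable (count_space UNIV) (\<lambda>q. ?F (j, q))" by (rule integral_count_space_split(2)[OF ex(2) F0])
    then have i: "integrable (count_space UNIV) (\<lambda>q. \<Lambda> j * qchar (- nb j) (2 - sb j) z * (hc ah bh j (fst q) * z ^ fst q * (hc ah' bh' j (snd q) * cnj z ^ snd q)))"
      unfolding Fj[OF j] .
    show "(\<integral>q. ?F (j, q) \<partial>count_space UNIV) = \<Lambda> j * qchar (- nb j) (2 - sb j) z * ((\<Sum>l. hc ah bh j l * z ^ l) * (\<Sum>l. hc ah' bh' j l * cnj z ^ l))"
      unfolding Fj[OF j]
      by (rule double_series_product[OF _ _ _ i]) (use \<Lambda>_nonzero[OF j] in \<open>simp_all add: hc_def\<close>)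
  qed
  finally show ?thesis .
qed

end

section \<open>The integral over p complex variables as an iterated convolution\<close>

context beta_chain
begin

definition q :: "nat \<Rightarrow> complex \<Rightarrow> complex" where
  "q i x = qchar (na i) (sa i - 2) x * qchar (nb i - na i) (sb i - sa i - 2) (1 - x)"

text \<open>The integrand for Lebesgue measure in m variables. For m = 0 the products are empty and
  \<open>F 0 z\<close> is constantly \<open>I 0 z\<close>.\<close>

definition F :: "nat \<Rightarrow> complex \<Rightarrow> (nat \<Rightarrow> complex) \<Rightarrow> complex" where
  "F m z x = (\<Prod>i\<in>{1..m}. q i (x i)) * qchar (- na 0) (- sa 0) (1 - z * (\<Prod>i\<in>{1..m}. x i))"

lemma q_measurable [measurable]: "q i \<in> borel_measurable borel"
  unfolding q_def[abs_def] by measurable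

lemma F_measurable [measurable]: "F m z \<in> borel_measurable (PiM {1..m} (\<lambda>_. lborel))"
  unfolding F_def[abs_def] by measurable

lemma F_measurable_pair [measurable]:
  "(\<lambda>(x, y). F m (z * y) x) \<in> borel_measurable (PiM {1..m} (\<lambda>_. lborel) \<Otimes>\<^sub>M lborel)"
  unfolding F_def[abs_def] by measurable

lemma f_div: "x \<noteq> 0 \<Longrightarrow> f i x / of_real ((norm x)\<^sup>2) = q i x"
  unfolding f_def q_def qchar_shift2[symmetric] by simp

text \<open>Fixing the last variable at y replaces z by z y, which is the recursion of the
  convolution.\<close>

lemma F_Suc: "F (Suc m) z (x(Suc m := y)) = q (Suc m) y * F m (z * y) x"
proof -
  have 1: "(\<Prod>i\<in>{1..m}. q i ((x(Suc m := y)) i)) = (\<Prod>i\<in>{1..m}. q i (x i))" by (rule prod.cong) auto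
  have 2: "(\<Prod>i\<in>{1..m}. (x(Suc m := y)) i) = (\<Prod>i\<in>{1..m}. x i)" by (rule prod.cong) auto
  have 3: "(\<Prod>i\<in>{1..Suc m}. h i) = h (Suc m) * (\<Prod>i\<in>{1..m}. h i)" for h :: "nat \<Rightarrow> complex"
    by (rule prod.nat_ivl_Suc') simp
  show ?thesis unfolding F_def 3 1 2 by (simp only: fun_upd_same mult.assoc)
qed

lemma interval_insert: "{1..Suc m} = insert (Suc m) {1..m}" by auto

lemma product_lborel: "product_sigma_finite (\<lambda>_::nat. lborel :: complex measure)"
  by (simp add: product_sigma_finite_def sigma_finite_lborel)

lemma nn_integral_F: "(\<integral>\<^sup>+x. ennreal (norm (F m z x)) \<partial>PiM {1..m} (\<lambda>_. lborel)) = J m z"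
proof (induction m arbitrary: z)
  case 0
  show ?case by (simp add: F_def PiM_empty nn_integral_count_space_finite)
next
  case (Suc m)
  interpret L: product_sigma_finite "\<lambda>_::nat. lborel :: complex measure" by (rule product_lborel)
  have "(\<integral>\<^sup>+x. ennreal (norm (F (Suc m) z x)) \<partial>PiM {1..Suc m} (\<lambda>_. lborel))
    = (\<integral>\<^sup>+y. \<integral>\<^sup>+x. ennreal (norm (F (Suc m) z (x(Suc m := y)))) \<partial>PiM {1..m} (\<lambda>_. lborel) \<partial>lborel)"
    unfolding interval_insert
    by (rule L.product_nn_integral_insert_rev) (use F_measurable[of "Suc m" z, unfolded interval_insert] in \<open>auto\<close>)
  also have "\<dots> = (\<integral>\<^sup>+y. ennreal (norm (q (Suc m) y)) * J m (z * y) \<partial>lborel)"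
  proof (rule nn_integral_cong)
    fix y
    have "(\<integral>\<^sup>+x. ennreal (norm (F (Suc m) z (x(Suc m := y)))) \<partial>PiM {1..m} (\<lambda>_. lborel))
      = (\<integral>\<^sup>+x. ennreal (norm (q (Suc m) y)) * ennreal (norm (F m (z * y) x)) \<partial>PiM {1..m} (\<lambda>_. lborel))"
      unfolding F_Suc norm_mult by (simp only: ennreal_mult norm_ge_zero)
    also have "\<dots> = ennreal (norm (q (Suc m) y)) * J m (z * y)"
      by (subst nn_integral_cmult) (simp_all add: Suc.IH del: One_nat_def)
    finally show "(\<integral>\<^sup>+x. ennreal (norm (F (Suc m) z (x(Suc m := y)))) \<partial>PiM {1..m} (\<lambda>_. lborel))
      = ennreal (norm (q (Suc m) y)) * J m (z * y)" .
  qed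
  also have "\<dots> = (\<integral>\<^sup>+y. ennreal (1 / (norm y)\<^sup>2) * (ennreal (norm (f (Suc m) y)) * J m (z * y)) \<partial>lborel)"
  proof (rule nn_integral_cong_AE)
    show "AE y in lborel. ennreal (norm (q (Suc m) y)) * J m (z * y) = ennreal (1 / (norm y)\<^sup>2) * (ennreal (norm (f (Suc m) y)) * J m (z * y))"
      using AE_lborel_singleton[of "0::complex"]
    proof eventually_elim
      case (elim y)
      have "norm (q (Suc m) y) = 1 / (norm y)\<^sup>2 * norm (f (Suc m) y)"
        unfolding f_div[OF elim, symmetric] norm_divide norm_of_real by simp
      then have "ennreal (norm (q (Suc m) y)) = ennreal (1 / (norm y)\<^sup>2) * ennreal (norm (f (Suc m) y))"
        by (simp add: ennreal_mult[symmetric])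
      then show ?case by (simp only: mult.assoc)
    qed
  qed
  also have "\<dots> = J (Suc m) z" unfolding J.simps by (rule nn_integral_haar[symmetric]) simp
  finally show ?case .
qed

lemma F_integrable: "J m z < \<infinity> \<Longrightarrow> integrable (PiM {1..m} (\<lambda>_. lborel)) (F m z)"
  unfolding integrable_iff_bounded nn_integral_F by (simp del: One_nat_def)

lemma integral_F: "J m z < \<infinity> \<Longrightarrow> (\<integral>x. F m z x \<partial>PiM {1..m} (\<lambda>_. lborel)) = I m z"
proof (induction m arbitrary: z)
  case 0
  show ?case by (simp add: F_def PiM_empty lebesgue_integral_count_space_finite)
next
  case (Suc m)
  let ?M = "PiM {1..m} (\<lambda>_. lborel :: complex measure)"
  interpret L: product_sigma_finite "\<lambda>_::nat. lborel :: complex measure" by (rule product_lborel)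
  interpret S: sigma_finite_measure ?M by (rule L.sigma_finite) simp
  interpret PP: pair_sigma_finite ?M "lborel :: complex measure" ..
  let ?G = "\<lambda>x y. q (Suc m) y * F m (z * y) x"
  have G_meas [measurable]: "case_prod ?G \<in> borel_measurable (?M \<Otimes>\<^sub>M lborel)"
  proof -
    have "(\<lambda>p. q (Suc m) (snd p) * (case p of (x, y) \<Rightarrow> F m (z * y) x)) \<in> borel_measurable (?M \<Otimes>\<^sub>M lborel)"
      by (intro borel_measurable_times F_measurable_pair) (simp del: One_nat_def)
    then show ?thesis by (simp add: split_beta' del: One_nat_def)
  qed
  have G_int: "integrable (?M \<Otimes>\<^sub>M lborel) (case_prod ?G)"
    unfolding integrable_iff_bounded
  proof
    have "(\<integral>\<^sup>+p. ennreal (norm (case_prod ?G p)) \<partial>(?M \<Otimes>\<^sub>M lborel)) = (\<integral>\<^sup>+x. \<integral>\<^sup>+y. ennreal (norm (?G x y)) \<partial>lborel \<partial>?M)"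
    proof -
      have nm: "(\<lambda>p. ennreal (norm (case_prod ?G p))) \<in> borel_measurable (?M \<Otimes>\<^sub>M lborel)"
        using G_meas by measurable
      show ?thesis by (rule trans[OF lborel.nn_integral_fst[OF nm, symmetric]]) (simp only: split_conv)
    qed
    also have "\<dots> = (\<integral>\<^sup>+x. ennreal (norm (F (Suc m) z x)) \<partial>PiM {1..Suc m} (\<lambda>_. lborel))"
      unfolding interval_insert F_Suc[symmetric]
      by (rule L.product_nn_integral_insert[symmetric]) (use F_measurable[of "Suc m" z, unfolded interval_insert] in \<open>auto\<close>)
    also have "\<dots> < \<infinity>" unfolding nn_integral_F by (rule Suc.prems)
    finally show "(\<integral>\<^sup>+p. ennreal (norm (case_prod ?G p)) \<partial>(?M \<Otimes>\<^sub>M lborel)) < \<infinity>" .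
  qed (rule G_meas)
  \<comment> \<open>The induction hypothesis is available only where \<open>J m\<close> is finite;
    finiteness at the next level provides this for almost every y.\<close>
  have fin: "AE y in lborel. J m (z * y) < \<infinity>"
  proof -
    have "AE x in haar. ennreal (norm (f (Suc m) x)) * J m (z * x) \<noteq> \<infinity>"
      by (rule nn_integral_PInf_AE) (use Suc.prems in auto)
    then have "AE x in haar. J m (z * x) < \<infinity>"
    proof eventually_elim
      case (elim x)
      then show ?case using f_nonzero[of "Suc m" x] by (auto simp: ennreal_mult_eq_top_iff less_top[symmetric])
    qed
    then show ?thesis unfolding AE_haar_iff .
  qed
  \<comment> \<open>Splitting off a coordinate of the product measure leaves the new variable
    innermost, whereas the convolution has it outermost; \<open>G_int\<close> justifies the
    exchange.\<close>
  have "(\<integral>x. F (Suc m) z x \<partial>PiM {1..Suc m} (\<lambda>_. lborel)) = (\<integral>x. (\<integral>y. F (Suc m) z (x(Suc m := y)) \<partial>lborel) \<partial>?M)"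
    unfolding interval_insert
    by (rule L.product_integral_insert) (use F_integrable[OF Suc.prems, unfolded interval_insert] in auto)
  also have "\<dots> = (\<integral>x. (\<integral>y. ?G x y \<partial>lborel) \<partial>?M)" unfolding F_Suc ..
  also have "\<dots> = (\<integral>y. (\<integral>x. ?G x y \<partial>?M) \<partial>lborel)" by (rule PP.Fubini_integral[OF G_int, symmetric])
  also have "\<dots> = (\<integral>y. f (Suc m) y * I m (z * y) / of_real ((norm y)\<^sup>2) \<partial>lborel)"
  proof (rule integral_cong_AE)
    show "AE y in lborel. (\<integral>x. ?G x y \<partial>?M) = f (Suc m) y * I m (z * y) / of_real ((norm y)\<^sup>2)"
      using fin AE_lborel_singleton[of "0::complex"]
    proof eventually_elim
      case (elim y)
      have "(\<integral>x. ?G x y \<partial>?M) = q (Suc m) y * I m (z * y)"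
        using Suc.IH[OF elim(1)] by (simp del: One_nat_def)
      then show ?case unfolding f_div[OF elim(2), symmetric] by simp
    qed
    have "(\<lambda>y. \<integral>x. ?G x y \<partial>?M) = (\<lambda>y. q (Suc m) y * (\<integral>x. F m (z * y) x \<partial>?M))" by (simp del: One_nat_def)
    moreover have "(\<lambda>y. q (Suc m) y * (\<integral>x. F m (z * y) x \<partial>?M)) \<in> borel_measurable lborel"
    proof (intro borel_measurable_times)
      have "(\<lambda>(y, x). F m (z * y) x) \<in> borel_measurable (lborel \<Otimes>\<^sub>M ?M)"
        using measurable_pair_swap[OF F_measurable_pair[of m z]] by (simp add: split_beta' del: One_nat_def)
      then show "(\<lambda>y. \<integral>x. F m (z * y) x \<partial>?M) \<in> borel_measurable lborel"
        by (rule S.borel_measurable_lebesgue_integral)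
    qed simp
    ultimately show "(\<lambda>y. \<integral>x. ?G x y \<partial>?M) \<in> borel_measurable lborel" by (simp only:)
  qed simp
  also have "\<dots> = I (Suc m) z" unfolding I.simps
    by (rule haar_integral_lborel(2)[symmetric]) simp
  finally show ?case .
qed

lemma prod_list_upt: "distinct xs \<Longrightarrow> prod_list (map h xs) = (\<Prod>i\<in>set xs. h i)" for h :: "nat \<Rightarrow> complex"
  by (simp add: prod.distinct_set_conv_list)

lemma hc_cong:
  assumes "\<And>i. i \<le> P \<Longrightarrow> x i = x' i" "\<And>i. i \<le> P \<Longrightarrow> y i = y' i" "j \<le> P"
  shows "hc x y j l = hc x' y' j l"
proof -
  have "(\<Prod>i\<in>{0..P}. pochhammer (x i - y j + 1) l) = (\<Prod>i\<in>{0..P}. pochhammer (x' i - y' j + 1) l)"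
    "(\<Prod>i\<in>{1..P} - {j}. pochhammer (y i - y j + 1) l) = (\<Prod>i\<in>{1..P} - {j}. pochhammer (y' i - y' j + 1) l)"
    using assms by (auto intro!: prod.cong)
  then show ?thesis unfolding hc_def using assms(2)[OF assms(3)] by simp
qed

lemma hypergeom_hc_0:
  assumes "y 0 = 1"
  shows "(\<Sum>l. hc x y 0 l * w ^ l) = hypergeom (map x [0..<P + 1]) (map y [1..<P + 1]) w"
proof -
  have s: "set [0..<P + 1] = {0..P}" "set [1..<P + 1] = {1..P} - {0}" by auto
  have 1: "prod_list (map (\<lambda>c. pochhammer c l) (map x [0..<P + 1])) = (\<Prod>i\<in>{0..P}. pochhammer (x i - y 0 + 1) l)" for l
    unfolding map_map prod_list_upt[OF distinct_upt] s comp_def assms by simp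
  have 2: "prod_list (map (\<lambda>c. pochhammer c l) (map y [1..<P + 1])) = (\<Prod>i\<in>{1..P} - {0}. pochhammer (y i - y 0 + 1) l)" for l
    unfolding map_map prod_list_upt[OF distinct_upt] s comp_def assms by simp
  show ?thesis unfolding hypergeom_def 1 2 hc_def by simp
qed

lemma hypergeom_hc:
  assumes "j \<noteq> 0"
  shows "(\<Sum>l. hc x y j l * w ^ l) = hypergeom (map (\<lambda>i. x i - y j + 1) [0..<P + 1])
    (map (\<lambda>i. 1 + y i - y j) (filter (\<lambda>i. i \<noteq> j) [1..<P + 1]) @ [2 - y j]) w"
proof -
  have s: "set [0..<P + 1] = {0..P}" "set (filter (\<lambda>i. i \<noteq> j) [1..<P + 1]) = {1..P} - {j}" by auto
  have di: "distinct (filter (\<lambda>i. i \<noteq> j) [1..<P + 1])" by (rule distinct_filter) simp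
  have 1: "prod_list (map (\<lambda>c. pochhammer c l) (map (\<lambda>i. x i - y j + 1) [0..<P + 1])) = (\<Prod>i\<in>{0..P}. pochhammer (x i - y j + 1) l)" for l
    unfolding map_map prod_list_upt[OF distinct_upt] s comp_def by simp
  have e: "1 + y i - y j = y i - y j + 1" for i by simp
  have 2: "prod_list (map (\<lambda>c. pochhammer c l) (map (\<lambda>i. 1 + y i - y j) (filter (\<lambda>i. i \<noteq> j) [1..<P + 1]) @ [2 - y j]))
    = (\<Prod>i\<in>{1..P} - {j}. pochhammer (y i - y j + 1) l) * pochhammer (2 - y j) l" for l
    unfolding map_append map_map prod_list.append prod_list_upt[OF di] s comp_def e by simp
  show ?thesis unfolding hypergeom_def 1 2 hc_def using assms by simp
qed

end

section \<open>Specialisation to the parameters of the theorem\<close>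

lemma Ints_choice:
  assumes "\<forall>i\<in>A. f i - g i \<in> (\<int> :: complex set)"
  shows "\<exists>n :: 'a \<Rightarrow> int. \<forall>i\<in>A. of_int (n i) = f i - g i"
proof (rule bchoice, rule ballI)
  fix i assume "i \<in> A"
  then have "f i - g i \<in> \<int>" using assms by blast
  then show "\<exists>k::int. of_int k = f i - g i" by (auto elim!: Ints_cases)
qed

theorem theorem3:
  fixes p :: nat and a b ta tb :: "nat \<Rightarrow> complex" and z :: complex
  assumes "p \<ge> 1"
    and "condC p a b ta tb"
    and "(\<Sum>i=1..p-1. b i) - (\<Sum>i=0..p-1. a i) \<notin> \<int>"
    and "Re (((\<Sum>i=1..p-1. b i) - (\<Sum>i=0..p-1. a i)) + ((\<Sum>i=1..p-1. tb i) - (\<Sum>i=0..p-1. ta i))) > -2"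
    and "Re (a p + ta p) > 0"
    and "Re (b p + tb p - a p - ta p) > 0"
    and "\<forall>j\<in>{1..p-1}. Re (b j + tb j - a p - ta p) < 2"
    and "\<forall>j\<in>{0..p-1}. Re (b p + tb p - a j - ta j) < 2"
    and "0 < norm z" and "norm z < 1"
    and "integrable (PiM {1..p} (\<lambda>_. (lborel :: complex measure)))
           (\<lambda>x. (\<Prod>i\<in>{1..p}. cpair (x i) (a i - 1) (ta i - 1)
                               * cpair (1 - x i) (b i - a i - 1) (tb i - ta i - 1))
                * cpair (1 - z * (\<Prod>i\<in>{1..p}. x i)) (- a 0) (- ta 0))"
  shows "(LINT x | PiM {1..p} (\<lambda>_. (lborel :: complex measure)).
            (\<Prod>i\<in>{1..p}. cpair (x i) (a i - 1) (ta i - 1)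
                          * cpair (1 - x i) (b i - a i - 1) (tb i - ta i - 1))
            * cpair (1 - z * (\<Prod>i\<in>{1..p}. x i)) (- a 0) (- ta 0))
       = (\<Prod>i\<in>{1..p}. fB (a i) (b i - a i) (ta i) (tb i - ta i))
           * hypergeom (map a [0..<p+1]) (map b [1..<p+1]) z
           * hypergeom (map ta [0..<p+1]) (map tb [1..<p+1]) (cnj z)
         + (\<Sum>j\<in>{1..p}.
              (neg1_pow (b j - tb j - a j + ta j)
                * fB (b j - 1) (1 - a 0) (tb j - 1) (1 - ta 0)
                * (\<Prod>i\<in>{1..p} - {j}. fB (a i - b j + 1) (b i - a i) (ta i - tb j + 1) (tb i - ta i)))
              * cpair z (1 - b j) (1 - tb j)
              * hypergeom (map (\<lambda>i. a i - b j + 1) [0..<p+1])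
                          (map (\<lambda>i. 1 + b i - b j) (filter (\<lambda>i. i \<noteq> j) [1..<p+1]) @ [2 - b j]) z
              * hypergeom (map (\<lambda>i. ta i - tb j + 1) [0..<p+1])
                          (map (\<lambda>i. 1 + tb i - tb j) (filter (\<lambda>i. i \<noteq> j) [1..<p+1]) @ [2 - tb j]) (cnj z))"
proof -
  have C: "\<And>i. i \<le> p \<Longrightarrow> a i \<notin> \<int>" "\<And>j. 1 \<le> j \<Longrightarrow> j \<le> p \<Longrightarrow> b j \<notin> \<int>"
    "\<And>i k. 1 \<le> i \<Longrightarrow> i \<le> p \<Longrightarrow> 1 \<le> k \<Longrightarrow> k \<le> p \<Longrightarrow> i \<noteq> k \<Longrightarrow> b i - b k \<notin> \<int>"
    "\<And>i j. i \<le> p \<Longrightarrow> 1 \<le> j \<Longrightarrow> j \<le> p \<Longrightarrow> a i - b j \<notin> \<int>"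
    "\<forall>i\<in>{0..p}. a i - ta i \<in> \<int>" "\<forall>j\<in>{1..p}. b j - tb j \<in> \<int>"
    using \<open>condC p a b ta tb\<close> unfolding condC_def by simp_all
  obtain na :: "nat \<Rightarrow> int" where na: "\<forall>i\<in>{0..p}. of_int (na i) = a i - ta i" using Ints_choice[OF C(5)] by (rule exE)
  obtain nb' :: "nat \<Rightarrow> int" where nb': "\<forall>j\<in>{1..p}. of_int (nb' j) = b j - tb j" using Ints_choice[OF C(6)] by (rule exE)
  \<comment> \<open>Index 0 is filled with b_0 = 1 and its tilded version 1, so the exponent 1 - b_0
    = 0 of the series u_0 fits the pattern of the others.\<close>
  define nb where "nb j = (if j = 0 then 0 else nb' j)" for j
  define sa where "sa i = a i + ta i" for i
  define sb where "sb j = (if j = 0 then 2 else b j + tb j)" for j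
  define b0 where "b0 j = (if j = 0 then 1 else b j)" for j
  define tb0 where "tb0 j = (if j = 0 then 1 else tb j)" for j
  have na_i: "of_int (na i) = a i - ta i" if "i \<le> p" for i using na that by simp
  have nb_j: "of_int (nb j) = b j - tb j" if "1 \<le> j" "j \<le> p" for j using nb' that by (simp add: nb_def)
  have ha: "(sa i + of_int (na i)) / 2 = a i" "(sa i - of_int (na i)) / 2 = ta i" if "i \<le> p" for i
    unfolding na_i[OF that] sa_def by simp_all
  have hb: "(sb j + of_int (nb j)) / 2 = b0 j" "(sb j - of_int (nb j)) / 2 = tb0 j" if "j \<le> p" for j
  proof -
    have "(sb j + of_int (nb j)) / 2 = b0 j \<and> (sb j - of_int (nb j)) / 2 = tb0 j"
    proof (cases "j = 0")
      case False
      then have "of_int (nb j) = b j - tb j" using that by (intro nb_j) auto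
      then show ?thesis using False by (simp add: sb_def b0_def tb0_def)
    qed (simp add: sb_def nb_def b0_def tb0_def)
    then show "(sb j + of_int (nb j)) / 2 = b0 j" "(sb j - of_int (nb j)) / 2 = tb0 j" by auto
  qed
  \<comment> \<open>Non-integrality of b_j is the separation condition for the pair b_j and b_0 =
    1.\<close>
  have b1: "b j - 1 \<notin> \<int>" "1 - b j \<notin> \<int>" if "1 \<le> j" "j \<le> p" for j
    using nonint_shift[OF C(2)[OF that], of _ "- 1"] nonint_shift[OF C(2)[OF that], of _ 1] by simp_all
  interpret beta_chain na nb sa sb p
  proof
    show "nb 0 = 0" "sb 0 = 2" by (simp_all add: nb_def sb_def)
    show "(sa i + of_int (na i)) / 2 - (sb j + of_int (nb j)) / 2 \<notin> \<int>" if "i \<le> p" "j \<le> p" for i j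
    proof (cases "j = 0")
      case True
      then show ?thesis unfolding ha[OF that(1)] hb[OF that(2)]
        using nonint_shift[OF C(1)[OF that(1)], of _ "- 1"] by (simp add: b0_def)
    next
      case False
      then show ?thesis unfolding ha[OF that(1)] hb[OF that(2)] using C(4)[of i j] that by (simp add: b0_def)
    qed
    show "(sb i + of_int (nb i)) / 2 - (sb j + of_int (nb j)) / 2 \<notin> \<int>" if "i \<le> p" "j \<le> p" "i \<noteq> j" for i j
      unfolding hb[OF that(1)] hb[OF that(2)]
      using C(3)[of i j] b1[of i] b1[of j] that by (cases "i = 0"; cases "j = 0") (simp_all add: b0_def)
  qed
  have ah: "ah i = a i" "ah' i = ta i" if "i \<le> p" for i using ha[OF that] by (simp_all add: ah_def ah'_def)
  have bh: "bh j = b0 j" "bh' j = tb0 j" if "j \<le> p" for j using hb[OF that] by (simp_all add: bh_def bh'_def)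
  have integrand: "(\<Prod>i\<in>{1..p}. cpair (x i) (a i - 1) (ta i - 1) * cpair (1 - x i) (b i - a i - 1) (tb i - ta i - 1))
      * cpair (1 - z * (\<Prod>i\<in>{1..p}. x i)) (- a 0) (- ta 0) = F p z x" for x
  proof -
    have "cpair (x i) (a i - 1) (ta i - 1) * cpair (1 - x i) (b i - a i - 1) (tb i - ta i - 1) = q i (x i)" if i: "1 \<le> i" "i \<le> p" for i
    proof -
      have e: "a i - 1 - (ta i - 1) = of_int (na i)" "b i - a i - 1 - (tb i - ta i - 1) = of_int (nb i - na i)"
        using na_i[OF i(2)] nb_j[OF i] by simp_all
      have s: "a i - 1 + (ta i - 1) = sa i - 2" "b i - a i - 1 + (tb i - ta i - 1) = sb i - sa i - 2"
        using i by (simp_all add: sa_def sb_def)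
      show ?thesis unfolding cpair_eq_qchar[OF e(1)] cpair_eq_qchar[OF e(2)] s q_def ..
    qed
    then have 1: "(\<Prod>i\<in>{1..p}. cpair (x i) (a i - 1) (ta i - 1) * cpair (1 - x i) (b i - a i - 1) (tb i - ta i - 1)) = (\<Prod>i\<in>{1..p}. q i (x i))"
      by (intro prod.cong) auto
    have e: "- a 0 - - ta 0 = of_int (- na 0)" using na_i[of 0] by simp
    have s: "- a 0 + - ta 0 = - sa 0" by (simp add: sa_def)
    show ?thesis unfolding 1 cpair_eq_qchar[OF e] s F_def ..
  qed
  have "integrable (PiM {1..p} (\<lambda>_. lborel)) (F p z)" using assms(11) unfolding integrand by simp
  \<comment> \<open>Absolute convergence enters here: by Tonelli the integral of the modulus of the
    integrand is \<open>J p z\<close>.\<close>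
  then have J: "J p z < \<infinity>" unfolding integrable_iff_bounded nn_integral_F by blast
  have I_eq: "(\<integral>x. F p z x \<partial>PiM {1..p} (\<lambda>_. lborel)) = I p z" by (rule integral_F[OF J])
  define H where "H j = (\<Sum>l. hc ah bh j l * z ^ l)" for j
  define H' where "H' j = (\<Sum>l. hc ah' bh' j l * cnj z ^ l)" for j
  have H: "H j = (\<Sum>l. hc a b0 j l * z ^ l)" "H' j = (\<Sum>l. hc ta tb0 j l * cnj z ^ l)" if "j \<le> p" for j
    unfolding H_def H'_def
    using hc_cong[of ah a bh b0 j] hc_cong[of ah' ta bh' tb0 j] ah bh that by simp_all
  have mb: "map b0 [1..<p + 1] = map b [1..<p + 1]" "map tb0 [1..<p + 1] = map tb [1..<p + 1]"
    by (auto simp: b0_def tb0_def)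
  have mf: "map (\<lambda>i. 1 + b0 i - b0 j) (filter (\<lambda>i. i \<noteq> j) [1..<p + 1]) = map (\<lambda>i. 1 + b i - b j) (filter (\<lambda>i. i \<noteq> j) [1..<p + 1])"
    "map (\<lambda>i. 1 + tb0 i - tb0 j) (filter (\<lambda>i. i \<noteq> j) [1..<p + 1]) = map (\<lambda>i. 1 + tb i - tb j) (filter (\<lambda>i. i \<noteq> j) [1..<p + 1])"
    if "j \<noteq> 0" for j using that by (auto simp: b0_def tb0_def)
  have H0: "H 0 = hypergeom (map a [0..<p + 1]) (map b [1..<p + 1]) z"
    "H' 0 = hypergeom (map ta [0..<p + 1]) (map tb [1..<p + 1]) (cnj z)"
    unfolding H[OF le0] mb[symmetric] by (rule hypergeom_hc_0; simp add: b0_def tb0_def)+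
  have bj: "b0 j = b j" "tb0 j = tb j" if "j \<noteq> 0" for j using that by (simp_all add: b0_def tb0_def)
  have Hj: "H j = hypergeom (map (\<lambda>i. a i - b j + 1) [0..<p + 1]) (map (\<lambda>i. 1 + b i - b j) (filter (\<lambda>i. i \<noteq> j) [1..<p + 1]) @ [2 - b j]) z"
    "H' j = hypergeom (map (\<lambda>i. ta i - tb j + 1) [0..<p + 1]) (map (\<lambda>i. 1 + tb i - tb j) (filter (\<lambda>i. i \<noteq> j) [1..<p + 1]) @ [2 - tb j]) (cnj z)"
    if "1 \<le> j" "j \<le> p" for j
  proof -
    have j0: "j \<noteq> 0" using that by simp
    show "H j = hypergeom (map (\<lambda>i. a i - b j + 1) [0..<p + 1]) (map (\<lambda>i. 1 + b i - b j) (filter (\<lambda>i. i \<noteq> j) [1..<p + 1]) @ [2 - b j]) z"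
      unfolding H[OF that(2)] hypergeom_hc[OF j0] mf[OF j0] unfolding bj[OF j0] ..
    show "H' j = hypergeom (map (\<lambda>i. ta i - tb j + 1) [0..<p + 1]) (map (\<lambda>i. 1 + tb i - tb j) (filter (\<lambda>i. i \<noteq> j) [1..<p + 1]) @ [2 - tb j]) (cnj z)"
      unfolding H[OF that(2)] hypergeom_hc[OF j0] mf[OF j0] unfolding bj[OF j0] ..
  qed
  have \<Lambda>0: "\<Lambda> 0 = (\<Prod>i\<in>{1..p}. fB (a i) (b i - a i) (ta i) (tb i - ta i))"
    unfolding \<Lambda>_def by (auto simp: Eb_def ah bh b0_def tb0_def intro!: prod.cong)
  have \<Lambda>j: "\<Lambda> j = neg1_pow (b j - tb j - a j + ta j) * fB (b j - 1) (1 - a 0) (tb j - 1) (1 - ta 0)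
      * (\<Prod>i\<in>{1..p} - {j}. fB (a i - b j + 1) (b i - a i) (ta i - tb j + 1) (tb i - ta i))"
    if "1 \<le> j" "j \<le> p" for j
  proof -
    have j0: "j \<noteq> 0" using that by simp
    have "b j - tb j - a j + ta j = of_int (nb j - na j)" using na_i[OF that(2)] nb_j[OF that] by simp
    then have n: "neg1_pow (b j - tb j - a j + ta j) = (-1) powi (nb j - na j)" by (simp only: neg1_pow_of_int)
    have "(\<Prod>i\<in>{1..p} - {j}. Eb i j) = (\<Prod>i\<in>{1..p} - {j}. fB (a i - b j + 1) (b i - a i) (ta i - tb j + 1) (tb i - ta i))"
      using that by (intro prod.cong) (auto simp: Eb_def ah bh b0_def tb0_def)
    then show ?thesis unfolding \<Lambda>_def n using j0 that by (simp add: ah bh bj)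
  qed
  have qj: "qchar (- nb j) (2 - sb j) z = cpair z (1 - b j) (1 - tb j)" if "1 \<le> j" "j \<le> p" for j
  proof -
    have e: "1 - b j - (1 - tb j) = of_int (- nb j)" using nb_j[OF that] by simp
    have s: "1 - b j + (1 - tb j) = 2 - sb j" using that by (simp add: sb_def)
    show ?thesis unfolding cpair_eq_qchar[OF e] s ..
  qed
  have q0: "qchar (- nb 0) (2 - sb 0) z = 1" by (simp add: nb_def sb_def)
  have split: "{..p} = insert 0 {1..p}" by auto
  have "I p z = (\<Sum>j\<le>p. \<Lambda> j * qchar (- nb j) (2 - sb j) z * (H j * H' j))"
    unfolding H_def H'_def by (rule I_expansion) (fact assms(9) assms(10) J)+
  also have "\<dots> = \<Lambda> 0 * H 0 * H' 0 + (\<Sum>j\<in>{1..p}. \<Lambda> j * cpair z (1 - b j) (1 - tb j) * H j * H' j)"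
  proof -
    have "(\<Sum>j\<in>{1..p}. \<Lambda> j * qchar (- nb j) (2 - sb j) z * (H j * H' j)) = (\<Sum>j\<in>{1..p}. \<Lambda> j * cpair z (1 - b j) (1 - tb j) * H j * H' j)"
      by (intro sum.cong) (auto simp: qj)
    then show ?thesis unfolding split by (simp add: q0)
  qed
  also have "(\<Sum>j\<in>{1..p}. \<Lambda> j * cpair z (1 - b j) (1 - tb j) * H j * H' j) = (\<Sum>j\<in>{1..p}.
              (neg1_pow (b j - tb j - a j + ta j)
                * fB (b j - 1) (1 - a 0) (tb j - 1) (1 - ta 0)
                * (\<Prod>i\<in>{1..p} - {j}. fB (a i - b j + 1) (b i - a i) (ta i - tb j + 1) (tb i - ta i)))
              * cpair z (1 - b j) (1 - tb j)
              * hypergeom (map (\<lambda>i. a i - b j + 1) [0..<p+1])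
                          (map (\<lambda>i. 1 + b i - b j) (filter (\<lambda>i. i \<noteq> j) [1..<p+1]) @ [2 - b j]) z
              * hypergeom (map (\<lambda>i. ta i - tb j + 1) [0..<p+1])
                          (map (\<lambda>i. 1 + tb i - tb j) (filter (\<lambda>i. i \<noteq> j) [1..<p+1]) @ [2 - tb j]) (cnj z))"
  proof (rule sum.cong[OF refl])
    fix j assume "j \<in> {1..p}"
    then have j: "1 \<le> j" "j \<le> p" by auto
    show "\<Lambda> j * cpair z (1 - b j) (1 - tb j) * H j * H' j = (neg1_pow (b j - tb j - a j + ta j)
                * fB (b j - 1) (1 - a 0) (tb j - 1) (1 - ta 0)
                * (\<Prod>i\<in>{1..p} - {j}. fB (a i - b j + 1) (b i - a i) (ta i - tb j + 1) (tb i - ta i)))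
              * cpair z (1 - b j) (1 - tb j)
              * hypergeom (map (\<lambda>i. a i - b j + 1) [0..<p+1])
                          (map (\<lambda>i. 1 + b i - b j) (filter (\<lambda>i. i \<noteq> j) [1..<p+1]) @ [2 - b j]) z
              * hypergeom (map (\<lambda>i. ta i - tb j + 1) [0..<p+1])
                          (map (\<lambda>i. 1 + tb i - tb j) (filter (\<lambda>i. i \<noteq> j) [1..<p+1]) @ [2 - tb j]) (cnj z)"
      unfolding \<Lambda>j[OF j] Hj[OF j] ..
  qed
  finally show ?thesis unfolding integrand I_eq \<Lambda>0 H0 .
qed

end
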